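(* Let $T$ be a tree chosen uniformly at random among all $n^{n-2}$ trees on the vertex set $[n]$. Then with probability $1-o(1)$ as $n\to\infty$, $$D(T)=(1+o(1))\Delta(T)=(1+o(1))\frac{\ln n}{\ln\ln n},$$ where $\Delta(T)$ is the maximum degree of $T$.
   Context: First order sentences about graphs use variables ranging over vertices, connectives, quantifiers, equality and adjacency. $D(G)$ is the smallest quantifier depth of a first order sentence which is true in $G$ and false in every graph not isomorphic to $G$. *)

theory Defs
  imports "HOL-Probability.Probability" "Graph_Theory.Graph_Theory"
begin

section \<open>Trees\<close>

text \<open>
  A finite simple undirected graph is a \<^const>\<open>pair_graph\<close>: a finite, symmetric, loop-free
  digraph without parallel arcs, where an edge is represented by its two orientations.

  The constant \<^const>\<open>Digraph_Component.tree\<close> is not usable for such graphs, since the walk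
  $a, b, a$ along a single edge satisfies \<^const>\<open>pre_digraph.cycle\<close>.  Cycles of length at least 3
  in a \<^const>\<open>pair_graph\<close> are exactly the cycles of the undirected graph.
\<close>

definition undirected_tree :: "'a pair_pre_digraph \<Rightarrow> bool" where
  "undirected_tree G \<longleftrightarrow>
     pair_graph G \<and> Digraph_Component.connected (with_proj G) \<and>
     \<not> (\<exists>p. pre_digraph.cycle (with_proj G) p \<and> length p \<ge> 3)"

definition labelled_trees :: "nat \<Rightarrow> nat pair_pre_digraph set" where
  "labelled_trees n = {T. undirected_tree T \<and> pverts T = {1..n}}"

definition random_tree :: "nat \<Rightarrow> nat pair_pre_digraph pmf" where
  "random_tree n = pmf_of_set (labelled_trees n)"

text \<open>In a \<^const>\<open>pair_graph\<close> the out-degree of a vertex is its number of neighbours.\<close>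

definition max_degree :: "'a pair_pre_digraph \<Rightarrow> nat" where
  "max_degree G = Max (out_degree (with_proj G) ` pverts G)"


section \<open>First order logic of graphs\<close>

datatype fo_formula =
    FEq nat nat
  | FAdj nat nat
  | FNot fo_formula
  | FAnd fo_formula fo_formula
  | FOr fo_formula fo_formula
  | FEx nat fo_formula
  | FAll nat fo_formula

primrec free_vars :: "fo_formula \<Rightarrow> nat set" where
  "free_vars (FEq x y) = {x, y}"
| "free_vars (FAdj x y) = {x, y}"
| "free_vars (FNot \<phi>) = free_vars \<phi>"
| "free_vars (FAnd \<phi> \<psi>) = free_vars \<phi> \<union> free_vars \<psi>"
| "free_vars (FOr \<phi> \<psi>) = free_vars \<phi> \<union> free_vars \<psi>"
| "free_vars (FEx x \<phi>) = free_vars \<phi> - {x}"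
| "free_vars (FAll x \<phi>) = free_vars \<phi> - {x}"

definition sentence :: "fo_formula \<Rightarrow> bool" where
  "sentence \<phi> \<longleftrightarrow> free_vars \<phi> = {}"

primrec quantifier_depth :: "fo_formula \<Rightarrow> nat" where
  "quantifier_depth (FEq x y) = 0"
| "quantifier_depth (FAdj x y) = 0"
| "quantifier_depth (FNot \<phi>) = quantifier_depth \<phi>"
| "quantifier_depth (FAnd \<phi> \<psi>) = max (quantifier_depth \<phi>) (quantifier_depth \<psi>)"
| "quantifier_depth (FOr \<phi> \<psi>) = max (quantifier_depth \<phi>) (quantifier_depth \<psi>)"
| "quantifier_depth (FEx x \<phi>) = Suc (quantifier_depth \<phi>)"
| "quantifier_depth (FAll x \<phi>) = Suc (quantifier_depth \<phi>)"

primrec sat :: "'a pair_pre_digraph \<Rightarrow> (nat \<Rightarrow> 'a) \<Rightarrow> fo_formula \<Rightarrow> bool" where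
  "sat G s (FEq x y) \<longleftrightarrow> s x = s y"
| "sat G s (FAdj x y) \<longleftrightarrow> (s x, s y) \<in> parcs G"
| "sat G s (FNot \<phi>) \<longleftrightarrow> \<not> sat G s \<phi>"
| "sat G s (FAnd \<phi> \<psi>) \<longleftrightarrow> sat G s \<phi> \<and> sat G s \<psi>"
| "sat G s (FOr \<phi> \<psi>) \<longleftrightarrow> sat G s \<phi> \<or> sat G s \<psi>"
| "sat G s (FEx x \<phi>) \<longleftrightarrow> (\<exists>v\<in>pverts G. sat G (s(x := v)) \<phi>)"
| "sat G s (FAll x \<phi>) \<longleftrightarrow> (\<forall>v\<in>pverts G. sat G (s(x := v)) \<phi>)"

text \<open>
  Only used for sentences, whose satisfaction does not depend on the assignment \<open>s\<close>.
\<close>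

definition true_in :: "'a pair_pre_digraph \<Rightarrow> fo_formula \<Rightarrow> bool" where
  "true_in G \<phi> \<longleftrightarrow> (\<forall>s. sat G s \<phi>)"

text \<open>
  Graphs are finite, so the graphs \<open>H\<close> on vertices of type \<^typ>\<open>nat\<close> represent all graphs
  up to isomorphism.
\<close>

definition defines_graph :: "fo_formula \<Rightarrow> 'a pair_pre_digraph \<Rightarrow> bool" where
  "defines_graph \<phi> G \<longleftrightarrow>
     sentence \<phi> \<and> true_in G \<phi> \<and>
     (\<forall>H :: nat pair_pre_digraph.
        pair_graph H \<and> \<not> digraph_iso (with_proj G) (with_proj H) \<longrightarrow> \<not> true_in H \<phi>)"

text \<open>
  The set below is nonempty for every finite \<open>G\<close>: with one quantified variable per vertex and one
  more to exclude further vertices, a sentence can describe \<open>G\<close> up to isomorphism.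
\<close>

definition D :: "'a pair_pre_digraph \<Rightarrow> nat" where
  "D G = (LEAST d. \<exists>\<phi>. defines_graph \<phi> G \<and> quantifier_depth \<phi> = d)"

end

theory Submission
  imports Defs "HOL-Real_Asymp.Real_Asymp"
begin

text \<open>
  A uniform labelled tree is a uniform rooted tree, given by its parent map, with the root
  forgotten.  The number of rooted trees that extend a given forest, weighted by the numbers of new
  children, has a closed form; hence moments of child counts can be computed exactly.

  A sentence of depth less than \<open>k\<close> cannot notice the removal of one of \<open>k\<close> leaves with a common
  neighbour, and the second moment method finds \<open>k \<ge> (1 - \<epsilon>) ln n / ln ln n\<close> such leaves; this bounds
  both \<open>D\<close> and the maximum degree from below.

  For the upper bound, the parities of the child counts along paths of length about \<open>(ln n)\<^sup>2\<close> tell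
  apart ancestors far above the leaves, so these vertices, the root and the parent relation are
  definable with \<open>O(ln ln n)\<close> quantifiers, while all subtrees hanging off have polylogarithmic size.
  Such a subtree is described recursively along a heavy path.  A branch of the recursion has
  length \<open>O(ln ln n)\<close>, and with high probability the child counts that it must count through
  add up to at most \<open>(1 + \<epsilon>) ln n / ln ln n\<close>.  A colouring by definable predicates
  in which the degrees between colour classes agree yields a covering map, hence an isomorphism.
\<close>

text \<open>Two obstacles shape the upper bound. First, the constant 1: telling vertices apart
  already involves counting up to about \<open>W\<close>, the most children that a few vertices of a
  descending path have together, so a second count put in front would double the bound. Counts are
  therefore nested only along descending paths. A count of children at a vertex is followed by a
  shape formula whose depth has been lowered by the number of children there, and the full colour
  enters only through one further quantifier. Second, a graph has no orientation. A formula sees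
  distances only, and a path with prescribed parities may be read in the wrong direction or may
  overlap a shifted copy of itself. Hence three kinds of parity coincidence are excluded: two paths
  in the same direction, two in opposite directions, and one path against its own shift.\<close>

section \<open>Rooted trees as parent maps\<close>

text \<open>The root is its own parent, so every iterate of \<open>p\<close> is total and all orbits
  end at \<open>r\<close>. Extensionality makes \<open>p\<close> determined by its values on
  \<open>V\<close>, so that trees can be counted as functions.\<close>

definition rooted :: "'a set \<Rightarrow> ('a \<Rightarrow> 'a) \<Rightarrow> 'a \<Rightarrow> bool" where
  "rooted V p r \<longleftrightarrow> p \<in> V \<rightarrow>\<^sub>E V \<and> r \<in> V \<and> p r = r \<and> (\<forall>v\<in>V. \<exists>k. (p ^^ k) v = r)"

definition rooted_trees :: "'a set \<Rightarrow> ('a \<Rightarrow> 'a) set" where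
  "rooted_trees V = {p. \<exists>r. rooted V p r}"

lemma funpow_fixpoint: "f r = r \<Longrightarrow> (f ^^ k) r = r"
  by (induction k) auto

lemma funpow_split: "i \<le> k \<Longrightarrow> (f ^^ k) v = (f ^^ (k - i)) ((f ^^ i) v)"
  by (metis comp_apply funpow_add le_add_diff_inverse2)

locale rooted_tree =
  fixes V :: "'a set" and p :: "'a \<Rightarrow> 'a" and r :: 'a
  assumes finV: "finite V" and rooted: "rooted V p r"
begin

lemma pV: "v \<in> V \<Longrightarrow> p v \<in> V"
  using rooted by (auto simp: rooted_def)

lemma rV: "r \<in> V" and pr: "p r = r" and pE: "p \<in> V \<rightarrow>\<^sub>E V"
  using rooted by (auto simp: rooted_def)

lemma ppV: "v \<in> V \<Longrightarrow> (p ^^ k) v \<in> V"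
  by (induction k) (auto simp: pV)

lemma reach: "v \<in> V \<Longrightarrow> \<exists>k. (p ^^ k) v = r"
  using rooted by (auto simp: rooted_def)

lemma ppr [simp]: "(p ^^ k) r = r"
  by (rule funpow_fixpoint) (rule pr)

definition dep :: "'a \<Rightarrow> nat" where "dep v = (LEAST k. (p ^^ k) v = r)"

lemma pp_dep: "v \<in> V \<Longrightarrow> (p ^^ dep v) v = r"
  unfolding dep_def using reach by (rule LeastI_ex)

lemma dep_le: "(p ^^ k) v = r \<Longrightarrow> dep v \<le> k"
  unfolding dep_def by (rule Least_le)

lemma pp_ge_dep: "v \<in> V \<Longrightarrow> dep v \<le> k \<Longrightarrow> (p ^^ k) v = r"
  using pp_dep[of v] funpow_split[of "dep v" k p v] by simp

lemma pp_eq_r_iff: "v \<in> V \<Longrightarrow> (p ^^ k) v = r \<longleftrightarrow> dep v \<le> k"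
  using dep_le pp_ge_dep by blast

lemma dep_r [simp]: "dep r = 0"
  using dep_le[of 0 r] by simp

lemma dep_eq_0: "v \<in> V \<Longrightarrow> dep v = 0 \<longleftrightarrow> v = r"
  using pp_dep[of v] by auto

lemma dep_p: "v \<in> V \<Longrightarrow> dep (p v) = dep v - 1"
proof (cases "v = r")
  case False
  assume v: "v \<in> V"
  have "(p ^^ k) (p v) = r \<longleftrightarrow> dep v \<le> Suc k" for k
    using pp_eq_r_iff[OF v, of "Suc k"] by (simp add: funpow_swap1)
  then have "dep (p v) \<le> k \<longleftrightarrow> dep v \<le> Suc k" for k
    using pp_eq_r_iff[OF pV[OF v]] by blast
  from this[of "dep v - 1"] this[of "dep (p v)"] show ?thesis by auto
qed (simp add: pr)

lemma dep_pp: "v \<in> V \<Longrightarrow> dep ((p ^^ k) v) = dep v - k"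
  by (induction k) (auto simp: dep_p ppV)

lemma p_eq_self_iff: "v \<in> V \<Longrightarrow> p v = v \<longleftrightarrow> v = r"
  using dep_p[of v] dep_eq_0[of v] pr by auto

lemma root_unique: "rooted V p r' \<Longrightarrow> r' = r"
  using p_eq_self_iff[of r'] by (auto simp: rooted_def)

lemma in_rooted_trees: "p \<in> rooted_trees V"
  using rooted by (auto simp: rooted_trees_def)

definition ch :: "'a \<Rightarrow> 'a set" where "ch v = {w \<in> V. w \<noteq> r \<and> p w = v}"

lemma finite_ch [simp]: "finite (ch v)"
  using finV by (auto simp: ch_def)

lemma ch_V: "w \<in> ch v \<Longrightarrow> w \<in> V" and ch_p: "w \<in> ch v \<Longrightarrow> p w = v" and ch_neq_r: "w \<in> ch v \<Longrightarrow> w \<noteq> r"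
  by (auto simp: ch_def)

lemma dep_ch: "w \<in> ch v \<Longrightarrow> dep w = Suc (dep v)"
  using dep_p[of w] dep_eq_0[of w] by (auto simp: ch_def)

definition sub :: "'a \<Rightarrow> 'a set" where "sub v = {w \<in> V. \<exists>k. (p ^^ k) w = v}"

lemma finite_sub [simp]: "finite (sub v)"
  using finV by (auto simp: sub_def)

lemma sub_self: "v \<in> V \<Longrightarrow> v \<in> sub v"
  by (auto simp: sub_def intro: exI[of _ 0])

lemma sub_V: "sub v \<subseteq> V" by (auto simp: sub_def)

lemma sub_mono: "w \<in> sub v \<Longrightarrow> sub w \<subseteq> sub v"
proof
  fix x assume w: "w \<in> sub v" and x: "x \<in> sub w"
  obtain i where i: "(p ^^ i) w = v" using w by (auto simp: sub_def)
  obtain j where j: "(p ^^ j) x = w" "x \<in> V" using x by (auto simp: sub_def)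
  have "(p ^^ (i + j)) x = v" using i j by (simp add: funpow_add)
  then show "x \<in> sub v" using j by (auto simp: sub_def)
qed

lemma ch_sub: "w \<in> ch v \<Longrightarrow> v \<in> V \<Longrightarrow> w \<in> sub v"
  by (auto simp: sub_def ch_def intro: exI[of _ 1])

lemma sub_eq: "v \<in> V \<Longrightarrow> sub v = insert v (\<Union>w\<in>ch v. sub w)"
proof (intro set_eqI iffI)
  fix x assume v: "v \<in> V" and x: "x \<in> sub v"
  define k where "k = (LEAST k. (p ^^ k) x = v)"
  have xV: "x \<in> V" and k: "(p ^^ k) x = v" and min: "\<And>j. j < k \<Longrightarrow> (p ^^ j) x \<noteq> v"
    unfolding k_def using x by (auto simp: sub_def intro: LeastI_ex dest: not_less_Least)
  show "x \<in> insert v (\<Union>w\<in>ch v. sub w)"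
  proof (cases k)
    case 0 then show ?thesis using k by auto
  next
    case (Suc j)
    let ?w = "(p ^^ j) x"
    have "p ?w = v" "?w \<noteq> v" using k Suc min[of j] by auto
    then have "?w \<in> ch v" using ppV[OF xV, of j] pr by (auto simp: ch_def)
    moreover have "x \<in> sub ?w" using xV by (auto simp: sub_def)
    ultimately show ?thesis by blast
  qed
next
  fix x assume v: "v \<in> V" and x: "x \<in> insert v (\<Union>w\<in>ch v. sub w)"
  then show "x \<in> sub v" using sub_self[OF v] sub_mono[OF ch_sub[OF _ v]] by blast
qed

text \<open>The root is excluded because, as a fixpoint, it is hit by every large power of
  \<open>p\<close>. Any other ancestor is hit at exactly one exponent, the difference of the
  depths.\<close>

lemma sub_level: "x \<in> sub v \<Longrightarrow> v \<noteq> r \<Longrightarrow> \<exists>k. (p ^^ k) x = v \<and> k \<le> dep x \<and> dep x = dep v + k"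
proof -
  assume x: "x \<in> sub v" and v: "v \<noteq> r"
  then obtain k where k: "(p ^^ k) x = v" "x \<in> V" by (auto simp: sub_def)
  have "k \<le> dep x" using k v pp_eq_r_iff[of x k] by auto
  then show ?thesis using dep_pp[of x k] k by auto
qed

text \<open>Siblings have the same depth, so a common descendant would reach both of them after the
  same number of steps.\<close>

lemma sub_ch_disjoint: "w \<in> ch v \<Longrightarrow> w' \<in> ch v \<Longrightarrow> w \<noteq> w' \<Longrightarrow> sub w \<inter> sub w' = {}"
proof (rule ccontr)
  assume w: "w \<in> ch v" "w' \<in> ch v" "w \<noteq> w'" and "sub w \<inter> sub w' \<noteq> {}"
  then obtain x where x: "x \<in> sub w" "x \<in> sub w'" by auto
  obtain k k' where "(p ^^ k) x = w" "dep x = dep w + k" "(p ^^ k') x = w'" "dep x = dep w' + k'"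
    using sub_level[OF x(1)] sub_level[OF x(2)] w ch_neq_r by metis
  moreover have "dep w = dep w'" using w dep_ch by simp
  ultimately show False using w by simp
qed

lemma self_notin_sub_ch: "w \<in> ch v \<Longrightarrow> v \<notin> sub w"
  using sub_level[of v w] dep_ch[of w v] ch_neq_r by fastforce

lemma card_sub: "v \<in> V \<Longrightarrow> card (sub v) = Suc (\<Sum>w\<in>ch v. card (sub w))"
proof -
  assume v: "v \<in> V"
  have "card (\<Union>w\<in>ch v. sub w) = (\<Sum>w\<in>ch v. card (sub w))"
    by (rule card_UN_disjoint) (auto dest: sub_ch_disjoint)
  moreover have "v \<notin> (\<Union>w\<in>ch v. sub w)" using self_notin_sub_ch by auto
  ultimately show ?thesis by (subst sub_eq[OF v]) (simp add: card_insert_disjoint)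
qed

end

section \<open>Counting rooted trees that extend a forest\<close>

text \<open>A partial parent assignment \<open>q\<close> on \<open>A\<close> without cycles; every vertex outside \<open>A\<close> is a fixpoint.\<close>

definition forest_on :: "'a set \<Rightarrow> 'a set \<Rightarrow> ('a \<Rightarrow> 'a) \<Rightarrow> bool" where
  "forest_on V A q \<longleftrightarrow> A \<subseteq> V \<and> (\<forall>v\<in>A. q v \<in> V) \<and> (\<forall>v. v \<notin> A \<longrightarrow> q v = v) \<and>
     (\<forall>v\<in>V. \<exists>k. (q ^^ k) v \<notin> A)"

definition extensions :: "'a set \<Rightarrow> 'a set \<Rightarrow> ('a \<Rightarrow> 'a) \<Rightarrow> ('a \<Rightarrow> 'a) set" where
  "extensions V A q = {p \<in> rooted_trees V. \<forall>v\<in>A. p v = q v}"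

lemma forest_on_rank:
  fixes rank :: "'a \<Rightarrow> nat"
  assumes "A \<subseteq> V" "\<And>v. v \<in> A \<Longrightarrow> q v \<in> V" "\<And>v. v \<notin> A \<Longrightarrow> q v = v"
    and "\<And>v. v \<in> A \<Longrightarrow> q v \<in> A \<Longrightarrow> rank (q v) < rank v"
  shows "forest_on V A q"
proof -
  have "\<exists>k. (q ^^ k) v \<notin> A" for v
  proof (induction "rank v" arbitrary: v rule: less_induct)
    case less
    show ?case
    proof (cases "v \<in> A \<and> q v \<in> A")
      case True
      then obtain k where "(q ^^ k) (q v) \<notin> A" using less assms(4)[of v] by blast
      then show ?thesis by (intro exI[of _ "Suc k"]) (simp add: funpow_swap1)
    next
      case False
      then show ?thesis by (cases "v \<in> A") (auto intro: exI[of _ 0] exI[of _ 1])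
    qed
  qed
  then show ?thesis using assms by (auto simp: forest_on_def)
qed

lemma forest_on_root_exists:
  assumes "forest_on V A q" "v \<in> V"
  obtains k where "(q ^^ k) v \<in> V - A" "\<And>j. j < k \<Longrightarrow> (q ^^ j) v \<in> A"
proof -
  define k where "k = (LEAST k. (q ^^ k) v \<notin> A)"
  have k: "(q ^^ k) v \<notin> A"
    unfolding k_def by (rule LeastI_ex) (use assms in \<open>auto simp: forest_on_def\<close>)
  have k': "(q ^^ j) v \<in> A" if "j < k" for j
    using not_less_Least[OF that[unfolded k_def]] by auto
  have "(q ^^ j) v \<in> V" for j
  proof (induction j)
    case (Suc j)
    then show ?case using assms by (cases "(q ^^ j) v \<in> A") (auto simp: forest_on_def)
  qed (simp add: assms)
  then show thesis using k k' that by blast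
qed

definition forest_root :: "'a set \<Rightarrow> ('a \<Rightarrow> 'a) \<Rightarrow> 'a \<Rightarrow> 'a" where
  "forest_root A q v = (THE w. w \<notin> A \<and> (\<exists>k. (q ^^ k) v = w))"

text \<open>Vertices outside \<open>A\<close> are fixpoints of \<open>q\<close>, so an orbit that
  has left \<open>A\<close> stays where it is; any exponent that leaves \<open>A\<close> yields the
  same root.\<close>

lemma forest_root_eq:
  assumes "forest_on V A q" "(q ^^ k) v \<notin> A"
  shows "forest_root A q v = (q ^^ k) v"
proof -
  have stay: "(q ^^ i) w = w" if "w \<notin> A" for i w
    using that assms(1) by (intro funpow_fixpoint) (auto simp: forest_on_def)
  have "(q ^^ i) v = (q ^^ k) v" if "(q ^^ i) v \<notin> A" for i
  proof (cases "i \<le> k")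
    case True
    then show ?thesis using stay[OF that, of "k - i"] funpow_split[OF True, of q v] by metis
  next
    case False
    then have "k \<le> i" by simp
    from funpow_split[OF this, of q v] stay[OF assms(2), of "i - k"] show ?thesis by metis
  qed
  then show ?thesis unfolding forest_root_def using assms(2) by (intro the_equality) blast+
qed

lemma funpow_cong_below:
  assumes "\<And>j. j < k \<Longrightarrow> f ((g ^^ j) v) = g ((g ^^ j) v)"
  shows "(f ^^ k) v = (g ^^ k) v"
  using assms by (induction k) auto

text \<open>The vertex \<open>v\<close> lies in a component whose root is not \<open>r\<close>. An
  orbit that reaches \<open>r\<close> continues at \<open>v\<close> and from there leaves the forest
  without meeting \<open>r\<close> again, so no cycle arises.\<close>

lemma forest_on_attach:
  assumes q: "forest_on V A q" and r: "r \<in> V - A" and v: "v \<in> V" and ne: "forest_root A q v \<noteq> r"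
  shows "forest_on V (insert r A) (q(r := v))"
proof -
  have *: "\<exists>k. ((q(r := v)) ^^ k) w \<notin> insert r A" if w: "w \<in> V" "forest_root A q w \<noteq> r" for w
  proof -
    obtain k where k: "(q ^^ k) w \<in> V - A" "\<And>j. j < k \<Longrightarrow> (q ^^ j) w \<in> A"
      using forest_on_root_exists[OF q w(1)] by blast
    have "((q(r := v)) ^^ k) w = (q ^^ k) w"
      by (rule funpow_cong_below) (use k(2) r in auto)
    moreover have "(q ^^ k) w \<noteq> r" using w forest_root_eq[OF q, of k w] k by auto
    ultimately show ?thesis using k by (intro exI[of _ k]) auto
  qed
  have "\<exists>k. ((q(r := v)) ^^ k) w \<notin> insert r A" if w: "w \<in> V" for w
  proof (cases "forest_root A q w = r")
    case True
    obtain k where k: "(q ^^ k) w \<in> V - A" "\<And>j. j < k \<Longrightarrow> (q ^^ j) w \<in> A"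
      using forest_on_root_exists[OF q w(1)] by blast
    have "((q(r := v)) ^^ k) w = (q ^^ k) w"
      by (rule funpow_cong_below) (use k(2) r in auto)
    also have "\<dots> = r" using True forest_root_eq[OF q, of k w] k by auto
    finally have "((q(r := v)) ^^ Suc k) w = v" by simp
    moreover obtain j where "((q(r := v)) ^^ j) v \<notin> insert r A" using *[OF v ne] by blast
    ultimately have "((q(r := v)) ^^ j) (((q(r := v)) ^^ Suc k) w) \<notin> insert r A"
      by (simp only: not_False_eq_True)
    moreover have "(f ^^ (j + Suc k)) w = (f ^^ j) ((f ^^ Suc k) w)" for f :: "'a \<Rightarrow> 'a"
      by (simp only: funpow_add o_apply)
    ultimately show ?thesis by (intro exI[of _ "j + Suc k"]) (simp only: not_False_eq_True)
  qed (rule *[OF w])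
  then show ?thesis using q r v by (auto simp: forest_on_def)
qed

text \<open>The complementary case: if \<open>v\<close> already leads to \<open>r\<close>, the new
  arc closes a cycle, and the only cycle in a rooted tree is the loop at its root.\<close>

lemma extensions_attach_empty:
  assumes q: "forest_on V A q" and r: "r \<in> V - A" and v: "v \<in> V" and eq: "forest_root A q v = r"
    and fin: "finite V" and p: "p \<in> extensions V A q" "p r = v"
  shows "v = r"
proof (rule ccontr)
  assume ne: "v \<noteq> r"
  obtain k where k: "(q ^^ k) v \<in> V - A" "\<And>j. j < k \<Longrightarrow> (q ^^ j) v \<in> A"
    using forest_on_root_exists[OF q v] by blast
  have pk: "(p ^^ k) v = r"
  proof -
    have "(p ^^ k) v = (q ^^ k) v"
      by (rule funpow_cong_below) (use p k(2) in \<open>auto simp: extensions_def\<close>)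
    then show ?thesis using eq forest_root_eq[OF q, of k v] k by auto
  qed
  obtain r0 where "rooted V p r0" using p by (auto simp: extensions_def rooted_trees_def)
  then interpret rooted_tree V p r0 using fin by unfold_locales
  have "dep v = dep r - 1" using dep_p[of r] r p by auto
  moreover have "dep r = dep v - k" using dep_pp[OF v, of k] pk by simp
  ultimately have "dep r = 0" by auto
  then have "r = r0" using dep_eq_0[of r] r by auto
  then show False using pr p ne by auto
qed

lemma extensions_attach:
  assumes "r \<in> V - A"
  shows "{p \<in> extensions V A q. p r = v} = extensions V (insert r A) (q(r := v))"
  using assms by (auto simp: extensions_def)

lemma extensions_root_unique:
  assumes fin: "finite V" and q: "forest_on V A q" and p: "p \<in> extensions V A q"
  shows "\<exists>r\<in>V - A. {w \<in> V - A. p w = w} = {r}"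
proof -
  obtain r where "rooted V p r" using p by (auto simp: extensions_def rooted_trees_def)
  then interpret rooted_tree V p r using fin by unfold_locales
  have "r \<notin> A"
  proof
    assume "r \<in> A"
    then have "q r = r" using p pr by (auto simp: extensions_def)
    then have "(q ^^ k) r \<in> A" for k using \<open>r \<in> A\<close> by (simp add: funpow_fixpoint)
    then show False using q rV by (auto simp: forest_on_def)
  qed
  then show ?thesis using rV p_eq_self_iff by (intro bexI[of _ r]) auto
qed

text \<open>A weighted Cayley formula; the exponent is the number of components of the forest minus
  one. The proof counts pairs of an extension and a component root \<open>r\<close> that is not the
  root of the extension. Every extension occurs in exactly as many pairs as the exponent says, and
  prescribing the arc from \<open>r\<close> to \<open>v\<close> contributes the weight
  \<open>x v\<close> and leaves a forest with one component less. Characteristic 0 allows the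
  multiplicity to be cancelled.\<close>

theorem sum_extensions:
  fixes x :: "'a \<Rightarrow> 'b :: field_char_0"
  assumes fin: "finite V" and q: "forest_on V A q" and V: "V \<noteq> {}"
  shows "(\<Sum>p\<in>extensions V A q. \<Prod>w\<in>{w \<in> V - A. p w \<noteq> w}. x (p w)) = (\<Sum>v\<in>V. x v) ^ (card (V - A) - 1)"
  using q
proof (induction "card (V - A)" arbitrary: A q)
  case 0
  then have "V - A = {}" using fin by simp
  moreover obtain v where "v \<in> V" using V by blast
  ultimately obtain k where "(q ^^ k) v \<in> V - A" using forest_on_root_exists[OF 0(2), of v] by metis
  then show ?case using \<open>V - A = {}\<close> by auto
next
  case (Suc k)
  note q = Suc.prems
  let ?X = "\<Sum>v\<in>V. x v"
  let ?f = "\<lambda>A p. \<Prod>w\<in>{w \<in> V - A. p w \<noteq> w}. x (p w)"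
  have finR: "finite (V - A)" using fin by simp
  have finRT: "finite (rooted_trees V)"
    by (rule finite_subset[OF _ finite_PiE[OF fin fin]])
       (auto simp: rooted_trees_def rooted_def)
  then have finE: "finite (extensions V A q)" for A q by (auto simp: extensions_def)
  show ?case
  \<comment> \<open>With a single component the extension is forced and there is no arc to choose;
    here the multiplicity is \<open>k = 0\<close> and could not be cancelled.\<close>
  proof (cases "k = 0")
    case True
    then have "card (V - A) = 1" using Suc.hyps(2) by simp
    then obtain r where r: "V - A = {r}" by (rule card_1_singletonE)
    have sub: "A \<subseteq> V" using q by (auto simp: forest_on_def)
    have rVA: "r \<in> V" "r \<notin> A" using r by auto
    have only: "w = r" if "w \<in> V" "w \<notin> A" for w using r that by blast
    have qr: "q r = r" using q rVA by (simp add: forest_on_def)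
    have eq: "extensions V A q = {restrict q V}"
    proof (intro set_eqI iffI)
      fix p assume p: "p \<in> extensions V A q"
      then obtain r' where "r' \<in> V - A" "{w \<in> V - A. p w = w} = {r'}"
        using extensions_root_unique[OF fin q] by blast
      then have "p r = r" unfolding r by auto
      moreover have "p \<in> V \<rightarrow>\<^sub>E V" and pq: "\<And>v. v \<in> A \<Longrightarrow> p v = q v"
        using p by (auto simp: extensions_def rooted_trees_def rooted_def)
      ultimately have "p v = restrict q V v" for v
        using only[of v] qr by (cases "v \<in> V"; cases "v \<in> A") auto
      then show "p \<in> {restrict q V}" by auto
    next
      fix p assume p: "p \<in> {restrict q V}"
      have "\<exists>k. (restrict q V ^^ k) v = r" if v: "v \<in> V" for v
      proof -
        obtain k where k: "(q ^^ k) v \<in> V - A" "\<And>j. j < k \<Longrightarrow> (q ^^ j) v \<in> A"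
          using forest_on_root_exists[OF q v] by blast
        have "(restrict q V ^^ k) v = (q ^^ k) v"
          by (rule funpow_cong_below) (use k(2) sub in auto)
        also have "\<dots> = r" using k(1) only by simp
        finally show ?thesis by blast
      qed
      moreover have "q v \<in> V" if "v \<in> V" for v
        using q that by (cases "v \<in> A") (simp_all add: forest_on_def)
      ultimately have "rooted V (restrict q V) r" using rVA qr by (simp add: rooted_def)
      then show "p \<in> extensions V A q" using p sub by (auto simp: extensions_def rooted_trees_def)
    qed
    have e: "{w \<in> V - A. restrict q V w \<noteq> w} = {}" using qr only by auto
    have "(\<Prod>w\<in>{w \<in> V - A. restrict q V w \<noteq> w}. x (restrict q V w)) = 1" by (simp only: e prod.empty)
    moreover have "sum f {a} = f a" for f :: "('a \<Rightarrow> 'a) \<Rightarrow> 'b" and a by simp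
    ultimately show ?thesis using \<open>card (V - A) = 1\<close> eq by (simp only: diff_self_eq_0 power_0)
  next
    case False
    have card1: "card {w \<in> V - A. p w \<noteq> w} = k" if p: "p \<in> extensions V A q" for p
    proof -
      obtain r where r: "r \<in> V - A" "{w \<in> V - A. p w = w} = {r}"
        by (rule bexE[OF extensions_root_unique[OF fin q p]])
      have "{w \<in> V - A. p w \<noteq> w} = (V - A) - {w \<in> V - A. p w = w}" by blast
      also have "card \<dots> = card (V - A) - 1" unfolding r(2) using r(1) by (rule card_Diff_singleton)
      finally show ?thesis using Suc.hyps(2) by simp
    qed
    have one: "(\<Sum>p\<in>{p \<in> extensions V A q. p r = v \<and> v \<noteq> r}. ?f A p) =
        (if forest_root A q v = r then 0 else x v * ?X ^ (k - 1))" if r: "r \<in> V - A" and v: "v \<in> V" for r v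
    proof (cases "forest_root A q v = r")
      case True
      then have e: "{p \<in> extensions V A q. p r = v \<and> v \<noteq> r} = {}"
        using extensions_attach_empty[OF q r v True fin] by blast
      show ?thesis unfolding e using True by simp
    next
      case F: False
      have "forest_root A q r = r" using forest_root_eq[OF q, of 0 r] r by simp
      then have vr: "v \<noteq> r" using F by metis
      have q': "forest_on V (insert r A) (q(r := v))" by (rule forest_on_attach[OF q r v F])
      have "V - insert r A = (V - A) - {r}" by blast
      then have c: "card (V - insert r A) = k" using card_Diff_singleton[OF r] Suc.hyps(2) by simp
      have "(\<Sum>p\<in>{p \<in> extensions V A q. p r = v \<and> v \<noteq> r}. ?f A p) =
          (\<Sum>p\<in>extensions V (insert r A) (q(r := v)). x v * ?f (insert r A) p)"
      proof (rule sum.cong)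
        show "{p \<in> extensions V A q. p r = v \<and> v \<noteq> r} = extensions V (insert r A) (q(r := v))"
          using extensions_attach[OF r, of q v] vr by auto
        fix p assume p: "p \<in> extensions V (insert r A) (q(r := v))"
        then have "p r = v" by (auto simp: extensions_def)
        then have "{w \<in> V - A. p w \<noteq> w} = insert r {w \<in> V - insert r A. p w \<noteq> w}" using r vr by auto
        then show "?f A p = x v * ?f (insert r A) p" using fin \<open>p r = v\<close> by simp
      qed
      also have "\<dots> = x v * ?X ^ (k - 1)"
        using Suc.hyps(1)[OF c[symmetric] q'] c by (simp add: sum_distrib_left[symmetric])
      finally show ?thesis using F by simp
    qed
    define F where "F = ?f A"
    have "of_nat k * (\<Sum>p\<in>extensions V A q. F p) = (\<Sum>p\<in>extensions V A q. of_nat k * F p)"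
      by (rule sum_distrib_left)
    also have "\<dots> = (\<Sum>p\<in>extensions V A q. \<Sum>r\<in>V - A. if p r \<noteq> r then F p else 0)"
    proof (rule sum.cong[OF refl])
      fix p assume p: "p \<in> extensions V A q"
      have "(\<Sum>r\<in>V - A. if p r \<noteq> r then F p else 0) = (\<Sum>r\<in>{w \<in> V - A. p w \<noteq> w}. F p)"
        by (rule sum.inter_filter[OF finR, symmetric])
      then show "of_nat k * F p = (\<Sum>r\<in>V - A. if p r \<noteq> r then F p else 0)"
        by (simp only: sum_constant card1[OF p])
    qed
    also have "\<dots> = (\<Sum>r\<in>V - A. \<Sum>p\<in>extensions V A q. if p r \<noteq> r then F p else 0)"
      by (rule sum.swap)
    also have "\<dots> = (\<Sum>r\<in>V - A. \<Sum>v\<in>V. \<Sum>p\<in>{p \<in> extensions V A q. p r = v \<and> v \<noteq> r}. F p)"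
    proof (rule sum.cong[OF refl])
      fix r assume r: "r \<in> V - A"
      have "(\<Sum>p\<in>{p \<in> extensions V A q. p r = v \<and> v \<noteq> r}. F p) =
          (\<Sum>p\<in>{p \<in> extensions V A q. p r = v}. if p r \<noteq> r then F p else 0)" for v
        using finE by (cases "v = r") (auto intro!: sum.cong sum.neutral)
      then have "(\<Sum>v\<in>V. \<Sum>p\<in>{p \<in> extensions V A q. p r = v \<and> v \<noteq> r}. F p) =
          (\<Sum>v\<in>V. \<Sum>p\<in>{p \<in> extensions V A q. p r = v}. if p r \<noteq> r then F p else 0)" by simp
      also have "\<dots> = (\<Sum>p\<in>extensions V A q. if p r \<noteq> r then F p else 0)"
        using r by (intro sum.group finE fin) (auto simp: extensions_def rooted_trees_def rooted_def)
      finally show "(\<Sum>p\<in>extensions V A q. if p r \<noteq> r then F p else 0) =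
        (\<Sum>v\<in>V. \<Sum>p\<in>{p \<in> extensions V A q. p r = v \<and> v \<noteq> r}. F p)" by simp
    qed
    also have "\<dots> = (\<Sum>r\<in>V - A. \<Sum>v\<in>V. if forest_root A q v = r then 0 else x v * ?X ^ (k - 1))"
      unfolding F_def by (intro sum.cong refl one)
    also have "\<dots> = (\<Sum>v\<in>V. \<Sum>r\<in>V - A. if forest_root A q v = r then 0 else x v * ?X ^ (k - 1))"
      by (rule sum.swap)
    \<comment> \<open>Each \<open>v\<close> lies in exactly one of the \<open>k + 1\<close>
      components, so the roots of the other \<open>k\<close> may be attached to it.\<close>
    also have "\<dots> = (\<Sum>v\<in>V. of_nat k * (x v * ?X ^ (k - 1)))"
    proof (rule sum.cong[OF refl])
      fix v assume v: "v \<in> V"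
      obtain j where "(q ^^ j) v \<in> V - A" by (rule forest_on_root_exists[OF q v])
      then have "forest_root A q v \<in> V - A" using forest_root_eq[OF q, of j v] by auto
      from card_Diff_singleton[OF this] have "card ((V - A) - {forest_root A q v}) = k"
        using Suc.hyps(2) by simp
      moreover have "(\<Sum>r\<in>V - A. if forest_root A q v = r then 0 else x v * ?X ^ (k - 1)) =
         (\<Sum>r\<in>(V - A) - {forest_root A q v}. x v * ?X ^ (k - 1))"
        using finR by (intro sum.mono_neutral_cong_right) auto
      ultimately show "(\<Sum>r\<in>V - A. if forest_root A q v = r then 0 else x v * ?X ^ (k - 1)) =
          of_nat k * (x v * ?X ^ (k - 1))" by simp
    qed
    also have "\<dots> = of_nat k * ?X ^ k"
      using False by (simp add: sum_distrib_left[symmetric] sum_distrib_right[symmetric] power_eq_if)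
    finally have "(\<Sum>p\<in>extensions V A q. F p) = ?X ^ k" using False by simp
    then show ?thesis unfolding F_def Suc.hyps(2)[symmetric] by simp
  qed
qed

lemma finite_rooted_trees: "finite V \<Longrightarrow> finite (rooted_trees V)"
  by (rule finite_subset[OF _ finite_PiE[of V "\<lambda>_. V"]]) (auto simp: rooted_trees_def rooted_def)

lemma card_rooted_trees:
  assumes "finite V" "V \<noteq> {}"
  shows "card (rooted_trees V) = card V ^ (card V - 1)"
proof -
  have "forest_on V {} (\<lambda>v. v)" by (auto simp: forest_on_def)
  from sum_extensions[OF assms(1) this assms(2), of "\<lambda>_. 1::real"]
  have "real (card (rooted_trees V)) = real (card V ^ (card V - 1))" by (simp add: extensions_def)
  then show ?thesis by (simp only: of_nat_eq_iff)
qed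

section \<open>From rooted trees to uniform labelled trees\<close>

definition tree_graph :: "'a set \<Rightarrow> ('a \<Rightarrow> 'a) \<Rightarrow> 'a pair_pre_digraph" where
  "tree_graph V p = \<lparr>pverts = V, parcs = {(x, y). x \<in> V \<and> y \<in> V \<and> x \<noteq> y \<and> (p x = y \<or> p y = x)}\<rparr>"

lemma tree_graph_simps [simp]:
  "pverts (tree_graph V p) = V"
  "(x, y) \<in> parcs (tree_graph V p) \<longleftrightarrow> x \<in> V \<and> y \<in> V \<and> x \<noteq> y \<and> (p x = y \<or> p y = x)"
  by (auto simp: tree_graph_def)

lemma pair_graph_tree_graph:
  assumes "finite V" shows "pair_graph (tree_graph V p)"
proof -
  have "finite (parcs (tree_graph V p))"
    by (rule finite_subset[of _ "V \<times> V"]) (use assms in \<open>auto simp: tree_graph_def\<close>)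
  then show ?thesis using assms
    by unfold_locales (auto simp: tree_graph_def symmetric_def sym_def)
qed

lemma connected_pair_graph_iff:
  assumes "pair_graph G"
  shows "Digraph_Component.connected (with_proj G) \<longleftrightarrow>
    pverts G \<noteq> {} \<and> (\<forall>u\<in>pverts G. \<forall>v\<in>pverts G. reachable (with_proj G) u v)"
proof -
  interpret pair_graph G by fact
  have "parcs (mk_symmetric (with_proj G)) = parcs G"
    using sym_arcs by (auto simp: mk_symmetric_def symmetric_def sym_def)
  then have "mk_symmetric (with_proj G) = G" by (simp add: mk_symmetric_def)
  then show ?thesis by (simp add: Digraph_Component.connected_def strongly_connected_def)
qed

lemma reachable_if_rooted:
  assumes fin: "finite V" and "rooted V p r" and u: "u \<in> V" and v: "v \<in> V"
  shows "reachable (with_proj (tree_graph V p)) u v"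
proof -
  interpret rooted_tree V p r using assms by unfold_locales
  interpret G: pair_graph "tree_graph V p" by (rule pair_graph_tree_graph[OF fin])
  have *: "reachable (with_proj (tree_graph V p)) w r" if "w \<in> V" for w
    using that
  proof (induction "dep w" arbitrary: w)
    case 0 then show ?case using dep_eq_0[of w] by simp
  next
    case (Suc k)
    have ne: "w \<noteq> r" using Suc by auto
    have "dep (p w) = k" using dep_p[of w] Suc by simp
    then have "reachable (with_proj (tree_graph V p)) (p w) r" using Suc pV by auto
    moreover have "(w, p w) \<in> parcs (tree_graph V p)"
      using Suc.prems pV[of w] p_eq_self_iff[of w] ne by auto
    ultimately show ?case by (metis G.adj_reachable_trans with_proj_simps(3))
  qed
  have "reachable (with_proj (tree_graph V p)) r v"
    using *[OF v] G.symmetric_reachable' by blast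
  then show ?thesis using *[OF u] G.reachable_trans by blast
qed

text \<open>Take a vertex of maximal depth on a cycle. Its two cyclic neighbours are adjacent to it
  and not deeper, so both are its parent, whereas in a cycle of length at least 3 they are
  distinct.\<close>

lemma undirected_tree_tree_graph:
  assumes fin: "finite V" and rt: "rooted V p r"
  shows "undirected_tree (tree_graph V p)"
proof -
  interpret rooted_tree V p r using assms by unfold_locales
  let ?G = "tree_graph V p"
  interpret G: pair_graph ?G by (rule pair_graph_tree_graph[OF fin])
  have "Digraph_Component.connected (with_proj ?G)"
    using connected_pair_graph_iff[OF pair_graph_tree_graph[OF fin]] reachable_if_rooted[OF fin rt] rV by auto
  moreover have "\<not> (pre_digraph.cycle (with_proj ?G) c \<and> length c \<ge> 3)" for c
  proof (rule notI, elim conjE)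
    assume "pre_digraph.cycle (with_proj ?G) c" and len: "length c \<ge> 3"
    then obtain u where w: "pre_digraph.awalk (with_proj ?G) u c u" and d: "distinct (tl (pawalk_verts u c))"
      by (auto simp: G.cycle_def)
    let ?m = "length c"
    have cas: "pcas u c u" and arcs: "set c \<subseteq> parcs ?G" using w by (auto simp: G.awalk_def)
    have pv: "pawalk_verts x c = x # map snd c" if "pcas x c y" for x y
      using that by (induction c arbitrary: x) auto
    have dist: "distinct (map snd c)" using d pv[OF cas] by simp
    have step: "\<And>i. Suc i < length c \<Longrightarrow> fst (c ! Suc i) = snd (c ! i)" "c \<noteq> [] \<Longrightarrow> fst (c ! 0) = x"
      "c \<noteq> [] \<Longrightarrow> snd (c ! (length c - 1)) = y" if "pcas x c y" for x y
    proof -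
      have "(\<forall>i. Suc i < length c \<longrightarrow> fst (c ! Suc i) = snd (c ! i)) \<and> (c \<noteq> [] \<longrightarrow> fst (c ! 0) = x) \<and>
       (c \<noteq> [] \<longrightarrow> snd (c ! (length c - 1)) = y)" using that
      proof (induction c arbitrary: x)
        case (Cons a c)
        then have "pcas (snd a) c y" "fst a = x" by auto
        with Cons.IH[of "snd a"] show ?case by (cases c) (auto simp: nth_Cons split: nat.split)
      qed simp
      then show "\<And>i. Suc i < length c \<Longrightarrow> fst (c ! Suc i) = snd (c ! i)" "c \<noteq> [] \<Longrightarrow> fst (c ! 0) = x"
      "c \<noteq> [] \<Longrightarrow> snd (c ! (length c - 1)) = y" by auto
    qed
    \<comment> \<open>Cyclic successor and predecessor of a position; length at least 3 makes them
      different.\<close>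
    define nx where "nx i = (if Suc i = ?m then 0 else Suc i)" for i
    define pv where "pv i = (if i = 0 then ?m - 1 else i - 1)" for i
    have ne: "c \<noteq> []" using len by auto
    have nxm: "nx i < ?m" "pv i < ?m" "nx i \<noteq> pv i" "nx (pv i) = i" if "i < ?m" for i
      using that len by (auto simp: nx_def pv_def)
    have nx: "fst (c ! nx i) = snd (c ! i)" if "i < ?m" for i
    proof (cases "Suc i = ?m")
      case True
      then have "i = ?m - 1" by simp
      then show ?thesis using step(2,3)[OF cas ne] True by (simp add: nx_def)
    next
      case False
      then show ?thesis using step(1)[OF cas, of i] that by (simp add: nx_def)
    qed
    let ?S = "(\<lambda>i. dep (snd (c ! i))) ` {..<?m}"
    have "Max ?S \<in> ?S" using len by (intro Max_in) (auto simp: lessThan_empty_iff)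
    then obtain i where i: "i < ?m" "dep (snd (c ! i)) = Max ?S" by auto
    have mx: "dep (snd (c ! j)) \<le> dep (snd (c ! i))" if "j < ?m" for j
      using that i by simp
    have up: "p x = y" if "(x, y) \<in> parcs ?G \<or> (y, x) \<in> parcs ?G" "dep y \<le> dep x" for x y
    proof -
      have xy: "x \<in> V" "y \<in> V" "x \<noteq> y" "p x = y \<or> p y = x" using that(1) by auto
      show ?thesis
      proof (rule ccontr)
        assume "p x \<noteq> y"
        then have "p y = x" using xy by auto
        then have "dep x = dep y - 1" using dep_p[of y] xy by auto
        then have "dep x = 0" "dep y = 0" using that(2) by auto
        then show False using dep_eq_0 xy by metis
      qed
    qed
    have mem: "c ! j \<in> parcs ?G" if "j < ?m" for j using arcs that nth_mem by blast
    have a: "fst (c ! i) = snd (c ! pv i)" using nx[of "pv i"] nxm[OF i(1)] by simp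
    have "c ! i = (snd (c ! pv i), snd (c ! i))" using a by (metis prod.collapse)
    then have "p (snd (c ! i)) = snd (c ! pv i)"
      using mem[OF i(1)] mx[of "pv i"] nxm(2)[OF i(1)] by (metis up)
    moreover have "c ! nx i = (snd (c ! i), snd (c ! nx i))" using nx[OF i(1)] by (metis prod.collapse)
    then have "p (snd (c ! i)) = snd (c ! nx i)"
      using mem[of "nx i"] mx[of "nx i"] nxm(1)[OF i(1)] by (metis up)
    ultimately have "map snd c ! pv i = map snd c ! nx i" using nxm[OF i(1)] by simp
    then have "pv i = nx i" using dist nxm[OF i(1)] by (subst (asm) nth_eq_iff_index_eq) auto
    then show False using nxm[OF i(1)] by simp
  qed
  ultimately show ?thesis using pair_graph_tree_graph[OF fin] by (auto simp: undirected_tree_def)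
qed

text \<open>Every vertex other than \<open>r\<close> points to a neighbour nearer to
  \<open>r\<close>. An arc of \<open>T\<close> missed by this parent map, together with the path
  joining its ends in the parent tree, would be a cycle of length at least 3.\<close>

lemma undirected_tree_rooted:
  assumes T: "undirected_tree T" and r: "r \<in> pverts T"
  shows "\<exists>p. rooted (pverts T) p r \<and> tree_graph (pverts T) p = T"
proof -
  have pg: "pair_graph T" using T by (auto simp: undirected_tree_def)
  interpret T: pair_graph T by fact
  let ?V = "pverts T" and ?E = "parcs T"
  have symE: "(x, y) \<in> ?E \<Longrightarrow> (y, x) \<in> ?E" for x y
    using T.sym_arcs by (auto simp: symmetric_def sym_def)
  have reach: "(v, r) \<in> ?E\<^sup>*" if "v \<in> ?V" for v
    using T connected_pair_graph_iff[OF pg] that r T.reachable_conv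
    by (auto simp: undirected_tree_def dest!: reachable_rtranclI)
  define d where "d v = (LEAST k. (v, r) \<in> ?E ^^ k)" for v
  have d: "(v, r) \<in> ?E ^^ d v" if "v \<in> ?V" for v
    unfolding d_def using reach[OF that] by (metis LeastI_ex rtrancl_power)
  have step: "\<exists>w. (v, w) \<in> ?E \<and> d w < d v" if v: "v \<in> ?V" "v \<noteq> r" for v
  proof -
    have "d v \<noteq> 0" using d[OF v(1)] v(2) by (intro notI) auto
    then obtain k where k: "d v = Suc k" by (cases "d v") auto
    then obtain w where "(v, w) \<in> ?E" "(w, r) \<in> ?E ^^ k" using d[OF v(1)] by (metis relpow_Suc_D2)
    moreover from this have "d w \<le> k" unfolding d_def by (intro Least_le)
    ultimately show ?thesis using k by auto
  qed
  define q where "q v = (if v = r then r else SOME w. (v, w) \<in> ?E \<and> d w < d v)" for v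
  define p where "p = restrict q ?V"
  have q: "(v, q v) \<in> ?E \<and> d (q v) < d v" if "v \<in> ?V" "v \<noteq> r" for v
    using someI_ex[OF step[OF that]] that by (simp add: q_def)
  have qV: "q v \<in> ?V" if "v \<in> ?V" for v
    using q[OF that] r T.arc_snd_in_verts[of "(v, q v)"] by (cases "v = r") (auto simp: q_def)
  have "\<exists>k. (p ^^ k) v = r" if "v \<in> ?V" for v
    using that
  proof (induction "d v" arbitrary: v rule: less_induct)
    case less
    show ?case
    proof (cases "v = r")
      case False
      then obtain k where "(p ^^ k) (q v) = r" using less q[of v] qV by blast
      then have "(p ^^ Suc k) v = r" using less.prems by (simp add: funpow_swap1 p_def)
      then show ?thesis by blast
    qed (auto intro: exI[of _ 0])
  qed
  then have rt: "rooted ?V p r" using r qV by (auto simp: rooted_def p_def q_def)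
  let ?G = "tree_graph ?V p"
  have fin: "finite ?V" by simp
  interpret G: pair_graph ?G by (rule pair_graph_tree_graph[OF fin])
  interpret R: rooted_tree ?V p r using fin rt by unfold_locales
  have sub: "parcs ?G \<subseteq> ?E"
  proof
    fix e assume "e \<in> parcs ?G"
    then obtain x y where e: "e = (x, y)" "x \<in> ?V" "y \<in> ?V" "x \<noteq> y" "p x = y \<or> p y = x"
      by (cases e) auto
    have "(z, p z) \<in> ?E" if "z \<in> ?V" "p z \<noteq> z" for z
    proof -
      have "z \<noteq> r" using that R.pr by auto
      then show ?thesis using q that by (auto simp: p_def)
    qed
    then show "e \<in> ?E" using e symE by metis
  qed
  have "?E \<subseteq> parcs ?G"
  proof (rule subsetI, rule ccontr)
    fix e assume e: "e \<in> ?E" "e \<notin> parcs ?G"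
    obtain u v where uv: "e = (u, v)" by (cases e)
    have V: "u \<in> ?V" "v \<in> ?V" "u \<noteq> v"
      using e uv T.arc_fst_in_verts[of e] T.arc_snd_in_verts[of e] T.pair_no_loops[of e] by auto
    have "reachable (with_proj ?G) u v" by (rule reachable_if_rooted[OF fin rt V(1,2)])
    then obtain c where c: "pre_digraph.apath (with_proj ?G) u c v" using G.reachable_apath by auto
    then have cw: "u \<in> ?V" "set c \<subseteq> parcs ?G" "pcas u c v" "distinct (pawalk_verts u c)"
      by (auto simp: G.apath_def G.awalk_def)
    have verts: "pawalk_verts x c = x # map snd c" if "pcas x c y" for x y
      using that by (induction c arbitrary: x) auto
    have app: "pcas x (c @ [(y, z)]) z" if "pcas x c y" for x y z
      using that by (induction c arbitrary: x) auto
    have verts2: "pawalk_verts x (c @ [(y, z)]) = x # map snd c @ [z]" if "pcas x c y" for x y z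
      using that by (induction c arbitrary: x) auto
    have len: "length c \<ge> 2"
    proof (rule ccontr)
      assume "\<not> length c \<ge> 2"
      then consider "c = []" | f where "c = [f]" by (cases c; cases "tl c") auto
      then show False
      proof cases
        case 1 then show False using cw V by auto
      next
        case 2 then show False using cw e uv by (cases f) auto
      qed
    qed
    let ?c = "c @ [(v, u)]"
    have "pre_digraph.awalk (with_proj T) u ?c u"
      using cw sub V app[OF cw(3)] symE e uv by (auto simp: T.awalk_def)
    moreover have "distinct (tl (pawalk_verts u ?c))"
      using verts2[OF cw(3)] verts[OF cw(3)] cw(4) by auto
    ultimately have "pre_digraph.cycle (with_proj T) ?c" by (auto simp: T.cycle_def)
    then show False using T len by (auto simp: undirected_tree_def)
  qed
  then have "?G = T" using sub by (cases T) (auto simp: tree_graph_def)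
  then show ?thesis using rt by blast
qed

text \<open>Induction on the depth of \<open>v\<close>. The maps already agree at
  \<open>p v\<close>, so the edge between \<open>v\<close> and \<open>p v\<close> cannot be the
  parent edge of \<open>p v\<close> under \<open>p'\<close>, and it has to be that of
  \<open>v\<close>.\<close>

lemma tree_graph_root_unique:
  assumes fin: "finite V" and rt: "rooted V p r" "rooted V p' r" and eq: "tree_graph V p = tree_graph V p'"
  shows "p = p'"
proof -
  interpret P: rooted_tree V p r using fin rt by unfold_locales
  have adj: "x \<in> V \<Longrightarrow> p x \<noteq> x \<Longrightarrow> p' x = p x \<or> p' (p x) = x" for x
    using P.pV[of x] arg_cong[OF eq, of parcs] by (auto simp: tree_graph_def set_eq_iff)
  have "p' v = p v" if "v \<in> V" for v
    using that
  proof (induction "P.dep v" arbitrary: v)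
    case 0
    then show ?case using P.dep_eq_0[of v] rt by (auto simp: rooted_def)
  next
    case (Suc k)
    have ne: "v \<noteq> r" using Suc by auto
    have k: "P.dep (p v) = k" using P.dep_p[of v] Suc by simp
    then have IH: "p' (p v) = p (p v)" using Suc P.pV by auto
    show ?case
    proof (rule ccontr)
      assume "p' v \<noteq> p v"
      then have "p (p v) = v" using adj[OF Suc.prems] IH P.p_eq_self_iff[OF Suc.prems] ne by auto
      then have "P.dep v = k - 1" using P.dep_p[OF P.pV[OF Suc.prems]] k by simp
      then show False using Suc by simp
    qed
  qed
  moreover have "p v = undefined" "p' v = undefined" if "v \<notin> V" for v
    using that rt by (auto simp: rooted_def PiE_def extensional_def)
  ultimately show ?thesis by (metis ext)
qed

lemma labelled_trees_eq:
  shows "labelled_trees n = tree_graph {1..n} ` rooted_trees {1..n}"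
proof (intro set_eqI iffI)
  fix T assume "T \<in> labelled_trees n"
  then have T: "undirected_tree T" "pverts T = {1..n}" by (auto simp: labelled_trees_def)
  then have "pverts T \<noteq> {}"
    by (auto simp: undirected_tree_def Digraph_Component.connected_def strongly_connected_def mk_symmetric_def)
  then obtain r where "r \<in> pverts T" by blast
  from undirected_tree_rooted[OF T(1) this] show "T \<in> tree_graph {1..n} ` rooted_trees {1..n}"
    using T by (auto simp: rooted_trees_def)
qed (auto simp: labelled_trees_def rooted_trees_def intro: undirected_tree_tree_graph)

text \<open>A labelled tree can be rooted at each of its \<open>n\<close> vertices, and in exactly
  one way.\<close>

lemma card_tree_graph_fibre:
  assumes "T \<in> labelled_trees n"
  shows "card {p \<in> rooted_trees {1..n}. tree_graph {1..n} p = T} = n"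
proof -
  let ?V = "{1..n}"
  have T: "undirected_tree T" "pverts T = ?V" using assms by (auto simp: labelled_trees_def)
  let ?F = "{p \<in> rooted_trees ?V. tree_graph ?V p = T}"
  have rt: "\<exists>!r. rooted ?V p r" if p: "p \<in> rooted_trees ?V" for p
  proof -
    obtain r where r: "rooted ?V p r" using p unfolding rooted_trees_def by blast
    then interpret rooted_tree ?V p r by unfold_locales auto
    show ?thesis using r root_unique by blast
  qed
  define g where "g p = (THE r. rooted ?V p r)" for p :: "nat \<Rightarrow> nat"
  have g: "rooted ?V p (g p)" if "p \<in> rooted_trees ?V" for p
    unfolding g_def using theI'[OF rt[OF that]] .
  have "bij_betw g ?F ?V"
  proof (rule bij_betw_imageI)
    show "inj_on g ?F"
    proof (rule inj_onI)
      fix p q assume "p \<in> ?F" "q \<in> ?F" "g p = g q"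
      then show "p = q" using tree_graph_root_unique[of ?V p "g p" q] g[of p] g[of q] by auto
    qed
    show "g ` ?F = ?V"
    proof (intro set_eqI iffI)
      fix r assume r: "r \<in> ?V"
      then obtain p where p: "rooted ?V p r" "tree_graph ?V p = T"
        using undirected_tree_rooted[OF T(1)] T(2) by auto
      then have "p \<in> ?F" by (auto simp: rooted_trees_def)
      moreover have "g p = r" unfolding g_def using p(1) rt[of p] \<open>p \<in> ?F\<close> by (intro the1_equality) auto
      ultimately show "r \<in> g ` ?F" by blast
    next
      fix r assume "r \<in> g ` ?F"
      then show "r \<in> ?V" using g by (auto simp: rooted_def)
    qed
  qed
  then show ?thesis using bij_betw_same_card by fastforce
qed

text \<open>All fibres of \<open>tree_graph\<close> have the same size \<open>n\<close>, so the
  uniform measure lifts to rooted trees and \<open>n\<close> cancels in the quotient.\<close>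

lemma prob_random_tree:
  assumes n: "n \<ge> 1"
  shows "measure_pmf.prob (random_tree n) {T. E T} =
    real (card {p \<in> rooted_trees {1..n}. E (tree_graph {1..n} p)}) / real n ^ (n - 1)"
proof -
  let ?V = "{1..n}" and ?L = "labelled_trees n"
  have finR: "finite (rooted_trees ?V)" by (rule finite_rooted_trees) simp
  then have finL: "finite ?L" by (simp add: labelled_trees_eq)
  have cnt: "card {p \<in> rooted_trees ?V. Q (tree_graph ?V p)} = n * card {T \<in> ?L. Q T}" for Q
  proof -
    have "card {p \<in> rooted_trees ?V. Q (tree_graph ?V p)} =
      (\<Sum>T\<in>{T \<in> ?L. Q T}. card {p \<in> rooted_trees ?V. tree_graph ?V p = T})"
    proof -
      have "{p \<in> rooted_trees ?V. Q (tree_graph ?V p)} =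
        (\<Union>T\<in>{T \<in> ?L. Q T}. {p \<in> rooted_trees ?V. tree_graph ?V p = T})"
        by (auto simp: labelled_trees_eq)
      then show ?thesis using finR finL by (simp only:) (rule card_UN_disjoint, auto)
    qed
    also have "\<dots> = (\<Sum>T\<in>{T \<in> ?L. Q T}. n)"
      by (intro sum.cong refl card_tree_graph_fibre) auto
    finally show ?thesis by simp
  qed
  have tot: "n * card ?L = n ^ (n - 1)"
    using cnt[of "\<lambda>_. True"] card_rooted_trees[of ?V] n by simp
  then have "?L \<noteq> {}" using n by (cases "?L = {}") auto
  then have "measure_pmf.prob (random_tree n) {T. E T} = card (?L \<inter> {T. E T}) / card ?L"
    unfolding random_tree_def using finL by (rule measure_pmf_of_set)
  also have "?L \<inter> {T. E T} = {T \<in> ?L. E T}" by auto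
  also have "real (card {T \<in> ?L. E T}) / real (card ?L) =
     real (n * card {T \<in> ?L. E T}) / real (n * card ?L)" using n by simp
  also have "\<dots> = real (card {p \<in> rooted_trees ?V. E (tree_graph ?V p)}) / real n ^ (n - 1)"
    unfolding tot cnt[of E] by simp
  finally show ?thesis .
qed

lemma sat_cong:
  "(\<And>x. x \<in> free_vars \<phi> \<Longrightarrow> s x = s' x) \<Longrightarrow> sat G s \<phi> \<longleftrightarrow> sat G s' \<phi>"
proof (induction \<phi> arbitrary: s s')
  case (FEx x \<phi>)
  have "sat G (s(x := v)) \<phi> \<longleftrightarrow> sat G (s'(x := v)) \<phi>" for v
    by (rule FEx.IH) (use FEx.prems in auto)
  then show ?case by simp
next
  case (FAll x \<phi>)
  have "sat G (s(x := v)) \<phi> \<longleftrightarrow> sat G (s'(x := v)) \<phi>" for v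
    by (rule FAll.IH) (use FAll.prems in auto)
  then show ?case by simp
next
  case (FNot \<phi>)
  show ?case using FNot.IH[of s s'] FNot.prems by simp
next
  case (FAnd \<phi> \<psi>)
  show ?case using FAnd.IH(1)[of s s'] FAnd.IH(2)[of s s'] FAnd.prems by simp
next
  case (FOr \<phi> \<psi>)
  show ?case using FOr.IH(1)[of s s'] FOr.IH(2)[of s s'] FOr.prems by simp
qed simp_all

section \<open>Definability with bounded quantifier depth\<close>

text \<open>
  Predicates stand for formulas up to equivalence on finite graphs: \<open>definable d X P\<close> means that
  \<open>P\<close> is expressed, uniformly in the graph, by a formula of quantifier depth at most \<open>d\<close> with free
  variables in \<open>X\<close>.
\<close>

definition definable :: "nat \<Rightarrow> nat set \<Rightarrow> (nat pair_pre_digraph \<Rightarrow> (nat \<Rightarrow> nat) \<Rightarrow> bool) \<Rightarrow> bool" where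
  "definable d X P \<longleftrightarrow> (\<exists>\<phi>. free_vars \<phi> \<subseteq> X \<and> quantifier_depth \<phi> \<le> d \<and>
     (\<forall>G s. pair_graph G \<longrightarrow> range s \<subseteq> pverts G \<longrightarrow> sat G s \<phi> = P G s))"

definition definable1 :: "nat \<Rightarrow> (nat pair_pre_digraph \<Rightarrow> nat \<Rightarrow> bool) \<Rightarrow> bool" where
  "definable1 d R \<longleftrightarrow> (\<forall>x. definable d {x} (\<lambda>G s. R G (s x)))"

definition definable2 :: "nat \<Rightarrow> (nat pair_pre_digraph \<Rightarrow> nat \<Rightarrow> nat \<Rightarrow> bool) \<Rightarrow> bool" where
  "definable2 d R \<longleftrightarrow> (\<forall>x y. definable d {x, y} (\<lambda>G s. R G (s x) (s y)))"

lemma definable_mono: "definable d X P \<Longrightarrow> d \<le> d' \<Longrightarrow> X \<subseteq> X' \<Longrightarrow> definable d' X' P"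
  unfolding definable_def by (meson order_trans)

lemma definable_cong:
  assumes "definable d X P" "\<And>G s. pair_graph G \<Longrightarrow> range s \<subseteq> pverts G \<Longrightarrow> P G s = Q G s"
  shows "definable d X Q"
  using assms unfolding definable_def by metis

lemma definable_eq: "x \<in> X \<Longrightarrow> y \<in> X \<Longrightarrow> definable d X (\<lambda>G s. s x = s y)"
  unfolding definable_def by (intro exI[of _ "FEq x y"]) simp

lemma definable_adj: "x \<in> X \<Longrightarrow> y \<in> X \<Longrightarrow> definable d X (\<lambda>G s. (s x, s y) \<in> parcs G)"
  unfolding definable_def by (intro exI[of _ "FAdj x y"]) simp

lemma definable_not: "definable d X P \<Longrightarrow> definable d X (\<lambda>G s. \<not> P G s)"
proof -
  assume "definable d X P"
  then obtain \<phi> where "free_vars \<phi> \<subseteq> X" "quantifier_depth \<phi> \<le> d"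
    "\<forall>G s. pair_graph G \<longrightarrow> range s \<subseteq> pverts G \<longrightarrow> sat G s \<phi> = P G s"
    unfolding definable_def by blast
  then show ?thesis unfolding definable_def by (intro exI[of _ "FNot \<phi>"]) simp
qed

lemma definable_and: "definable d X P \<Longrightarrow> definable d X Q \<Longrightarrow> definable d X (\<lambda>G s. P G s \<and> Q G s)"
proof -
  assume "definable d X P" "definable d X Q"
  then obtain \<phi> \<psi> where "free_vars \<phi> \<subseteq> X" "quantifier_depth \<phi> \<le> d"
    "\<forall>G s. pair_graph G \<longrightarrow> range s \<subseteq> pverts G \<longrightarrow> sat G s \<phi> = P G s"
    "free_vars \<psi> \<subseteq> X" "quantifier_depth \<psi> \<le> d"
    "\<forall>G s. pair_graph G \<longrightarrow> range s \<subseteq> pverts G \<longrightarrow> sat G s \<psi> = Q G s"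
    unfolding definable_def by blast
  then show ?thesis unfolding definable_def by (intro exI[of _ "FAnd \<phi> \<psi>"]) simp
qed

lemma definable_or: "definable d X P \<Longrightarrow> definable d X Q \<Longrightarrow> definable d X (\<lambda>G s. P G s \<or> Q G s)"
proof -
  assume "definable d X P" "definable d X Q"
  then obtain \<phi> \<psi> where "free_vars \<phi> \<subseteq> X" "quantifier_depth \<phi> \<le> d"
    "\<forall>G s. pair_graph G \<longrightarrow> range s \<subseteq> pverts G \<longrightarrow> sat G s \<phi> = P G s"
    "free_vars \<psi> \<subseteq> X" "quantifier_depth \<psi> \<le> d"
    "\<forall>G s. pair_graph G \<longrightarrow> range s \<subseteq> pverts G \<longrightarrow> sat G s \<psi> = Q G s"
    unfolding definable_def by blast
  then show ?thesis unfolding definable_def by (intro exI[of _ "FOr \<phi> \<psi>"]) simp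
qed

lemma definable_imp: "definable d X P \<Longrightarrow> definable d X Q \<Longrightarrow> definable d X (\<lambda>G s. P G s \<longrightarrow> Q G s)"
  by (rule definable_cong[OF definable_or[OF definable_not[of d X P], of Q]]) auto

lemma definable_iff:
  "definable d X P \<Longrightarrow> definable d X Q \<Longrightarrow> definable d X (\<lambda>G s. P G s \<longleftrightarrow> Q G s)"
  by (rule definable_cong[OF definable_and[OF definable_imp[of d X P Q] definable_imp[of d X Q P]]]) auto

lemma definable_const: "X \<noteq> {} \<Longrightarrow> definable d X (\<lambda>G s. b)"
proof -
  assume "X \<noteq> {}"
  then obtain x where "x \<in> X" by blast
  then have T: "definable d X (\<lambda>G s. True)" using definable_eq[of x X x] by simp
  show ?thesis using T definable_not[OF T] by (cases b) auto
qed

lemma definable_ball: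
  assumes "finite I" "X \<noteq> {}" "\<And>i. i \<in> I \<Longrightarrow> definable d X (P i)"
  shows "definable d X (\<lambda>G s. \<forall>i\<in>I. P i G s)"
  using assms(1,3)
proof (induction I)
  case empty then show ?case using definable_const[OF assms(2), of d True] by simp
next
  case (insert i I) then show ?case using definable_and[of d X "P i"] by simp
qed

lemma definable_bex:
  assumes "finite I" "X \<noteq> {}" "\<And>i. i \<in> I \<Longrightarrow> definable d X (P i)"
  shows "definable d X (\<lambda>G s. \<exists>i\<in>I. P i G s)"
  using definable_not[OF definable_ball[OF assms(1,2), of d "\<lambda>i G s. \<not> P i G s"]]
    definable_not[OF assms(3)] by simp

lemma ex_fresh: "finite X \<Longrightarrow> \<exists>z::nat. z \<notin> X"
  using ex_new_if_finite infinite_UNIV_nat by blast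

text \<open>The second hypothesis says that \<open>R\<close> reads the assignment only at \<open>X\<close>.\<close>

lemma definable_ex:
  assumes X: "finite X" and R: "\<And>G s s'. (\<forall>x\<in>X. s x = s' x) \<Longrightarrow> R G s = R G s'"
    and def: "\<And>z. z \<notin> X \<Longrightarrow> definable d (insert z X) (\<lambda>G s. R G s (s z))"
  shows "definable (Suc d) X (\<lambda>G s. \<exists>v\<in>pverts G. R G s v)"
proof -
  obtain z where z: "z \<notin> X" using ex_fresh[OF X] by blast
  obtain \<phi> where \<phi>: "free_vars \<phi> \<subseteq> insert z X" "quantifier_depth \<phi> \<le> d"
    "\<And>G s. pair_graph G \<Longrightarrow> range s \<subseteq> pverts G \<Longrightarrow> sat G s \<phi> = R G s (s z)"
    using def[OF z] unfolding definable_def by blast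
  have "sat G s (FEx z \<phi>) = (\<exists>v\<in>pverts G. R G s v)" if G: "pair_graph G" "range s \<subseteq> pverts G" for G s
  proof -
    have "sat G (s(z := v)) \<phi> = R G s v" if "v \<in> pverts G" for v
    proof -
      have "range (s(z := v)) \<subseteq> pverts G" using G that by auto
      from \<phi>(3)[OF G(1) this] have "sat G (s(z := v)) \<phi> = R G (s(z := v)) v" by simp
      also have "R G (s(z := v)) = R G s" by (rule R) (use z in auto)
      finally show ?thesis .
    qed
    then show ?thesis by simp
  qed
  moreover have "free_vars (FEx z \<phi>) \<subseteq> X" "quantifier_depth (FEx z \<phi>) \<le> Suc d"
    using \<phi>(1,2) by auto
  ultimately show ?thesis unfolding definable_def by blast
qed

lemma definable_all:
  assumes X: "finite X" and R: "\<And>G s s'. (\<forall>x\<in>X. s x = s' x) \<Longrightarrow> R G s = R G s'"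
    and def: "\<And>z. z \<notin> X \<Longrightarrow> definable d (insert z X) (\<lambda>G s. R G s (s z))"
  shows "definable (Suc d) X (\<lambda>G s. \<forall>v\<in>pverts G. R G s v)"
proof -
  have "definable (Suc d) X (\<lambda>G s. \<exists>v\<in>pverts G. \<not> R G s v)"
  proof (rule definable_ex[OF X])
    show "(\<lambda>v. \<not> R G s v) = (\<lambda>v. \<not> R G s' v)" if "\<forall>x\<in>X. s x = s' x" for G s s'
      using R[OF that, of G] by simp
    show "definable d (insert z X) (\<lambda>G s. \<not> R G s (s z))" if "z \<notin> X" for z
      by (rule definable_not[OF def[OF that]])
  qed
  from definable_not[OF this] show ?thesis by simp
qed

lemma pair_graph_finite: "pair_graph G \<Longrightarrow> finite (pverts G)"
  by (auto simp: pair_graph_def pair_digraph_def pair_fin_digraph_def pair_fin_digraph_axioms_def)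

text \<open>Witnesses are chosen one after the other. The induction generalises over the set
  \<open>W\<close> of variables that hold earlier witnesses; avoiding them takes equalities only, so
  each witness costs exactly one quantifier.\<close>

lemma definable_card_ge:
  assumes X: "finite X" "X \<noteq> {}" and R: "\<And>G s s'. (\<forall>x\<in>X. s x = s' x) \<Longrightarrow> R G s = R G s'"
    and def: "\<And>z. z \<notin> X \<Longrightarrow> definable d (insert z X) (\<lambda>G s. R G s (s z))"
  shows "definable (d + c) X (\<lambda>G s. c \<le> card {v \<in> pverts G. R G s v})"
proof -
  have "definable (d + c) (X \<union> W) (\<lambda>G s. c \<le> card {v \<in> pverts G. R G s v \<and> v \<notin> s ` W})"
    if "finite W" for W
    using that
  proof (induction c arbitrary: W)
    case 0
    then show ?case using definable_const[of "X \<union> W" _ True] X by simp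
  next
    case (Suc c)
    let ?Q = "\<lambda>G s u. R G s u \<and> u \<notin> s ` W \<and> c \<le> card {v \<in> pverts G. R G s v \<and> v \<notin> s ` W \<and> v \<noteq> u}"
    have inv: "R G s = R G s' \<and> s ` W = s' ` W" if "\<forall>x\<in>X \<union> W. s x = s' x" for G s s'
    proof
      show "R G s = R G s'" by (rule R) (use that in auto)
      show "s ` W = s' ` W" using that by (auto simp: image_iff)
    qed
    have "definable (Suc (d + c)) (X \<union> W) (\<lambda>G s. \<exists>u\<in>pverts G. ?Q G s u)"
    proof (rule definable_ex)
      show "finite (X \<union> W)" using X Suc by simp
      show "?Q G s = ?Q G s'" if "\<forall>x\<in>X \<union> W. s x = s' x" for G s s'
        using inv[OF that, of G] by simp
      fix z assume z: "z \<notin> X \<union> W"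
      have 1: "definable (d + c) (insert z (X \<union> W)) (\<lambda>G s. R G s (s z))"
        by (rule definable_mono[OF def]) (use z in auto)
      have 2: "definable (d + c) (insert z (X \<union> W)) (\<lambda>G s. \<not> (\<exists>w\<in>W. s z = s w))"
        by (intro definable_not definable_bex definable_eq) (use Suc in auto)
      have 3: "definable (d + c) (X \<union> insert z W)
        (\<lambda>G s. c \<le> card {v \<in> pverts G. R G s v \<and> v \<notin> s ` insert z W})"
        using Suc.IH[of "insert z W"] Suc.prems by simp
      have e: "{v \<in> pverts G. R G s v \<and> v \<notin> s ` insert z W} = {v \<in> pverts G. R G s v \<and> v \<notin> s ` W \<and> v \<noteq> s z}"
        for G :: "nat pair_pre_digraph" and s by auto
      have "X \<union> insert z W = insert z (X \<union> W)" by auto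
      note 3 = 3[unfolded this e]
      show "definable (d + c) (insert z (X \<union> W)) (\<lambda>G s. ?Q G s (s z))"
        by (rule definable_cong[OF definable_and[OF 1 definable_and[OF 2 3]]]) auto
    qed
    then have "definable (d + Suc c) (X \<union> W) (\<lambda>G s. \<exists>u\<in>pverts G. ?Q G s u)" by simp
    then show ?case
    proof (rule definable_cong)
      fix G :: "nat pair_pre_digraph" and s assume G: "pair_graph G"
      let ?S = "{v \<in> pverts G. R G s v \<and> v \<notin> s ` W}"
      have fin: "finite ?S" using pair_graph_finite[OF G] by simp
      have eq: "{v \<in> pverts G. R G s v \<and> v \<notin> s ` W \<and> v \<noteq> u} = ?S - {u}" for u by auto
      show "(\<exists>u\<in>pverts G. ?Q G s u) = (Suc c \<le> card ?S)"
      proof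
        assume "\<exists>u\<in>pverts G. ?Q G s u"
        then obtain u where u: "u \<in> ?S" "c \<le> card (?S - {u})" using eq by auto
        then show "Suc c \<le> card ?S" using card_Suc_Diff1[OF fin u(1)] by linarith
      next
        assume c: "Suc c \<le> card ?S"
        then have "?S \<noteq> {}" by (metis card.empty not_less_eq_eq zero_le)
        then obtain u where u: "u \<in> ?S" by blast
        then have "c \<le> card (?S - {u})" using card_Suc_Diff1[OF fin u] c by linarith
        then show "\<exists>u\<in>pverts G. ?Q G s u" using u eq by auto
      qed
    qed
  qed
  from this[of "{}"] show ?thesis by simp
qed

text \<open>The two inequalities are joined by a connective, so their depths are not added: the
  price is \<open>Suc c\<close>.\<close>

lemma definable_card_eq:
  assumes X: "finite X" "X \<noteq> {}" and R: "\<And>G s s'. (\<forall>x\<in>X. s x = s' x) \<Longrightarrow> R G s = R G s'"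
    and def: "\<And>z. z \<notin> X \<Longrightarrow> definable d (insert z X) (\<lambda>G s. R G s (s z))"
  shows "definable (d + Suc c) X (\<lambda>G s. card {v \<in> pverts G. R G s v} = c)"
proof -
  have "definable (d + Suc c) X (\<lambda>G s. c \<le> card {v \<in> pverts G. R G s v} \<and> \<not> Suc c \<le> card {v \<in> pverts G. R G s v})"
    by (intro definable_and definable_not definable_mono[OF definable_card_ge[OF assms, of c]]
        definable_card_ge[OF assms]) auto
  then show ?thesis by (rule definable_cong) auto
qed

lemma definable1D: "definable1 d R \<Longrightarrow> x \<in> X \<Longrightarrow> d \<le> d' \<Longrightarrow> definable d' X (\<lambda>G s. R G (s x))"
  unfolding definable1_def by (blast intro: definable_mono)

lemma definable2D: "definable2 d R \<Longrightarrow> x \<in> X \<Longrightarrow> y \<in> X \<Longrightarrow> d \<le> d' \<Longrightarrow> definable d' X (\<lambda>G s. R G (s x) (s y))"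
  unfolding definable2_def by (rule definable_mono[of d "{x, y}"]) auto

definition near :: "'a pair_pre_digraph \<Rightarrow> nat \<Rightarrow> 'a \<Rightarrow> 'a \<Rightarrow> bool" where
  "near G k x y \<longleftrightarrow> (\<exists>m\<le>k. (x, y) \<in> parcs G ^^ m)"

lemma near_0 [simp]: "near G 0 x y \<longleftrightarrow> x = y"
  by (auto simp: near_def)

lemma near_1: "near G (Suc 0) x y \<longleftrightarrow> x = y \<or> (x, y) \<in> parcs G"
  unfolding near_def by (auto simp: le_Suc_eq)

lemma near_split:
  assumes "pair_graph G" "x \<in> pverts G"
  shows "near G (a + b) x y \<longleftrightarrow> (\<exists>z\<in>pverts G. near G a x z \<and> near G b z y)"
proof
  assume "near G (a + b) x y"
  then obtain m where m: "m \<le> a + b" "(x, y) \<in> parcs G ^^ m" by (auto simp: near_def)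
  have "m = min m a + (m - min m a)" by simp
  then have "(x, y) \<in> parcs G ^^ min m a O parcs G ^^ (m - min m a)" using m by (metis relpow_add)
  then obtain z where z: "(x, z) \<in> parcs G ^^ min m a" "(z, y) \<in> parcs G ^^ (m - min m a)" by blast
  interpret pair_graph G by fact
  have "(x, z) \<in> parcs G ^^ k \<Longrightarrow> z \<in> pverts G" for k z
    by (cases k) (use assms(2) in_arcsD2 in auto)
  then show "\<exists>z\<in>pverts G. near G a x z \<and> near G b z y"
    using z m by (intro bexI[of _ z]) (auto simp: near_def intro: exI[of _ "min m a"] exI[of _ "m - min m a"])
next
  assume "\<exists>z\<in>pverts G. near G a x z \<and> near G b z y"
  then obtain z i j where "i \<le> a" "j \<le> b" "(x, z) \<in> parcs G ^^ i" "(z, y) \<in> parcs G ^^ j"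
    by (auto simp: near_def)
  then show "near G (a + b) x y" unfolding near_def
    by (intro exI[of _ "i + j"]) (auto simp: relpow_add)
qed

text \<open>Halving: distances up to \<open>2 ^ K\<close> cost only \<open>K\<close> quantifiers.\<close>

lemma definable2_near: "k \<le> 2 ^ K \<Longrightarrow> definable2 K (\<lambda>G. near G k)"
proof (induction K arbitrary: k)
  case 0
  then consider "k = 0" | "k = Suc 0" by (cases k) auto
  then show ?case
  proof cases
    case 1 then show ?thesis by (auto simp: definable2_def intro!: definable_eq)
  next
    case 2 then show ?thesis by (auto simp: definable2_def near_1 intro!: definable_eq definable_adj definable_or)
  qed
next
  case (Suc K)
  define a where "a = k div 2"
  define b where "b = k - a"
  have ab: "k = a + b" "a \<le> 2 ^ K" "b \<le> 2 ^ K" using Suc.prems by (auto simp: a_def b_def)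
  show ?case unfolding definable2_def
  proof (intro allI)
    fix x y
    have "definable (Suc K) {x, y} (\<lambda>G s. \<exists>z\<in>pverts G. near G a (s x) z \<and> near G b z (s y))"
    proof (rule definable_ex)
      fix z
      show "definable K (insert z {x, y}) (\<lambda>G s. near G a (s x) (s z) \<and> near G b (s z) (s y))"
        by (intro definable_and definable2D[OF Suc.IH[OF ab(2)]] definable2D[OF Suc.IH[OF ab(3)]]) auto
    qed auto
    then show "definable (Suc K) {x, y} (\<lambda>G s. near G k (s x) (s y))"
    proof (rule definable_cong)
      fix G :: "nat pair_pre_digraph" and s :: "nat \<Rightarrow> nat"
      assume G: "pair_graph G" "range s \<subseteq> pverts G"
      then have "s x \<in> pverts G" by auto
      from near_split[OF G(1) this] show "(\<exists>z\<in>pverts G. near G a (s x) z \<and> near G b z (s y)) = near G k (s x) (s y)"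
        unfolding ab(1) by simp
    qed
  qed
qed

text \<open>\<open>definable\<close> speaks only about assignments into the vertex set and so says
  nothing about the graph without vertices, which is also a \<open>pair_graph\<close>. The first
  conjunct of \<open>?\<psi>\<close> excludes it; this explains the maximum with 1.\<close>

lemma defining_sentence:
  fixes G :: "nat pair_pre_digraph"
  assumes G: "pair_graph G" "pverts G \<noteq> {}" and def: "definable d {} (\<lambda>G s. P G)" and "P G"
    and iso: "\<And>H :: nat pair_pre_digraph. pair_graph H \<Longrightarrow> pverts H \<noteq> {} \<Longrightarrow> P H \<Longrightarrow> digraph_iso (with_proj G) (with_proj H)"
    and ne: "\<And>H :: nat pair_pre_digraph. P H \<Longrightarrow> pverts H \<noteq> {}"
  shows "\<exists>\<phi>. defines_graph \<phi> G \<and> quantifier_depth \<phi> \<le> max d 1"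
proof -
  obtain \<phi> where \<phi>: "free_vars \<phi> = {}" "quantifier_depth \<phi> \<le> d"
    "\<And>G s. pair_graph G \<Longrightarrow> range s \<subseteq> pverts G \<Longrightarrow> sat G s \<phi> = P G"
    using def unfolding definable_def by auto
  let ?\<psi> = "FAnd (FEx 0 (FEq 0 0)) \<phi>"
  have *: "sat H s ?\<psi> \<longleftrightarrow> pverts H \<noteq> {} \<and> P H" if H: "pair_graph H" for H :: "nat pair_pre_digraph" and s
  proof (cases "pverts H = {}")
    case False
    then obtain v where v: "v \<in> pverts H" by blast
    have "sat H s \<phi> = sat H (\<lambda>_. v) \<phi>" by (rule sat_cong) (use \<phi> in auto)
    then show ?thesis using \<phi>(3)[OF H, of "\<lambda>_. v"] v by auto
  qed auto
  have "defines_graph ?\<psi> G"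
    unfolding defines_graph_def true_in_def using * G assms(4) iso \<phi>(1) by (auto simp: sentence_def)
  then show ?thesis using \<phi>(2) by (intro exI[of _ ?\<psi>]) auto
qed

lemma D_le: "defines_graph \<phi> G \<Longrightarrow> D G \<le> quantifier_depth \<phi>"
  unfolding D_def by (intro Least_le) auto

lemma D_attained:
  assumes "defines_graph \<phi> G"
  shows "\<exists>\<psi>. defines_graph \<psi> G \<and> quantifier_depth \<psi> = D G"
  unfolding D_def by (rule LeastI_ex) (use assms in auto)

section \<open>A lower bound from twin leaves\<close>

lemma sat_automorphism:
  assumes "bij_betw \<pi> (pverts G) (pverts G)" "\<And>x y. x \<in> pverts G \<Longrightarrow> y \<in> pverts G \<Longrightarrow> (\<pi> x, \<pi> y) \<in> parcs G \<longleftrightarrow> (x, y) \<in> parcs G"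
    and "\<And>x. x \<in> free_vars \<phi> \<Longrightarrow> s x \<in> pverts G"
  shows "sat G (\<pi> \<circ> s) \<phi> \<longleftrightarrow> sat G s \<phi>"
  using assms(3)
proof (induction \<phi> arbitrary: s)
  case (FEq x y)
  then show ?case using assms(1) by (auto simp: bij_betw_def inj_on_def)
next
  case (FAdj x y)
  then show ?case using assms(2) by auto
next
  case (FEx x \<phi>)
  have "(\<exists>v\<in>pverts G. sat G ((\<pi> \<circ> s)(x := v)) \<phi>) \<longleftrightarrow> (\<exists>v\<in>pverts G. sat G ((\<pi> \<circ> s)(x := \<pi> v)) \<phi>)"
    using assms(1) by (metis (mono_tags, lifting) bij_betw_imp_surj_on image_iff)
  also have "\<dots> \<longleftrightarrow> (\<exists>v\<in>pverts G. sat G (s(x := v)) \<phi>)"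
  proof (rule bex_cong[OF refl])
    fix v assume v: "v \<in> pverts G"
    have e: "(\<pi> \<circ> s)(x := \<pi> v) = \<pi> \<circ> (s(x := v))" by auto
    show "sat G ((\<pi> \<circ> s)(x := \<pi> v)) \<phi> \<longleftrightarrow> sat G (s(x := v)) \<phi>"
      unfolding e by (rule FEx.IH) (use FEx.prems v in auto)
  qed
  finally show ?case unfolding sat.simps .
next
  case (FAll x \<phi>)
  have "(\<forall>v\<in>pverts G. sat G ((\<pi> \<circ> s)(x := v)) \<phi>) \<longleftrightarrow> (\<forall>v\<in>pverts G. sat G ((\<pi> \<circ> s)(x := \<pi> v)) \<phi>)"
    using assms(1) by (metis (mono_tags, lifting) bij_betw_imp_surj_on image_iff)
  also have "\<dots> \<longleftrightarrow> (\<forall>v\<in>pverts G. sat G (s(x := v)) \<phi>)"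
  proof (rule ball_cong[OF refl])
    fix v assume v: "v \<in> pverts G"
    have e: "(\<pi> \<circ> s)(x := \<pi> v) = \<pi> \<circ> (s(x := v))" by auto
    show "sat G ((\<pi> \<circ> s)(x := \<pi> v)) \<phi> \<longleftrightarrow> sat G (s(x := v)) \<phi>"
      unfolding e by (rule FAll.IH) (use FAll.prems v in auto)
  qed
  finally show ?case unfolding sat.simps .
next
  case (FNot \<phi>)
  show ?case using FNot.IH[of s] FNot.prems by simp
next
  case (FAnd \<phi> \<psi>)
  show ?case using FAnd.IH(1)[of s] FAnd.IH(2)[of s] FAnd.prems by simp
next
  case (FOr \<phi> \<psi>)
  show ?case using FOr.IH(1)[of s] FOr.IH(2)[of s] FOr.prems by simp
qed

definition remove_vertex :: "'a \<Rightarrow> 'a pair_pre_digraph \<Rightarrow> 'a pair_pre_digraph" where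
  "remove_vertex l G = \<lparr>pverts = pverts G - {l}, parcs = parcs G \<inter> (pverts G - {l}) \<times> (pverts G - {l})\<rparr>"

lemma pair_graph_remove_vertex: "pair_graph G \<Longrightarrow> pair_graph (remove_vertex l G)"
proof -
  assume "pair_graph G"
  then interpret pair_graph G .
  show ?thesis using sym_arcs
    by unfold_locales (auto simp: remove_vertex_def symmetric_def sym_def dest: pair_no_loops)
qed

text \<open>With fewer pebbles than twin leaves, a leaf that carries no pebble is always available.\<close>

lemma sat_remove_twin:
  assumes G: "pair_graph G" and S: "S \<subseteq> pverts G" "finite S" "l \<in> S" "v \<notin> S"
    and leaf: "\<And>x y. x \<in> S \<Longrightarrow> (x, y) \<in> parcs G \<longleftrightarrow> y = v"
    and s: "\<And>x. x \<in> free_vars \<phi> \<Longrightarrow> s x \<in> pverts G - {l}"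
    and small: "card (s ` free_vars \<phi> \<inter> S) + quantifier_depth \<phi> < card S"
  shows "sat G s \<phi> \<longleftrightarrow> sat (remove_vertex l G) s \<phi>"
proof -
  interpret pair_graph G by fact
  have symE: "(x, y) \<in> parcs G \<Longrightarrow> (y, x) \<in> parcs G" for x y
    using sym_arcs by (auto simp: symmetric_def sym_def)
  let ?G' = "remove_vertex l G"
  have V': "pverts ?G' = pverts G - {l}" by (simp add: remove_vertex_def)
  \<comment> \<open>The vertex \<open>l\<close>, which the smaller graph lacks, is replaced by a
    twin \<open>l'\<close> that carries no pebble. Transposing the two is an automorphism that fixes
    all pebbled vertices.\<close>
  have move: "\<exists>v'\<in>pverts G - {l}. sat G (t(x := l)) \<psi> \<longleftrightarrow> sat G (t(x := v')) \<psi>"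
    if t: "\<And>y. y \<in> free_vars \<psi> - {x} \<Longrightarrow> t y \<in> pverts G - {l}"
      and c: "card (t ` (free_vars \<psi> - {x}) \<inter> S) + Suc (quantifier_depth \<psi>) < card S" for t x \<psi>
  proof -
    let ?U = "insert l (t ` (free_vars \<psi> - {x}) \<inter> S)"
    have "finite ?U" using S by simp
    then have "card ?U < card S" using c by (simp add: card_insert_if)
    then obtain l' where l': "l' \<in> S" "l' \<notin> ?U" using \<open>finite ?U\<close> by (meson card_mono not_less subsetI)
    let ?\<pi> = "Transposition.transpose l l'"
    have mem: "l \<in> pverts G" "l' \<in> pverts G" "l' \<noteq> l" "l \<noteq> v" "l' \<noteq> v" using S l' by auto
    have "sat G (?\<pi> \<circ> (t(x := l'))) \<psi> \<longleftrightarrow> sat G (t(x := l')) \<psi>"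
    proof (rule sat_automorphism)
      show "bij_betw ?\<pi> (pverts G) (pverts G)"
        using mem by (intro bij_betw_byWitness[where f' = ?\<pi>]) (auto simp: Transposition.transpose_def)
      have L: "(y, l) \<in> parcs G \<longleftrightarrow> y = v" "(l, y) \<in> parcs G \<longleftrightarrow> y = v"
        "(y, l') \<in> parcs G \<longleftrightarrow> y = v" "(l', y) \<in> parcs G \<longleftrightarrow> y = v" for y
        using leaf[OF S(3)] leaf[OF l'(1)] symE by blast+
      show "(?\<pi> a, ?\<pi> b) \<in> parcs G \<longleftrightarrow> (a, b) \<in> parcs G" for a b
        using mem by (auto simp: Transposition.transpose_def L)
      show "(t(x := l')) y \<in> pverts G" if "y \<in> free_vars \<psi>" for y
        using t[of y] that mem by auto
    qed
    moreover have "sat G (?\<pi> \<circ> (t(x := l'))) \<psi> \<longleftrightarrow> sat G (t(x := l)) \<psi>"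
    proof (rule sat_cong)
      fix y assume y: "y \<in> free_vars \<psi>"
      show "(?\<pi> \<circ> (t(x := l'))) y = (t(x := l)) y"
      proof (cases "y = x")
        case False
        then have "t y \<noteq> l" "t y \<noteq> l'" using t[of y] y l' by auto
        then show ?thesis using False by (auto simp: Transposition.transpose_def)
      qed auto
    qed
    ultimately show ?thesis using mem by blast
  qed
  have quant: "((\<exists>a\<in>pverts G. sat G (t(x := a)) \<psi>) \<longleftrightarrow> (\<exists>a\<in>pverts ?G'. sat ?G' (t(x := a)) \<psi>)) \<and>
     ((\<forall>a\<in>pverts G. sat G (t(x := a)) \<psi>) \<longleftrightarrow> (\<forall>a\<in>pverts ?G'. sat ?G' (t(x := a)) \<psi>))"
    if IH: "\<And>t. (\<And>y. y \<in> free_vars \<psi> \<Longrightarrow> t y \<in> pverts G - {l}) \<Longrightarrow>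
        card (t ` free_vars \<psi> \<inter> S) + quantifier_depth \<psi> < card S \<Longrightarrow> sat G t \<psi> \<longleftrightarrow> sat ?G' t \<psi>"
      and t: "\<And>y. y \<in> free_vars \<psi> - {x} \<Longrightarrow> t y \<in> pverts G - {l}"
      and c: "card (t ` (free_vars \<psi> - {x}) \<inter> S) + Suc (quantifier_depth \<psi>) < card S" for t x \<psi>
  proof -
    have eq: "sat G (t(x := a)) \<psi> \<longleftrightarrow> sat ?G' (t(x := a)) \<psi>" if a: "a \<in> pverts G - {l}" for a
    proof (rule IH)
      show "(t(x := a)) y \<in> pverts G - {l}" if "y \<in> free_vars \<psi>" for y using t[of y] that a by auto
      have "(t(x := a)) ` free_vars \<psi> \<inter> S \<subseteq> insert a (t ` (free_vars \<psi> - {x}) \<inter> S)" by auto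
      then have "card ((t(x := a)) ` free_vars \<psi> \<inter> S) \<le> card (insert a (t ` (free_vars \<psi> - {x}) \<inter> S))"
        using S by (intro card_mono) auto
      also have "\<dots> \<le> Suc (card (t ` (free_vars \<psi> - {x}) \<inter> S))" by (rule card_insert_le_m1) auto
      finally show "card ((t(x := a)) ` free_vars \<psi> \<inter> S) + quantifier_depth \<psi> < card S" using c by simp
    qed
    obtain v' where v': "v' \<in> pverts G - {l}" "sat G (t(x := l)) \<psi> \<longleftrightarrow> sat G (t(x := v')) \<psi>"
      using move[OF t c] by blast
    show ?thesis unfolding V' using eq v' by (metis DiffE DiffI singletonD)
  qed
  show ?thesis using s small
  proof (induction \<phi> arbitrary: s)
  case (FEq x y)
  then show ?case by auto
next
  case (FAdj x y)
  then show ?case by (auto simp: remove_vertex_def)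
next
  case (FNot \<phi>)
  show ?case using FNot.IH[of s] FNot.prems by simp
next
  case (FAnd \<phi> \<psi>)
  have "card (s ` free_vars \<phi> \<inter> S) \<le> card (s ` free_vars (FAnd \<phi> \<psi>) \<inter> S)"
    "card (s ` free_vars \<psi> \<inter> S) \<le> card (s ` free_vars (FAnd \<phi> \<psi>) \<inter> S)"
    using S by (auto intro!: card_mono)
  then show ?case using FAnd.IH(1)[of s] FAnd.IH(2)[of s] FAnd.prems by simp
next
  case (FOr \<phi> \<psi>)
  have "card (s ` free_vars \<phi> \<inter> S) \<le> card (s ` free_vars (FOr \<phi> \<psi>) \<inter> S)"
    "card (s ` free_vars \<psi> \<inter> S) \<le> card (s ` free_vars (FOr \<phi> \<psi>) \<inter> S)"
    using S by (auto intro!: card_mono)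
  then show ?case using FOr.IH(1)[of s] FOr.IH(2)[of s] FOr.prems by simp
next
  case (FEx x \<phi>)
  show ?case using quant[of \<phi> x s, OF FEx.IH] FEx.prems by simp
next
  case (FAll x \<phi>)
  show ?case using quant[of \<phi> x s, OF FAll.IH] FAll.prems by simp
  qed
qed

text \<open>If \<open>D G\<close> were less than \<open>card S\<close>, the graph with one leaf of
  \<open>S\<close> deleted would satisfy a defining sentence of \<open>G\<close> although it has
  fewer vertices. The hypothesis on \<open>\<phi>\<close> ensures that the \<open>LEAST\<close> in
  \<open>D\<close> is attained.\<close>

theorem D_ge_twin_leaves:
  fixes G :: "nat pair_pre_digraph"
  assumes G: "pair_graph G" and S: "S \<subseteq> pverts G" "v \<in> pverts G - S"
    and leaf: "\<And>x y. x \<in> S \<Longrightarrow> (x, y) \<in> parcs G \<longleftrightarrow> y = v"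
    and def: "defines_graph \<phi> G"
  shows "card S \<le> D G"
proof (rule ccontr)
  assume small: "\<not> card S \<le> D G"
  obtain \<psi> where \<psi>: "defines_graph \<psi> G" "quantifier_depth \<psi> = D G" using D_attained[OF def] by blast
  have fin: "finite S" using S pair_graph_finite[OF G] finite_subset by auto
  obtain l where l: "l \<in> S" using small by fastforce
  let ?H = "remove_vertex l G"
  have fv: "free_vars \<psi> = {}" using \<psi> by (auto simp: defines_graph_def sentence_def)
  have "sat G s \<psi> \<longleftrightarrow> sat ?H s \<psi>" for s
    by (rule sat_remove_twin[OF G S(1) fin l _ leaf]) (use fv S small \<psi> in auto)
  then have "true_in ?H \<psi>" using \<psi> by (auto simp: defines_graph_def true_in_def)
  then have "digraph_iso (with_proj G) (with_proj ?H)"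
    using \<psi>(1) pair_graph_remove_vertex[OF G, of l] unfolding defines_graph_def by blast
  then obtain f where f: "pre_digraph.digraph_isomorphism (with_proj G) f" "with_proj ?H = app_iso f (with_proj G)"
    by (auto simp: digraph_iso_def)
  have "pverts ?H = iso_verts f ` pverts G" using f(2) by (metis verts_app_iso with_proj_simps(1))
  moreover have "inj_on (iso_verts f) (pverts G)"
    using f(1) by (auto simp: pre_digraph.digraph_isomorphism_def)
  ultimately have "card (pverts ?H) = card (pverts G)" by (simp add: card_image)
  moreover have "pverts ?H = pverts G - {l}" by (simp add: remove_vertex_def)
  ultimately show False using l S pair_graph_finite[OF G]
    by (metis card_Diff1_less less_irrefl subsetD)
qed

section \<open>Coverings of graphs by a coloured tree\<close>

lemma colour_match:
  assumes fin: "finite A" "finite B"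
    and cnt: "\<And>c. c \<in> \<kappa> ` A \<Longrightarrow> card {a \<in> A. \<kappa> a = c} \<le> card {b \<in> B. \<mu> b = c}"
  shows "\<exists>g. inj_on g A \<and> g ` A \<subseteq> B \<and> (\<forall>a\<in>A. \<mu> (g a) = \<kappa> a)"
proof -
  let ?P = "\<lambda>c g. inj_on g {a \<in> A. \<kappa> a = c} \<and> g ` {a \<in> A. \<kappa> a = c} \<subseteq> {b \<in> B. \<mu> b = c}"
  have fin': "finite {a \<in> A. \<kappa> a = c}" "finite {b \<in> B. \<mu> b = c}" for c using fin by simp_all
  have "\<forall>c\<in>\<kappa> ` A. \<exists>g. ?P c g"
    by (intro ballI iffD2[OF inj_on_iff_card_le[OF fin']] cnt)
  from bchoice[OF this] obtain g where g': "\<forall>c\<in>\<kappa> ` A. ?P c (g c)" ..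
  then have g: "?P c (g c)" if "c \<in> \<kappa> ` A" for c using that by blast
  have mem: "g (\<kappa> a) a \<in> B" "\<mu> (g (\<kappa> a) a) = \<kappa> a" if "a \<in> A" for a
    using g[of "\<kappa> a"] that by blast+
  have "inj_on (\<lambda>a. g (\<kappa> a) a) A"
  proof (rule inj_onI)
    fix a b assume ab: "a \<in> A" "b \<in> A" "g (\<kappa> a) a = g (\<kappa> b) b"
    then have "\<kappa> a = \<kappa> b" using mem by metis
    then show "a = b" using g[of "\<kappa> a"] ab by (auto simp: inj_on_def)
  qed
  then show ?thesis using mem by (intro exI[of _ "\<lambda>a. g (\<kappa> a) a"]) auto
qed

lemma sum_card_fibres:
  assumes "finite A" "finite C" "\<kappa> ` A \<subseteq> C"
  shows "(\<Sum>c\<in>C. card {a \<in> A. \<kappa> a = c}) = card A"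
  using sum.group[OF assms, of "\<lambda>_. 1::nat"] by simp

text \<open>
  Matching colours along the tree gives a covering map from the tree to \<open>H\<close>; it is bijective since
  the colour of the root is carried by a single vertex on both sides.
\<close>

theorem covering_iso:
  fixes V :: "'a set" and H :: "'b pair_pre_digraph" and \<kappa> :: "'a \<Rightarrow> 'c"
  assumes fin: "finite V" and rt: "rooted V p r" and H: "pair_graph H" and \<rho>: "\<rho> \<in> pverts H"
    and col: "\<And>x. x \<in> pverts H \<Longrightarrow> \<mu> x = \<kappa> r \<longleftrightarrow> x = \<rho>"
    and root: "\<And>u. u \<in> V \<Longrightarrow> \<kappa> u = \<kappa> r \<Longrightarrow> u = r"
    and rng: "\<And>x. x \<in> pverts H \<Longrightarrow> \<mu> x \<in> \<kappa> ` V"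
    and cnt: "\<And>u x v. u \<in> V \<Longrightarrow> x \<in> pverts H \<Longrightarrow> \<mu> x = \<kappa> u \<Longrightarrow> v \<in> V \<Longrightarrow>
      card {w \<in> V. (u, w) \<in> parcs (tree_graph V p) \<and> \<kappa> w = \<kappa> v} =
      card {y \<in> pverts H. (x, y) \<in> parcs H \<and> \<mu> y = \<kappa> v}"
  shows "digraph_iso (with_proj (tree_graph V p)) (with_proj H)"
proof -
  interpret rooted_tree V p r using fin rt by unfold_locales
  interpret H: pair_graph H by fact
  let ?T = "tree_graph V p"
  have symH: "(x, y) \<in> parcs H \<Longrightarrow> (y, x) \<in> parcs H" for x y
    using H.sym_arcs by (auto simp: symmetric_def sym_def)
  define N where "N u = {w \<in> V. (u, w) \<in> parcs ?T}" for u
  define M where "M x = {y \<in> pverts H. (x, y) \<in> parcs H}" for x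
  have finN: "finite (N u)" "finite (M x)" for u x using fin by (auto simp: N_def M_def)
  have N: "N u = ch u \<union> (if u = r then {} else {p u})" if u: "u \<in> V" for u
  proof -
    have "w \<in> N u \<longleftrightarrow> w \<in> ch u \<or> u \<noteq> r \<and> w = p u" for w
      using u pV[OF u] p_eq_self_iff[of w] p_eq_self_iff[OF u] pr by (auto simp: N_def ch_def)
    then show ?thesis by auto
  qed
  have pch: "p u \<notin> ch u" if "u \<in> V" "u \<noteq> r" for u
    using dep_ch[of "p u" u] dep_p[OF that(1)] by auto
  have cntN: "card {w \<in> N u. \<kappa> w = \<kappa> v} = card {y \<in> M x. \<mu> y = \<kappa> v}"
    if "u \<in> V" "x \<in> pverts H" "\<mu> x = \<kappa> u" "v \<in> V" for u x v
    using cnt[OF that] by (simp add: N_def M_def conj_assoc)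
  \<comment> \<open>Partial coverings are extended level by level. Injectivity on a neighbourhood is
    demanded only at depths less than \<open>k\<close>, since the children of deeper vertices have
    no prescribed images yet.\<close>
  define ok where "ok k f \<longleftrightarrow> f r = \<rho> \<and> (\<forall>v\<in>V. dep v \<le> k \<longrightarrow> f v \<in> pverts H \<and> \<mu> (f v) = \<kappa> v \<and>
      (v \<noteq> r \<longrightarrow> (f v, f (p v)) \<in> parcs H)) \<and> (\<forall>u\<in>V. dep u < k \<longrightarrow> inj_on f (N u))" for k f
  have "\<exists>f. ok k f" for k
  proof (induction k)
    case 0
    have "ok 0 (\<lambda>_. \<rho>)" using \<rho> col dep_eq_0 by (auto simp: ok_def)
    then show ?case by blast
  next
    case (Suc k)
    then obtain f where f: "ok k f" by blast
    have fv: "f v \<in> pverts H" "\<mu> (f v) = \<kappa> v" "v \<noteq> r \<Longrightarrow> (f v, f (p v)) \<in> parcs H"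
      if "v \<in> V" "dep v \<le> k" for v using f that by (auto simp: ok_def)
    \<comment> \<open>What is left for the children of \<open>u\<close>: the image of the parent is
      already taken. Both colour counts lose one at the colour of the parent, so they still
      agree.\<close>
    define B where "B u = M (f u) - (if u = r then {} else {f (p u)})" for u
    have "\<exists>g. inj_on g (ch u) \<and> g ` ch u \<subseteq> B u \<and> (\<forall>a\<in>ch u. \<mu> (g a) = \<kappa> a)"
      if u: "u \<in> V" "dep u = k" for u
    proof (rule colour_match)
      show "finite (ch u)" "finite (B u)" using finN by (auto simp: B_def)
      fix c assume "c \<in> \<kappa> ` ch u"
      then obtain v where v: "v \<in> V" "c = \<kappa> v" by (auto simp: ch_def)
      have e: "card {w \<in> N u. \<kappa> w = c} = card {y \<in> M (f u). \<mu> y = c}"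
        using cntN[of u "f u" v] fv u v by simp
      show "card {a \<in> ch u. \<kappa> a = c} \<le> card {b \<in> B u. \<mu> b = c}"
      proof (cases "u = r")
        case True
        then show ?thesis using e N[OF u(1)] by (simp add: B_def)
      next
        case False
        have pu: "p u \<in> V" "dep (p u) \<le> k" using pV[OF u(1)] dep_p[OF u(1)] u by auto
        have "f (p u) \<in> M (f u)" using fv(1)[OF pu] fv(3)[of u] u False by (auto simp: M_def)
        have fp: "\<mu> (f (p u)) = \<kappa> (p u)" using fv(2)[OF pu] .
        have 1: "card {w \<in> N u. \<kappa> w = c} = card {a \<in> ch u. \<kappa> a = c} + (if \<kappa> (p u) = c then 1 else 0)"
        proof -
          have "{w \<in> N u. \<kappa> w = c} = {a \<in> ch u. \<kappa> a = c} \<union> (if \<kappa> (p u) = c then {p u} else {})"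
            using N[OF u(1)] False by auto
          then show ?thesis using pch[OF u(1) False] by auto
        qed
        have 2: "card {y \<in> M (f u). \<mu> y = c} = card {b \<in> B u. \<mu> b = c} + (if \<kappa> (p u) = c then 1 else 0)"
        proof -
          have "{y \<in> M (f u). \<mu> y = c} = {b \<in> B u. \<mu> b = c} \<union> (if \<kappa> (p u) = c then {f (p u)} else {})"
            using \<open>f (p u) \<in> M (f u)\<close> fp False by (auto simp: B_def)
          moreover have "f (p u) \<notin> B u" using False by (auto simp: B_def)
          ultimately show ?thesis using finN by (auto simp: B_def)
        qed
        show ?thesis using e 1 2 by simp
      qed
    qed
    then have "\<forall>u\<in>{u \<in> V. dep u = k}. \<exists>g. inj_on g (ch u) \<and> g ` ch u \<subseteq> B u \<and> (\<forall>a\<in>ch u. \<mu> (g a) = \<kappa> a)"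
      by blast
    from bchoice[OF this] obtain g where g': "\<forall>u\<in>{u \<in> V. dep u = k}.
       inj_on (g u) (ch u) \<and> g u ` ch u \<subseteq> B u \<and> (\<forall>a\<in>ch u. \<mu> (g u a) = \<kappa> a)" ..
    have g: "inj_on (g u) (ch u) \<and> g u ` ch u \<subseteq> B u \<and> (\<forall>a\<in>ch u. \<mu> (g u a) = \<kappa> a)"
      if "u \<in> V" "dep u = k" for u using g' that by blast
    define f' where "f' w = (if dep w = Suc k then g (p w) w else f w)" for w
    have old: "f' w = f w" if "dep w \<le> k" for w using that by (simp add: f'_def)
    have new: "f' w = g (p w) w" "p w \<in> V" "dep (p w) = k" "w \<in> ch (p w)" "w \<noteq> r" if "w \<in> V" "dep w = Suc k" for w
    proof -
      show "w \<noteq> r" using that by auto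
      then show "f' w = g (p w) w" "p w \<in> V" "dep (p w) = k" "w \<in> ch (p w)"
        using that pV[of w] dep_p[of w] by (auto simp: f'_def ch_def)
    qed
    have "ok (Suc k) f'"
      unfolding ok_def
    proof (intro conjI ballI impI)
      show "f' r = \<rho>" using f by (simp add: f'_def ok_def)
    next
      fix v assume v: "v \<in> V" "dep v \<le> Suc k"
      have "f' v \<in> pverts H \<and> \<mu> (f' v) = \<kappa> v \<and> (v \<noteq> r \<longrightarrow> (f' v, f' (p v)) \<in> parcs H)"
      proof (cases "dep v \<le> k")
        case True
        moreover have "f' (p v) = f (p v)" using old[of "p v"] dep_p[OF v(1)] True by simp
        ultimately show ?thesis using fv[OF v(1)] old by simp
      next
        case False
        then have d: "dep v = Suc k" using v by simp
        note n = new[OF v(1) d]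
        have "g (p v) v \<in> B (p v)" "\<mu> (g (p v) v) = \<kappa> v" using g[OF n(2,3)] n(4) by blast+
        then have "g (p v) v \<in> pverts H" "(f (p v), g (p v) v) \<in> parcs H" "\<mu> (g (p v) v) = \<kappa> v"
          by (auto simp: B_def M_def)
        then show ?thesis using n(1) old[of "p v"] n(3) symH by simp
      qed
      then show "f' v \<in> pverts H" "\<mu> (f' v) = \<kappa> v" "v \<noteq> r \<Longrightarrow> (f' v, f' (p v)) \<in> parcs H" by auto
    next
      fix u assume u: "u \<in> V" "dep u < Suc k"
      show "inj_on f' (N u)"
      proof (cases "dep u < k")
        case True
        have "f' w = f w" if "w \<in> N u" for w
        proof (rule old)
          show "dep w \<le> k" using that N[OF u(1)] dep_ch[of w u] dep_p[OF u(1)] True by (auto split: if_splits)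
        qed
        moreover have "inj_on f (N u)" using f u True by (auto simp: ok_def)
        ultimately show ?thesis by (simp cong: inj_on_cong)
      next
        case False
        then have d: "dep u = k" using u by simp
        have "f' w = g u w" if "w \<in> ch u" for w
          using that dep_ch[OF that] d by (auto simp: f'_def ch_def)
        then have 1: "inj_on f' (ch u)" "f' ` ch u \<subseteq> B u" using g[OF u(1) d] by (auto cong: inj_on_cong)
        show ?thesis
        proof (cases "u = r")
          case True
          then show ?thesis using 1 N[OF u(1)] by simp
        next
          case False
          have "f' (p u) = f (p u)" using old[of "p u"] dep_p[OF u(1)] d by simp
          then have "f' (p u) \<notin> f' ` ch u" using 1 False by (auto simp: B_def)
          then show ?thesis using 1 N[OF u(1)] False pch[OF u(1)] by simp
        qed
      qed
    qed
    then show ?case by blast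
  qed
  then obtain f where f0: "ok (Suc (Max (dep ` V))) f" by blast
  have mx: "dep v \<le> Max (dep ` V)" if "v \<in> V" for v using fin that by simp
  have fv: "f v \<in> pverts H" "\<mu> (f v) = \<kappa> v" "v \<noteq> r \<Longrightarrow> (f v, f (p v)) \<in> parcs H" "inj_on f (N v)"
    if "v \<in> V" for v
  proof -
    have "dep v \<le> Suc (Max (dep ` V))" "dep v < Suc (Max (dep ` V))" using mx[OF that] by auto
    then show "f v \<in> pverts H" "\<mu> (f v) = \<kappa> v" "v \<noteq> r \<Longrightarrow> (f v, f (p v)) \<in> parcs H" "inj_on f (N v)"
      using f0 that unfolding ok_def by blast+
  qed
  have fr: "f r = \<rho>" using f0 by (simp add: ok_def)
  have hom: "(f u, f w) \<in> parcs H" if u: "u \<in> V" and w: "w \<in> N u" for u w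
  proof (cases "w \<in> ch u")
    case True
    then have "w \<in> V" "w \<noteq> r" "p w = u" by (auto simp: ch_def)
    then show ?thesis using fv(3)[of w] symH by auto
  next
    case False
    then show ?thesis using w N[OF u] fv(3)[OF u] by (auto split: if_splits)
  qed
  have NV: "N u \<subseteq> V" for u by (auto simp: N_def)
  \<comment> \<open>Local injectivity together with equal colour counts, summed over all colours,
    makes \<open>f\<close> a bijection on every neighbourhood; this is the covering
    property.\<close>
  have img: "f ` N u = M (f u)" if u: "u \<in> V" for u
  proof (rule card_subset_eq[OF finN(2)])
    show "f ` N u \<subseteq> M (f u)" using hom[OF u] NV fv(1) by (auto simp: M_def)
    have "card (f ` N u) = card (N u)" using fv(4)[OF u] by (rule card_image)
    also have "\<dots> = (\<Sum>c\<in>\<kappa> ` V. card {w \<in> N u. \<kappa> w = c})"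
      by (intro sum_card_fibres[symmetric] finite_imageI fin finN image_mono NV)
    also have "\<dots> = (\<Sum>c\<in>\<kappa> ` V. card {y \<in> M (f u). \<mu> y = c})"
    proof (rule sum.cong[OF refl])
      fix c assume "c \<in> \<kappa> ` V"
      then obtain v where "v \<in> V" "c = \<kappa> v" by blast
      then show "card {w \<in> N u. \<kappa> w = c} = card {y \<in> M (f u). \<mu> y = c}"
        using cntN[OF u fv(1,2)[OF u]] by simp
    qed
    also have "\<dots> = card (M (f u))"
      using rng by (intro sum_card_fibres finite_imageI fin finN) (unfold M_def, blast)
    finally show "card (f ` N u) = card (M (f u))" .
  qed
  have adjN: "w \<in> N u \<longleftrightarrow> u \<in> N w" if "u \<in> V" "w \<in> V" for u w
    using that by (auto simp: N_def)
  have pN: "p u \<in> N u" if "u \<in> V" "u \<noteq> r" for u using N[OF that(1)] that by auto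
  \<comment> \<open>A coincidence \<open>f v = f u\<close> is passed on to the parent of
    \<open>u\<close> and some neighbour of \<open>v\<close>, and finally to the root, whose colour
    occurs only once in the tree. Injectivity on neighbourhoods brings it back down.\<close>
  have inj: "v = u" if "u \<in> V" "v \<in> V" "f v = f u" for u v
    using that
  proof (induction "dep u" arbitrary: u v)
    case 0
    then have "u = r" using dep_eq_0 by simp
    then have "\<kappa> v = \<kappa> r" using 0 fv(2) by metis
    then show ?case using root[OF 0(3)] \<open>u = r\<close> by simp
  next
    case (Suc k)
    have ne: "u \<noteq> r" using Suc.hyps(2) by auto
    have pu: "p u \<in> V" "dep (p u) = k" using pV[OF Suc.prems(1)] dep_p[OF Suc.prems(1)] Suc.hyps(2) by auto
    have "f (p u) \<in> M (f v)" using img[OF Suc.prems(1)] pN[OF Suc.prems(1) ne] Suc.prems(3) by auto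
    then obtain v' where v': "v' \<in> N v" "f v' = f (p u)" using img[OF Suc.prems(2)] by (metis imageE)
    have "v' = p u" using Suc.hyps(1)[of "p u" v'] pu v' NV by auto
    then have "v \<in> N (p u)" using v' adjN[OF Suc.prems(2) pu(1)] by simp
    moreover have "u \<in> N (p u)" using pN[OF Suc.prems(1) ne] adjN[OF Suc.prems(1) pu(1)] by simp
    ultimately show ?case using fv(4)[OF pu(1)] Suc.prems(3) by (auto dest: inj_onD)
  qed
  \<comment> \<open>A vertex with the colour of \<open>u\<close> has a neighbour with the colour of
    \<open>p u\<close>, and so on up to the root colour, which only \<open>\<rho> = f r\<close>
    carries. The covering property lifts this path back into the tree.\<close>
  have surj: "x \<in> f ` V" if "x \<in> pverts H" "u \<in> V" "\<mu> x = \<kappa> u" for x u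
    using that
  proof (induction "dep u" arbitrary: u x)
    case 0
    then have "u = r" using dep_eq_0 by simp
    then have "x = \<rho>" using 0 col by simp
    then show ?case using fr rV by auto
  next
    case (Suc k)
    have ne: "u \<noteq> r" using Suc.hyps(2) by auto
    have pu: "p u \<in> V" "dep (p u) = k" using pV[OF Suc.prems(2)] dep_p[OF Suc.prems(2)] Suc.hyps(2) by auto
    have "p u \<in> {w \<in> N u. \<kappa> w = \<kappa> (p u)}" using pN[OF Suc.prems(2) ne] by simp
    then have "card {w \<in> N u. \<kappa> w = \<kappa> (p u)} \<noteq> 0" using finN by (auto simp: card_eq_0_iff)
    then have "card {y \<in> M x. \<mu> y = \<kappa> (p u)} \<noteq> 0"
      using cntN[OF Suc.prems(2) Suc.prems(1) Suc.prems(3) pu(1)] by simp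
    then obtain y where y: "y \<in> M x" "\<mu> y = \<kappa> (p u)" by (metis (mono_tags, lifting) card.empty empty_Collect_eq)
    then have "y \<in> f ` V" using Suc.hyps(1)[of "p u" y] pu by (auto simp: M_def)
    then obtain w where w: "w \<in> V" "y = f w" by blast
    have "x \<in> M (f w)" using y(1) w Suc.prems(1) symH by (auto simp: M_def)
    then show ?case using img[OF w(1)] NV by blast
  qed
  have inj_f: "inj_on f V" using inj by (auto simp: inj_on_def)
  have im_f: "f ` V = pverts H"
  proof
    show "f ` V \<subseteq> pverts H" using fv(1) by blast
    show "pverts H \<subseteq> f ` V"
    proof
      fix x assume x: "x \<in> pverts H"
      then obtain u where "u \<in> V" "\<mu> x = \<kappa> u" using rng by blast
      then show "x \<in> f ` V" using surj x by blast
    qed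
  qed
  have arcs: "parcs H = map_prod f f ` parcs ?T"
  proof (intro set_eqI iffI)
    fix e assume e: "e \<in> parcs H"
    obtain x y where xy: "e = (x, y)" by (cases e)
    have "x \<in> pverts H" "y \<in> pverts H" using e xy H.in_arcsD1 H.in_arcsD2 by auto
    then obtain u where u: "u \<in> V" "x = f u" using im_f by auto
    then have "y \<in> M (f u)" using e xy \<open>y \<in> pverts H\<close> by (auto simp: M_def)
    then obtain w where w: "w \<in> N u" "y = f w" using img[OF u(1)] by (metis imageE)
    then have "(u, w) \<in> parcs ?T" unfolding N_def by blast
    then show "e \<in> map_prod f f ` parcs ?T" using xy u w by (auto intro!: image_eqI[of _ _ "(u, w)"])
  next
    fix e assume "e \<in> map_prod f f ` parcs ?T"
    then obtain u w where uw: "(u, w) \<in> parcs ?T" "e = (f u, f w)" by (auto simp del: tree_graph_simps)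
    then have "u \<in> V" "w \<in> N u" by (auto simp: N_def)
    then show "e \<in> parcs H" using hom uw by simp
  qed
  define hm where "hm = \<lparr>iso_verts = f, iso_arcs = map_prod f f, iso_head = (snd :: 'b \<times> 'b \<Rightarrow> 'b), iso_tail = fst\<rparr>"
  interpret T: pair_graph ?T by (rule pair_graph_tree_graph[OF fin])
  have wf: "wf_digraph (with_proj ?T)" by (rule T.wf_digraph_axioms)
  have "inj_on (map_prod f f) (parcs ?T)"
    by (rule inj_on_subset[OF map_prod_inj_on[OF inj_f inj_f]]) auto
  then have "pre_digraph.digraph_isomorphism (with_proj ?T) hm"
    using wf inj_f by (auto simp: pre_digraph.digraph_isomorphism_def hm_def)
  moreover have "with_proj H = app_iso hm (with_proj ?T)"
    using im_f arcs by (simp add: app_iso_def hm_def with_proj_def)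
  ultimately show ?thesis unfolding digraph_iso_def by blast
qed

section \<open>Distances and subtree shapes in a rooted tree\<close>

lemma near_trans: "near G a x z \<Longrightarrow> near G b z y \<Longrightarrow> near G (a + b) x y"
  unfolding near_def by (metis add_mono relpow_add relcompI)

lemma near_mono: "near G a x y \<Longrightarrow> a \<le> b \<Longrightarrow> near G b x y"
  unfolding near_def by (meson order_trans)

text \<open>Isomorphism types of finite rooted trees: the multiset holds the types of the subtrees
  at the children of the root.\<close>

datatype shape = Shape "shape multiset"

context rooted_tree
begin

abbreviation T :: "'a pair_pre_digraph" where "T \<equiv> tree_graph V p"

text \<open>A walk can be straightened into \<open>i\<close> steps up followed by \<open>j\<close>
  steps down. A further step up cancels the last descent, or lengthens the climb if there is none; a
  further step down lengthens the descent.\<close>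

lemma near_iff:
  assumes x: "x \<in> V" and y: "y \<in> V"
  shows "near T k x y \<longleftrightarrow> (\<exists>i j. i + j \<le> k \<and> (p ^^ i) x = (p ^^ j) y)"
proof
  assume "near T k x y"
  then obtain m where m: "m \<le> k" "(x, y) \<in> parcs T ^^ m" unfolding near_def by blast
  have "\<exists>i j. i + j \<le> m \<and> (p ^^ i) x = (p ^^ j) y"
    using m(2)
  proof (induction m arbitrary: y)
    case 0
    then have "(p ^^ 0) x = (p ^^ 0) y" by simp
    then show ?case by blast
  next
    case (Suc m)
    from Suc.prems obtain z where z: "(x, z) \<in> parcs T ^^ m" "(z, y) \<in> parcs T" by (rule relpow_Suc_E)
    obtain i j where ij: "i + j \<le> m" "(p ^^ i) x = (p ^^ j) z" using Suc.IH[OF z(1)] by blast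
    have "p z = y \<or> p y = z" using z(2) by simp
    then show ?case
    proof
      assume zy: "p z = y"
      show ?thesis
      proof (cases j)
        case 0
        then have "(p ^^ Suc i) x = (p ^^ 0) y" using ij zy by simp
        then show ?thesis using ij by (intro exI[of _ "Suc i"] exI[of _ 0]) simp
      next
        case (Suc j')
        then have "(p ^^ i) x = (p ^^ j') y" using ij zy by (simp add: funpow_swap1)
        then show ?thesis using ij Suc by (intro exI[of _ i] exI[of _ j']) simp
      qed
    next
      assume "p y = z"
      then have "(p ^^ i) x = (p ^^ Suc j) y" using ij by (simp add: funpow_swap1)
      then show ?thesis using ij by (intro exI[of _ i] exI[of _ "Suc j"]) simp
    qed
  qed
  then show "\<exists>i j. i + j \<le> k \<and> (p ^^ i) x = (p ^^ j) y" using m(1) by (meson order_trans)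
next
  assume "\<exists>i j. i + j \<le> k \<and> (p ^^ i) x = (p ^^ j) y"
  then obtain i j where ij: "i + j \<le> k" "(p ^^ i) x = (p ^^ j) y" by blast
  have step: "near T 1 z (p z) \<and> near T 1 (p z) z" if "z \<in> V" for z
    using that pV[OF that] by (auto simp: near_1)
  have up: "near T i z ((p ^^ i) z) \<and> near T i ((p ^^ i) z) z" if "z \<in> V" for z i
  proof (induction i)
    case (Suc i)
    then show ?case
      using step[OF ppV[OF that, of i]] near_trans[of T i z "(p ^^ i) z" 1 "(p ^^ Suc i) z"]
        near_trans[of T 1 "(p ^^ Suc i) z" "(p ^^ i) z" i z] by simp
  qed simp
  have "near T (i + j) x y"
    using near_trans[of T i x "(p ^^ i) x" j y] up[OF x, of i] up[OF y, of j] ij(2) by simp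
  then show "near T k x y" using ij(1) by (rule near_mono)
qed

lemma near_sym: "x \<in> V \<Longrightarrow> y \<in> V \<Longrightarrow> near T k x y \<longleftrightarrow> near T k y x"
  by (simp add: near_iff) (metis add.commute)

lemma near_dep: "x \<in> V \<Longrightarrow> y \<in> V \<Longrightarrow> near T k x y \<Longrightarrow> dep x \<le> dep y + k"
proof -
  assume V: "x \<in> V" "y \<in> V" and "near T k x y"
  then obtain i j where "i + j \<le> k" "(p ^^ i) x = (p ^^ j) y" by (auto simp: near_iff)
  moreover from this have "dep x - i = dep y - j" using dep_pp V by metis
  ultimately show ?thesis by linarith
qed

text \<open>The difference in depth already uses up all \<open>m\<close> steps, so none is left for
  climbing away from \<open>h\<close>.\<close>

lemma near_below:
  assumes "h \<in> V" "z \<in> V" "near T m h z" "dep h + m \<le> dep z"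
  shows "(p ^^ m) z = h"
proof -
  obtain i j where ij: "i + j \<le> m" "(p ^^ i) h = (p ^^ j) z" using assms by (auto simp: near_iff)
  then have "dep h - i = dep z - j" using dep_pp assms by metis
  then have "i = 0" "j = m" using ij assms by linarith+
  then show ?thesis using ij by simp
qed

lemma near_anc: "z \<in> V \<Longrightarrow> near T k ((p ^^ k) z) z"
proof -
  assume z: "z \<in> V"
  have "0 + k \<le> k \<and> (p ^^ 0) ((p ^^ k) z) = (p ^^ k) z" by simp
  then show ?thesis unfolding near_iff[OF ppV[OF z] z] by blast
qed

lemma near_anc': "z \<in> V \<Longrightarrow> near T k z ((p ^^ k) z)"
  using near_anc near_sym ppV by blast

lemma pp_dep_eq: "z \<in> V \<Longrightarrow> (p ^^ m) z = y \<Longrightarrow> y \<noteq> r \<Longrightarrow> dep z = dep y + m"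
  using dep_pp[of z m] pp_eq_r_iff[of z m] by auto

text \<open>This is how a formula without orientation recognises descent. A path from
  \<open>y\<close> that starts upwards, or that has a step to spare, would bring \<open>p y\<close>
  within distance \<open>m\<close> as well.\<close>

lemma near_child_iff:
  assumes "y \<in> V" "y \<noteq> r" "z \<in> V"
  shows "near T m y z \<and> \<not> near T m (p y) z \<longleftrightarrow> (p ^^ m) z = y"
proof
  assume L: "near T m y z \<and> \<not> near T m (p y) z"
  then obtain i j where ij: "i + j \<le> m" "(p ^^ i) y = (p ^^ j) z" using assms by (auto simp: near_iff)
  have no: "(p ^^ i') (p y) \<noteq> (p ^^ j') z" if "i' + j' \<le> m" for i' j'
    using L that near_iff[OF pV[OF assms(1)] assms(3)] by blast
  have i: "i = 0"
  proof (cases i)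
    case (Suc i')
    then show ?thesis using no[of i' j] ij by (simp add: funpow_swap1)
  qed
  have "j = m"
  proof (rule ccontr)
    assume "j \<noteq> m"
    then show False using no[of 0 "Suc j"] ij i by simp
  qed
  then show "(p ^^ m) z = y" using ij i by simp
next
  assume R: "(p ^^ m) z = y"
  have d: "dep z = dep y + m" using pp_dep_eq[OF assms(3) R assms(2)] .
  have "dep y \<noteq> 0" using dep_eq_0[OF assms(1)] assms(2) by simp
  then have "dep (p y) < dep y" using dep_p[OF assms(1)] by simp
  then have "\<not> near T m (p y) z"
    using near_dep[OF assms(3) pV[OF assms(1)], of m] near_sym[OF assms(3) pV[OF assms(1)]] d by auto
  then show "near T m y z \<and> \<not> near T m (p y) z" using near_anc[OF assms(3), of m] R by simp
qed

text \<open>The number bounds the recursion. Once it reaches the size of the subtree the value no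
  longer changes, so \<open>card V\<close> serves all vertices alike in \<open>ty\<close>.\<close>

primrec shp :: "nat \<Rightarrow> 'a \<Rightarrow> shape" where
  "shp 0 v = Shape {#}"
| "shp (Suc h) v = Shape (image_mset (shp h) (mset_set (ch v)))"

definition ty :: "'a \<Rightarrow> shape" where "ty v = shp (card V) v"

lemma shp_stable: "v \<in> V \<Longrightarrow> card (sub v) \<le> h \<Longrightarrow> card (sub v) \<le> h' \<Longrightarrow> shp h v = shp h' v"
proof (induction "card (sub v)" arbitrary: v h h' rule: less_induct)
  case less
  have "card (sub v) \<noteq> 0" using card_sub[OF less.prems(1)] by simp
  then obtain k k' where k: "h = Suc k" "h' = Suc k'" using less.prems by (metis not0_implies_Suc le_zero_eq)
  have "shp k w = shp k' w" if "w \<in> ch v" for w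
  proof -
    have "card (sub w) \<le> (\<Sum>w\<in>ch v. card (sub w))" using that by (intro member_le_sum) auto
    then have "card (sub w) < card (sub v)" using card_sub[OF less.prems(1)] by simp
    then show ?thesis using less.hyps[of w k k'] less.prems k that ch_V by auto
  qed
  then show ?case unfolding k by (simp, intro image_mset_cong) auto
qed

lemma card_sub_le: "card (sub v) \<le> card V"
  using finV sub_V by (intro card_mono) auto

lemma card_sub_ch: "v \<in> V \<Longrightarrow> w \<in> ch v \<Longrightarrow> card (sub w) < card (sub v)"
  using card_sub[of v] member_le_sum[of w "ch v" "\<lambda>w. card (sub w)"] by simp

lemma ty_eq: "v \<in> V \<Longrightarrow> ty v = Shape (image_mset ty (mset_set (ch v)))"
proof -
  assume v: "v \<in> V"
  have "ty v = shp (Suc (card V)) v" unfolding ty_def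
    by (rule shp_stable[OF v]) (use card_sub_le[of v] in auto)
  moreover have "ty = shp (card V)" by (rule ext) (simp add: ty_def)
  ultimately show ?thesis by simp
qed

definition off :: "nat \<Rightarrow> 'a \<Rightarrow> 'a set" where "off i z = ch ((p ^^ Suc i) z) - {(p ^^ i) z}"

definition offty :: "nat \<Rightarrow> 'a \<Rightarrow> shape multiset" where "offty i z = image_mset ty (mset_set (off i z))"

lemma finite_off [simp]: "finite (off i z)" by (simp add: off_def)

lemma ty_step:
  assumes "z \<in> V" "(p ^^ i) z \<noteq> r"
  shows "ty ((p ^^ Suc i) z) = Shape (add_mset (ty ((p ^^ i) z)) (offty i z))"
proof -
  let ?c = "(p ^^ i) z"
  have c: "?c \<in> ch ((p ^^ Suc i) z)" using assms ppV[OF assms(1)] by (simp add: ch_def)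
  then have e: "ch ((p ^^ Suc i) z) = insert ?c (off i z)" "?c \<notin> off i z" by (auto simp: off_def)
  have "ty ((p ^^ Suc i) z) = Shape (image_mset ty (mset_set (insert ?c (off i z))))"
    using ty_eq[OF ppV[OF assms(1), of "Suc i"]] e(1) by metis
  then show ?thesis using e(2) by (simp add: offty_def)
qed

text \<open>Equal shapes allow the path from \<open>v\<close> down to \<open>z\<close> to be copied
  below \<open>y\<close>, choosing at each step a child of the same shape.\<close>

lemma ty_path:
  assumes "ty y = ty v" "y \<in> V" "y \<noteq> r" "z \<in> V" "(p ^^ m) z = v" "v \<noteq> r"
  shows "\<exists>z'\<in>V. (p ^^ m) z' = y \<and> (\<forall>i\<le>m. ty ((p ^^ i) z') = ty ((p ^^ i) z))"
  using assms
proof (induction m arbitrary: y v)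
  case 0
  then show ?case by (intro bexI[of _ y]) auto
next
  case (Suc m)
  let ?c = "(p ^^ m) z"
  have c: "?c \<in> V" "?c \<noteq> r" "p ?c = v" using Suc.prems ppV pr by auto
  then have vV: "v \<in> V" using pV by auto
  have "?c \<in> ch v" using c by (simp add: ch_def)
  then have "ty ?c \<in># image_mset ty (mset_set (ch v))" by simp
  also have "image_mset ty (mset_set (ch v)) = image_mset ty (mset_set (ch y))"
    using Suc.prems(1) ty_eq[OF vV] ty_eq[OF Suc.prems(2)] by simp
  finally obtain c' where c': "c' \<in> ch y" "ty c' = ty ?c" by auto
  obtain z' where z': "z' \<in> V" "(p ^^ m) z' = c'" "\<forall>i\<le>m. ty ((p ^^ i) z') = ty ((p ^^ i) z)"
    using Suc.IH[OF c'(2) ch_V[OF c'(1)] ch_neq_r[OF c'(1)] Suc.prems(4) refl c(2)] by blast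
  have "(p ^^ Suc m) z' = y" using z'(2) ch_p[OF c'(1)] by simp
  moreover have "ty ((p ^^ i) z') = ty ((p ^^ i) z)" if "i \<le> Suc m" for i
    using that z'(3) \<open>(p ^^ Suc m) z' = y\<close> Suc.prems(1,5) by (cases "i = Suc m") auto
  ultimately show ?case using z'(1) by blast
qed

text \<open>The shape of a subtree is determined by the shapes hanging off a path down to a leaf.\<close>

lemma ty_eq_iff_path:
  assumes y: "y \<in> V" "y \<noteq> r" and v: "v \<noteq> r" and z: "z \<in> V" "(p ^^ m) z = v" "ch z = {}"
  shows "ty y = ty v \<longleftrightarrow> (\<exists>z'\<in>V. (p ^^ m) z' = y \<and> ch z' = {} \<and> (\<forall>i<m. offty i z' = offty i z))"
proof
  have nr: "(p ^^ i) w \<noteq> r" if "i \<le> m" "(p ^^ m) w \<noteq> r" for i w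
  proof
    assume "(p ^^ i) w = r"
    then have "(p ^^ m) w = r" using funpow_split[OF that(1), of p w] by (simp only: ppr)
    then show False using that(2) by simp
  qed
  assume "ty y = ty v"
  then obtain z' where z': "z' \<in> V" "(p ^^ m) z' = y" "\<forall>i\<le>m. ty ((p ^^ i) z') = ty ((p ^^ i) z)"
    using ty_path[OF _ y z(1,2) v] by blast
  have "ty z' = ty z" using z'(3) by (metis funpow_0 zero_le)
  then have "image_mset ty (mset_set (ch z')) = {#}" using ty_eq[OF z'(1)] ty_eq[OF z(1)] z(3) by simp
  then have "ch z' = {}" by (simp add: mset_set_empty_iff)
  moreover have "offty i z' = offty i z" if "i < m" for i
  proof -
    have "ty ((p ^^ Suc i) z') = ty ((p ^^ Suc i) z)" "ty ((p ^^ i) z') = ty ((p ^^ i) z)"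
      using z'(3) that by (auto simp del: funpow.simps)
    then show ?thesis
      using ty_step[OF z'(1), of i] ty_step[OF z(1), of i] nr[of i z'] nr[of i z] that z'(2) z(2) y v by simp
  qed
  ultimately show "\<exists>z'\<in>V. (p ^^ m) z' = y \<and> ch z' = {} \<and> (\<forall>i<m. offty i z' = offty i z)"
    using z' by blast
next
  have nr: "(p ^^ i) w \<noteq> r" if "i \<le> m" "(p ^^ m) w \<noteq> r" for i w
  proof
    assume "(p ^^ i) w = r"
    then have "(p ^^ m) w = r" using funpow_split[OF that(1), of p w] by (simp only: ppr)
    then show False using that(2) by simp
  qed
  assume "\<exists>z'\<in>V. (p ^^ m) z' = y \<and> ch z' = {} \<and> (\<forall>i<m. offty i z' = offty i z)"
  then obtain z' where z': "z' \<in> V" "(p ^^ m) z' = y" "ch z' = {}" "\<And>i. i < m \<Longrightarrow> offty i z' = offty i z"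
    by blast
  have "i \<le> m \<Longrightarrow> ty ((p ^^ i) z') = ty ((p ^^ i) z)" for i
  proof (induction i)
    case 0
    then show ?case using ty_eq[OF z'(1)] ty_eq[OF z(1)] z'(3) z(3) by simp
  next
    case (Suc i)
    then show ?case
      using ty_step[OF z'(1), of i] ty_step[OF z(1), of i] nr[of i z'] nr[of i z] z' z(2) y v by simp
  qed
  then show "ty y = ty v" using z'(2) z(2) by blast
qed

text \<open>Descend to a child with a largest subtree. Another child has a subtree no larger, and
  both fit into the subtree of the parent without its top, so the other one has less than half of
  it.\<close>

lemma heavy_path:
  assumes "v \<in> V" "v \<noteq> r"
  shows "\<exists>z\<in>V. \<exists>m. (p ^^ m) z = v \<and> m < card (sub v) \<and> ch z = {} \<and>
    (\<forall>i<m. \<forall>c\<in>off i z. 2 * card (sub c) < card (sub v))"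
  using assms
proof (induction "card (sub v)" arbitrary: v rule: less_induct)
  case less
  show ?case
  proof (cases "ch v = {}")
    case True
    have "card (sub v) > 0" using card_sub[OF less.prems(1)] by simp
    then show ?thesis using less.prems True by (intro bexI[of _ v] exI[of _ 0]) auto
  next
    case False
    let ?f = "\<lambda>w. card (sub w)"
    have "Max (?f ` ch v) \<in> ?f ` ch v" using False by (intro Max_in) auto
    then obtain u where u: "u \<in> ch v" "?f u = Max (?f ` ch v)" by auto
    have mx: "?f w \<le> ?f u" if "w \<in> ch v" for w using u(2) that by simp
    have lt: "?f u < ?f v" by (rule card_sub_ch[OF less.prems(1) u(1)])
    obtain z m where z: "z \<in> V" "(p ^^ m) z = u" "m < card (sub u)" "ch z = {}"
      "\<forall>i<m. \<forall>c\<in>off i z. 2 * card (sub c) < card (sub u)"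
      using less.hyps[OF lt ch_V[OF u(1)] ch_neq_r[OF u(1)]] by blast
    have "2 * card (sub c) < card (sub v)" if "i < Suc m" "c \<in> off i z" for i c
    proof (cases "i = m")
      case True
      then have c: "c \<in> ch v" "c \<noteq> u" using that(2) z(2) ch_p[OF u(1)] by (auto simp: off_def)
      have "?f c + ?f u = (\<Sum>w\<in>{c, u}. ?f w)" using c by simp
      also have "\<dots> \<le> (\<Sum>w\<in>ch v. ?f w)" using c u by (intro sum_mono2) auto
      finally show ?thesis using mx[OF c(1)] card_sub[OF less.prems(1)] by simp
    next
      case False
      then have "2 * card (sub c) < card (sub u)" using that z(5)[rule_format, of i c] by simp
      then show ?thesis using lt by simp
    qed
    moreover have "(p ^^ Suc m) z = v" using z(2) ch_p[OF u(1)] by simp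
    ultimately show ?thesis using z lt by (intro bexI[of _ z] exI[of _ "Suc m"]) auto
  qed
qed

text \<open>
  \<open>chain_bound v k w\<close>: below \<open>v\<close>, any \<open>k\<close> vertices of a descending path have at most \<open>w\<close> children
  altogether.  These children are what Spoiler has to count.
\<close>

definition chain_bound :: "'a \<Rightarrow> nat \<Rightarrow> nat \<Rightarrow> bool" where
  "chain_bound v k w \<longleftrightarrow> (\<forall>z\<in>V. \<forall>j S. (p ^^ j) z = v \<longrightarrow> S \<subseteq> (\<lambda>i. (p ^^ i) z) ` {..j} \<longrightarrow> card S \<le> k \<longrightarrow>
     (\<Sum>u\<in>S. card (ch u)) \<le> w)"

text \<open>The parent of \<open>c\<close> lies above every chain below \<open>c\<close> and can be
  added to it. Its children are thus deducted from the budget, at the price of one vertex of the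
  chain.\<close>

lemma chain_bound_below:
  assumes b: "chain_bound v (Suc k) w" and z: "z \<in> V" "(p ^^ Suc j) z = v" and "c \<in> ch ((p ^^ Suc i) z)"
    and ij: "i \<le> j"
  shows "card (ch ((p ^^ Suc i) z)) \<le> w" "chain_bound c k (w - card (ch ((p ^^ Suc i) z)))"
proof -
  let ?h = "(p ^^ Suc i) z"
  have hv: "(p ^^ (j - i)) ?h = v" using funpow_split[of "Suc i" "Suc j" p z] ij z by simp
  have hV: "?h \<in> V" using ppV z by blast
  have "{?h} \<subseteq> (\<lambda>i. (p ^^ i) ?h) ` {..j - i}" by (auto intro: image_eqI[of _ _ 0])
  then have "(\<Sum>u\<in>{?h}. card (ch u)) \<le> w"
    using b hV hv unfolding chain_bound_def by (metis card.empty card.insert empty_iff finite.emptyI Suc_le_mono zero_le)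
  then show h: "card (ch ?h) \<le> w" by simp
  show "chain_bound c k (w - card (ch ?h))" unfolding chain_bound_def
  proof (intro ballI allI impI)
    fix x a S assume x: "x \<in> V" "(p ^^ a) x = c" and S: "S \<subseteq> (\<lambda>i. (p ^^ i) x) ` {..a}" "card S \<le> k"
    have pc: "p c = ?h" "c \<noteq> r" "c \<in> V" using assms(4) by (auto simp: ch_def simp del: funpow.simps)
    have xh: "(p ^^ Suc a) x = ?h" using x pc(1) by simp
    have nin: "?h \<notin> S"
    proof
      assume "?h \<in> S"
      then obtain b where b: "b \<le> a" "?h = (p ^^ b) x" using S(1) by blast
      have "dep c = dep x - a" "dep ?h = dep x - b" using dep_pp[OF x(1)] x(2) b(2) by metis+
      moreover have "dep c = Suc (dep ?h)" by (rule dep_ch[OF assms(4)])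
      ultimately show False using b(1) by linarith
    qed
    have finS: "finite S" using S(1) finite_subset by blast
    have "(p ^^ (Suc a + (j - i))) x = v" using xh hv by (metis add.commute comp_apply funpow_add)
    moreover have "insert ?h S \<subseteq> (\<lambda>i. (p ^^ i) x) ` {..Suc a + (j - i)}"
    proof
      fix s assume "s \<in> insert ?h S"
      then consider "s = ?h" | b where "b \<le> a" "s = (p ^^ b) x" using S(1) by blast
      then show "s \<in> (\<lambda>i. (p ^^ i) x) ` {..Suc a + (j - i)}"
      proof cases
        case 1 then show ?thesis using xh by (intro image_eqI[of _ _ "Suc a"]) auto
      next
        case 2 then show ?thesis by (intro image_eqI[of _ _ b]) auto
      qed
    qed
    moreover have "card (insert ?h S) \<le> Suc k" using S(2) finS nin by simp
    ultimately have "(\<Sum>u\<in>insert ?h S. card (ch u)) \<le> w"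
      using b x(1) unfolding chain_bound_def by blast
    then show "(\<Sum>u\<in>S. card (ch u)) \<le> w - card (ch ?h)" using finS nin by simp
  qed
qed

end

lemma count_image_mset_set:
  "finite A \<Longrightarrow> count (image_mset f (mset_set A)) c = card {a \<in> A. f a = c}"
proof (induction A rule: finite_induct)
  case (insert x A)
  have "{a \<in> insert x A. f a = c} = (if f x = c then insert x {a \<in> A. f a = c} else {a \<in> A. f a = c})"
    by auto
  then show ?case using insert by simp
qed simp

text \<open>The right side mentions only values taken on \<open>B\<close>: one exact count for each
  of them and the condition that no other value occurs. In this form a formula compares an unknown
  family \<open>A\<close> with a known one.\<close>

lemma image_mset_set_eq_iff:
  assumes "finite A" "finite B"
  shows "image_mset f (mset_set A) = image_mset f (mset_set B) \<longleftrightarrow>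
    (\<forall>b\<in>B. card {a \<in> A. f a = f b} = card {b' \<in> B. f b' = f b}) \<and> (\<forall>a\<in>A. \<exists>b\<in>B. f a = f b)"
proof
  assume e: "image_mset f (mset_set A) = image_mset f (mset_set B)"
  have "card {a \<in> A. f a = c} = card {b \<in> B. f b = c}" for c
    using count_image_mset_set[OF assms(1), of f c] count_image_mset_set[OF assms(2), of f c] e by simp
  moreover have "f ` A = f ` B" using arg_cong[OF e, of set_mset] assms by simp
  then have "\<forall>a\<in>A. \<exists>b\<in>B. f a = f b" by blast
  ultimately show "(\<forall>b\<in>B. card {a \<in> A. f a = f b} = card {b' \<in> B. f b' = f b}) \<and> (\<forall>a\<in>A. \<exists>b\<in>B. f a = f b)"
    by blast
next
  assume R: "(\<forall>b\<in>B. card {a \<in> A. f a = f b} = card {b' \<in> B. f b' = f b}) \<and> (\<forall>a\<in>A. \<exists>b\<in>B. f a = f b)"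
  have "card {a \<in> A. f a = c} = card {b \<in> B. f b = c}" for c
  proof (cases "c \<in> f ` B")
    case True then show ?thesis using R by blast
  next
    case False
    then have "{a \<in> A. f a = c} = {}" "{b \<in> B. f b = c} = {}" using R by blast+
    then show ?thesis by (simp only:)
  qed
  then show "image_mset f (mset_set A) = image_mset f (mset_set B)"
    using assms by (intro multiset_eqI) (simp add: count_image_mset_set)
qed

section \<open>Formulas for the shapes of small subtrees\<close>

locale nat_tree = rooted_tree V p r for V :: "nat set" and p r
begin

lemma pairT: "pair_graph T" by (rule pair_graph_tree_graph[OF finV])

text \<open>
  The formula guesses the bottom \<open>z'\<close> of the heavy path and compares, vertex by vertex, the multisets
  of shapes hanging off; every recursive call at least halves the subtree.
\<close>

lemma shape_definable:
  assumes M: "M \<le> 2 ^ K"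
  shows "v \<in> V \<Longrightarrow> v \<noteq> r \<Longrightarrow> card (sub v) < 2 ^ k \<Longrightarrow> card (sub v) \<le> M \<Longrightarrow> chain_bound v k w \<Longrightarrow>
    \<exists>R. definable2 (w + 6 * k + K) R \<and> (\<forall>y\<in>V - {r}. R T (p y) y \<longleftrightarrow> ty y = ty v)"
proof (induction k arbitrary: v w)
  case 0
  then show ?case using card_sub[of v] by simp
next
  case (Suc k)
  note v = Suc.prems(1,2)
  obtain z m where z: "z \<in> V" "(p ^^ m) z = v" "m < card (sub v)" "ch z = {}"
    and small: "\<forall>i<m. \<forall>c\<in>off i z. 2 * card (sub c) < card (sub v)"
    using heavy_path[OF v] by blast
  define C where "C = (\<Union>i<m. off i z)"
  have "\<forall>c\<in>C. \<exists>R. definable2 (w - card (ch (p c)) + 6 * k + K) R \<and> (\<forall>y\<in>V - {r}. R T (p y) y \<longleftrightarrow> ty y = ty c)"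
  proof
    fix c assume "c \<in> C"
    then obtain i where i: "i < m" "c \<in> off i z" by (auto simp: C_def)
    have c: "c \<in> ch ((p ^^ Suc i) z)" using i(2) by (simp add: off_def)
    have pc: "p c = (p ^^ Suc i) z" by (rule ch_p[OF c])
    have sm: "2 * card (sub c) < card (sub v)" using small i by simp
    have m1: "(p ^^ Suc (m - 1)) z = v" using z(2) i(1) by simp
    have "i \<le> m - 1" using i(1) by simp
    from chain_bound_below(2)[OF Suc.prems(5) z(1) m1 c this]
    have b: "chain_bound c k (w - card (ch (p c)))" unfolding pc .
    show "\<exists>R. definable2 (w - card (ch (p c)) + 6 * k + K) R \<and> (\<forall>y\<in>V - {r}. R T (p y) y \<longleftrightarrow> ty y = ty c)"
    proof (rule Suc.IH[OF ch_V[OF c] ch_neq_r[OF c] _ _ b])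
      show "card (sub c) < 2 ^ k" using sm Suc.prems(3) by simp
      show "card (sub c) \<le> M" using sm Suc.prems(4) by simp
    qed
  qed
  from bchoice[OF this] obtain Rc where Rc': "\<forall>c\<in>C. definable2 (w - card (ch (p c)) + 6 * k + K) (Rc c) \<and>
      (\<forall>y\<in>V - {r}. Rc c T (p y) y \<longleftrightarrow> ty y = ty c)" ..
  then have Rc: "definable2 (w - card (ch (p c)) + 6 * k + K) (Rc c)"
    "\<And>y. y \<in> V \<Longrightarrow> y \<noteq> r \<Longrightarrow> Rc c T (p y) y \<longleftrightarrow> ty y = ty c" if "c \<in> C" for c
    using that by auto
  define n where "n i c = card {c' \<in> off i z. ty c' = ty c}" for i c
  \<comment> \<open>Here \<open>x\<close> stands for the parent of \<open>y\<close>, which fixes the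
    upward direction. The parent of \<open>h\<close> is within \<open>m - 1 - i\<close> of
    \<open>x\<close>, and the path vertex below \<open>h\<close> is within \<open>i\<close> of
    \<open>z'\<close>; the other children of \<open>h\<close> satisfy neither.\<close>
  define offp where "offp i G x h z' u \<longleftrightarrow> (h, u) \<in> parcs G \<and> \<not> near G (m - 1 - i) x u \<and> \<not> near G i u z'"
    for i and G :: "nat pair_pre_digraph" and x h z' u
  define body where "body i G x y z' \<longleftrightarrow> (\<exists>h\<in>pverts G. near G (m - Suc i) y h \<and> near G (Suc i) h z' \<and>
      (\<forall>c\<in>off i z. card {u \<in> pverts G. offp i G x h z' u \<and> Rc c G h u} = n i c) \<and>
      (\<forall>u\<in>pverts G. offp i G x h z' u \<longrightarrow> (\<exists>c\<in>off i z. Rc c G h u)))"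
    for i and G :: "nat pair_pre_digraph" and x y z'
  \<comment> \<open>The condition on the neighbours of \<open>z'\<close> says that it is a leaf: its
    distance from \<open>x\<close> is \<open>m + 1\<close>, so its parent is at distance
    \<open>m\<close> but a child would be at distance \<open>m + 2\<close>.\<close>
  define R where "R G x y \<longleftrightarrow> (\<exists>z'\<in>pverts G. near G m y z' \<and> \<not> near G m x z' \<and>
      (\<forall>u\<in>pverts G. (z', u) \<in> parcs G \<longrightarrow> near G m x u) \<and> (\<forall>i\<in>{..<m}. body i G x y z'))"
    for G :: "nat pair_pre_digraph" and x y
  let ?d = "w + 6 * k + K"
  have near_def': "definable2 K (\<lambda>G. near G j)" if "j \<le> m" for j
    by (rule definable2_near) (use that z(3) Suc.prems(4) M in linarith)
  have offp_def': "definable d X (\<lambda>G s. offp i G (s x) (s h) (s z') (s u))"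
    if "i < m" "{x, h, z', u} \<subseteq> X" "K \<le> d" for i x h z' u X d
    unfolding offp_def
    by (intro definable_and definable_not definable_adj definable2D[OF near_def']) (use that in auto)
  have body_def': "definable (Suc (Suc ?d)) X (\<lambda>G s. body i G (s x) (s y) (s z'))"
    if i: "i < m" and X: "{x, y, z'} \<subseteq> X" "finite X" for i x y z' X
    unfolding body_def
  proof (rule definable_ex)
    fix h assume h: "h \<notin> X"
    let ?X = "insert h X"
    have X': "finite ?X" "?X \<noteq> {}" using X by auto
    have "definable (Suc ?d) ?X (\<lambda>G s. card {u \<in> pverts G. offp i G (s x) (s h) (s z') u \<and> Rc c G (s h) u} = n i c)"
      if c: "c \<in> off i z" for c
    proof -
      have cC: "c \<in> C" using i c by (auto simp: C_def)
      have c': "c \<in> ch ((p ^^ Suc i) z)" using c by (simp add: off_def)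
      have pc: "p c = (p ^^ Suc i) z" by (rule ch_p[OF c'])
      have m1: "(p ^^ Suc (m - 1)) z = v" using z(2) i(1) by simp
      have "i \<le> m - 1" using i by simp
      from chain_bound_below(1)[OF Suc.prems(5) z(1) m1 c' this]
      have "card (ch (p c)) \<le> w" unfolding pc .
      moreover have "n i c \<le> card (ch (p c))" unfolding n_def pc by (intro card_mono) (auto simp: off_def)
      \<comment> \<open>The counted vertices are children of \<open>p c\<close>, and all those
        children have been deducted from the depth of \<open>Rc c\<close>. Counting therefore fits
        into the budget \<open>w\<close>, up to one quantifier.\<close>
      ultimately have le: "(w - card (ch (p c)) + 6 * k + K) + Suc (n i c) \<le> Suc ?d" by linarith
      show ?thesis
      proof (rule definable_mono[OF definable_card_eq[OF X'] le order_refl])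
        show "(\<lambda>u. offp i G (s x) (s h) (s z') u \<and> Rc c G (s h) u) = (\<lambda>u. offp i G (s' x) (s' h) (s' z') u \<and> Rc c G (s' h) u)"
          if "\<forall>a\<in>?X. s a = s' a" for G s s'
        proof -
          have "s x = s' x" "s h = s' h" "s z' = s' z'" using that X by auto
          then show ?thesis by simp
        qed
        show "definable (w - card (ch (p c)) + 6 * k + K) (insert u ?X)
           (\<lambda>G s. offp i G (s x) (s h) (s z') (s u) \<and> Rc c G (s h) (s u))" for u
          by (intro definable_and offp_def' i definable2D[OF Rc(1)[OF cC]]) (use X in auto)
      qed
    qed
    moreover have "definable (Suc ?d) ?X (\<lambda>G s. \<forall>u\<in>pverts G. offp i G (s x) (s h) (s z') u \<longrightarrow> (\<exists>c\<in>off i z. Rc c G (s h) u))"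
    proof (rule definable_all[OF X'(1)])
      show "(\<lambda>u. offp i G (s x) (s h) (s z') u \<longrightarrow> (\<exists>c\<in>off i z. Rc c G (s h) u)) =
        (\<lambda>u. offp i G (s' x) (s' h) (s' z') u \<longrightarrow> (\<exists>c\<in>off i z. Rc c G (s' h) u))"
        if "\<forall>a\<in>?X. s a = s' a" for G s s'
      proof -
        have "s x = s' x" "s h = s' h" "s z' = s' z'" using that X by auto
        then show ?thesis by simp
      qed
      have "C \<subseteq> C" by simp
      show "definable ?d (insert u ?X) (\<lambda>G s. offp i G (s x) (s h) (s z') (s u) \<longrightarrow> (\<exists>c\<in>off i z. Rc c G (s h) (s u)))" for u
      proof (intro definable_imp offp_def' i definable_bex finite_off)
        fix c assume "c \<in> off i z"
        then have "c \<in> C" using i by (auto simp: C_def)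
        then show "definable ?d (insert u ?X) (\<lambda>G s. Rc c G (s h) (s u))"
          by (intro definable2D[OF Rc(1)]) auto
      qed (use X in auto)
    qed
    ultimately show "definable (Suc ?d) ?X (\<lambda>G s. near G (m - Suc i) (s y) (s h) \<and> near G (Suc i) (s h) (s z') \<and>
      (\<forall>c\<in>off i z. card {u \<in> pverts G. offp i G (s x) (s h) (s z') u \<and> Rc c G (s h) u} = n i c) \<and>
      (\<forall>u\<in>pverts G. offp i G (s x) (s h) (s z') u \<longrightarrow> (\<exists>c\<in>off i z. Rc c G (s h) u)))"
      by (intro definable_and definable2D[OF near_def'] definable_ball finite_off) (use X i in auto)
  next
    show "(\<lambda>h. near G (m - Suc i) (s y) h \<and> near G (Suc i) h (s z') \<and>
      (\<forall>c\<in>off i z. card {u \<in> pverts G. offp i G (s x) h (s z') u \<and> Rc c G h u} = n i c) \<and>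
      (\<forall>u\<in>pverts G. offp i G (s x) h (s z') u \<longrightarrow> (\<exists>c\<in>off i z. Rc c G h u))) =
     (\<lambda>h. near G (m - Suc i) (s' y) h \<and> near G (Suc i) h (s' z') \<and>
      (\<forall>c\<in>off i z. card {u \<in> pverts G. offp i G (s' x) h (s' z') u \<and> Rc c G h u} = n i c) \<and>
      (\<forall>u\<in>pverts G. offp i G (s' x) h (s' z') u \<longrightarrow> (\<exists>c\<in>off i z. Rc c G h u)))"
      if "\<forall>a\<in>X. s a = s' a" for G s s'
    proof -
      have "s x = s' x" "s y = s' y" "s z' = s' z'" using that X by auto
      then show ?thesis by simp
    qed
  qed (use X in auto)
  have R_def': "definable2 (w + 6 * Suc k + K) R"
    unfolding definable2_def
  proof (intro allI)
    fix x y
    have "definable (Suc (Suc (Suc ?d))) {x, y} (\<lambda>G s. R G (s x) (s y))"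
      unfolding R_def
    proof (rule definable_ex)
      fix z' assume z': "z' \<notin> {x, y}"
      have "definable (Suc K) (insert z' {x, y}) (\<lambda>G s. \<forall>u\<in>pverts G. (s z', u) \<in> parcs G \<longrightarrow> near G m (s x) u)"
        by (rule definable_all) (auto intro!: definable_imp definable_adj definable2D[OF near_def'])
      then have "definable (Suc (Suc ?d)) (insert z' {x, y}) (\<lambda>G s. \<forall>u\<in>pverts G. (s z', u) \<in> parcs G \<longrightarrow> near G m (s x) u)"
        by (rule definable_mono) auto
      then show "definable (Suc (Suc ?d)) (insert z' {x, y}) (\<lambda>G s. near G m (s y) (s z') \<and> \<not> near G m (s x) (s z') \<and>
        (\<forall>u\<in>pverts G. (s z', u) \<in> parcs G \<longrightarrow> near G m (s x) u) \<and> (\<forall>i\<in>{..<m}. body i G (s x) (s y) (s z')))"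
        by (intro definable_and definable_not definable2D[OF near_def'] definable_ball body_def') auto
    qed auto
    then show "definable (w + 6 * Suc k + K) {x, y} (\<lambda>G s. R G (s x) (s y))" by (rule definable_mono) auto
  qed
  have "R T (p y) y \<longleftrightarrow> ty y = ty v" if y: "y \<in> V" "y \<noteq> r" for y
  proof -
    have yd: "dep y \<noteq> 0" using dep_eq_0[OF y(1)] y(2) by simp
    have dpy: "dep (p y) = dep y - 1" by (rule dep_p[OF y(1)])
    have pyV: "p y \<in> V" by (rule pV[OF y(1)])
    have leaf: "(\<forall>u\<in>V. (z', u) \<in> parcs T \<longrightarrow> near T m (p y) u) \<longleftrightarrow> ch z' = {}"
      if z': "z' \<in> V" "(p ^^ m) z' = y" for z'
    proof -
      have dz: "dep z' = dep y + m" by (rule pp_dep_eq[OF z' y(2)])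
      have "z' \<noteq> r" using dz yd by auto
      then have pz: "p z' \<noteq> z'" using p_eq_self_iff[OF z'(1)] by simp
      show ?thesis
      proof
        assume L: "\<forall>u\<in>V. (z', u) \<in> parcs T \<longrightarrow> near T m (p y) u"
        show "ch z' = {}"
        proof (rule ccontr)
          assume "ch z' \<noteq> {}"
          then obtain u where u: "u \<in> ch z'" by blast
          then have uV: "u \<in> V" "p u = z'" "u \<noteq> z'" using dep_ch[OF u] by (auto simp: ch_def)
          then have "near T m (p y) u" using L z'(1) by simp
          then have "dep u \<le> dep (p y) + m" using near_sym[OF pyV uV(1)] near_dep[OF uV(1) pyV] by simp
          then show False using dep_ch[OF u] dz dpy yd by simp
        qed
      next
        assume e: "ch z' = {}"
        show "\<forall>u\<in>V. (z', u) \<in> parcs T \<longrightarrow> near T m (p y) u"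
        proof (intro ballI impI)
          fix u assume u: "u \<in> V" "(z', u) \<in> parcs T"
          have "p u \<noteq> z' \<or> u = r" using e u(1) by (auto simp: ch_def)
          then have "p z' = u" using u(2) pr by auto
          then have "(p ^^ m) u = p y" using z'(2) by (metis funpow_swap1)
          then show "near T m (p y) u" using near_anc[OF u(1), of m] by simp
        qed
      qed
    qed
    have bd: "body i T (p y) y z' \<longleftrightarrow> offty i z' = offty i z" if z': "z' \<in> V" "(p ^^ m) z' = y" and i: "i < m" for i z'
    proof -
      let ?h = "(p ^^ Suc i) z'"
      have dz: "dep z' = dep y + m" by (rule pp_dep_eq[OF z' y(2)])
      have hV: "?h \<in> V" by (rule ppV[OF z'(1)])
      have hy: "(p ^^ (m - Suc i)) ?h = y" using funpow_split[of "Suc i" m p z'] i z'(2) by simp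
      have dh: "dep ?h = dep y + (m - Suc i)" by (rule pp_dep_eq[OF hV hy y(2)])
      have h: "near T (m - Suc i) y h \<and> near T (Suc i) h z' \<longleftrightarrow> h = ?h" if "h \<in> V" for h
      proof
        assume a: "near T (m - Suc i) y h \<and> near T (Suc i) h z'"
        have "dep h \<le> dep y + (m - Suc i)" using a near_sym[OF y(1) that] near_dep[OF that y(1)] by blast
        then have "dep h + Suc i \<le> dep z'" using dz i by linarith
        from near_below[OF that z'(1) _ this] a show "h = ?h" by simp
      next
        assume "h = ?h"
        then show "near T (m - Suc i) y h \<and> near T (Suc i) h z'"
          using near_anc[OF z'(1), of "Suc i"] near_anc[OF hV, of "m - Suc i"] hy by metis
      qed
      have ofp: "offp i T (p y) ?h z' u \<longleftrightarrow> u \<in> off i z'" if u: "u \<in> V" for u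
      proof
        assume o: "offp i T (p y) ?h z' u"
        have "p ?h \<noteq> u"
        proof
          assume "p ?h = u"
          then have "(p ^^ (m - Suc i)) u = p y" using hy by (metis funpow_swap1)
          then have "near T (m - Suc i) (p y) u" using near_anc[OF u, of "m - Suc i"] by simp
          then show False using o by (simp add: offp_def)
        qed
        then have pu: "p u = ?h" "u \<noteq> ?h" using o by (auto simp: offp_def simp del: funpow.simps)
        then have "u \<noteq> r" using pr by auto
        moreover have "u \<noteq> (p ^^ i) z'" using o near_anc[OF z'(1), of i] by (auto simp: offp_def)
        ultimately show "u \<in> off i z'" using u pu by (simp add: off_def ch_def)
      next
        assume o: "u \<in> off i z'"
        then have uc: "u \<in> ch ?h" "u \<noteq> (p ^^ i) z'" by (simp_all add: off_def)
        have du: "dep u = Suc (dep ?h)" by (rule dep_ch[OF uc(1)])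
        have "\<not> near T (m - 1 - i) (p y) u"
        proof
          assume "near T (m - 1 - i) (p y) u"
          then have "dep u \<le> dep (p y) + (m - 1 - i)" using near_sym[OF pyV u] near_dep[OF u pyV] by blast
          then show False using du dh dpy yd by linarith
        qed
        moreover have "\<not> near T i u z'"
        proof
          assume "near T i u z'"
          moreover have "dep u + i \<le> dep z'" using du dh dz i by linarith
          ultimately show False using near_below[OF u z'(1)] uc(2) by blast
        qed
        moreover have "(?h, u) \<in> parcs T" using u hV ch_p[OF uc(1)] du by auto
        ultimately show "offp i T (p y) ?h z' u" by (simp add: offp_def)
      qed
      have offV: "off i z' \<subseteq> V" by (auto simp: off_def ch_def)
      have RT: "Rc c T ?h u \<longleftrightarrow> ty u = ty c" if "u \<in> off i z'" "c \<in> off i z" for u c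
      proof -
        have uc: "u \<in> ch ?h" using that(1) by (simp add: off_def)
        have "c \<in> C" using that(2) i by (auto simp: C_def)
        from Rc(2)[OF this ch_V[OF uc] ch_neq_r[OF uc]] show ?thesis unfolding ch_p[OF uc] .
      qed
      have "{u \<in> V. offp i T (p y) ?h z' u \<and> Rc c T ?h u} = {u \<in> off i z'. ty u = ty c}" if "c \<in> off i z" for c
        using ofp RT[OF _ that] offV by blast
      moreover have "(\<forall>u\<in>V. offp i T (p y) ?h z' u \<longrightarrow> (\<exists>c\<in>off i z. Rc c T ?h u)) \<longleftrightarrow> (\<forall>u\<in>off i z'. \<exists>c\<in>off i z. ty u = ty c)"
        using ofp RT offV by blast
      moreover have "body i T (p y) y z' \<longleftrightarrow>
         (\<forall>c\<in>off i z. card {u \<in> V. offp i T (p y) ?h z' u \<and> Rc c T ?h u} = n i c) \<and>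
         (\<forall>u\<in>V. offp i T (p y) ?h z' u \<longrightarrow> (\<exists>c\<in>off i z. Rc c T ?h u))"
        unfolding body_def tree_graph_simps(1) using h hV by blast
      ultimately have "body i T (p y) y z' \<longleftrightarrow> (\<forall>c\<in>off i z. card {u \<in> off i z'. ty u = ty c} = n i c) \<and>
         (\<forall>u\<in>off i z'. \<exists>c\<in>off i z. ty u = ty c)" by simp
      then show ?thesis unfolding offty_def n_def using image_mset_set_eq_iff[OF finite_off finite_off] by blast
    qed
    have "R T (p y) y \<longleftrightarrow> (\<exists>z'\<in>V. (p ^^ m) z' = y \<and> ch z' = {} \<and> (\<forall>i<m. offty i z' = offty i z))"
      unfolding R_def tree_graph_simps(1)
    proof (rule bex_cong[OF refl])
      fix z' assume z': "z' \<in> V"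
      show "(near T m y z' \<and> \<not> near T m (p y) z' \<and> (\<forall>u\<in>V. (z', u) \<in> parcs T \<longrightarrow> near T m (p y) u) \<and>
          (\<forall>i\<in>{..<m}. body i T (p y) y z')) \<longleftrightarrow> ((p ^^ m) z' = y \<and> ch z' = {} \<and> (\<forall>i<m. offty i z' = offty i z))"
        using near_child_iff[OF y z', of m] leaf[OF z'] bd[OF z'] by blast
    qed
    then show ?thesis using ty_eq_iff_path[OF y v(2) z(1,2,4)] by simp
  qed
  then show ?case using R_def' by blast
qed

end

section \<open>Defining the vertices far above the leaves\<close>

text \<open>The properties of a typical tree on which the upper bound rests. In
  \<open>chains\<close>, \<open>Suc k0\<close> stands for the vertex where a subtree is attached and
  \<open>k0\<close> levels of recursion inside it. \<open>no_same\<close> compares two paths read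
  upwards, \<open>no_opp\<close> one read upwards with one read downwards. The length
  \<open>L = 2 * N + 1\<close> makes room for two disjoint windows of \<open>N + 1\<close>
  vertices.\<close>

locale good_tree = nat_tree V p r for V :: "nat set" and p r +
  fixes L N K k0 s0 W :: nat
  assumes L_N: "L = 2 * N + 1" and L_K: "2 * L + 2 \<le> 2 ^ K" and s0_K: "s0 \<le> 2 ^ K" and s0_k0: "s0 < 2 ^ k0"
    and small: "\<And>v. v \<in> V \<Longrightarrow> v \<notin> (p ^^ L) ` V \<Longrightarrow> card (sub v) \<le> s0"
    and chains: "\<And>z S. z \<in> V \<Longrightarrow> S \<subseteq> (\<lambda>i. (p ^^ i) z) ` {..L} \<Longrightarrow> card S \<le> Suc k0 \<Longrightarrow>
        (\<Sum>u\<in>S. card (ch u)) \<le> W"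
    and no_same: "\<And>a b. a \<in> V \<Longrightarrow> b \<in> V \<Longrightarrow> L \<le> dep a \<Longrightarrow> L \<le> dep b \<Longrightarrow>
        (\<And>i. i \<le> L \<Longrightarrow> (p ^^ i) a \<noteq> (p ^^ i) b) \<Longrightarrow>
        \<exists>i<L. odd (card (ch ((p ^^ i) a))) \<noteq> odd (card (ch ((p ^^ i) b)))"
    and no_opp: "\<And>a b. a \<in> V \<Longrightarrow> b \<in> V \<Longrightarrow> N \<le> dep a \<Longrightarrow> N \<le> dep b \<Longrightarrow>
        (\<And>i j. i \<le> N \<Longrightarrow> j \<le> N \<Longrightarrow> (p ^^ i) a \<noteq> (p ^^ j) b) \<Longrightarrow>
        \<exists>i\<ge>1. i < N \<and> odd (card (ch ((p ^^ i) a))) \<noteq> odd (card (ch ((p ^^ (N - i)) b)))"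
begin

text \<open>Besides the vertices with a descendant \<open>L\<close> levels below, this contains the
  root, which is its own iterate. The set is closed under parents.\<close>

definition A :: "nat set" where "A = (p ^^ L) ` V"

lemma A_V: "A \<subseteq> V" using ppV by (auto simp: A_def)

lemma r_A: "r \<in> A" unfolding A_def using rV ppr by (metis imageI)

lemma A_p: "v \<in> A \<Longrightarrow> p v \<in> A"
proof -
  assume "v \<in> A"
  then obtain z where "z \<in> V" "v = (p ^^ L) z" by (auto simp: A_def)
  then have "p v = (p ^^ L) (p z)" "p z \<in> V" using pV by (auto simp: funpow_swap1)
  then show ?thesis by (auto simp: A_def)
qed

lemma A_I: "z \<in> V \<Longrightarrow> L \<le> j \<Longrightarrow> (p ^^ j) z \<in> A"
proof -
  assume z: "z \<in> V" "L \<le> j"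
  have "(p ^^ j) z = (p ^^ (L + (j - L))) z" using z by simp
  also have "\<dots> = (p ^^ L) ((p ^^ (j - L)) z)" by (simp only: funpow_add comp_apply)
  finally show ?thesis unfolding A_def using ppV[OF z(1)] by blast
qed

lemma near_definable: "j \<le> 2 * L + 2 \<Longrightarrow> definable2 K (\<lambda>G. near G j)"
  by (rule definable2_near) (use L_K in linarith)

lemma ch_le_W: "v \<in> V \<Longrightarrow> card (ch v) \<le> W"
proof -
  assume v: "v \<in> V"
  have "{v} \<subseteq> (\<lambda>i. (p ^^ i) v) ` {..L}" by (auto intro: image_eqI[of _ _ 0])
  from chains[OF v this] show ?thesis by simp
qed

text \<open>Since \<open>c\<close> is not in \<open>A\<close>, a path from below up to
  \<open>c\<close> has fewer than \<open>L\<close> arcs, and it can be prolonged by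
  \<open>p c\<close> within the range of \<open>chains\<close>. As the new vertex is not in
  \<open>S\<close>, its children are deducted.\<close>

lemma off_chain:
  assumes c: "c \<in> V" "c \<notin> A"
  shows "chain_bound c k0 (W - card (ch (p c)))"
  unfolding chain_bound_def
proof (intro ballI allI impI)
  fix z j S assume z: "z \<in> V" "(p ^^ j) z = c" and S: "S \<subseteq> (\<lambda>i. (p ^^ i) z) ` {..j}" "card S \<le> k0"
  have j: "j < L" using A_I[OF z(1), of j] z(2) c(2) by (cases "L \<le> j") auto
  have cr: "c \<noteq> r" using c r_A by auto
  have dz: "dep z = dep c + j" by (rule pp_dep_eq[OF z cr])
  have dpc: "dep (p c) < dep c" using dep_p[OF c(1)] dep_eq_0[OF c(1)] cr by simp
  have nin: "p c \<notin> S"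
  proof
    assume "p c \<in> S"
    then obtain i where i: "i \<le> j" "p c = (p ^^ i) z" using S(1) by blast
    then have "dep (p c) = dep z - i" using dep_pp[OF z(1)] by simp
    then show False using i dz dpc by linarith
  qed
  have finS: "finite S" using S(1) finite_subset by blast
  have "insert (p c) S \<subseteq> (\<lambda>i. (p ^^ i) z) ` {..L}"
  proof
    fix s assume "s \<in> insert (p c) S"
    then consider "s = p c" | i where "i \<le> j" "s = (p ^^ i) z" using S(1) by blast
    then show "s \<in> (\<lambda>i. (p ^^ i) z) ` {..L}"
    proof cases
      case 1
      then have "s = (p ^^ Suc j) z" using z(2) by simp
      then show ?thesis using j by (metis Suc_leI atMost_iff imageI)
    next
      case 2
      then show ?thesis using j by (intro image_eqI[of _ _ i]) auto
    qed
  qed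
  moreover have "card (insert (p c) S) \<le> Suc k0" using finS nin S(2) by simp
  ultimately have "(\<Sum>u\<in>insert (p c) S. card (ch u)) \<le> W" by (rule chains[OF z(1)])
  then show "(\<Sum>u\<in>S. card (ch u)) \<le> W - card (ch (p c))" using finS nin by simp
qed

lemma off_shape_definable:
  assumes c: "c \<in> V" "c \<notin> A"
  shows "\<exists>R. definable2 (W - card (ch (p c)) + 6 * k0 + K) R \<and> (\<forall>y\<in>V - {r}. R T (p y) y \<longleftrightarrow> ty y = ty c)"
proof (rule shape_definable[OF s0_K c(1) _ _ _ off_chain[OF c]])
  show "c \<noteq> r" using c r_A by auto
  have "card (sub c) \<le> s0" using small[OF c(1)] c(2) by (simp add: A_def)
  then show "card (sub c) < 2 ^ k0" "card (sub c) \<le> s0" using s0_k0 by auto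
qed

text \<open>The parity of the degree, tested only up to \<open>Suc W\<close>. In the tree this
  suffices, as a vertex has at most \<open>W\<close> children and one parent. Away from the root an
  odd degree means an even number of children.\<close>

definition parity :: "nat pair_pre_digraph \<Rightarrow> nat \<Rightarrow> bool" where
  "parity G x \<longleftrightarrow> (\<exists>c\<in>{c. c \<le> Suc W \<and> odd c}. card {u \<in> pverts G. (x, u) \<in> parcs G} = c)"

lemma parity_definable: "definable1 (W + 2) parity"
  unfolding definable1_def parity_def
proof (intro allI definable_bex)
  fix x c assume "c \<in> {c. c \<le> Suc W \<and> odd c}"
  have "definable (0 + Suc c) {x} (\<lambda>G s. card {u \<in> pverts G. (s x, u) \<in> parcs G} = c)"
    by (rule definable_card_eq) (auto intro: definable_adj)
  then show "definable (W + 2) {x} (\<lambda>G s. card {u \<in> pverts G. (s x, u) \<in> parcs G} = c)"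
    by (rule definable_mono) (use \<open>c \<in> _\<close> in auto)
qed auto

lemma nbrs: "v \<in> V \<Longrightarrow> {u \<in> V. (v, u) \<in> parcs T} = ch v \<union> (if v = r then {} else {p v})"
proof -
  assume v: "v \<in> V"
  have "u \<in> V \<and> (v, u) \<in> parcs T \<longleftrightarrow> u \<in> ch v \<or> v \<noteq> r \<and> u = p v" for u
    using v pV[OF v] p_eq_self_iff[of u] p_eq_self_iff[OF v] pr by (auto simp: ch_def)
  then show ?thesis by auto
qed

lemma p_notin_ch: "u \<in> V \<Longrightarrow> p u \<notin> ch u"
  using dep_ch[of "p u" u] dep_p[of u] by auto

lemma parity_T: "v \<in> V \<Longrightarrow> v \<noteq> r \<Longrightarrow> parity T v \<longleftrightarrow> even (card (ch v))"
  using p_notin_ch[of v] ch_le_W[of v] by (simp add: parity_def nbrs del: tree_graph_simps(2))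

lemma pp_neq_r: "z \<in> V \<Longrightarrow> i < dep z \<Longrightarrow> (p ^^ i) z \<noteq> r"
  using pp_eq_r_iff[of z i] by simp

text \<open>Close to the root, the variable for the root provides the orientation: \<open>x\<close>
  has depth at most \<open>d\<close> and \<open>z'\<close> depth at least \<open>d + L\<close>, so a
  path of length \<open>L\<close> between them is vertical. If \<open>x\<close> were not
  \<open>a\<close>, the paths up to \<open>x\<close> and to \<open>a\<close> would carry the same
  parities without ever meeting at the same step, against \<open>no_same\<close>.\<close>

lemma anchor_low:
  assumes a: "a \<in> A" "a \<noteq> r" and d: "dep a < L"
  shows "\<exists>R. definable2 (W + K + 6) R \<and> (\<forall>x\<in>V. R T r x \<longleftrightarrow> x = a)"
proof -
  obtain z where z: "z \<in> V" "(p ^^ L) z = a" using a by (auto simp: A_def)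
  define d where "d = dep a"
  have dL: "d < L" using d by (simp add: d_def)
  have dz: "dep z = d + L" unfolding d_def by (rule pp_dep_eq[OF z a(2)])
  have aV: "a \<in> V" using a A_V by auto
  define R where "R G \<rho> x \<longleftrightarrow> near G d \<rho> x \<and> (\<exists>z'\<in>pverts G. \<not> near G (d + L - 1) \<rho> z' \<and> near G L x z' \<and>
     (\<forall>i\<in>{..<L}. \<exists>u\<in>pverts G. near G i u z' \<and> near G (L - i) x u \<and> (parity G u \<longleftrightarrow> parity T ((p ^^ i) z))))"
    for G \<rho> x
  have nd: "definable2 K (\<lambda>G. near G j)" if "j \<le> d + L" for j
    by (rule near_definable) (use that dL in auto)
  have "definable2 (W + K + 6) R"
    unfolding definable2_def
  proof (intro allI)
    fix \<rho> x
    have "definable (Suc (Suc (W + K + 2))) {\<rho>, x} (\<lambda>G s. \<exists>z'\<in>pverts G. \<not> near G (d + L - 1) (s \<rho>) z' \<and> near G L (s x) z' \<and>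
     (\<forall>i\<in>{..<L}. \<exists>u\<in>pverts G. near G i u z' \<and> near G (L - i) (s x) u \<and> (parity G u \<longleftrightarrow> parity T ((p ^^ i) z))))"
    proof (rule definable_ex)
      fix z' assume "z' \<notin> {\<rho>, x}"
      have "definable (Suc (W + K + 2)) (insert z' {\<rho>, x}) (\<lambda>G s. \<exists>u\<in>pverts G. near G i u (s z') \<and> near G (L - i) (s x) u \<and> (parity G u \<longleftrightarrow> parity T ((p ^^ i) z)))"
        if i: "i < L" for i
      proof (rule definable_ex)
        fix u
        show "definable (W + K + 2) (insert u (insert z' {\<rho>, x})) (\<lambda>G s. near G i (s u) (s z') \<and> near G (L - i) (s x) (s u) \<and> (parity G (s u) \<longleftrightarrow> parity T ((p ^^ i) z)))"
          by (intro definable_and definable_iff definable_const definable2D[OF nd] definable1D[OF parity_definable]) (use i in auto)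
      qed auto
      then show "definable (Suc (W + K + 2)) (insert z' {\<rho>, x}) (\<lambda>G s. \<not> near G (d + L - 1) (s \<rho>) (s z') \<and> near G L (s x) (s z') \<and>
     (\<forall>i\<in>{..<L}. \<exists>u\<in>pverts G. near G i u (s z') \<and> near G (L - i) (s x) u \<and> (parity G u \<longleftrightarrow> parity T ((p ^^ i) z))))"
        by (intro definable_and definable_not definable_ball definable2D[OF nd]) auto
    qed auto
    then have "definable (W + K + 6) {\<rho>, x} (\<lambda>G s. \<exists>z'\<in>pverts G. \<not> near G (d + L - 1) (s \<rho>) z' \<and> near G L (s x) z' \<and>
     (\<forall>i\<in>{..<L}. \<exists>u\<in>pverts G. near G i u z' \<and> near G (L - i) (s x) u \<and> (parity G u \<longleftrightarrow> parity T ((p ^^ i) z))))"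
      by (rule definable_mono) auto
    then show "definable (W + K + 6) {\<rho>, x} (\<lambda>G s. R G (s \<rho>) (s x))"
      unfolding R_def by (intro definable_and definable2D[OF nd]) auto
  qed
  moreover have "R T r x \<longleftrightarrow> x = a" if x: "x \<in> V" for x
  proof
    assume "R T r x"
    then obtain z' where nx: "near T d r x" and z': "z' \<in> V" "\<not> near T (d + L - 1) r z'" "near T L x z'"
      and w: "\<forall>i\<in>{..<L}. \<exists>u\<in>V. near T i u z' \<and> near T (L - i) x u \<and> (parity T u \<longleftrightarrow> parity T ((p ^^ i) z))"
      unfolding R_def tree_graph_simps(1) by blast
    have dx: "dep x \<le> d" using near_dep[OF x rV, of d] near_sym[OF x rV] nx by simp
    have dz': "d + L \<le> dep z'"
    proof (rule ccontr)
      assume "\<not> d + L \<le> dep z'"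
      then have "dep z' \<le> d + L - 1" by simp
      then have "(p ^^ (d + L - 1)) z' = r" by (rule pp_ge_dep[OF z'(1)])
      then show False using z'(2) near_anc[OF z'(1), of "d + L - 1"] by simp
    qed
    have xz: "(p ^^ L) z' = x" using near_below[OF x z'(1,3)] dx dz' by simp
    have par: "parity T ((p ^^ i) z') \<longleftrightarrow> parity T ((p ^^ i) z)" if i: "i < L" for i
    proof -
      obtain u where u: "u \<in> V" "near T i u z'" "near T (L - i) x u" "parity T u \<longleftrightarrow> parity T ((p ^^ i) z)"
        using w i by blast
      have "dep u \<le> dep x + (L - i)" using near_sym[OF x u(1)] near_dep[OF u(1) x] u(3) by blast
      then have "dep u + i \<le> dep z'" using dx dz' i by linarith
      then have "(p ^^ i) z' = u" by (rule near_below[OF u(1) z'(1) u(2)])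
      then show ?thesis using u(4) by simp
    qed
    show "x = a"
    proof (rule ccontr)
      assume ne: "x \<noteq> a"
      have "(p ^^ i) z' \<noteq> (p ^^ i) z" if i: "i \<le> L" for i
      proof
        assume "(p ^^ i) z' = (p ^^ i) z"
        then have "x = a" using funpow_split[OF i, of p z] funpow_split[OF i, of p z'] xz z(2) by simp
        then show False using ne by simp
      qed
      then obtain i where i: "i < L" "odd (card (ch ((p ^^ i) z'))) \<noteq> odd (card (ch ((p ^^ i) z)))"
        using no_same[OF z'(1) z(1)] dz dz' by auto
      have "i < dep z" "i < dep z'" using i(1) dz dz' by linarith+
      then show False using par[OF i(1)] i(2) parity_T[OF ppV[OF z'(1), of i] pp_neq_r[OF z'(1), of i]]
          parity_T[OF ppV[OF z(1), of i] pp_neq_r[OF z(1), of i]] by simp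
    qed
  next
    assume xa: "x = a"
    have "near T d r x"
      using near_anc[OF aV, of d] pp_dep[OF aV] xa by (simp add: d_def)
    moreover have "\<not> near T (d + L - 1) r z"
      using near_dep[OF z(1) rV, of "d + L - 1"] near_sym[OF rV z(1)] dz dL by auto
    moreover have "near T L x z" using near_anc[OF z(1), of L] z(2) xa by simp
    moreover have "\<exists>u\<in>V. near T i u z \<and> near T (L - i) x u \<and> (parity T u \<longleftrightarrow> parity T ((p ^^ i) z))" if "i < L" for i
    proof (intro bexI conjI)
      show "near T i ((p ^^ i) z) z" by (rule near_anc[OF z(1)])
      show "near T (L - i) x ((p ^^ i) z)"
        using near_anc[OF ppV[OF z(1), of i], of "L - i"] funpow_split[of i L p z] that z(2) xa by simp
    qed (use ppV[OF z(1)] in auto)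
    ultimately show "R T r x" unfolding R_def tree_graph_simps(1) using z(1) by blast
  qed
  ultimately show ?thesis by blast
qed

text \<open>A vertex whose distances to the ends add up to the length of the geodesic lies on it.
  The two short walks through \<open>y\<close> combine to a connection of \<open>z\<close> and
  \<open>z2\<close>, which has length at least \<open>m\<close>, so neither wastes a step. The bound
  \<open>t \<le> dep z\<close> excludes idle steps at the root.\<close>

lemma geodesic_point:
  assumes V: "z \<in> V" "z2 \<in> V" "y \<in> V" and t: "(p ^^ t) z = (p ^^ s) z2" "t + s = m" "t \<le> dep z"
    and geo: "\<And>i j. (p ^^ i) z = (p ^^ j) z2 \<Longrightarrow> m \<le> i + j"
    and y: "near T i z y" "near T (m - i) y z2" and i: "i \<le> t"
  shows "y = (p ^^ i) z"
proof -
  obtain a b where ab: "a + b \<le> i" "(p ^^ a) z = (p ^^ b) y" using y(1) V by (auto simp: near_iff)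
  obtain c d where cd: "c + d \<le> m - i" "(p ^^ c) y = (p ^^ d) z2" using y(2) V by (auto simp: near_iff)
  show ?thesis
  proof (cases "b \<le> c")
    case True
    have "(p ^^ (c - b + a)) z = (p ^^ (c - b)) ((p ^^ b) y)" using ab(2) by (simp add: funpow_add)
    also have "\<dots> = (p ^^ d) z2" using funpow_split[OF True, of p y] cd(2) by simp
    finally have "m \<le> (c - b + a) + d" by (rule geo)
    then have "b = 0" "a = i" using ab(1) cd(1) t(2) i True by linarith+
    then show ?thesis using ab(2) by simp
  next
    case False
    then have cb: "c \<le> b" by simp
    have "(p ^^ a) z = (p ^^ (b - c)) ((p ^^ c) y)" using ab(2) funpow_split[OF cb, of p y] by simp
    also have "\<dots> = (p ^^ (b - c + d)) z2" using cd(2) by (simp add: funpow_add)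
    finally have "m \<le> a + (b - c + d)" by (rule geo)
    then have c0: "c = 0" "d = m - i" "a + b = i" using ab(1) cd(1) t(2) i cb False by linarith+
    then have yd: "y = (p ^^ d) z2" using cd(2) by simp
    have "s \<le> d" using c0 t i by linarith
    then have "y = (p ^^ (d - s)) ((p ^^ t) z)" using funpow_split[of s d p z2] yd t(1) by simp
    then have y': "y = (p ^^ (d - s + t)) z" by (simp add: funpow_add)
    then have "dep y = dep z - (d - s + t)" using dep_pp[OF V(1)] by simp
    moreover have "dep y - b = dep z - a" using ab(2) dep_pp V by metis
    ultimately have "dep z - (d - s + t) - b = dep z - a" by simp
    then have "i = t" using c0 t i \<open>s \<le> d\<close> False by linarith
    then have "d - s + t = i" using c0 t by linarith
    then show ?thesis using y' by simp
  qed
qed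

text \<open>Here the formula sees only a geodesic of length \<open>2 * L\<close> with midpoint
  \<open>x\<close> and the parities of the path up from \<open>z\<close>. The geodesic climbs
  \<open>t\<close> steps and then descends. If the climb includes the half before \<open>x\<close>,
  \<open>no_same\<close> yields \<open>x = a\<close>; otherwise the half after \<open>x\<close>
  descends, which contradicts \<open>no_opp\<close>.\<close>

lemma anchor_high:
  assumes a: "a \<in> A" "a \<noteq> r" and d: "L \<le> dep a"
  shows "\<exists>R. definable2 (W + K + 6) R \<and> (\<forall>x\<in>V. R T r x \<longleftrightarrow> x = a)"
proof -
  obtain z where z: "z \<in> V" "(p ^^ L) z = a" using a by (auto simp: A_def)
  have dz: "dep z = dep a + L" by (rule pp_dep_eq[OF z a(2)])
  have aV: "a \<in> V" using a A_V by auto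
  let ?m = "2 * L"
  define Q where "Q G z' z2 \<longleftrightarrow> (\<forall>i\<in>{..<?m}. \<exists>u\<in>pverts G. near G i z' u \<and> near G (?m - i) u z2 \<and> (parity G u \<longleftrightarrow> parity T ((p ^^ i) z)))"
    for G z' z2
  define R where "R G (\<rho>::nat) x \<longleftrightarrow> (\<exists>z'\<in>pverts G. \<exists>z2\<in>pverts G. \<not> near G (?m - 1) z' z2 \<and> near G L z' x \<and> near G L x z2 \<and> Q G z' z2)"
    for G \<rho> x
  have nd: "definable2 K (\<lambda>G. near G j)" if "j \<le> ?m" for j
    by (rule near_definable) (use that in auto)
  have "definable (Suc (W + K + 2)) X (\<lambda>G s. Q G (s z') (s z2))" if X: "z' \<in> X" "z2 \<in> X" "finite X" for X z' z2
    unfolding Q_def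
  proof (intro definable_ball)
    fix i assume i: "i \<in> {..<?m}"
    show "definable (Suc (W + K + 2)) X (\<lambda>G s. \<exists>u\<in>pverts G. near G i (s z') u \<and> near G (?m - i) u (s z2) \<and> (parity G u \<longleftrightarrow> parity T ((p ^^ i) z)))"
    proof (rule definable_ex)
      show "(\<lambda>u. near G i (s z') u \<and> near G (?m - i) u (s z2) \<and> (parity G u \<longleftrightarrow> parity T ((p ^^ i) z))) =
        (\<lambda>u. near G i (s' z') u \<and> near G (?m - i) u (s' z2) \<and> (parity G u \<longleftrightarrow> parity T ((p ^^ i) z)))"
        if "\<forall>x\<in>X. s x = s' x" for G s s' using that X by auto
      show "definable (W + K + 2) (insert u X) (\<lambda>G s. near G i (s z') (s u) \<and> near G (?m - i) (s u) (s z2) \<and> (parity G (s u) \<longleftrightarrow> parity T ((p ^^ i) z)))" for u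
        by (intro definable_and definable_iff definable_const definable2D[OF nd] definable1D[OF parity_definable]) (use i X in auto)
    qed (use X in auto)
  qed (use X in auto)
  note Q_def' = this
  have "definable2 (W + K + 6) R"
    unfolding definable2_def
  proof (intro allI)
    fix \<rho> x
    have "definable (Suc (Suc (Suc (W + K + 2)))) {\<rho>, x} (\<lambda>G s. R G (s \<rho>) (s x))"
      unfolding R_def
    proof (rule definable_ex)
      fix z'
      show "definable (Suc (Suc (W + K + 2))) (insert z' {\<rho>, x}) (\<lambda>G s. \<exists>z2\<in>pverts G. \<not> near G (?m - 1) (s z') z2 \<and> near G L (s z') (s x) \<and> near G L (s x) z2 \<and> Q G (s z') z2)"
      proof (rule definable_ex)
        fix z2
        show "definable (Suc (W + K + 2)) (insert z2 (insert z' {\<rho>, x})) (\<lambda>G s. \<not> near G (?m - 1) (s z') (s z2) \<and> near G L (s z') (s x) \<and> near G L (s x) (s z2) \<and> Q G (s z') (s z2))"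
          by (intro definable_and definable_not Q_def' definable2D[OF nd]) auto
      qed auto
    qed auto
    then show "definable (W + K + 6) {\<rho>, x} (\<lambda>G s. R G (s \<rho>) (s x))" by (rule definable_mono) auto
  qed
  moreover have "R T r x \<longleftrightarrow> x = a" if x: "x \<in> V" for x
  proof
    assume "R T r x"
    then obtain z' z2 where V': "z' \<in> V" "z2 \<in> V" and g: "\<not> near T (?m - 1) z' z2"
      and zx: "near T L z' x" "near T L x z2" and w: "Q T z' z2"
      unfolding R_def tree_graph_simps(1) by blast
    have geo: "?m \<le> i + j" if "(p ^^ i) z' = (p ^^ j) z2" for i j
    proof (rule ccontr)
      assume "\<not> ?m \<le> i + j"
      then have "i + j \<le> ?m - 1" by simp
      then show False using g that near_iff[OF V'] by blast
    qed
    have "near T ?m z' z2" using near_trans[OF zx] by (simp add: mult_2)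
    then obtain t s where ts: "t + s \<le> ?m" "(p ^^ t) z' = (p ^^ s) z2" using near_iff[OF V'] by blast
    then have tsm: "t + s = ?m" using geo[OF ts(2)] by simp
    have td: "t \<le> dep z'"
    proof (rule ccontr)
      assume "\<not> t \<le> dep z'"
      then have "(p ^^ dep z') z' = (p ^^ s) z2" "dep z' < t" using pp_dep[OF V'(1)] pp_ge_dep[OF V'(1), of t] ts(2) by auto
      then show False using geo[of "dep z'" s] tsm by simp
    qed
    have sd: "s \<le> dep z2"
    proof (rule ccontr)
      assume "\<not> s \<le> dep z2"
      then have "(p ^^ t) z' = (p ^^ dep z2) z2" "dep z2 < s" using pp_dep[OF V'(2)] pp_ge_dep[OF V'(2), of s] ts(2) by auto
      then show False using geo[of t "dep z2"] tsm by simp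
    qed
    have geo': "?m \<le> i + j" if "(p ^^ i) z2 = (p ^^ j) z'" for i j
      using geo[of j i] that by simp
    have up: "y = (p ^^ i) z'" if "y \<in> V" "near T i z' y" "near T (?m - i) y z2" "i \<le> t" for y i
      by (rule geodesic_point[OF V' that(1) ts(2) tsm td geo that(2-4)])
    have down: "y = (p ^^ (?m - i)) z2" if "y \<in> V" "near T i z' y" "near T (?m - i) y z2" "t \<le> i" "i \<le> ?m" for y i
    proof (rule geodesic_point[OF V'(2,1) that(1) ts(2)[symmetric] _ sd geo'])
      show "near T (?m - i) z2 y" using that near_sym V' by blast
      have "?m - (?m - i) = i" using that(5) by simp
      then show "near T (?m - (?m - i)) y z'" using that near_sym V' by simp
    qed (use tsm that in auto)
    have par: "\<exists>u\<in>V. near T i z' u \<and> near T (?m - i) u z2 \<and> (parity T u \<longleftrightarrow> parity T ((p ^^ i) z))" if "i < ?m" for i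
      using w that unfolding Q_def tree_graph_simps(1) by blast
    have zpar: "parity T ((p ^^ i) z) \<longleftrightarrow> even (card (ch ((p ^^ i) z)))" if "i < ?m" for i
      by (rule parity_T[OF ppV[OF z(1)] pp_neq_r[OF z(1)]]) (use that dz d in linarith)
    have "?m - L = L" by simp
    show "x = a"
    proof (rule ccontr)
      assume ne: "x \<noteq> a"
      show False
      proof (cases "L \<le> t")
        case True
        have xz: "x = (p ^^ L) z'" using up[OF x zx(1) _ True] zx(2) by simp
        have "(p ^^ i) z' \<noteq> (p ^^ i) z" if i: "i \<le> L" for i
        proof
          assume "(p ^^ i) z' = (p ^^ i) z"
          then have "x = a" using funpow_split[OF i, of p z] funpow_split[OF i, of p z'] xz z(2) by simp
          then show False using ne by simp
        qed
        then obtain i where i: "i < L" "odd (card (ch ((p ^^ i) z'))) \<noteq> odd (card (ch ((p ^^ i) z)))"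
          using no_same[OF V'(1) z(1)] dz td True by auto
        obtain u where u: "u \<in> V" "near T i z' u" "near T (?m - i) u z2" "parity T u \<longleftrightarrow> parity T ((p ^^ i) z)"
          using par[of i] i(1) by auto
        have "u = (p ^^ i) z'" using up[OF u(1-3)] i(1) True by simp
        moreover have "i < dep z'" using i(1) True td by linarith
        ultimately show False
          using u(4) zpar[of i] i parity_T[OF ppV[OF V'(1), of i] pp_neq_r[OF V'(1), of i]] by simp
      next
        case False
        then have s: "L < s" using tsm by simp
        have xz: "x = (p ^^ L) z2" using down[OF x zx(1)] zx(2) False by simp
        have eq: "odd (card (ch ((p ^^ j) a))) \<longleftrightarrow> odd (card (ch ((p ^^ (L - j)) z2)))" if j: "j < L" for j
        proof -
          obtain u where u: "u \<in> V" "near T (L + j) z' u" "near T (?m - (L + j)) u z2" "parity T u \<longleftrightarrow> parity T ((p ^^ (L + j)) z)"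
            using par[of "L + j"] j by auto
          have "u = (p ^^ (?m - (L + j))) z2" using down[OF u(1-3)] j False by simp
          then have u': "u = (p ^^ (L - j)) z2" by (simp add: mult_2)
          have "L - j < dep z2" using s sd by linarith
          then have "parity T u \<longleftrightarrow> even (card (ch u))"
            using parity_T[OF u(1)] pp_neq_r[OF V'(2)] u' by simp
          moreover have "(p ^^ (L + j)) z = (p ^^ j) a"
            using z(2) by (metis add.commute comp_apply funpow_add)
          ultimately show ?thesis using u(4) zpar[of "L + j"] j u' by simp
        qed
        have da: "dep ((p ^^ i) a) = dep a - i" "dep ((p ^^ i) z2) = dep z2 - i" for i
          using dep_pp aV V'(2) by auto
        show False
        \<comment> \<open>\<open>no_opp\<close> requires paths without any common vertex. The
          \<open>2 * N + 2\<close> vertices from \<open>a\<close> up to its \<open>L\<close>-th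
          ancestor form two windows; comparing depths selects one in which the two paths occupy
          disjoint ranges of depth.\<close>
        proof (cases "dep a - N > dep z2 - (L - N)")
          case True
          define b where "b = (p ^^ (L - N)) z2"
          have b: "b \<in> V" "dep b = dep z2 - (L - N)" using ppV[OF V'(2)] da by (auto simp: b_def)
          have db: "dep ((p ^^ j) b) = dep b - j" for j using dep_pp b by simp
          have ne: "(p ^^ i) a \<noteq> (p ^^ j) b" if "i \<le> N" "j \<le> N" for i j
          proof
            assume "(p ^^ i) a = (p ^^ j) b"
            then have "dep a - i = dep b - j" using da(1)[of i] db[of j] by simp
            then show False using True b(2) that by linarith
          qed
          have "N \<le> dep a" "N \<le> dep b" using d L_N b(2) s sd by linarith+
          from no_opp[OF aV b(1) this ne] obtain i where i: "1 \<le> i" "i < N"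
            "odd (card (ch ((p ^^ i) a))) \<noteq> odd (card (ch ((p ^^ (N - i)) b)))" by blast
          have "(p ^^ (N - i)) b = (p ^^ (N - i + (L - N))) z2" unfolding b_def by (simp add: funpow_add)
          also have "N - i + (L - N) = L - i" using i L_N by simp
          finally show False using i eq[of i] L_N by simp
        next
          case F: False
          define a' where "a' = (p ^^ Suc N) a"
          have a': "a' \<in> V" "dep a' = dep a - Suc N" using ppV[OF aV] da by (auto simp: a'_def simp del: funpow.simps)
          have db: "dep ((p ^^ j) a') = dep a' - j" for j using dep_pp a' by simp
          have ne: "(p ^^ i) a' \<noteq> (p ^^ j) z2" if "i \<le> N" "j \<le> N" for i j
          proof
            assume "(p ^^ i) a' = (p ^^ j) z2"
            then have "dep a' - i = dep z2 - j" using da(2)[of j] db[of i] by simp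
            then show False using F a'(2) that s sd d L_N by linarith
          qed
          have "N \<le> dep a'" "N \<le> dep z2" using d L_N a'(2) s sd by linarith+
          from no_opp[OF a'(1) V'(2) this ne] obtain i where i: "1 \<le> i" "i < N"
            "odd (card (ch ((p ^^ i) a'))) \<noteq> odd (card (ch ((p ^^ (N - i)) z2)))" by blast
          have "(p ^^ i) a' = (p ^^ (i + Suc N)) a" unfolding a'_def by (simp only: funpow_add comp_apply)
          moreover have "L - (i + Suc N) = N - i" using i L_N by simp
          ultimately show False using i eq[of "i + Suc N"] L_N by simp
        qed
      qed
    qed
  next
    assume xa: "x = a"
    define z2 where "z2 = (p ^^ ?m) z"
    have z2: "z2 \<in> V" "(p ^^ L) a = z2" using ppV z unfolding z2_def by (auto simp: mult_2 funpow_add)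
    have z2d: "dep z = dep z2 + ?m"
      using dep_pp[OF z(1), of ?m] dz d unfolding z2_def by simp
    have "\<not> near T (?m - 1) z z2" using near_dep[OF z(1) z2(1), of "?m - 1"] z2d L_N by auto
    moreover have "near T L z x" using near_anc'[OF z(1), of L] z(2) xa by simp
    moreover have "near T L x z2" using near_anc'[OF aV, of L] z2(2) xa by simp
    moreover have "Q T z z2" unfolding Q_def tree_graph_simps(1)
    proof
      fix i assume i: "i \<in> {..<?m}"
      have "near T (?m - i) ((p ^^ i) z) z2"
        using near_anc'[OF ppV[OF z(1), of i], of "?m - i"] funpow_split[of i ?m p z] i unfolding z2_def by simp
      then show "\<exists>u\<in>V. near T i z u \<and> near T (?m - i) u z2 \<and> (parity T u \<longleftrightarrow> parity T ((p ^^ i) z))"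
        using near_anc'[OF z(1), of i] ppV[OF z(1), of i] by blast
    qed
    ultimately show "R T r x" unfolding R_def tree_graph_simps(1) using z(1) z2(1) by blast
  qed
  ultimately show ?thesis by blast
qed

lemma anchor_definable:
  assumes "a \<in> A"
  shows "\<exists>R. definable2 (W + K + 6) R \<and> (\<forall>x\<in>V. R T r x \<longleftrightarrow> x = a)"
proof (cases "a = r")
  case True
  have "definable2 (W + K + 6) (\<lambda>G \<rho> x. x = \<rho>)"
    unfolding definable2_def by (auto intro!: definable_eq)
  then show ?thesis using True by blast
next
  case False
  then show ?thesis using anchor_low[OF assms False] anchor_high[OF assms False] by (cases "dep a < L") auto
qed

end

section \<open>Colouring all vertices by definable keys\<close>

lemma bex_unique: "\<forall>x\<in>V. R x \<longleftrightarrow> x = a \<Longrightarrow> a \<in> V \<Longrightarrow> (\<exists>b\<in>V. R b \<and> F b) \<longleftrightarrow> F a"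
  by auto

context good_tree
begin

definition lev :: "nat \<Rightarrow> nat" where "lev v = (LEAST e. (p ^^ e) v \<in> A)"

definition anc :: "nat \<Rightarrow> nat" where "anc v = (p ^^ lev v) v"

text \<open>The colour for the covering argument. Vertices of \<open>A\<close> receive private
  colours; any other vertex is described by its lowest ancestor in \<open>A\<close> and the shapes
  met on the way up to it.\<close>

definition key :: "nat \<Rightarrow> nat \<times> shape list" where
  "key v = (anc v, map (\<lambda>i. ty ((p ^^ i) v)) [0..<lev v])"

lemma anc_A: "v \<in> V \<Longrightarrow> anc v \<in> A"
  unfolding anc_def lev_def by (rule LeastI[of _ "dep v"]) (simp add: pp_dep r_A)

lemma lev_notin: "i < lev v \<Longrightarrow> (p ^^ i) v \<notin> A"
  unfolding lev_def by (rule not_less_Least)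

lemma lev_le: "(p ^^ e) v \<in> A \<Longrightarrow> lev v \<le> e"
  unfolding lev_def by (rule Least_le)

lemma lev_le_dep: "v \<in> V \<Longrightarrow> lev v \<le> dep v"
  by (rule lev_le) (simp add: pp_dep r_A)

lemma lev_le_L: "v \<in> V \<Longrightarrow> lev v \<le> L"
  by (rule lev_le[OF A_I]) auto

lemma lev_A: "v \<in> A \<Longrightarrow> lev v = 0"
  using lev_le[of 0 v] by simp

lemma lev_notA: "v \<in> V \<Longrightarrow> v \<notin> A \<Longrightarrow> lev v = Suc (lev (p v))"
proof -
  assume v: "v \<in> V" "v \<notin> A"
  have "(p ^^ Suc (lev (p v))) v \<in> A" using anc_A[OF pV[OF v(1)]] by (simp add: anc_def funpow_swap1)
  then have 1: "lev v \<le> Suc (lev (p v))" by (rule lev_le)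
  have "lev v \<noteq> 0" using v anc_A[OF v(1)] by (intro notI) (simp add: anc_def)
  then obtain e where e: "lev v = Suc e" by (cases "lev v") auto
  have "(p ^^ e) (p v) \<in> A" using anc_A[OF v(1)] e by (simp add: anc_def funpow_swap1)
  then have "lev (p v) \<le> e" by (rule lev_le)
  then show ?thesis using 1 e by simp
qed

lemma key_A: "v \<in> A \<Longrightarrow> key v = (v, [])"
  by (simp add: key_def anc_def lev_A)

lemma key_notA: "v \<in> V \<Longrightarrow> v \<notin> A \<Longrightarrow> key v = (fst (key (p v)), ty v # snd (key (p v)))"
proof -
  assume v: "v \<in> V" "v \<notin> A"
  have l: "lev v = Suc (lev (p v))" by (rule lev_notA[OF v])
  have "map (\<lambda>i. ty ((p ^^ i) v)) [0..<Suc (lev (p v))] = ty v # map (\<lambda>i. ty ((p ^^ i) (p v))) [0..<lev (p v)]"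
    by (rule nth_equalityI) (auto simp: nth_Cons funpow_swap1 simp del: upt_Suc split: nat.split)
  moreover have "anc v = anc (p v)" by (simp add: anc_def l funpow_swap1)
  ultimately show ?thesis by (simp add: key_def l)
qed

text \<open>Having a descendant \<open>L\<close> levels below is visible in the shape, because paths
  can be copied along equal shapes. The root is excluded since it may belong to \<open>A\<close>
  merely as a fixpoint.\<close>

lemma ty_A: "y \<in> V \<Longrightarrow> y \<noteq> r \<Longrightarrow> ty y = ty v \<Longrightarrow> v \<in> A \<Longrightarrow> v \<noteq> r \<Longrightarrow> y \<in> A"
proof -
  assume y: "y \<in> V" "y \<noteq> r" "ty y = ty v" and v: "v \<in> A" "v \<noteq> r"
  obtain z where "z \<in> V" "(p ^^ L) z = v" using v by (auto simp: A_def)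
  from ty_path[OF y(3,1,2) this v(2)] show "y \<in> A" by (auto simp: A_def)
qed

lemma ty_A_iff: "y \<in> V \<Longrightarrow> y \<noteq> r \<Longrightarrow> v \<in> V \<Longrightarrow> v \<noteq> r \<Longrightarrow> ty y = ty v \<Longrightarrow> y \<in> A \<longleftrightarrow> v \<in> A"
  using ty_A[of y v] ty_A[of v y] by auto

text \<open>Shapes decide membership in \<open>A\<close>, so agreement along \<open>lev v\<close>
  steps prevents \<open>x\<close> from meeting \<open>A\<close> earlier and forces
  \<open>lev x = lev v\<close>. The condition on the depth excludes an early arrival at the root
  followed by idle steps.\<close>

lemma key_eq_iff:
  assumes x: "x \<in> V" and v: "v \<in> V"
  shows "key x = key v \<longleftrightarrow> (p ^^ lev v) x = anc v \<and> dep x = dep (anc v) + lev v \<and>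
     (\<forall>i<lev v. ty ((p ^^ i) x) = ty ((p ^^ i) v))"
proof
  assume e: "key x = key v"
  then have "length (snd (key x)) = length (snd (key v))" by simp
  then have l: "lev x = lev v" by (simp add: key_def)
  have a: "(p ^^ lev v) x = anc v" using e l by (simp add: key_def anc_def)
  moreover have "dep (anc v) = dep x - lev v" using dep_pp[OF x, of "lev v"] a by simp
  then have "dep x = dep (anc v) + lev v" using lev_le_dep[OF x] l by simp
  moreover have "\<forall>i<lev v. ty ((p ^^ i) x) = ty ((p ^^ i) v)"
    using e l by (auto simp: key_def)
  ultimately show "(p ^^ lev v) x = anc v \<and> dep x = dep (anc v) + lev v \<and>
     (\<forall>i<lev v. ty ((p ^^ i) x) = ty ((p ^^ i) v))" by blast
next
  assume R: "(p ^^ lev v) x = anc v \<and> dep x = dep (anc v) + lev v \<and>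
     (\<forall>i<lev v. ty ((p ^^ i) x) = ty ((p ^^ i) v))"
  have nA: "(p ^^ i) x \<notin> A" if i: "i < lev v" for i
  proof
    assume xA: "(p ^^ i) x \<in> A"
    have n: "(p ^^ i) v \<notin> A" by (rule lev_notin[OF i])
    then have "(p ^^ i) v \<noteq> r" using r_A by auto
    moreover have "(p ^^ i) x \<noteq> r" by (rule pp_neq_r[OF x]) (use R i in linarith)
    ultimately show False using ty_A_iff[OF ppV[OF x] _ ppV[OF v], of i i] R i xA n by auto
  qed
  have "lev x \<le> lev v" by (rule lev_le) (use R anc_A[OF v] in simp)
  moreover have "\<not> lev x < lev v" using nA[of "lev x"] anc_A[OF x] by (auto simp: anc_def)
  ultimately have l: "lev x = lev v" by simp
  then show "key x = key v" using R by (simp add: key_def anc_def)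
qed

text \<open>Descent from the anchor \<open>a\<close> is recognised with the help of its parent,
  which is an anchor too; for the root, which has no other parent, a distance condition takes its
  place. Anchor and shape formulas stand side by side under a few quantifiers, so their depths are
  not added.\<close>

lemma key_definable:
  assumes v: "v \<in> V"
  shows "\<exists>R. definable2 (W + 6 * k0 + K + 8) R \<and> (\<forall>x\<in>V. R T r x \<longleftrightarrow> key x = key v)"
proof (cases "v \<in> A")
  case True
  obtain R where R: "definable2 (W + K + 6) R" "\<forall>x\<in>V. R T r x \<longleftrightarrow> x = v"
    using anchor_definable[OF True] by blast
  have "key x = key v \<longleftrightarrow> x = v" if "x \<in> V" for x
  proof
    assume "key x = key v"
    then have k: "key x = (v, [])" using key_A[OF True] by simp
    then have "lev x = 0" by (simp add: key_def)
    then show "x = v" using k by (simp add: key_def anc_def)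
  qed simp
  moreover have "definable2 (W + 6 * k0 + K + 8) R"
    unfolding definable2_def by (intro allI definable2D[OF R(1)]) auto
  ultimately show ?thesis using R(2) by blast
next
  case False
  define a where "a = anc v"
  define d where "d = lev v"
  have aA: "a \<in> A" "a \<in> V" using anc_A[OF v] A_V by (auto simp: a_def)
  have d0: "d \<noteq> 0" using lev_notA[OF v False] by (simp add: d_def)
  have dL: "d \<le> L" using lev_le_L[OF v] by (simp add: d_def)
  obtain Ra where Ra: "definable2 (W + K + 6) Ra" "\<forall>x\<in>V. Ra T r x \<longleftrightarrow> x = a"
    using anchor_definable[OF aA(1)] by blast
  obtain Rb where Rb: "definable2 (W + K + 6) Rb" "\<forall>x\<in>V. Rb T r x \<longleftrightarrow> x = p a"
    using anchor_definable[OF A_p[OF aA(1)]] by blast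
  have "\<forall>i\<in>{..<d}. \<exists>R. definable2 (W + 6 * k0 + K) R \<and> (\<forall>y\<in>V - {r}. R T (p y) y \<longleftrightarrow> ty y = ty ((p ^^ i) v))"
  proof
    fix i assume "i \<in> {..<d}"
    then have nA: "(p ^^ i) v \<notin> A" using lev_notin by (simp add: d_def)
    obtain R where R: "definable2 (W - card (ch (p ((p ^^ i) v))) + 6 * k0 + K) R"
      "\<forall>y\<in>V - {r}. R T (p y) y \<longleftrightarrow> ty y = ty ((p ^^ i) v)"
      using off_shape_definable[OF ppV[OF v] nA] by blast
    have "definable2 (W + 6 * k0 + K) R" unfolding definable2_def
      by (intro allI definable2D[OF R(1)]) auto
    then show "\<exists>R. definable2 (W + 6 * k0 + K) R \<and> (\<forall>y\<in>V - {r}. R T (p y) y \<longleftrightarrow> ty y = ty ((p ^^ i) v))"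
      using R(2) by blast
  qed
  from bchoice[OF this] obtain S where S: "\<forall>i\<in>{..<d}. definable2 (W + 6 * k0 + K) (S i) \<and>
      (\<forall>y\<in>V - {r}. S i T (p y) y \<longleftrightarrow> ty y = ty ((p ^^ i) v))" ..
  \<comment> \<open>The distances to \<open>x\<close> and \<open>a'\<close> identify
    \<open>h\<close> and \<open>g\<close> as the ancestors of \<open>x\<close> after
    \<open>i\<close> and \<open>Suc i\<close> steps. The shape formula needs \<open>g\<close> as the
    parent of \<open>h\<close>.\<close>
  define st where "st i G x a' \<longleftrightarrow> (\<exists>h\<in>pverts G. \<exists>g\<in>pverts G. near G i h x \<and> near G (d - i) a' h \<and>
      near G (Suc i) g x \<and> near G (d - Suc i) a' g \<and> S i G g h)" for i G x a'
  define R where "R G \<rho> x \<longleftrightarrow> (\<exists>a'\<in>pverts G. Ra G \<rho> a' \<and> near G d a' x \<and>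
      (if a = r then \<not> near G (d - 1) a' x else \<exists>b\<in>pverts G. Rb G \<rho> b \<and> \<not> near G d b x) \<and>
      (\<forall>i\<in>{..<d}. st i G x a'))" for G \<rho> x
  let ?d = "W + 6 * k0 + K"
  have nd: "definable2 K (\<lambda>G. near G j)" if "j \<le> d" for j
    by (rule near_definable) (use that dL in auto)
  have st_def': "definable (?d + 2) X (\<lambda>G s. st i G (s x) (s a'))"
    if i: "i < d" and X: "x \<in> X" "a' \<in> X" "finite X" for i x a' X
  proof -
    have "definable (Suc (Suc ?d)) X (\<lambda>G s. st i G (s x) (s a'))"
      unfolding st_def
    proof (rule definable_ex)
      fix h
      show "definable (Suc ?d) (insert h X) (\<lambda>G s. \<exists>g\<in>pverts G. near G i (s h) (s x) \<and> near G (d - i) (s a') (s h) \<and>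
        near G (Suc i) g (s x) \<and> near G (d - Suc i) (s a') g \<and> S i G g (s h))"
      proof (rule definable_ex)
        fix g
        have Si: "definable2 ?d (S i)" using S i by blast
        show "definable ?d (insert g (insert h X)) (\<lambda>G s. near G i (s h) (s x) \<and> near G (d - i) (s a') (s h) \<and>
          near G (Suc i) (s g) (s x) \<and> near G (d - Suc i) (s a') (s g) \<and> S i G (s g) (s h))"
          by (intro definable_and definable2D[OF nd] definable2D[OF Si]) (use i X in auto)
      qed (use X in auto)
    qed (use X in auto)
    then show ?thesis by (rule definable_mono) auto
  qed
  have "definable2 (?d + 8) R"
    unfolding definable2_def
  proof (intro allI)
    fix \<rho> x
    have "definable (Suc (?d + 7)) {\<rho>, x} (\<lambda>G s. R G (s \<rho>) (s x))"
      unfolding R_def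
    proof (rule definable_ex)
      fix a' assume "a' \<notin> {\<rho>, x}"
      let ?X = "insert a' {\<rho>, x}"
      have "definable (Suc (W + K + 6)) ?X (\<lambda>G s. \<exists>b\<in>pverts G. Rb G (s \<rho>) b \<and> \<not> near G d b (s x))"
        by (rule definable_ex) (auto intro!: definable_and definable_not definable2D[OF nd] definable2D[OF Rb(1)])
      then have b: "definable (?d + 7) ?X (\<lambda>G s. \<exists>b\<in>pverts G. Rb G (s \<rho>) b \<and> \<not> near G d b (s x))"
        by (rule definable_mono) auto
      have c: "definable (?d + 7) ?X (\<lambda>G s. if a = r then \<not> near G (d - 1) (s a') (s x) else \<exists>b\<in>pverts G. Rb G (s \<rho>) b \<and> \<not> near G d b (s x))"
        using b by (cases "a = r") (auto intro!: definable_not definable2D[OF nd])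
      have e: "definable (?d + 7) ?X (\<lambda>G s. \<forall>i\<in>{..<d}. st i G (s x) (s a'))"
      proof (intro definable_ball)
        fix i assume "i \<in> {..<d}"
        then show "definable (?d + 7) ?X (\<lambda>G s. st i G (s x) (s a'))"
          by (intro definable_mono[OF st_def'[of i x ?X a']]) auto
      qed auto
      show "definable (?d + 7) ?X (\<lambda>G s. Ra G (s \<rho>) (s a') \<and> near G d (s a') (s x) \<and>
        (if a = r then \<not> near G (d - 1) (s a') (s x) else \<exists>b\<in>pverts G. Rb G (s \<rho>) b \<and> \<not> near G d b (s x)) \<and>
        (\<forall>i\<in>{..<d}. st i G (s x) (s a')))"
        by (intro definable_and c e definable2D[OF nd] definable2D[OF Ra(1)]) auto
    qed auto
    then show "definable (?d + 8) {\<rho>, x} (\<lambda>G s. R G (s \<rho>) (s x))" by (rule definable_mono) auto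
  qed
  moreover have "R T r x \<longleftrightarrow> key x = key v" if x: "x \<in> V" for x
  proof -
    have c: "near T d a x \<and> (if a = r then \<not> near T (d - 1) a x else \<not> near T d (p a) x) \<longleftrightarrow>
        (p ^^ d) x = a \<and> dep x = dep a + d"
    proof (cases "a = r")
      case True
      have n: "near T j r x \<longleftrightarrow> dep x \<le> j" for j
      proof
        assume "near T j r x"
        then show "dep x \<le> j" using near_dep[OF x rV, of j] near_sym[OF x rV] by simp
      next
        assume "dep x \<le> j"
        then show "near T j r x" using near_anc[OF x, of j] pp_ge_dep[OF x] by simp
      qed
      have e: "near T d a x \<longleftrightarrow> dep x \<le> d" "near T (d - 1) a x \<longleftrightarrow> dep x \<le> d - 1"
        "(p ^^ d) x = a \<longleftrightarrow> dep x \<le> d" "dep a = 0"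
        unfolding True by (rule n, rule n, rule pp_eq_r_iff[OF x], rule dep_r)
      show ?thesis unfolding if_P[OF True] e using d0 by linarith
    next
      case F: False
      show ?thesis unfolding if_not_P[OF F] near_child_iff[OF aA(2) F x, of d]
        using pp_dep_eq[OF x _ F, of d] by blast
    qed
    have s: "st i T x a \<longleftrightarrow> ty ((p ^^ i) x) = ty ((p ^^ i) v)"
      if xa: "(p ^^ d) x = a" "dep x = dep a + d" and i: "i < d" for i
    proof -
      have u: "h = (p ^^ j) x" if "h \<in> V" "near T j h x" "near T (d - j) a h" "j \<le> d" for h j
      proof -
        have "dep h \<le> dep a + (d - j)" using near_sym[OF aA(2) that(1)] near_dep[OF that(1) aA(2)] that(3) by blast
        then have "dep h + j \<le> dep x" using xa that(4) by linarith
        from near_below[OF that(1) x that(2) this] show ?thesis by simp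
      qed
      have n: "near T (d - j) a ((p ^^ j) x)" if "j \<le> d" for j
        using near_anc[OF ppV[OF x, of j], of "d - j"] funpow_split[OF that, of p x] xa(1) by simp
      have nr: "(p ^^ i) x \<noteq> r" by (rule pp_neq_r[OF x]) (use xa i in linarith)
      have "st i T x a \<longleftrightarrow> S i T ((p ^^ Suc i) x) ((p ^^ i) x)"
      proof
        assume "st i T x a"
        then obtain h g where hg: "h \<in> V" "g \<in> V" "near T i h x" "near T (d - i) a h"
          "near T (Suc i) g x" "near T (d - Suc i) a g" "S i T g h"
          unfolding st_def tree_graph_simps(1) by blast
        have "h = (p ^^ i) x" by (rule u[OF hg(1,3,4)]) (use i in simp)
        moreover have "g = (p ^^ Suc i) x" by (rule u[OF hg(2,5,6)]) (use i in simp)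
        ultimately show "S i T ((p ^^ Suc i) x) ((p ^^ i) x)" using hg(7) by simp
      next
        assume "S i T ((p ^^ Suc i) x) ((p ^^ i) x)"
        then show "st i T x a" unfolding st_def tree_graph_simps(1)
          using ppV[OF x, of i] ppV[OF x, of "Suc i"] near_anc[OF x, of i] near_anc[OF x, of "Suc i"] n[of i] n[of "Suc i"] i
          by (meson Suc_leI less_imp_le)
      qed
      also have "\<dots> \<longleftrightarrow> ty ((p ^^ i) x) = ty ((p ^^ i) v)"
        using S i ppV[OF x, of i] nr by simp
      finally show ?thesis .
    qed
    have "R T r x \<longleftrightarrow> near T d a x \<and> (if a = r then \<not> near T (d - 1) a x else \<not> near T d (p a) x) \<and>
       (\<forall>i\<in>{..<d}. st i T x a)"
    proof -
      have "R T r x \<longleftrightarrow> near T d a x \<and> (if a = r then \<not> near T (d - 1) a x else \<exists>b\<in>V. Rb T r b \<and> \<not> near T d b x) \<and>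
       (\<forall>i\<in>{..<d}. st i T x a)"
        unfolding R_def tree_graph_simps(1) by (rule bex_unique[OF Ra(2) aA(2)])
      moreover have "(\<exists>b\<in>V. Rb T r b \<and> \<not> near T d b x) \<longleftrightarrow> \<not> near T d (p a) x"
        by (rule bex_unique[OF Rb(2) pV[OF aA(2)]])
      ultimately show ?thesis by presburger
    qed
    also have "\<dots> \<longleftrightarrow> (p ^^ d) x = a \<and> dep x = dep a + d \<and> (\<forall>i<d. ty ((p ^^ i) x) = ty ((p ^^ i) v))"
      using c s by blast
    finally show ?thesis using key_eq_iff[OF x v] by (simp add: a_def d_def)
  qed
  ultimately show ?thesis by blast
qed

definition nb :: "nat \<Rightarrow> nat \<times> shape list \<Rightarrow> nat" where
  "nb u \<kappa> = card {w \<in> V. (u, w) \<in> parcs T \<and> key w = \<kappa>}"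

lemma key_r_iff: "u \<in> V \<Longrightarrow> a \<in> A \<Longrightarrow> key u = key a \<longleftrightarrow> u = a"
proof
  assume u: "u \<in> V" and a: "a \<in> A" and "key u = key a"
  then have k: "key u = (a, [])" using key_A[OF a] by simp
  then have "lev u = 0" by (simp add: key_def)
  then show "u = a" using k by (simp add: key_def anc_def)
qed simp

lemma length_key: "length (snd (key v)) = lev v" by (simp add: key_def)

lemma ch_notA: "u \<notin> A \<Longrightarrow> w \<in> ch u \<Longrightarrow> w \<notin> A"
  using A_p[of w] by (auto simp: ch_def)

lemma nb_eq: "u \<in> V \<Longrightarrow> nb u \<kappa> = card {w \<in> ch u. key w = \<kappa>} + (if u \<noteq> r \<and> key (p u) = \<kappa> then 1 else 0)"
proof -
  assume u: "u \<in> V"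
  have "{w \<in> V. (u, w) \<in> parcs T \<and> key w = \<kappa>} = {w \<in> {w \<in> V. (u, w) \<in> parcs T}. key w = \<kappa>}" by blast
  also have "\<dots> = {w \<in> ch u. key w = \<kappa>} \<union> (if u \<noteq> r \<and> key (p u) = \<kappa> then {p u} else {})"
    unfolding nbrs[OF u] by auto
  finally show ?thesis using p_notin_ch[OF u] by (auto simp: nb_def)
qed

text \<open>A colour from \<open>A\<close> belongs to one vertex only. Outside \<open>A\<close> the
  children are outside \<open>A\<close> as well, and their keys extend that of \<open>u\<close> by
  their shapes, so the counts are read off from \<open>ty u\<close>.\<close>

lemma nb_equitable:
  assumes u: "u \<in> V" "u' \<in> V" "key u = key u'"
  shows "nb u \<kappa> = nb u' \<kappa>"
proof (cases "u \<in> A")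
  case True
  then show ?thesis using key_r_iff[OF u(2) True] u(3) by simp
next
  case False
  have F': "u' \<notin> A" using False key_r_iff[OF u(1), of u'] u(3) by auto
  have nr: "u \<noteq> r" "u' \<noteq> r" using False F' r_A by auto
  have k: "key (p u) = key (p u')" "ty u = ty u'"
    using u(3) key_notA[OF u(1) False] key_notA[OF u(2) F'] by (auto simp: prod_eq_iff)
  have c: "card {w \<in> ch x. key w = \<kappa>} = (if fst \<kappa> = fst (key u) \<and> snd \<kappa> \<noteq> [] \<and> tl (snd \<kappa>) = snd (key u)
     then count (image_mset ty (mset_set (ch x))) (hd (snd \<kappa>)) else 0)" if x: "x \<in> V" "x \<notin> A" "key x = key u" for x
  proof -
    have kw: "key w = (fst (key u), ty w # snd (key u))" if "w \<in> ch x" for w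
      using key_notA[OF ch_V[OF that] ch_notA[OF x(2) that]] ch_p[OF that] x(3) by simp
    have "key w = \<kappa> \<longleftrightarrow> (fst \<kappa> = fst (key u) \<and> snd \<kappa> \<noteq> [] \<and> tl (snd \<kappa>) = snd (key u)) \<and> ty w = hd (snd \<kappa>)"
      if "w \<in> ch x" for w
      unfolding kw[OF that] by (cases \<kappa>; cases "snd \<kappa>") auto
    then have "{w \<in> ch x. key w = \<kappa>} = (if fst \<kappa> = fst (key u) \<and> snd \<kappa> \<noteq> [] \<and> tl (snd \<kappa>) = snd (key u)
       then {w \<in> ch x. ty w = hd (snd \<kappa>)} else {})" by auto
    then show ?thesis by (simp add: count_image_mset_set)
  qed
  have "image_mset ty (mset_set (ch u)) = image_mset ty (mset_set (ch u'))"
    using k(2) ty_eq[OF u(1)] ty_eq[OF u(2)] by simp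
  then show ?thesis unfolding nb_eq[OF u(1)] nb_eq[OF u(2)]
    using c[OF u(1) False refl] c[OF u(2) F' u(3)[symmetric]] k nr by simp
qed

text \<open>In \<open>A\<close> keys are injective, and outside \<open>A\<close> the levels differ.
  Consequently exactly one neighbour of \<open>u\<close> has the colour of its parent, and a formula
  can find it.\<close>

lemma key_parent_neq:
  assumes u: "u \<in> V" "u \<noteq> r" and w: "w \<in> ch u"
  shows "key w \<noteq> key (p u)"
proof
  assume e: "key w = key (p u)"
  then have l: "lev w = lev (p u)" using length_key by metis
  show False
  proof (cases "u \<in> A")
    case True
    then have "w = p u" using key_r_iff[OF ch_V[OF w] A_p[OF True]] e by simp
    then show False using p_notin_ch[OF u(1)] w by simp
  next
    case False
    have "lev w = Suc (lev u)" using lev_notA[OF ch_V[OF w] ch_notA[OF False w]] ch_p[OF w] by simp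
    then show False using lev_notA[OF u(1) False] l by simp
  qed
qed

text \<open>At the children of \<open>x\<close> the key formula, of depth about \<open>W\<close>,
  may be replaced by a shape formula. The latter is shallow enough to be placed behind a
  count.\<close>

lemma key_child:
  assumes x: "x \<in> V" "key x = key u" and v: "v \<in> ch u" "v \<notin> A" and y: "y \<in> ch x"
  shows "key y = key v \<longleftrightarrow> ty y = ty v"
proof -
  have nr: "y \<noteq> r" "v \<noteq> r" using ch_neq_r y v(1) by auto
  have kv: "key v = (fst (key u), ty v # snd (key u))"
    using key_notA[OF ch_V[OF v(1)] v(2)] ch_p[OF v(1)] by simp
  show ?thesis
  proof (cases "y \<in> A")
    case True
    then have "ty y \<noteq> ty v" using ty_A_iff[OF ch_V[OF y] nr(1) ch_V[OF v(1)] nr(2)] v(2) by auto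
    moreover have "key y \<noteq> key v" unfolding kv key_A[OF True] by simp
    ultimately show ?thesis by simp
  next
    case False
    then show ?thesis using key_notA[OF ch_V[OF y] False] ch_p[OF y] kv x(2) by simp
  qed
qed

text \<open>The sentence states the colouring and its degree matrix. \<open>P1\<close> to
  \<open>P3\<close> say that every vertex has exactly one colour and that only \<open>\<rho>\<close>
  has that of the root. Counting with \<open>Q\<close> would add the count to a depth already near
  \<open>W\<close>, so \<open>P4\<close> does it for counts up to 1 only. \<open>P5\<close> treats
  the larger classes, which consist of children outside \<open>A\<close>: it counts with
  \<open>B v\<close>, whose depth was lowered by the number of children of \<open>u\<close>, and
  identifies \<open>B v\<close> with \<open>Q\<close> under one separate quantifier.\<close>

theorem D_upper:
  "\<exists>\<phi>. defines_graph \<phi> T \<and> quantifier_depth \<phi> \<le> W + 6 * k0 + K + 14"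
proof -
  let ?dk = "W + 6 * k0 + K + 8"
  let ?Ks = "key ` V"
  have "\<forall>\<kappa>\<in>?Ks. \<exists>R. definable2 ?dk R \<and> (\<forall>x\<in>V. R T r x \<longleftrightarrow> key x = \<kappa>)"
    using key_definable by blast
  from bchoice[OF this] obtain Q where Q': "\<forall>\<kappa>\<in>?Ks. definable2 ?dk (Q \<kappa>) \<and> (\<forall>x\<in>V. Q \<kappa> T r x \<longleftrightarrow> key x = \<kappa>)" ..
  have Q: "definable2 ?dk (Q (key v))" "\<And>x. x \<in> V \<Longrightarrow> Q (key v) T r x \<longleftrightarrow> key x = key v" if "v \<in> V" for v
    using Q' that by auto
  have "\<forall>c\<in>V - A. \<exists>R. definable2 (W - card (ch (p c)) + 6 * k0 + K) R \<and> (\<forall>y\<in>V - {r}. R T (p y) y \<longleftrightarrow> ty y = ty c)"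
    using off_shape_definable by blast
  from bchoice[OF this] obtain B where B': "\<forall>c\<in>V - A. definable2 (W - card (ch (p c)) + 6 * k0 + K) (B c) \<and>
     (\<forall>y\<in>V - {r}. B c T (p y) y \<longleftrightarrow> ty y = ty c)" ..
  have B: "definable2 (W - card (ch (p c)) + 6 * k0 + K) (B c)"
    "\<And>y. y \<in> V \<Longrightarrow> y \<noteq> r \<Longrightarrow> B c T (p y) y \<longleftrightarrow> ty y = ty c" if "c \<in> V" "c \<notin> A" for c
    using B' that by auto
  have finK: "finite ?Ks" using finV by simp
  define P1 where "P1 G \<rho> x \<longleftrightarrow> (\<exists>\<kappa>\<in>?Ks. Q \<kappa> G \<rho> x)" for G \<rho> x
  define P2 where "P2 G \<rho> x \<longleftrightarrow> (\<forall>\<kappa>\<in>?Ks. \<forall>\<kappa>'\<in>?Ks. \<kappa> \<noteq> \<kappa>' \<longrightarrow> \<not> (Q \<kappa> G \<rho> x \<and> Q \<kappa>' G \<rho> x))" for G \<rho> x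
  define P3 where "P3 G \<rho> x \<longleftrightarrow> (Q (key r) G \<rho> x \<longleftrightarrow> x = \<rho>)" for G \<rho> x
  define P4 where "P4 G \<rho> x \<longleftrightarrow> (\<forall>u\<in>V. \<forall>v\<in>{v \<in> V. nb u (key v) \<le> 1}. Q (key u) G \<rho> x \<longrightarrow>
     card {y \<in> pverts G. (x, y) \<in> parcs G \<and> Q (key v) G \<rho> y} = nb u (key v))" for G \<rho> x
  \<comment> \<open>\<open>w\<close> is the parent of \<open>x\<close>, recognised by its colour. At
    the root \<open>p r = r\<close> gives \<open>w = x\<close>, which removes no neighbour.\<close>
  define P5 where "P5 G \<rho> x \<longleftrightarrow> (\<forall>w\<in>pverts G. \<forall>u\<in>V. \<forall>v\<in>ch u - A.
     Q (key u) G \<rho> x \<and> (x = w \<or> (x, w) \<in> parcs G) \<and> Q (key (p u)) G \<rho> w \<longrightarrow>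
     card {y \<in> pverts G. (x, y) \<in> parcs G \<and> y \<noteq> w \<and> B v G x y} = nb u (key v) \<and>
     (\<forall>y\<in>pverts G. (x, y) \<in> parcs G \<and> y \<noteq> w \<longrightarrow> (B v G x y \<longleftrightarrow> Q (key v) G \<rho> y)))" for G \<rho> x
  define P where "P G \<longleftrightarrow> (\<exists>\<rho>\<in>pverts G. \<forall>x\<in>pverts G. P1 G \<rho> x \<and> P2 G \<rho> x \<and> P3 G \<rho> x \<and> P4 G \<rho> x \<and> P5 G \<rho> x)" for G
  have VK: "v \<in> V \<Longrightarrow> key v \<in> ?Ks" for v by blast
  have Qd: "definable2 ?dk (Q \<kappa>)" if "\<kappa> \<in> ?Ks" for \<kappa> using Q' that by blast
  have nb_le: "nb u (key v) \<le> card (ch u)" if u: "u \<in> V" and v: "v \<in> ch u" for u v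
  proof -
    have "\<not> (u \<noteq> r \<and> key (p u) = key v)" using key_parent_neq[OF u _ v] by metis
    then have "nb u (key v) = card {w \<in> ch u. key w = key v}" unfolding nb_eq[OF u] by simp
    also have "\<dots> \<le> card (ch u)" by (intro card_mono) auto
    finally show ?thesis .
  qed
  have "definable (Suc (Suc (?dk + 4))) {} (\<lambda>G s. P G)"
    unfolding P_def
  proof (rule definable_ex)
    fix \<rho> :: nat
    show "definable (Suc (?dk + 4)) (insert \<rho> {}) (\<lambda>G s. \<forall>x\<in>pverts G. P1 G (s \<rho>) x \<and> P2 G (s \<rho>) x \<and> P3 G (s \<rho>) x \<and> P4 G (s \<rho>) x \<and> P5 G (s \<rho>) x)"
    proof (rule definable_all)
      fix x assume x: "x \<notin> insert \<rho> {}"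
      let ?X = "insert x (insert \<rho> {})"
      have X: "finite ?X" "?X \<noteq> {}" by auto
      have 1: "definable (?dk + 4) ?X (\<lambda>G s. P1 G (s \<rho>) (s x))"
        unfolding P1_def by (intro definable_bex finK X(2) definable2D[OF Qd]) auto
      have 2: "definable (?dk + 4) ?X (\<lambda>G s. P2 G (s \<rho>) (s x))"
        unfolding P2_def
        by (intro definable_ball finK X(2) definable_imp definable_not definable_and definable_const definable2D[OF Qd]) auto
      have 3: "definable (?dk + 4) ?X (\<lambda>G s. P3 G (s \<rho>) (s x))"
        unfolding P3_def by (intro definable_iff definable2D[OF Qd] definable_eq) (auto simp: rV)
      have 4: "definable (?dk + 4) ?X (\<lambda>G s. P4 G (s \<rho>) (s x))"
        unfolding P4_def
      proof (intro definable_ball X(2) definable_imp)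
        fix u v assume u: "u \<in> V" and v: "v \<in> {v \<in> V. nb u (key v) \<le> 1}"
        show "definable (?dk + 4) ?X (\<lambda>G s. Q (key u) G (s \<rho>) (s x))"
          by (rule definable2D[OF Qd[OF VK[OF u]]]) auto
        have "definable (?dk + Suc (nb u (key v))) ?X (\<lambda>G s. card {y \<in> pverts G. (s x, y) \<in> parcs G \<and> Q (key v) G (s \<rho>) y} = nb u (key v))"
          by (rule definable_card_eq[OF X]) (use v in \<open>auto intro!: definable_and definable_adj definable2D[OF Qd]\<close>)
        then show "definable (?dk + 4) ?X (\<lambda>G s. card {y \<in> pverts G. (s x, y) \<in> parcs G \<and> Q (key v) G (s \<rho>) y} = nb u (key v))"
          by (rule definable_mono) (use v in auto)
      qed (use finV in auto)
      have 5: "definable (?dk + 4) ?X (\<lambda>G s. P5 G (s \<rho>) (s x))"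
        unfolding P5_def
      proof (rule definable_mono[OF definable_all[where d = "?dk + 3"]])
        fix w assume w: "w \<notin> ?X"
        let ?Y = "insert w ?X"
        have Y: "finite ?Y" "?Y \<noteq> {}" by auto
        show "definable (?dk + 3) ?Y (\<lambda>G s. \<forall>u\<in>V. \<forall>v\<in>ch u - A.
          Q (key u) G (s \<rho>) (s x) \<and> (s x = s w \<or> (s x, s w) \<in> parcs G) \<and> Q (key (p u)) G (s \<rho>) (s w) \<longrightarrow>
          card {y \<in> pverts G. (s x, y) \<in> parcs G \<and> y \<noteq> s w \<and> B v G (s x) y} = nb u (key v) \<and>
          (\<forall>y\<in>pverts G. (s x, y) \<in> parcs G \<and> y \<noteq> s w \<longrightarrow> (B v G (s x) y \<longleftrightarrow> Q (key v) G (s \<rho>) y)))"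
        proof (intro definable_ball Y(2) definable_imp definable_and definable_or definable_eq definable_adj)
          fix u v assume u: "u \<in> V" and v: "v \<in> ch u - A"
          have vV: "v \<in> V" "v \<notin> A" "p v = u" "v \<in> ch u" using v ch_V ch_p by auto
          show "definable (?dk + 3) ?Y (\<lambda>G s. Q (key u) G (s \<rho>) (s x))"
            by (rule definable2D[OF Qd[OF VK[OF u]]]) auto
          show "definable (?dk + 3) ?Y (\<lambda>G s. Q (key (p u)) G (s \<rho>) (s w))"
            by (rule definable2D[OF Qd[OF VK[OF pV[OF u]]]]) auto
          have Bd: "definable2 (W - card (ch u) + 6 * k0 + K) (B v)" using B(1)[OF vV(1,2)] vV(3) by simp
          have "definable ((W - card (ch u) + 6 * k0 + K) + Suc (nb u (key v))) ?Y
             (\<lambda>G s. card {y \<in> pverts G. (s x, y) \<in> parcs G \<and> y \<noteq> s w \<and> B v G (s x) y} = nb u (key v))"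
            by (rule definable_card_eq[OF Y]) (auto intro!: definable_and definable_not definable_eq definable_adj definable2D[OF Bd])
          then show "definable (?dk + 3) ?Y
             (\<lambda>G s. card {y \<in> pverts G. (s x, y) \<in> parcs G \<and> y \<noteq> s w \<and> B v G (s x) y} = nb u (key v))"
            by (rule definable_mono) (use nb_le[OF u vV(4)] ch_le_W[OF u] in auto)
          have "definable (Suc ?dk) ?Y (\<lambda>G s. \<forall>y\<in>pverts G. (s x, y) \<in> parcs G \<and> y \<noteq> s w \<longrightarrow> (B v G (s x) y \<longleftrightarrow> Q (key v) G (s \<rho>) y))"
            by (rule definable_all)
              (use vV(1) in \<open>auto intro!: definable_imp definable_iff definable_and definable_not definable_eq definable_adj definable2D[OF Bd] definable2D[OF Qd]\<close>)
          then show "definable (?dk + 3) ?Y (\<lambda>G s. \<forall>y\<in>pverts G. (s x, y) \<in> parcs G \<and> y \<noteq> s w \<longrightarrow> (B v G (s x) y \<longleftrightarrow> Q (key v) G (s \<rho>) y))"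
            by (rule definable_mono) auto
        qed (use finV in auto)
      qed auto
      show "definable (?dk + 4) ?X (\<lambda>G s. P1 G (s \<rho>) (s x) \<and> P2 G (s \<rho>) (s x) \<and> P3 G (s \<rho>) (s x) \<and> P4 G (s \<rho>) (s x) \<and> P5 G (s \<rho>) (s x))"
        by (intro definable_and 1 2 3 4 5)
    qed auto
  qed auto
  moreover have "P T"
    unfolding P_def tree_graph_simps(1)
  proof (intro bexI[of _ r] ballI conjI rV)
    fix x assume x: "x \<in> V"
    show "P1 T r x" unfolding P1_def using Q(2)[OF x x] x by blast
    show "P2 T r x" unfolding P2_def using Q(2)[OF _ x] by auto
    show "P3 T r x" unfolding P3_def using Q(2)[OF rV x] key_r_iff[OF x r_A] by simp
    have cnt: "card {y \<in> V. (x, y) \<in> parcs T \<and> key y = key v} = nb u (key v)" if "u \<in> V" "key x = key u" for u v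
      using nb_equitable[OF x that(1,2), of "key v"] by (simp add: nb_def)
    show "P4 T r x" unfolding P4_def tree_graph_simps(1)
    proof (intro ballI impI)
      fix u v assume u: "u \<in> V" and v: "v \<in> {v \<in> V. nb u (key v) \<le> 1}" and "Q (key u) T r x"
      then have k: "key x = key u" using Q(2)[OF u x] by simp
      have "{y \<in> V. (x, y) \<in> parcs T \<and> Q (key v) T r y} = {y \<in> V. (x, y) \<in> parcs T \<and> key y = key v}"
        using Q(2)[of v] v by blast
      then show "card {y \<in> V. (x, y) \<in> parcs T \<and> Q (key v) T r y} = nb u (key v)"
        using cnt[OF u k] by simp
    qed
    show "P5 T r x" unfolding P5_def tree_graph_simps(1)
    proof (intro ballI impI)
      fix w u v assume w: "w \<in> V" and u: "u \<in> V" and v: "v \<in> ch u - A"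
        and h: "Q (key u) T r x \<and> (x = w \<or> (x, w) \<in> parcs T) \<and> Q (key (p u)) T r w"
      have k: "key x = key u" using h Q(2)[OF u x] by simp
      have kw: "key w = key (p u)" using h Q(2)[OF pV[OF u] w] by simp
      have xr: "x = r \<longleftrightarrow> u = r" using k key_r_iff[OF x r_A] key_r_iff[OF u r_A] by metis
      have vV: "v \<in> V" "v \<notin> A" "v \<in> ch u" using v ch_V by auto
      have kpx: "key (p x) = key (p u)"
      proof (cases "u \<in> A")
        case True
        then show ?thesis using key_r_iff[OF x True] k by simp
      next
        case False
        have "x \<notin> A" using False key_r_iff[OF u, of x] k by auto
        then show ?thesis using k key_notA[OF u False] key_notA[OF x] by (auto simp: prod_eq_iff)
      qed
      have wpx: "w = p x"
      proof (cases "u = r")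
        case True
        then have "key w = key r" using kw pr by simp
        then show ?thesis using True xr key_r_iff[OF w r_A] pr by simp
      next
        case False
        have xnr: "x \<noteq> r" using False xr by simp
        have "x \<noteq> w"
        proof
          assume "x = w"
          then have ku: "key u = key (p u)" using k kw by simp
          show False
          proof (cases "u \<in> A")
            case True
            then have "p u = u" using key_r_iff[OF pV[OF u] True] ku by simp
            then show False using p_eq_self_iff[OF u] False by simp
          next
            case F: False
            then show False using ku lev_notA[OF u F] length_key by (metis n_not_Suc_n)
          qed
        qed
        then have "w \<in> ch x \<union> {p x}" using h nbrs[OF x] xnr w by auto
        moreover have "w \<notin> ch x" using key_parent_neq[OF x xnr, of w] kpx kw by auto
        ultimately show ?thesis by simp
      qed
      have nbx: "y \<in> V \<and> (x, y) \<in> parcs T \<and> y \<noteq> w \<longleftrightarrow> y \<in> ch x" for y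
      proof -
        have "y \<in> V \<and> (x, y) \<in> parcs T \<longleftrightarrow> y \<in> {u \<in> V. (x, u) \<in> parcs T}" by blast
        also have "\<dots> \<longleftrightarrow> y \<in> ch x \<or> x \<noteq> r \<and> y = p x" unfolding nbrs[OF x] by simp
        finally show ?thesis using wpx p_notin_ch[OF x] by blast
      qed
      have By: "B v T x y \<longleftrightarrow> key y = key v" if y: "y \<in> ch x" for y
        using B(2)[OF vV(1,2) ch_V[OF y] ch_neq_r[OF y]] ch_p[OF y] key_child[OF x k vV(3,2) y] by simp
      have "{y \<in> V. (x, y) \<in> parcs T \<and> y \<noteq> w \<and> B v T x y} = {y \<in> ch x. key y = key v}"
        using nbx By by blast
      moreover have "card {y \<in> ch x. key y = key v} = nb u (key v)"
      proof -
        have "\<not> (u \<noteq> r \<and> key (p u) = key v)" using key_parent_neq[OF u _ vV(3)] by metis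
        then have "\<not> (x \<noteq> r \<and> key (p x) = key v)" using kpx xr by simp
        then have "nb x (key v) = card {y \<in> ch x. key y = key v}" unfolding nb_eq[OF x] by simp
        then show ?thesis using nb_equitable[OF x u k] by simp
      qed
      moreover have "B v T x y \<longleftrightarrow> Q (key v) T r y" if "y \<in> V" "(x, y) \<in> parcs T \<and> y \<noteq> w" for y
        using By[of y] nbx[of y] that Q(2)[OF vV(1) that(1)] by blast
      ultimately show "card {y \<in> V. (x, y) \<in> parcs T \<and> y \<noteq> w \<and> B v T x y} = nb u (key v) \<and>
        (\<forall>y\<in>V. (x, y) \<in> parcs T \<and> y \<noteq> w \<longrightarrow> (B v T x y \<longleftrightarrow> Q (key v) T r y))" by simp
    qed
  qed
  moreover have "digraph_iso (with_proj T) (with_proj H)" if H: "pair_graph H" "P H" for H :: "nat pair_pre_digraph"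
  proof -
    interpret H: pair_graph H by fact
    obtain \<rho> where \<rho>: "\<rho> \<in> pverts H" and PH: "\<And>x. x \<in> pverts H \<Longrightarrow> P1 H \<rho> x \<and> P2 H \<rho> x \<and> P3 H \<rho> x \<and> P4 H \<rho> x \<and> P5 H \<rho> x"
      using H(2) unfolding P_def by blast
    define \<mu> where "\<mu> x = (THE \<kappa>. \<kappa> \<in> ?Ks \<and> Q \<kappa> H \<rho> x)" for x
    have ex1: "\<exists>!\<kappa>. \<kappa> \<in> ?Ks \<and> Q \<kappa> H \<rho> x" if "x \<in> pverts H" for x
      using PH[OF that] unfolding P1_def P2_def by blast
    have \<mu>: "\<mu> x = \<kappa> \<longleftrightarrow> Q \<kappa> H \<rho> x" if "x \<in> pverts H" "\<kappa> \<in> ?Ks" for x \<kappa>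
      using theI'[OF ex1[OF that(1)]] ex1[OF that(1)] that(2) unfolding \<mu>_def by blast
    have \<mu>K: "\<mu> x \<in> ?Ks" if "x \<in> pverts H" for x
      using theI'[OF ex1[OF that]] unfolding \<mu>_def by blast
    show ?thesis
    proof (rule covering_iso[OF finV rooted H(1) \<rho>, where \<kappa> = key and \<mu> = \<mu>])
      show "\<mu> x = key r \<longleftrightarrow> x = \<rho>" if "x \<in> pverts H" for x
        using \<mu>[OF that VK[OF rV]] PH[OF that] unfolding P3_def by blast
      show "u = r" if "u \<in> V" "key u = key r" for u using key_r_iff[OF that(1) r_A] that(2) by simp
      show "\<mu> x \<in> key ` V" if "x \<in> pverts H" for x by (rule \<mu>K[OF that])
      fix u x v assume u: "u \<in> V" and x: "x \<in> pverts H" and xu: "\<mu> x = key u" and v: "v \<in> V"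
      have Qx: "Q (key u) H \<rho> x" using \<mu>[OF x VK[OF u]] xu by simp
      have low: "card {y \<in> pverts H. (x, y) \<in> parcs H \<and> Q (key v') H \<rho> y} = nb u (key v')"
        if "v' \<in> V" "nb u (key v') \<le> 1" for v'
        using PH[OF x] Qx that u unfolding P4_def by blast
      have "card {y \<in> pverts H. (x, y) \<in> parcs H \<and> Q (key v) H \<rho> y} = nb u (key v)"
      proof (cases "nb u (key v) \<le> 1")
        case True
        then show ?thesis by (rule low[OF v])
      next
        case False
        \<comment> \<open>At least two neighbours have the colour of \<open>v\<close> and only one
          of them can be the parent, so some child \<open>v'\<close> represents the colour. It lies
          outside \<open>A\<close>, where colours are not private, and \<open>P5\<close> applies to
          it.\<close>
        have "{w \<in> ch u. key w = key v} \<noteq> {}"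
        proof
          assume e: "{w \<in> ch u. key w = key v} = {}"
          have "nb u (key v) \<le> 1" unfolding nb_eq[OF u] e by simp
          then show False using False by simp
        qed
        then obtain v' where v': "v' \<in> ch u" "key v' = key v" by blast
        have v'A: "v' \<notin> A"
        proof
          assume a: "v' \<in> A"
          have "{w \<in> V. (u, w) \<in> parcs T \<and> key w = key v} \<subseteq> {v'}"
            using key_r_iff[OF _ a] v'(2) by auto
          then have "nb u (key v) \<le> card {v'}" unfolding nb_def by (intro card_mono) auto
          then show False using False by simp
        qed
        have nb1: "key (p u) \<noteq> key v \<or> u = r" using key_parent_neq[OF u _ v'(1)] v'(2) by metis
        obtain w where w: "w \<in> pverts H" "x = w \<or> (x, w) \<in> parcs H" "Q (key (p u)) H \<rho> w"
        proof (cases "u = r")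
          case True
          then have "Q (key (p u)) H \<rho> x" using Qx pr by simp
          then show ?thesis using that x by blast
        next
          case F: False
          have "w \<notin> ch u" if "key w = key (p u)" for w using key_parent_neq[OF u F, of w] that by blast
          then have "{w \<in> ch u. key w = key (p u)} = {}" by blast
          then have "nb u (key (p u)) = 1" using nb_eq[OF u, of "key (p u)"] F by simp
          then have "card {y \<in> pverts H. (x, y) \<in> parcs H \<and> Q (key (p u)) H \<rho> y} = 1"
            using low[OF pV[OF u]] by simp
          then obtain w where "{y \<in> pverts H. (x, y) \<in> parcs H \<and> Q (key (p u)) H \<rho> y} = {w}"
            by (rule card_1_singletonE)
          then show ?thesis using that by blast
        qed
        have p5: "card {y \<in> pverts H. (x, y) \<in> parcs H \<and> y \<noteq> w \<and> B v' H x y} = nb u (key v') \<and>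
          (\<forall>y\<in>pverts H. (x, y) \<in> parcs H \<and> y \<noteq> w \<longrightarrow> (B v' H x y \<longleftrightarrow> Q (key v') H \<rho> y))"
          using PH[OF x] Qx w u v'(1) v'A unfolding P5_def by blast
        \<comment> \<open>The count in \<open>P5\<close> omits \<open>w\<close>, so \<open>w\<close>
          must not have the colour of \<open>v\<close>. If it did, the colours would force
          \<open>u = r\<close>, hence \<open>w = x = \<rho>\<close>, and the arc from
          \<open>x\<close> to \<open>w\<close> would be a loop.\<close>
        have nw: "\<not> ((x, w) \<in> parcs H \<and> Q (key v) H \<rho> w)"
        proof
          assume a: "(x, w) \<in> parcs H \<and> Q (key v) H \<rho> w"
          then have "key (p u) = key v"
            using \<mu>[OF w(1) VK[OF v]] \<mu>[OF w(1) VK[OF pV[OF u]]] w(3) by simp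
          then have "u = r" using nb1 by simp
          then have "w = \<rho>" "x = \<rho>" using w(1,3) x Qx pr PH[OF w(1)] PH[OF x] unfolding P3_def by auto
          then show False using a H.pair_no_loops[of "(x, w)"] by auto
        qed
        have "{y \<in> pverts H. (x, y) \<in> parcs H \<and> Q (key v) H \<rho> y} =
          {y \<in> pverts H. (x, y) \<in> parcs H \<and> y \<noteq> w \<and> B v' H x y}"
          using p5 nw v'(2) by auto
        then show ?thesis using p5 v'(2) by simp
      qed
      moreover have "{y \<in> pverts H. (x, y) \<in> parcs H \<and> Q (key v) H \<rho> y} = {y \<in> pverts H. (x, y) \<in> parcs H \<and> \<mu> y = key v}"
        using \<mu>[OF _ VK[OF v]] by blast
      ultimately show "card {w \<in> V. (u, w) \<in> parcs T \<and> key w = key v} = card {y \<in> pverts H. (x, y) \<in> parcs H \<and> \<mu> y = key v}"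
        by (simp add: nb_def)
    qed
  qed
  moreover have "pverts H \<noteq> {}" if "P H" for H using that by (auto simp: P_def)
  moreover have "pverts T \<noteq> {}" using rV by auto
  ultimately obtain \<phi> where "defines_graph \<phi> T" "quantifier_depth \<phi> \<le> max (Suc (Suc (?dk + 4))) 1"
    using defining_sentence[OF pairT, of "Suc (Suc (?dk + 4))" P] by blast
  then show ?thesis by (intro exI[of _ \<phi>]) simp
qed

end

section \<open>Child counts in random extensions of a forest\<close>

text \<open>The children not prescribed by the forest on \<open>A\<close>; only these are random
  once the forest is fixed.\<close>

definition extra :: "'a set \<Rightarrow> 'a set \<Rightarrow> ('a \<Rightarrow> 'a) \<Rightarrow> 'a \<Rightarrow> nat" where
  "extra V A p v = card {w \<in> V - A. p w \<noteq> w \<and> p w = v}"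

definition children :: "'a set \<Rightarrow> ('a \<Rightarrow> 'a) \<Rightarrow> 'a \<Rightarrow> 'a set" where
  "children V p v = {w \<in> V. p w \<noteq> w \<and> p w = v}"

lemma (in rooted_tree) ch_eq_children: "ch v = children V p v"
  using p_eq_self_iff by (auto simp: ch_def children_def)

lemma prod_power_extra:
  fixes x :: "'a \<Rightarrow> 'b :: comm_monoid_mult"
  assumes "finite V" "p \<in> V \<rightarrow> V"
  shows "(\<Prod>w\<in>{w \<in> V - A. p w \<noteq> w}. x (p w)) = (\<Prod>v\<in>V. x v ^ extra V A p v)"
proof -
  have "(\<Prod>w\<in>{w \<in> V - A. p w \<noteq> w}. x (p w)) =
      (\<Prod>v\<in>V. \<Prod>w\<in>{w \<in> {w \<in> V - A. p w \<noteq> w}. p w = v}. x (p w))"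
    by (rule prod.group[symmetric]) (use assms in auto)
  also have "\<dots> = (\<Prod>v\<in>V. x v ^ extra V A p v)"
  proof (rule prod.cong[OF refl])
    fix v assume "v \<in> V"
    have "(\<Prod>w\<in>{w \<in> {w \<in> V - A. p w \<noteq> w}. p w = v}. x (p w)) = (\<Prod>w\<in>{w \<in> {w \<in> V - A. p w \<noteq> w}. p w = v}. x v)"
      by (rule prod.cong) auto
    also have "\<dots> = x v ^ extra V A p v" by (simp add: extra_def conj_assoc)
    finally show "(\<Prod>w\<in>{w \<in> {w \<in> V - A. p w \<noteq> w}. p w = v}. x (p w)) = x v ^ extra V A p v" .
  qed
  finally show ?thesis .
qed

text \<open>As an identity in the weights this says that, in a uniform extension, the numbers
  \<open>extra V A p v\<close> are jointly multinomial with \<open>card V - card A - 1\<close>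
  trials. Special weights yield tail bounds, signs and exclusions.\<close>

theorem sum_extensions_extra:
  fixes x :: "'a \<Rightarrow> 'b :: field_char_0"
  assumes fin: "finite V" and q: "forest_on V A q" and V: "V \<noteq> {}"
  shows "(\<Sum>p\<in>extensions V A q. \<Prod>v\<in>V. x v ^ extra V A p v) = (\<Sum>v\<in>V. x v) ^ (card V - card A - 1)"
proof -
  have A: "A \<subseteq> V" using q by (auto simp: forest_on_def)
  have "(\<Sum>p\<in>extensions V A q. \<Prod>v\<in>V. x v ^ extra V A p v) =
      (\<Sum>p\<in>extensions V A q. \<Prod>w\<in>{w \<in> V - A. p w \<noteq> w}. x (p w))"
  proof (rule sum.cong[OF refl])
    fix p assume "p \<in> extensions V A q"
    then have "p \<in> V \<rightarrow> V" by (auto simp: extensions_def rooted_trees_def rooted_def)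
    then show "(\<Prod>v\<in>V. x v ^ extra V A p v) = (\<Prod>w\<in>{w \<in> V - A. p w \<noteq> w}. x (p w))"
      by (rule prod_power_extra[OF fin, symmetric])
  qed
  also have "\<dots> = (\<Sum>v\<in>V. x v) ^ (card (V - A) - 1)" by (rule sum_extensions[OF assms])
  also have "card (V - A) = card V - card A" using A fin by (simp add: card_Diff_subset finite_subset)
  finally show ?thesis .
qed

lemma finite_extensions: "finite V \<Longrightarrow> finite (extensions V A q)"
  by (simp add: extensions_def finite_rooted_trees)

lemma card_children_extensions:
  assumes fin: "finite V" and q: "forest_on V A q" and p: "p \<in> extensions V A q" and ne: "\<And>w. w \<in> A \<Longrightarrow> q w \<noteq> w"
  shows "card (children V p v) = card {w \<in> A. q w = v} + extra V A p v"
proof -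
  have A: "A \<subseteq> V" using q by (auto simp: forest_on_def)
  have pq: "\<And>w. w \<in> A \<Longrightarrow> p w = q w" using p by (auto simp: extensions_def)
  have "children V p v = {w \<in> A. q w = v} \<union> {w \<in> V - A. p w \<noteq> w \<and> p w = v}"
    using A pq ne by (auto simp: children_def)
  moreover have "finite A" using A fin finite_subset by blast
  ultimately show ?thesis using fin by (simp add: extra_def, subst card_Un_disjoint) auto
qed

section \<open>Weight bounds\<close>

lemma sum_indicator_weight:
  assumes "finite V" "S \<subseteq> V"
  shows "(\<Sum>v\<in>V. if v \<in> S then y else 1 :: real) = real (card V) + real (card S) * (y - 1)"
proof -
  have fS: "finite S" using assms finite_subset by blast
  have "(\<Sum>v\<in>V. if v \<in> S then y else 1 :: real) = (\<Sum>v\<in>V. 1 + (if v \<in> S then y - 1 else 0))"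
    by (intro sum.cong) auto
  also have "\<dots> = real (card V) + (\<Sum>v\<in>V. if v \<in> S then y - 1 else 0)" by (simp add: sum.distrib)
  also have "(\<Sum>v\<in>V. if v \<in> S then y - 1 else 0) = (\<Sum>v\<in>S. y - 1)"
    using assms by (simp add: sum.If_cases Int_absorb1)
  finally show ?thesis by simp
qed

lemma prod_indicator_weight:
  assumes "finite V" "S \<subseteq> V"
  shows "(\<Prod>v\<in>V. (if v \<in> S then y else 1 :: real) ^ f v) = y ^ (\<Sum>v\<in>S. f v)"
proof -
  have fS: "finite S" using assms finite_subset by blast
  have "(\<Prod>v\<in>V. (if v \<in> S then y else 1 :: real) ^ f v) = (\<Prod>v\<in>V. if v \<in> S then y ^ f v else 1)"
    by (intro prod.cong) auto
  also have "\<dots> = (\<Prod>v\<in>S. y ^ f v)" using assms by (simp add: prod.If_cases Int_absorb1)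
  also have "\<dots> = y ^ (\<Sum>v\<in>S. f v)" by (simp add: power_sum)
  finally show ?thesis .
qed

text \<open>For \<open>a \<ge> 0\<close> any exponent up to \<open>n\<close> is harmless. For
  negative \<open>a\<close> the exponent must not be too small; it is only assumed to be at least
  \<open>n / 2\<close>, hence the half in the exponential.\<close>

lemma power_add_le_exp:
  assumes "0 \<le> 1 + a / n" "0 < (n::real)" "0 \<le> a \<Longrightarrow> real e \<le> n" "a < 0 \<Longrightarrow> n / 2 \<le> real e"
  shows "(n + a) ^ e \<le> n ^ e * (if 0 \<le> a then exp a else exp (a / 2))"
proof -
  have "(n + a) ^ e = n ^ e * (1 + a / n) ^ e"
    using assms(2) by (simp add: power_mult_distrib[symmetric] field_simps)
  also have "(1 + a / n) ^ e \<le> exp (a / n) ^ e"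
    using assms(1) exp_ge_add_one_self[of "a / n"] by (intro power_mono) auto
  also have "exp (a / n) ^ e = exp (real e * (a / n))" by (rule exp_of_nat_mult[symmetric])
  also have "\<dots> \<le> (if 0 \<le> a then exp a else exp (a / 2))"
  proof (cases "0 \<le> a")
    case True
    then have "real e * (a / n) \<le> n * (a / n)" using assms by (intro mult_right_mono) auto
    then show ?thesis using True assms(2) by simp
  next
    case False
    then have "real e * (a / n) \<le> (n / 2) * (a / n)" using assms(2,4) by (intro mult_right_mono_neg) (auto simp: divide_le_0_iff)
    then show ?thesis using False assms(2) by simp
  qed
  finally show ?thesis using assms(2) by simp
qed

text \<open>Exponential Markov inequality.\<close>

lemma card_many_extra:
  assumes fin: "finite V" and q: "forest_on V A q" and V: "V \<noteq> {}" and S: "S \<subseteq> V" "card S \<le> k" and y: "1 \<le> y"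
  shows "real (card {p \<in> extensions V A q. m \<le> (\<Sum>v\<in>S. extra V A p v)}) * y ^ m \<le>
    real (card V) ^ (card V - card A - 1) * exp (real k * (y - 1))"
proof -
  let ?E = "extensions V A q" and ?e = "card V - card A - 1"
  let ?x = "\<lambda>v. if v \<in> S then y else 1 :: real"
  have n: "card V > 0" using fin V by (simp add: card_gt_0_iff)
  have "real (card {p \<in> ?E. m \<le> (\<Sum>v\<in>S. extra V A p v)}) * y ^ m =
      (\<Sum>p\<in>{p \<in> ?E. m \<le> (\<Sum>v\<in>S. extra V A p v)}. y ^ m)" by simp
  also have "\<dots> \<le> (\<Sum>p\<in>{p \<in> ?E. m \<le> (\<Sum>v\<in>S. extra V A p v)}. y ^ (\<Sum>v\<in>S. extra V A p v))"
    using y by (intro sum_mono power_increasing) auto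
  also have "\<dots> \<le> (\<Sum>p\<in>?E. y ^ (\<Sum>v\<in>S. extra V A p v))"
    using finite_extensions[OF fin] y by (intro sum_mono2) auto
  also have "\<dots> = (\<Sum>p\<in>?E. \<Prod>v\<in>V. ?x v ^ extra V A p v)"
    by (simp only: prod_indicator_weight[OF fin S(1)])
  also have "\<dots> = (real (card V) + real (card S) * (y - 1)) ^ ?e"
    by (simp only: sum_extensions_extra[OF fin q V] sum_indicator_weight[OF fin S(1)])
  also have "\<dots> \<le> real (card V) ^ ?e * (if 0 \<le> real (card S) * (y - 1) then exp (real (card S) * (y - 1)) else exp (real (card S) * (y - 1) / 2))"
  proof (rule power_add_le_exp)
    have nn: "0 \<le> real (card S) * (y - 1)" using y by simp
    then show "0 \<le> 1 + real (card S) * (y - 1) / real (card V)" by simp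
    show "real (card V) / 2 \<le> real ?e" if "real (card S) * (y - 1) < 0" using that nn by simp
  qed (use n in auto)
  also have "\<dots> \<le> real (card V) ^ ?e * exp (real k * (y - 1))"
    using y S by (auto intro!: mult_left_mono mult_right_mono)
  finally show ?thesis .
qed

lemma sum_power_card_Pow: "finite J \<Longrightarrow> (\<Sum>I\<in>Pow J. c ^ card I) = (1 + c :: 'b :: comm_semiring_1) ^ card J"
proof (induction J rule: finite_induct)
  case (insert j J)
  have "(\<Sum>I\<in>insert j ` Pow J. c ^ card I) = (\<Sum>I\<in>Pow J. c ^ card (insert j I))"
    using insert by (intro sum.reindex_cong[where l = "insert j"]) (auto intro!: inj_onI)
  also have "\<dots> = (\<Sum>I\<in>Pow J. c * c ^ card I)"
  proof (rule sum.cong[OF refl])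
    fix I assume "I \<in> Pow J"
    then have "finite I" "j \<notin> I" using insert finite_subset by auto
    then show "c ^ card (insert j I) = c * c ^ card I" by simp
  qed
  finally have *: "(\<Sum>I\<in>insert j ` Pow J. c ^ card I) = c * (\<Sum>I\<in>Pow J. c ^ card I)"
    by (simp add: sum_distrib_left)
  have "(\<Sum>I\<in>Pow (insert j J). c ^ card I) = (\<Sum>I\<in>Pow J. c ^ card I) + (\<Sum>I\<in>insert j ` Pow J. c ^ card I)"
    unfolding Pow_insert using insert by (intro sum.union_disjoint) auto
  then show ?case using insert * by (simp add: algebra_simps)
qed simp

text \<open>
  Parities are independent enough: the indicator of equal parities is a product of factors
  $(1 \pm (-1)^{c(u_j) + c(w_j)}) / 2$, and each monomial of the expansion is a weighted count.
\<close>

lemma card_equal_parities: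
  assumes fin: "finite V" and q: "forest_on V A q" and V: "V \<noteq> {}"
    and J: "finite J" "inj_on u J" "inj_on w J" "u ` J \<subseteq> V" "w ` J \<subseteq> V" "u ` J \<inter> w ` J = {}"
    and big: "4 * card J \<le> card V" "2 * card A + 2 \<le> card V"
    and ne: "\<And>x. x \<in> A \<Longrightarrow> q x \<noteq> x"
  shows "real (card {p \<in> extensions V A q. \<forall>j\<in>J. odd (card (children V p (u j))) = odd (card (children V p (w j)))})
     \<le> real (card V) ^ (card V - card A - 1) * (3 / 5) ^ card J"
proof -
  let ?E = "extensions V A q" and ?e = "card V - card A - 1" and ?n = "real (card V)"
  \<comment> \<open>\<open>s j\<close> is the fixed sign from the prescribed children and
    \<open>\<psi> p j\<close> the random one; their product is 1 exactly when the two parities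
    agree.\<close>
  define s :: "'b \<Rightarrow> real" where "s j = (-1) ^ (card {x \<in> A. q x = u j} + card {x \<in> A. q x = w j})" for j
  define \<psi> :: "('a \<Rightarrow> 'a) \<Rightarrow> 'b \<Rightarrow> real" where "\<psi> p j = (-1) ^ (extra V A p (u j) + extra V A p (w j))" for p j
  have n: "?n > 0" using fin V by (simp add: card_gt_0_iff)
  have s\<psi>: "s j * \<psi> p j = (if odd (card (children V p (u j))) = odd (card (children V p (w j))) then 1 else -1)"
    if "p \<in> ?E" for p j
    unfolding s_def \<psi>_def power_add[symmetric]
    using card_children_extensions[OF fin q that ne, of "u j"] card_children_extensions[OF fin q that ne, of "w j"]
    by (auto simp: minus_one_power_iff)
  let ?bad = "{p \<in> ?E. \<forall>j\<in>J. odd (card (children V p (u j))) = odd (card (children V p (w j)))}"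
  \<comment> \<open>Weight -1 at \<open>2 * card I\<close> vertices lowers the sum of all weights by
    \<open>4 * card I\<close>.\<close>
  have main: "(\<Sum>p\<in>?E. \<Prod>j\<in>I. \<psi> p j) = (?n - 4 * card I) ^ ?e" if I: "I \<subseteq> J" for I
  proof -
    let ?U = "u ` I \<union> w ` I"
    have fI: "finite I" using I J finite_subset by blast
    have U: "?U \<subseteq> V" using image_mono[OF I, of u] image_mono[OF I, of w] J(4,5) by blast
    have inj: "inj_on u I" "inj_on w I" by (rule inj_on_subset[OF J(2) I], rule inj_on_subset[OF J(3) I])
    have dis: "u ` I \<inter> w ` I = {}" using image_mono[OF I, of u] image_mono[OF I, of w] J(6) by blast
    have cU: "card ?U = 2 * card I"
      using fI inj dis by (subst card_Un_disjoint) (auto simp: card_image)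
    have "(\<Prod>j\<in>I. \<psi> p j) = (\<Prod>v\<in>V. (if v \<in> ?U then -1 else 1 :: real) ^ extra V A p v)" for p
    proof -
      have "(\<Sum>v\<in>?U. extra V A p v) = (\<Sum>v\<in>u ` I. extra V A p v) + (\<Sum>v\<in>w ` I. extra V A p v)"
        using fI dis by (intro sum.union_disjoint) auto
      also have "\<dots> = (\<Sum>j\<in>I. extra V A p (u j) + extra V A p (w j))"
        using inj by (simp add: sum.reindex sum.distrib)
      finally show ?thesis unfolding prod_indicator_weight[OF fin U] \<psi>_def by (simp add: power_sum)
    qed
    then have "(\<Sum>p\<in>?E. \<Prod>j\<in>I. \<psi> p j) = (\<Sum>v\<in>V. if v \<in> ?U then -1 else 1 :: real) ^ ?e"
      by (simp only: sum_extensions_extra[OF fin q V])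
    also have "(\<Sum>v\<in>V. if v \<in> ?U then -1 else 1 :: real) = ?n - 4 * card I"
      unfolding sum_indicator_weight[OF fin U] cU by simp
    finally show ?thesis .
  qed
  have "real (card ?bad) = (\<Sum>p\<in>?bad. \<Prod>j\<in>J. (1 + s j * \<psi> p j) / 2)"
  proof -
    have "(\<Prod>j\<in>J. (1 + s j * \<psi> p j) / 2) = 1" if "p \<in> ?bad" for p
      using that s\<psi>[of p] by (intro prod.neutral) auto
    then show ?thesis by simp
  qed
  also have "\<dots> \<le> (\<Sum>p\<in>?E. \<Prod>j\<in>J. (1 + s j * \<psi> p j) / 2)"
  proof (rule sum_mono2[OF finite_extensions[OF fin]])
    fix p assume "p \<in> ?E - ?bad"
    then have pE: "p \<in> ?E" by blast
    have nn: "0 \<le> (1 + s j * \<psi> p j) / 2" for j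
    proof -
      have "s j * \<psi> p j = 1 \<or> s j * \<psi> p j = -1" unfolding s\<psi>[OF pE] by presburger
      then show ?thesis by auto
    qed
    show "0 \<le> (\<Prod>j\<in>J. (1 + s j * \<psi> p j) / 2)" by (rule prod_nonneg, rule nn)
  qed (rule Collect_restrict)
  also have "\<dots> = (\<Sum>p\<in>?E. (1/2) ^ card J * (\<Sum>I\<in>Pow J. \<Prod>j\<in>I. s j * \<psi> p j))"
  proof (rule sum.cong[OF refl])
    fix p
    have "(\<Prod>j\<in>J. (1 + s j * \<psi> p j) / 2) = (\<Prod>j\<in>J. (1/2) * (s j * \<psi> p j + 1))"
      by (intro prod.cong refl) (simp add: field_simps)
    also have "\<dots> = (1/2) ^ card J * (\<Prod>j\<in>J. s j * \<psi> p j + 1)"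
      by (simp only: prod.distrib prod_constant)
    also have "(\<Prod>j\<in>J. s j * \<psi> p j + 1) = (\<Sum>I\<in>Pow J. (\<Prod>j\<in>I. s j * \<psi> p j) * (\<Prod>j\<in>J - I. 1))"
      by (rule prod_add[OF J(1)])
    finally show "(\<Prod>j\<in>J. (1 + s j * \<psi> p j) / 2) = (1/2) ^ card J * (\<Sum>I\<in>Pow J. \<Prod>j\<in>I. s j * \<psi> p j)" by simp
  qed
  also have "\<dots> = (1/2) ^ card J * (\<Sum>p\<in>?E. \<Sum>I\<in>Pow J. \<Prod>j\<in>I. s j * \<psi> p j)"
    by (simp add: sum_distrib_left)
  also have "(\<Sum>p\<in>?E. \<Sum>I\<in>Pow J. \<Prod>j\<in>I. s j * \<psi> p j) = (\<Sum>I\<in>Pow J. \<Sum>p\<in>?E. \<Prod>j\<in>I. s j * \<psi> p j)"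
    by (rule sum.swap)
  also have "\<dots> = (\<Sum>I\<in>Pow J. (\<Prod>j\<in>I. s j) * (\<Sum>p\<in>?E. \<Prod>j\<in>I. \<psi> p j))"
    by (simp add: prod.distrib sum_distrib_left)
  \<comment> \<open>Since \<open>?e\<close> is at least half of \<open>?n\<close>, each monomial is
    at most \<open>?n ^ ?e * exp (-2) ^ card I\<close>, and \<open>exp 2 \<ge> 1 + 2 + 2\<close>.
    Summing over \<open>I\<close> gives \<open>((1 + 1/5) / 2) ^ card J\<close>, the origin of
    \<open>3/5\<close>.\<close>
  also have "\<dots> \<le> (\<Sum>I\<in>Pow J. ?n ^ ?e * (1/5) ^ card I)"
  proof (rule sum_mono)
    fix I assume "I \<in> Pow J"
    then have I: "I \<subseteq> J" by simp
    have cI: "4 * card I \<le> card V" using card_mono[OF J(1) I] big by simp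
    have "\<bar>\<Prod>j\<in>I. s j\<bar> = 1" unfolding abs_prod s_def by (simp add: power_abs)
    moreover have nn: "0 \<le> (?n - 4 * card I) ^ ?e" using cI by (intro zero_le_power) simp
    moreover have "P * X \<le> X" if "\<bar>P\<bar> = 1" "0 \<le> X" for P X :: real
      using that by (auto simp: abs_if split: if_splits)
    ultimately have "(\<Prod>j\<in>I. s j) * (\<Sum>p\<in>?E. \<Prod>j\<in>I. \<psi> p j) \<le> (?n - 4 * card I) ^ ?e"
      unfolding main[OF I] by blast
    also have "\<dots> \<le> ?n ^ ?e * (1/5) ^ card I"
    proof (cases "card I = 0")
      case False
      have "(?n + (- (4 * real (card I)))) ^ ?e \<le> ?n ^ ?e * (if 0 \<le> - (4 * real (card I)) then exp (- (4 * real (card I))) else exp (- (4 * real (card I)) / 2))"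
      proof (rule power_add_le_exp)
        show "0 \<le> 1 + - (4 * real (card I)) / ?n" using cI n by (simp add: field_simps)
        show "?n / 2 \<le> real ?e" using big(2) by linarith
      qed (use n False in auto)
      then have "(?n - 4 * card I) ^ ?e \<le> ?n ^ ?e * exp (- 2 * real (card I))" using False by simp
      also have "exp (- 2 * real (card I)) = exp (-2) ^ card I"
        using exp_of_nat_mult[of "card I" "-2 :: real"] by (simp add: mult.commute)
      also have "?n ^ ?e * \<dots> \<le> ?n ^ ?e * (1/5) ^ card I"
      proof (intro mult_left_mono power_mono)
        show "exp (-2 :: real) \<le> 1/5"
          using exp_lower_Taylor_quadratic[of "2::real"] by (simp add: exp_minus field_simps)
      qed auto
      finally show ?thesis .
    qed simp
    finally show "(\<Prod>j\<in>I. s j) * (\<Sum>p\<in>?E. \<Prod>j\<in>I. \<psi> p j) \<le> ?n ^ ?e * (1/5) ^ card I" .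
  qed
  also have "\<dots> = ?n ^ ?e * (6/5) ^ card J"
    using sum_power_card_Pow[OF J(1), of "1/5 :: real"] by (simp add: sum_distrib_left[symmetric])
  also have "(1/2) ^ card J * (?n ^ ?e * (6/5) ^ card J) = ?n ^ ?e * (3/5 :: real) ^ card J"
    by (simp add: power_mult_distrib[symmetric])
  finally show ?thesis by simp
qed

section \<open>Vertical paths\<close>

text \<open>The arcs \<open>\<sigma> i \<mapsto> \<sigma> (i + 1)\<close> for \<open>i \<in> I\<close>: one vertical path, or several if \<open>I\<close> has gaps.\<close>

definition arcs_map :: "(nat \<Rightarrow> 'a) \<Rightarrow> nat \<Rightarrow> nat set \<Rightarrow> 'a \<Rightarrow> 'a" where
  "arcs_map \<sigma> l I v = (if v \<in> \<sigma> ` I then \<sigma> (Suc (the_inv_into {..<l} \<sigma> v)) else v)"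

lemma arcs_map:
  assumes \<sigma>: "inj_on \<sigma> {..<l}" "\<sigma> ` {..<l} \<subseteq> V" and I: "I \<subseteq> {i. Suc i < l}"
  shows "\<And>i. i \<in> I \<Longrightarrow> arcs_map \<sigma> l I (\<sigma> i) = \<sigma> (Suc i)" "forest_on V (\<sigma> ` I) (arcs_map \<sigma> l I)"
    "\<And>v. v \<in> \<sigma> ` I \<Longrightarrow> arcs_map \<sigma> l I v \<noteq> v" "card (\<sigma> ` I) = card I"
    "\<And>v. card {x \<in> \<sigma> ` I. arcs_map \<sigma> l I x = v} \<le> 1"
proof -
  have lt: "i < l" "Suc i < l" if "i \<in> I" for i using I that by auto
  have inv: "the_inv_into {..<l} \<sigma> (\<sigma> i) = i" if "i < l" for i
    using the_inv_into_f_f[OF \<sigma>(1)] that by simp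
  show e: "arcs_map \<sigma> l I (\<sigma> i) = \<sigma> (Suc i)" if "i \<in> I" for i
    using that lt(1)[OF that] inv by (simp add: arcs_map_def)
  show ne: "arcs_map \<sigma> l I v \<noteq> v" if v: "v \<in> \<sigma> ` I" for v
  proof -
    obtain i where i: "i \<in> I" "v = \<sigma> i" using v by blast
    have "\<sigma> (Suc i) \<noteq> \<sigma> i" using \<sigma>(1) lt[OF i(1)] by (metis inj_onD lessThan_iff n_not_Suc_n)
    then show ?thesis using e[OF i(1)] i(2) by simp
  qed
  show "forest_on V (\<sigma> ` I) (arcs_map \<sigma> l I)"
  proof (rule forest_on_rank[where rank = "\<lambda>v. l - the_inv_into {..<l} \<sigma> v"])
    show "\<sigma> ` I \<subseteq> V" using \<sigma>(2) lt by fastforce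
    fix v
    show "v \<notin> \<sigma> ` I \<Longrightarrow> arcs_map \<sigma> l I v = v" by (simp add: arcs_map_def)
    assume "v \<in> \<sigma> ` I"
    then obtain i where i: "i \<in> I" "v = \<sigma> i" by blast
    show "arcs_map \<sigma> l I v \<in> V" using e[OF i(1)] i(2) \<sigma>(2) lt[OF i(1)] by auto
    show "l - the_inv_into {..<l} \<sigma> (arcs_map \<sigma> l I v) < l - the_inv_into {..<l} \<sigma> v"
      using e[OF i(1)] i(2) inv lt[OF i(1)] by simp
  qed
  have injI: "inj_on \<sigma> I" using \<sigma>(1) lt(1) by (meson inj_on_subset lessThan_iff subsetI)
  then show "card (\<sigma> ` I) = card I" by (rule card_image)
  show "card {x \<in> \<sigma> ` I. arcs_map \<sigma> l I x = v} \<le> 1" for v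
  proof -
    have "x = y" if xy: "x \<in> \<sigma> ` I" "y \<in> \<sigma> ` I" "arcs_map \<sigma> l I x = arcs_map \<sigma> l I y" for x y
    proof -
      obtain i j where ij: "i \<in> I" "x = \<sigma> i" "j \<in> I" "y = \<sigma> j" using xy by blast
      then have "\<sigma> (Suc i) = \<sigma> (Suc j)" using e xy(3) by metis
      then have "Suc i = Suc j" using \<sigma>(1) lt[OF ij(1)] lt[OF ij(3)] by (metis inj_onD lessThan_iff)
      then show ?thesis using ij by simp
    qed
    then have "\<exists>a. {x \<in> \<sigma> ` I. arcs_map \<sigma> l I x = v} \<subseteq> {a}" by blast
    then obtain a where "{x \<in> \<sigma> ` I. arcs_map \<sigma> l I x = v} \<subseteq> {a}" by blast
    from card_mono[OF _ this] show ?thesis by simp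
  qed
qed

lemma in_extensions_arcs_map:
  assumes \<sigma>: "inj_on \<sigma> {..<l}" "\<sigma> ` {..<l} \<subseteq> V" and I: "I \<subseteq> {i. Suc i < l}"
    and p: "p \<in> rooted_trees V" "\<And>i. i \<in> I \<Longrightarrow> p (\<sigma> i) = \<sigma> (Suc i)"
  shows "p \<in> extensions V (\<sigma> ` I) (arcs_map \<sigma> l I)"
  using arcs_map(1)[OF \<sigma> I] p by (auto simp: extensions_def)

lemma card_UN_le_sum:
  assumes "finite I" "B \<subseteq> (\<Union>i\<in>I. F i)" "\<And>i. i \<in> I \<Longrightarrow> finite (F i)" "\<And>i. i \<in> I \<Longrightarrow> real (card (F i)) \<le> c"
  shows "real (card B) \<le> real (card I) * c"
proof -
  have "card B \<le> card (\<Union>i\<in>I. F i)" using assms by (intro card_mono) auto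
  also have "\<dots> \<le> (\<Sum>i\<in>I. card (F i))" by (rule card_UN_le[OF assms(1)])
  finally have "real (card B) \<le> (\<Sum>i\<in>I. real (card (F i)))" by (metis of_nat_mono of_nat_sum)
  also have "\<dots> \<le> (\<Sum>i\<in>I. c)" by (intro sum_mono assms)
  finally show ?thesis by simp
qed

text \<open>Tuples with repetition reach every nonempty subset of size at most \<open>k\<close>, so
  the choice of positions on a path is bounded by a plain power.\<close>

lemma enumerate_small_set:
  assumes "finite B" "B \<noteq> {}" "card B \<le> k"
  shows "\<exists>\<beta>\<in>{..<k} \<rightarrow>\<^sub>E B. \<beta> ` {..<k} = B"
proof -
  obtain h where h: "bij_betw h {0..<card B} B" using ex_bij_betw_nat_finite[OF assms(1)] by blast
  obtain b where b: "b \<in> B" using assms by blast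
  define \<beta> where "\<beta> = (\<lambda>i\<in>{..<k}. if i < card B then h i else b)"
  have hB: "h i \<in> B" if "i < card B" for i using h that by (auto simp: bij_betw_def)
  have "B \<subseteq> \<beta> ` {..<k}"
  proof
    fix x assume "x \<in> B"
    then have "x \<in> h ` {0..<card B}" using h by (simp add: bij_betw_def)
    then obtain i where "i < card B" "x = h i" by auto
    then show "x \<in> \<beta> ` {..<k}" using assms(3) by (intro image_eqI[of _ _ i]) (auto simp: \<beta>_def)
  qed
  moreover have "\<beta> \<in> {..<k} \<rightarrow>\<^sub>E B" using hB b by (auto simp: \<beta>_def)
  ultimately show ?thesis by (intro bexI[of _ \<beta>]) auto
qed

text \<open>Injectivity says that the path does not yet idle at the root, so that its
  \<open>m\<close> arcs can be prescribed.\<close>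

definition heavy_chain :: "'a set \<Rightarrow> nat \<Rightarrow> nat \<Rightarrow> nat \<Rightarrow> ('a \<Rightarrow> 'a) set" where
  "heavy_chain V m k W = {p \<in> rooted_trees V. \<exists>z\<in>V. inj_on (\<lambda>i. (p ^^ i) z) {..m} \<and>
     (\<exists>S \<subseteq> (\<lambda>i. (p ^^ i) z) ` {..m}. card S \<le> k \<and> W < (\<Sum>u\<in>S. card (children V p u)))}"

text \<open>Union bound over the path and the positions of \<open>S\<close> on it. The path itself
  gives each vertex at most one child, so at least \<open>Suc W - k\<close> children are extra, and
  the exponential Markov inequality applies. Choosing \<open>m + 1\<close> vertices against
  \<open>m\<close> prescribed arcs leaves one surplus factor \<open>card V\<close>.\<close>

lemma card_heavy_chain:
  assumes fin: "finite V" and m: "m < card V" and y: "1 \<le> y"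
  shows "real (card (heavy_chain V m k W)) * y ^ (Suc W - k) \<le>
    real (card V) ^ card V * real (Suc m) ^ k * exp (real k * (y - 1))"
proof -
  let ?n = "card V" and ?l = "Suc m" and ?I = "{..<m}"
  let ?\<Sigma> = "({..<?l} \<rightarrow>\<^sub>E V) \<times> ({..<k} \<rightarrow>\<^sub>E {..m})"
  have V: "V \<noteq> {}" using m by auto
  have I: "?I \<subseteq> {i. Suc i < ?l}" by auto
  define F where "F = (\<lambda>(\<sigma>, \<beta>). if inj_on \<sigma> {..<?l} then
     {p \<in> extensions V (\<sigma> ` ?I) (arcs_map \<sigma> ?l ?I). Suc W - k \<le> (\<Sum>v\<in>\<sigma> ` \<beta> ` {..<k}. extra V (\<sigma> ` ?I) p v)} else {})"
  have cov: "heavy_chain V m k W \<subseteq> (\<Union>x\<in>?\<Sigma>. F x)"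
  proof
    fix p assume "p \<in> heavy_chain V m k W"
    then obtain z S where p: "p \<in> rooted_trees V" and z: "z \<in> V" and inj: "inj_on (\<lambda>i. (p ^^ i) z) {..m}"
      and S: "S \<subseteq> (\<lambda>i. (p ^^ i) z) ` {..m}" "card S \<le> k" "W < (\<Sum>u\<in>S. card (children V p u))"
      by (auto simp: heavy_chain_def)
    obtain r where "rooted V p r" using p by (auto simp: rooted_trees_def)
    then interpret rooted_tree V p r using fin by unfold_locales
    define \<sigma> where "\<sigma> = (\<lambda>i\<in>{..<?l}. (p ^^ i) z)"
    have \<sigma>: "\<sigma> \<in> {..<?l} \<rightarrow>\<^sub>E V" using ppV[OF z] by (auto simp: \<sigma>_def)
    have \<sigma>i: "inj_on \<sigma> {..<?l}" using inj by (auto simp: \<sigma>_def inj_on_def)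
    have \<sigma>V: "\<sigma> ` {..<?l} \<subseteq> V" using \<sigma> by auto
    define B where "B = {i. i \<le> m \<and> (p ^^ i) z \<in> S}"
    have SB: "S = \<sigma> ` B" using S(1) by (auto simp: B_def \<sigma>_def)
    have Bm: "B \<subseteq> {..m}" by (auto simp: B_def)
    have "card (\<sigma> ` B) = card B"
    proof (rule card_image[OF inj_on_subset[OF \<sigma>i]])
      show "B \<subseteq> {..<?l}" using Bm by auto
    qed
    then have cB: "card B \<le> k" using S(2) SB by simp
    have "S \<noteq> {}" using S(3) by auto
    then have B0: "B \<noteq> {}" using SB by auto
    have "finite B" using Bm finite_subset by blast
    from enumerate_small_set[OF this B0 cB] obtain \<beta> where \<beta>: "\<beta> \<in> {..<k} \<rightarrow>\<^sub>E B" "\<beta> ` {..<k} = B"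
      by (rule bexE)
    have \<beta>': "\<beta> \<in> {..<k} \<rightarrow>\<^sub>E {..m}" using \<beta>(1) Bm by (auto simp: PiE_iff)
    have ext: "p \<in> extensions V (\<sigma> ` ?I) (arcs_map \<sigma> ?l ?I)"
      by (rule in_extensions_arcs_map[OF \<sigma>i \<sigma>V I p]) (simp add: \<sigma>_def)
    have "Suc W \<le> (\<Sum>u\<in>S. card (children V p u))" using S(3) by simp
    also have "\<dots> = (\<Sum>u\<in>S. card {x \<in> \<sigma> ` ?I. arcs_map \<sigma> ?l ?I x = u} + extra V (\<sigma> ` ?I) p u)"
    proof (rule sum.cong[OF refl])
      fix u
      show "card (children V p u) = card {x \<in> \<sigma> ` ?I. arcs_map \<sigma> ?l ?I x = u} + extra V (\<sigma> ` ?I) p u"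
        by (rule card_children_extensions[OF fin arcs_map(2)[OF \<sigma>i \<sigma>V I] ext arcs_map(3)[OF \<sigma>i \<sigma>V I]])
    qed
    also have "\<dots> \<le> (\<Sum>u\<in>S. 1 + extra V (\<sigma> ` ?I) p u)"
      by (intro sum_mono add_mono arcs_map(5)[OF \<sigma>i \<sigma>V I] order_refl)
    also have "\<dots> = card S + (\<Sum>u\<in>S. extra V (\<sigma> ` ?I) p u)" by (simp only: sum.distrib) simp
    finally have "Suc W - k \<le> (\<Sum>u\<in>S. extra V (\<sigma> ` ?I) p u)" using S(2) by linarith
    then have "p \<in> F (\<sigma>, \<beta>)" using ext \<sigma>i SB \<beta>(2) by (simp add: F_def)
    then show "p \<in> (\<Union>x\<in>?\<Sigma>. F x)" using \<sigma> \<beta>' by blast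
  qed
  have fin\<Sigma>: "finite ?\<Sigma>" using fin by (intro finite_cartesian_product finite_PiE) auto
  have finF: "finite (F x)" for x using finite_extensions[OF fin] by (cases x) (simp add: F_def)
  let ?c = "real ?n ^ (?n - m - 1) * exp (real k * (y - 1)) / y ^ (Suc W - k)"
  have cF: "real (card (F x)) \<le> ?c" if "x \<in> ?\<Sigma>" for x
  proof -
    obtain \<sigma> \<beta> where x: "x = (\<sigma>, \<beta>)" by (cases x)
    have \<sigma>V: "\<sigma> ` {..<?l} \<subseteq> V" and \<beta>: "\<beta> ` {..<k} \<subseteq> {..m}" using that x by auto
    have y0: "0 < y ^ (Suc W - k)" using y by simp
    show ?thesis
    proof (cases "inj_on \<sigma> {..<?l}")
      case True
      have S1: "\<sigma> ` \<beta> ` {..<k} \<subseteq> V"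
      proof
        fix v assume "v \<in> \<sigma> ` \<beta> ` {..<k}"
        then obtain i where "i < k" "v = \<sigma> (\<beta> i)" by auto
        moreover have "\<beta> i \<le> m" using \<beta> \<open>i < k\<close> by auto
        ultimately show "v \<in> V" using \<sigma>V by auto
      qed
      have "card (\<sigma> ` \<beta> ` {..<k}) \<le> card (\<beta> ` {..<k})" by (rule card_image_le) auto
      also have "\<dots> \<le> card {..<k}" by (rule card_image_le) auto
      finally have S2: "card (\<sigma> ` \<beta> ` {..<k}) \<le> k" by simp
      have "card (\<sigma> ` ?I) = m" using arcs_map(4)[OF True \<sigma>V I] by simp
      then show ?thesis
        using card_many_extra[OF fin arcs_map(2)[OF True \<sigma>V I] V S1 S2 y, of "Suc W - k"] True y0
        by (simp add: F_def x pos_le_divide_eq)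
    next
      case False
      then show ?thesis using y0 by (simp add: F_def x)
    qed
  qed
  have "real (card (heavy_chain V m k W)) \<le> real (card ?\<Sigma>) * ?c"
    by (rule card_UN_le_sum[OF fin\<Sigma> cov finF cF])
  moreover have "card ?\<Sigma> = ?n ^ Suc m * Suc m ^ k" by (simp add: card_cartesian_product card_PiE)
  moreover have "real ?n ^ Suc m * real ?n ^ (?n - m - 1) = real ?n ^ ?n"
    using m by (simp add: power_add[symmetric] del: power_Suc)
  moreover have "real (a ^ Suc m * b ^ k) * (c * d / e) = (real a ^ Suc m * c) * real b ^ k * d / e"
    for a b :: nat and c d e :: real by (simp only: of_nat_mult of_nat_power times_divide_eq_right mult_ac)
  ultimately have "real (card (heavy_chain V m k W)) \<le> real ?n ^ ?n * real (Suc m) ^ k * exp (real k * (y - 1)) / y ^ (Suc W - k)"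
    by metis
  then show ?thesis using y by (simp add: pos_le_divide_eq)
qed

text \<open>A common form for the parity coincidences: \<open>\<sigma>\<close> places
  \<open>l\<close> distinct vertices, \<open>I\<close> tells which consecutive ones are joined by
  parent arcs, and \<open>J\<close> indexes the pairs of positions that agree.\<close>

definition equal_parities :: "'a set \<Rightarrow> nat \<Rightarrow> nat set \<Rightarrow> nat set \<Rightarrow> (nat \<Rightarrow> nat) \<Rightarrow> (nat \<Rightarrow> nat) \<Rightarrow> ('a \<Rightarrow> 'a) set" where
  "equal_parities V l I J \<alpha> \<beta> = {p \<in> rooted_trees V. \<exists>\<sigma>. inj_on \<sigma> {..<l} \<and> \<sigma> ` {..<l} \<subseteq> V \<and>
     (\<forall>i\<in>I. p (\<sigma> i) = \<sigma> (Suc i)) \<and>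
     (\<forall>j\<in>J. odd (card (children V p (\<sigma> (\<alpha> j)))) = odd (card (children V p (\<sigma> (\<beta> j)))))}"

text \<open>Union bound over the placement \<open>\<sigma>\<close>. With \<open>l\<close> vertices
  and \<open>card I\<close> prescribed arcs, each path of the pattern leaves a surplus factor
  \<open>card V\<close>.\<close>

lemma card_equal_parities_le:
  assumes fin: "finite V" and V: "V \<noteq> {}" and I: "I \<subseteq> {i. Suc i < l}"
    and J: "finite J" "inj_on \<alpha> J" "inj_on \<beta> J" "\<alpha> ` J \<subseteq> {..<l}" "\<beta> ` J \<subseteq> {..<l}" "\<alpha> ` J \<inter> \<beta> ` J = {}"
    and big: "4 * card J \<le> card V" "2 * card I + 2 \<le> card V"
  shows "real (card (equal_parities V l I J \<alpha> \<beta>)) \<le> real (card V) ^ (l + (card V - card I - 1)) * (3/5) ^ card J"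
proof -
  let ?n = "card V"
  define F where "F \<sigma> = (if inj_on \<sigma> {..<l} then {p \<in> extensions V (\<sigma> ` I) (arcs_map \<sigma> l I).
     \<forall>j\<in>J. odd (card (children V p ((\<sigma> \<circ> \<alpha>) j))) = odd (card (children V p ((\<sigma> \<circ> \<beta>) j)))} else {})" for \<sigma>
  have cov: "equal_parities V l I J \<alpha> \<beta> \<subseteq> (\<Union>\<sigma>\<in>{..<l} \<rightarrow>\<^sub>E V. F \<sigma>)"
  proof
    fix p assume "p \<in> equal_parities V l I J \<alpha> \<beta>"
    then obtain \<sigma>' where p: "p \<in> rooted_trees V" and i': "inj_on \<sigma>' {..<l}" and V': "\<sigma>' ` {..<l} \<subseteq> V"
      and arc: "\<forall>i\<in>I. p (\<sigma>' i) = \<sigma>' (Suc i)"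
      and par: "\<forall>j\<in>J. odd (card (children V p (\<sigma>' (\<alpha> j)))) = odd (card (children V p (\<sigma>' (\<beta> j))))"
      by (auto simp: equal_parities_def)
    define \<sigma> where "\<sigma> = restrict \<sigma>' {..<l}"
    have e: "\<sigma> i = \<sigma>' i" if "i < l" for i using that by (simp add: \<sigma>_def)
    have \<sigma>: "\<sigma> \<in> {..<l} \<rightarrow>\<^sub>E V" using V' by (auto simp: \<sigma>_def)
    have \<sigma>i: "inj_on \<sigma> {..<l}" using i' by (auto simp: \<sigma>_def inj_on_def)
    have \<sigma>V: "\<sigma> ` {..<l} \<subseteq> V" using \<sigma> by auto
    have "p (\<sigma> i) = \<sigma> (Suc i)" if "i \<in> I" for i
    proof -
      have "Suc i < l" "i < l" using I that by auto
      then show ?thesis using arc e that by metis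
    qed
    then have "p \<in> extensions V (\<sigma> ` I) (arcs_map \<sigma> l I)" by (rule in_extensions_arcs_map[OF \<sigma>i \<sigma>V I p])
    moreover have "\<sigma> (\<alpha> j) = \<sigma>' (\<alpha> j)" "\<sigma> (\<beta> j) = \<sigma>' (\<beta> j)" if "j \<in> J" for j
      using e J(4,5) that by auto
    then have "\<forall>j\<in>J. odd (card (children V p ((\<sigma> \<circ> \<alpha>) j))) = odd (card (children V p ((\<sigma> \<circ> \<beta>) j)))"
      using par by (simp add: comp_def)
    ultimately have "p \<in> F \<sigma>" using \<sigma>i unfolding F_def by simp
    then show "p \<in> (\<Union>\<sigma>\<in>{..<l} \<rightarrow>\<^sub>E V. F \<sigma>)" using \<sigma> by blast
  qed
  have finF: "finite (F \<sigma>)" for \<sigma> using finite_extensions[OF fin] by (simp add: F_def)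
  have cF: "real (card (F \<sigma>)) \<le> real ?n ^ (?n - card I - 1) * (3/5) ^ card J" if "\<sigma> \<in> {..<l} \<rightarrow>\<^sub>E V" for \<sigma>
  proof (cases "inj_on \<sigma> {..<l}")
    case True
    have \<sigma>V: "\<sigma> ` {..<l} \<subseteq> V" using that by auto
    have cI: "card (\<sigma> ` I) = card I" by (rule arcs_map(4)[OF True \<sigma>V I])
    have "inj_on (\<sigma> \<circ> \<alpha>) J" "inj_on (\<sigma> \<circ> \<beta>) J"
      by (rule comp_inj_on[OF J(2) inj_on_subset[OF True J(4)]], rule comp_inj_on[OF J(3) inj_on_subset[OF True J(5)]])
    moreover have "(\<sigma> \<circ> \<alpha>) ` J \<subseteq> V" "(\<sigma> \<circ> \<beta>) ` J \<subseteq> V"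
      unfolding image_comp[symmetric] using \<sigma>V image_mono[OF J(4), of \<sigma>] image_mono[OF J(5), of \<sigma>] by blast+
    moreover have "(\<sigma> \<circ> \<alpha>) ` J \<inter> (\<sigma> \<circ> \<beta>) ` J = {}"
      unfolding image_comp[symmetric] inj_on_image_Int[OF True J(4,5), symmetric] J(6) by simp
    ultimately have "real (card {p \<in> extensions V (\<sigma> ` I) (arcs_map \<sigma> l I).
       \<forall>j\<in>J. odd (card (children V p ((\<sigma> \<circ> \<alpha>) j))) = odd (card (children V p ((\<sigma> \<circ> \<beta>) j)))})
      \<le> real ?n ^ (?n - card (\<sigma> ` I) - 1) * (3/5) ^ card J"
      by (intro card_equal_parities[OF fin arcs_map(2)[OF True \<sigma>V I] V J(1) _ _ _ _ _ big(1)] arcs_map(3)[OF True \<sigma>V I])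
         (use big cI in \<open>simp_all add: comp_def\<close>)
    then show ?thesis using True unfolding F_def cI by simp
  qed (simp add: F_def)
  have "real (card (equal_parities V l I J \<alpha> \<beta>)) \<le> real (card ({..<l} \<rightarrow>\<^sub>E V)) * (real ?n ^ (?n - card I - 1) * (3/5) ^ card J)"
    by (rule card_UN_le_sum[OF _ cov finF cF]) (use fin in \<open>auto intro: finite_PiE\<close>)
  then show ?thesis by (simp add: card_PiE power_add mult_ac)
qed

section \<open>Excluding parity coincidences\<close>

text \<open>Subtracting \<open>\<delta>\<close> maps the odd blocks injectively into the even ones.
  The restriction to even blocks serves to make the pairs \<open>t\<close>,
  \<open>t + \<delta>\<close> disjoint: the second member lies in an odd block.\<close>

lemma card_even_blocks: "\<delta> \<ge> 1 \<Longrightarrow> N \<le> 2 * card {t. t \<le> N \<and> even (t div \<delta>)}" for \<delta> N :: nat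
proof -
  assume d: "\<delta> \<ge> 1"
  let ?E = "{t. t \<le> N \<and> even (t div \<delta>)}" and ?O = "{t. t \<le> N \<and> odd (t div \<delta>)}"
  have ge: "\<delta> \<le> t" if "odd (t div \<delta>)" for t
  proof (rule ccontr)
    assume "\<not> \<delta> \<le> t" then have "t div \<delta> = 0" by simp
    then show False using that by simp
  qed
  have "(\<lambda>t. t - \<delta>) ` ?O \<subseteq> ?E"
  proof
    fix x assume "x \<in> (\<lambda>t. t - \<delta>) ` ?O"
    then obtain t where t: "t \<le> N" "odd (t div \<delta>)" "x = t - \<delta>" by auto
    have "(t - \<delta>) div \<delta> = t div \<delta> - 1" using ge[OF t(2)] d by (simp add: le_div_geq)
    then show "x \<in> ?E" using t by auto
  qed
  moreover have "inj_on (\<lambda>t. t - \<delta>) ?O" using ge by (auto simp: inj_on_def) (metis le_add_diff_inverse2)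
  ultimately have "card ?O \<le> card ?E" by (intro card_inj_on_le[of "\<lambda>t. t - \<delta>"]) auto
  moreover have "card (?E \<union> ?O) = card ?E + card ?O" by (intro card_Un_disjoint) auto
  moreover have "?E \<union> ?O = {..N}" by auto
  ultimately show ?thesis by simp
qed

text \<open>The arc from position \<open>N\<close> to \<open>N + 1\<close> is left out, so the
  positions up to \<open>N\<close> and from \<open>N + 1\<close> to \<open>2 * N + 1\<close> form
  separate paths.\<close>

definition two_paths :: "nat \<Rightarrow> nat set" where "two_paths N = {..<2 * N + 1} - {N}"

lemma card_two_paths: "card (two_paths N) = 2 * N"
  by (simp add: two_paths_def card_Diff_singleton)

context rooted_tree
begin

lemma funpow_inj: "z \<in> V \<Longrightarrow> m \<le> dep z \<Longrightarrow> inj_on (\<lambda>i. (p ^^ i) z) {..m}"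
proof (rule inj_onI)
  fix i j assume z: "z \<in> V" "m \<le> dep z" and ij: "i \<in> {..m}" "j \<in> {..m}" "(p ^^ i) z = (p ^^ j) z"
  then have "dep z - i = dep z - j" using dep_pp[OF z(1)] by metis
  then show "i = j" using ij z by simp
qed

text \<open>The path is cut off at the root, after \<open>min L (dep z)\<close> steps, because
  beyond it the vertices repeat and \<open>heavy_chain\<close> demands distinct ones.\<close>

lemma light_chains:
  assumes "\<And>m. m \<le> L \<Longrightarrow> p \<notin> heavy_chain V m k W"
    and z: "z \<in> V" and S: "S \<subseteq> (\<lambda>i. (p ^^ i) z) ` {..L}" "card S \<le> k"
  shows "(\<Sum>u\<in>S. card (ch u)) \<le> W"
proof (rule ccontr)
  assume h: "\<not> (\<Sum>u\<in>S. card (ch u)) \<le> W"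
  define m where "m = min L (dep z)"
  have "(\<lambda>i. (p ^^ i) z) ` {..L} \<subseteq> (\<lambda>i. (p ^^ i) z) ` {..m}"
  proof
    fix x assume "x \<in> (\<lambda>i. (p ^^ i) z) ` {..L}"
    then obtain i where i: "i \<le> L" "x = (p ^^ i) z" by auto
    show "x \<in> (\<lambda>i. (p ^^ i) z) ` {..m}"
    proof (cases "i \<le> dep z")
      case True then show ?thesis using i by (intro image_eqI[of _ _ i]) (auto simp: m_def)
    next
      case False
      then have "x = (p ^^ dep z) z" using pp_ge_dep[OF z, of i] pp_dep[OF z] i by simp
      then show ?thesis using False i by (intro image_eqI[of _ _ "dep z"]) (auto simp: m_def)
    qed
  qed
  then have S': "S \<subseteq> (\<lambda>i. (p ^^ i) z) ` {..m}" using S by blast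
  have "W < (\<Sum>u\<in>S. card (children V p u))" using h by (simp add: ch_eq_children)
  moreover have "inj_on (\<lambda>i. (p ^^ i) z) {..m}" by (rule funpow_inj[OF z]) (simp add: m_def)
  ultimately have "p \<in> heavy_chain V m k W"
    unfolding heavy_chain_def using in_rooted_trees z S' S(2) by blast
  then show False using assms(1)[of m] by (simp add: m_def)
qed

lemma two_paths_parities:
  assumes V: "a \<in> V" "b \<in> V" and d: "N \<le> dep a" "N \<le> dep b"
    and dis: "\<And>i j. i \<le> N \<Longrightarrow> j \<le> N \<Longrightarrow> (p ^^ i) a \<noteq> (p ^^ j) b"
    and \<pi>: "\<And>j. j \<in> J \<Longrightarrow> j \<le> N \<and> \<pi> j \<le> N"
    and par: "\<And>j. j \<in> J \<Longrightarrow> odd (card (ch ((p ^^ j) a))) = odd (card (ch ((p ^^ \<pi> j) b)))"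
  shows "p \<in> equal_parities V (2 * N + 2) (two_paths N) J (\<lambda>j. j) (\<lambda>j. Suc N + \<pi> j)"
proof -
  define \<sigma> where "\<sigma> i = (if i \<le> N then (p ^^ i) a else (p ^^ (i - Suc N)) b)" for i
  have "inj_on \<sigma> {..<2 * N + 2}"
  proof (rule inj_onI)
    fix i j assume ij: "i \<in> {..<2 * N + 2}" "j \<in> {..<2 * N + 2}" "\<sigma> i = \<sigma> j"
    have ia: "i = j" if "i \<le> N" "j \<le> N"
      using funpow_inj[OF V(1) d(1)] ij(3) that by (auto simp: \<sigma>_def inj_on_def)
    have ib: "i - Suc N = j - Suc N" if "\<not> i \<le> N" "\<not> j \<le> N"
    proof -
      have "i - Suc N \<in> {..N}" "j - Suc N \<in> {..N}" using ij by auto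
      then show ?thesis using funpow_inj[OF V(2) d(2)] ij(3) that by (auto simp: \<sigma>_def inj_on_def)
    qed
    have "(i \<le> N) = (j \<le> N)"
    proof (rule ccontr)
      assume "(i \<le> N) \<noteq> (j \<le> N)"
      then consider "i \<le> N" "\<not> j \<le> N" | "\<not> i \<le> N" "j \<le> N" by blast
      then show False
      proof cases
        case 1
        then have "j - Suc N \<le> N" using ij(2) by simp
        then show False using dis[of i "j - Suc N"] ij(3) 1 by (simp add: \<sigma>_def)
      next
        case 2
        then have "i - Suc N \<le> N" using ij(1) by simp
        then show False using dis[of j "i - Suc N"] ij(3) 2 by (simp add: \<sigma>_def)
      qed
    qed
    then show "i = j" using ia ib by (cases "i \<le> N") auto
  qed
  moreover have "\<sigma> ` {..<2 * N + 2} \<subseteq> V" using ppV V by (auto simp: \<sigma>_def)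
  moreover have "p (\<sigma> i) = \<sigma> (Suc i)" if i: "i \<in> two_paths N" for i
  proof (cases "i < N")
    case False
    then have "Suc i - Suc N = Suc (i - Suc N)" "\<not> i \<le> N" using i by (auto simp: two_paths_def)
    then show ?thesis by (simp add: \<sigma>_def)
  qed (simp add: \<sigma>_def)
  moreover have "odd (card (children V p (\<sigma> j))) = odd (card (children V p (\<sigma> (Suc N + \<pi> j))))" if "j \<in> J" for j
    using par[OF that] \<pi>[OF that] by (simp add: \<sigma>_def ch_eq_children)
  ultimately show ?thesis unfolding equal_parities_def using in_rooted_trees by blast
qed

text \<open>If the two paths have no common vertex for \<open>N\<close> steps, the two-path event
  applies. Otherwise they meet at different numbers \<open>i\<close> and \<open>j\<close> of steps;
  from then on one is the other shifted by their difference \<open>\<delta>\<close>, and equal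
  parities become a period \<open>\<delta>\<close> along a single path.\<close>

lemma no_same_if:
  assumes L: "L = 2 * N + 1"
    and n1: "p \<notin> equal_parities V (2 * N + 2) (two_paths N) {..<N} (\<lambda>j. j) (\<lambda>j. Suc N + j)"
    and n2: "\<And>\<delta>. 1 \<le> \<delta> \<Longrightarrow> \<delta> \<le> N \<Longrightarrow> p \<notin> equal_parities V (Suc (N + \<delta>)) {..<N + \<delta>} {t. t \<le> N \<and> even (t div \<delta>)} (\<lambda>t. t) (\<lambda>t. t + \<delta>)"
    and V: "a \<in> V" "b \<in> V" and d: "L \<le> dep a" "L \<le> dep b"
    and ne: "\<And>i. i \<le> L \<Longrightarrow> (p ^^ i) a \<noteq> (p ^^ i) b"
  shows "\<exists>i<L. odd (card (ch ((p ^^ i) a))) \<noteq> odd (card (ch ((p ^^ i) b)))"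
proof (rule ccontr)
  assume "\<not> ?thesis"
  then have eq: "odd (card (ch ((p ^^ i) a))) = odd (card (ch ((p ^^ i) b)))" if "i < L" for i using that by blast
  show False
  proof (cases "\<forall>i\<le>N. \<forall>j\<le>N. (p ^^ i) a \<noteq> (p ^^ j) b")
    case True
    have "p \<in> equal_parities V (2 * N + 2) (two_paths N) {..<N} (\<lambda>j. j) (\<lambda>j. Suc N + j)"
      by (rule two_paths_parities[OF V, where \<pi> = "\<lambda>j. j"]) (use True d L eq in auto)
    then show False using n1 by simp
  next
    case False
    have shift: False if V: "a \<in> V" and d: "L \<le> dep a" and m: "(p ^^ i) a = (p ^^ j) b" "j < i" "i \<le> N"
      and eq: "\<And>i. i < L \<Longrightarrow> odd (card (ch ((p ^^ i) a))) = odd (card (ch ((p ^^ i) b)))" for a b i j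
    proof -
      define \<delta> where "\<delta> = i - j"
      have \<delta>: "1 \<le> \<delta>" "\<delta> \<le> N" "i = \<delta> + j" using m by (auto simp: \<delta>_def)
      define c where "c = (p ^^ j) a"
      have cV: "c \<in> V" using ppV[OF V] by (simp add: c_def)
      have dc: "N + \<delta> \<le> dep c" using dep_pp[OF V, of j] d L m \<delta> by (simp add: c_def)
      have pc: "(p ^^ t) c = (p ^^ (t + j)) a" for t by (simp add: c_def funpow_add)
      have "odd (card (ch ((p ^^ t) c))) = odd (card (ch ((p ^^ (t + \<delta>)) c)))" if "t \<le> N" for t
      proof -
        have "(p ^^ (t + \<delta>)) c = (p ^^ (t + i)) a" unfolding pc using \<delta>(3) by (simp add: add.assoc)
        also have "\<dots> = (p ^^ t) ((p ^^ j) b)" using m(1) by (simp add: funpow_add)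
        also have "\<dots> = (p ^^ (t + j)) b" by (simp add: funpow_add)
        finally have e: "(p ^^ (t + \<delta>)) c = (p ^^ (t + j)) b" .
        have "t + j < L" using that m L by linarith
        then show ?thesis unfolding e unfolding pc by (rule eq)
      qed
      moreover have "inj_on (\<lambda>i. (p ^^ i) c) {..<Suc (N + \<delta>)}"
        using funpow_inj[OF cV dc] by (simp add: lessThan_Suc_atMost)
      moreover have "(\<lambda>i. (p ^^ i) c) ` {..<Suc (N + \<delta>)} \<subseteq> V" using ppV[OF cV] by auto
      ultimately have "p \<in> equal_parities V (Suc (N + \<delta>)) {..<N + \<delta>} {t. t \<le> N \<and> even (t div \<delta>)} (\<lambda>t. t) (\<lambda>t. t + \<delta>)"
        unfolding equal_parities_def using in_rooted_trees
        by (intro CollectI conjI exI[of _ "\<lambda>i. (p ^^ i) c"]) (auto simp: ch_eq_children)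
      then show False using n2[OF \<delta>(1,2)] by simp
    qed
    obtain i j where ij: "i \<le> N" "j \<le> N" "(p ^^ i) a = (p ^^ j) b" using False by blast
    have "i \<noteq> j" using ne[of i] ij L by auto
    then consider "j < i" | "i < j" by linarith
    then show False
    proof cases
      case 1 then show False using shift[OF V(1) d(1) ij(3)] ij eq by blast
    next
      case 2 then show False using shift[OF V(2) d(2) ij(3)[symmetric]] ij eq by blast
    qed
  qed
qed

lemma no_opp_if:
  assumes n: "p \<notin> equal_parities V (2 * N + 2) (two_paths N) {1..<N} (\<lambda>j. j) (\<lambda>j. Suc N + (N - j))"
    and V: "a \<in> V" "b \<in> V" and d: "N \<le> dep a" "N \<le> dep b"
    and dis: "\<And>i j. i \<le> N \<Longrightarrow> j \<le> N \<Longrightarrow> (p ^^ i) a \<noteq> (p ^^ j) b"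
  shows "\<exists>i\<ge>1. i < N \<and> odd (card (ch ((p ^^ i) a))) \<noteq> odd (card (ch ((p ^^ (N - i)) b)))"
proof (rule ccontr)
  assume c: "\<not> ?thesis"
  have "p \<in> equal_parities V (2 * N + 2) (two_paths N) {1..<N} (\<lambda>j. j) (\<lambda>j. Suc N + (N - j))"
    by (rule two_paths_parities[OF V d dis]) (use c in auto)
  then show False using n by simp
qed

end

lemma card_same_direction:
  assumes fin: "finite V" and N: "4 * N + 2 \<le> card V"
  shows "real (card (equal_parities V (2 * N + 2) (two_paths N) {..<N} (\<lambda>j. j) (\<lambda>j. Suc N + j)))
    \<le> real (card V) ^ (card V + 1) * (3/5) ^ N"
proof -
  have "real (card (equal_parities V (2 * N + 2) (two_paths N) {..<N} (\<lambda>j. j) (\<lambda>j. Suc N + j)))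
    \<le> real (card V) ^ (2 * N + 2 + (card V - card (two_paths N) - 1)) * (3/5) ^ card {..<N}"
    by (rule card_equal_parities_le[OF fin]) (use N in \<open>auto simp: inj_on_def card_two_paths, auto simp: two_paths_def\<close>)
  also have "2 * N + 2 + (card V - card (two_paths N) - 1) = card V + 1" using N by (simp add: card_two_paths)
  finally show ?thesis by simp
qed

lemma card_opposite_direction:
  assumes fin: "finite V" and N: "4 * N + 2 \<le> card V"
  shows "real (card (equal_parities V (2 * N + 2) (two_paths N) {1..<N} (\<lambda>j. j) (\<lambda>j. Suc N + (N - j))))
    \<le> real (card V) ^ (card V + 1) * (3/5) ^ (N - 1)"
proof -
  have "real (card (equal_parities V (2 * N + 2) (two_paths N) {1..<N} (\<lambda>j. j) (\<lambda>j. Suc N + (N - j))))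
    \<le> real (card V) ^ (2 * N + 2 + (card V - card (two_paths N) - 1)) * (3/5) ^ card {1..<N}"
    by (rule card_equal_parities_le[OF fin]) (use N in \<open>auto simp: inj_on_def card_two_paths, auto simp: two_paths_def\<close>)
  also have "2 * N + 2 + (card V - card (two_paths N) - 1) = card V + 1" using N by (simp add: card_two_paths)
  finally show ?thesis by simp
qed

lemma card_periodic:
  assumes fin: "finite V" and N: "4 * N + 4 \<le> card V" and \<delta>: "1 \<le> \<delta>" "\<delta> \<le> N"
  shows "real (card (equal_parities V (Suc (N + \<delta>)) {..<N + \<delta>} {t. t \<le> N \<and> even (t div \<delta>)} (\<lambda>t. t) (\<lambda>t. t + \<delta>)))
    \<le> real (card V) ^ card V * (3/5) ^ (N div 2)"
proof -
  let ?J = "{t. t \<le> N \<and> even (t div \<delta>)}"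
  have cJ: "card ?J \<le> card {..N}" by (rule card_mono) auto
  have "real (card (equal_parities V (Suc (N + \<delta>)) {..<N + \<delta>} ?J (\<lambda>t. t) (\<lambda>t. t + \<delta>)))
    \<le> real (card V) ^ (Suc (N + \<delta>) + (card V - card {..<N + \<delta>} - 1)) * (3/5) ^ card ?J"
  proof (rule card_equal_parities_le[OF fin])
    show "(\<lambda>t. t) ` ?J \<inter> (\<lambda>t. t + \<delta>) ` ?J = {}" using \<delta> by auto
  qed (use N \<delta> cJ in \<open>auto simp: inj_on_def\<close>)
  also have "Suc (N + \<delta>) + (card V - card {..<N + \<delta>} - 1) = card V" using N \<delta> by simp
  also have "(3/5 :: real) ^ card ?J \<le> (3/5) ^ (N div 2)"
    using card_even_blocks[OF \<delta>(1), of N] by (intro power_decreasing) auto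
  finally show ?thesis by (simp add: mult_left_mono)
qed

section \<open>Shallow subtrees are small\<close>

text \<open>The power of \<open>card B\<close> counts the ways in which the next level
  \<open>C\<close> can choose parents in \<open>B\<close>; \<open>t\<close> is the price of each
  prescribed arc.\<close>

fun level_weight :: "real \<Rightarrow> 'a set \<Rightarrow> 'a set list \<Rightarrow> real" where
  "level_weight t B [] = 1"
| "level_weight t B (C # Cs) = (real (card B) * t) ^ card C * level_weight t C Cs"

text \<open>The iterated exponentials of the generating function of trees of bounded height.\<close>

primrec iterexp :: "real \<Rightarrow> nat \<Rightarrow> real" where
  "iterexp x 0 = 1"
| "iterexp x (Suc h) = exp (x / exp 1 * iterexp x h)"

lemma iterexp_nonneg: "0 \<le> iterexp x h"
  by (cases h) auto

lemma level_weight_nonneg: "0 \<le> t \<Longrightarrow> 0 \<le> level_weight t B Cs"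
  by (induction Cs arbitrary: B) auto

text \<open>The levels may be arbitrary and even overlapping subsets, which only enlarges the sum.
  Summing over the first level is then a binomial expansion, bounded by an exponential.\<close>

lemma sum_level_weight:
  assumes fin: "finite V" and x: "0 \<le> x" and t: "t = x / (exp 1 * real (card V))" and n: "0 < card V"
  shows "(\<Sum>Cs\<in>{Cs. set Cs \<subseteq> Pow V \<and> length Cs = h}. level_weight t B Cs) \<le> iterexp x h ^ card B"
proof (induction h arbitrary: B)
  case 0
  have "{Cs. set Cs \<subseteq> Pow V \<and> length Cs = 0} = {[]}" by auto
  then show ?case by simp
next
  case (Suc h)
  let ?Ls = "{Cs. set Cs \<subseteq> Pow V \<and> length Cs = h}"
  let ?n = "real (card V)" and ?b = "real (card B)"
  have t0: "0 \<le> t" using x t by simp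
  have "(\<Sum>Cs\<in>{Cs. set Cs \<subseteq> Pow V \<and> length Cs = Suc h}. level_weight t B Cs) =
      (\<Sum>(C, Cs)\<in>Pow V \<times> ?Ls. level_weight t B (C # Cs))"
  proof (rule sum.reindex_bij_witness[where i = "\<lambda>(C, Cs). C # Cs" and j = "\<lambda>Cs. (hd Cs, tl Cs)"])
    fix Cs assume "Cs \<in> {Cs. set Cs \<subseteq> Pow V \<and> length Cs = Suc h}"
    then show "(case (hd Cs, tl Cs) of (C, Cs) \<Rightarrow> C # Cs) = Cs" "(hd Cs, tl Cs) \<in> Pow V \<times> ?Ls"
      "(case (hd Cs, tl Cs) of (C, Cs) \<Rightarrow> level_weight t B (C # Cs)) = level_weight t B Cs"
      by (cases Cs; auto)+
  qed auto
  also have "\<dots> = (\<Sum>C\<in>Pow V. \<Sum>Cs\<in>?Ls. (?b * t) ^ card C * level_weight t C Cs)"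
    by (simp add: sum.cartesian_product)
  also have "\<dots> = (\<Sum>C\<in>Pow V. (?b * t) ^ card C * (\<Sum>Cs\<in>?Ls. level_weight t C Cs))"
    by (simp add: sum_distrib_left)
  also have "\<dots> \<le> (\<Sum>C\<in>Pow V. (?b * t) ^ card C * iterexp x h ^ card C)"
    using t0 by (intro sum_mono mult_left_mono Suc.IH) auto
  also have "\<dots> = (\<Sum>C\<in>Pow V. (?b * t * iterexp x h) ^ card C)" by (simp add: power_mult_distrib)
  also have "\<dots> = (1 + ?b * t * iterexp x h) ^ card V" by (rule sum_power_card_Pow[OF fin])
  also have "\<dots> \<le> exp (?b * t * iterexp x h) ^ card V"
    using t0 iterexp_nonneg[of x h] by (intro power_mono) (auto simp: exp_ge_add_one_self)
  also have "\<dots> = exp (?n * (?b * t * iterexp x h))" by (rule exp_of_nat_mult[symmetric])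
  also have "?n * (?b * t * iterexp x h) = ?b * (x / exp 1 * iterexp x h)"
    using n by (simp add: t field_simps)
  also have "exp (?b * (x / exp 1 * iterexp x h)) = iterexp x (Suc h) ^ card B"
    unfolding iterexp.simps by (rule exp_of_nat_mult)
  finally show ?case .
qed

text \<open>At \<open>x = 1\<close> the map \<open>z \<mapsto> exp (z / exp 1)\<close> touches the
  diagonal at its fixpoint \<open>exp 1\<close>. For \<open>x = 1 + \<delta>\<close> the iterates
  escape, but slowly: written as \<open>exp (1 + g)\<close>, a value gains at most
  \<open>4 * \<delta>\<close> in \<open>g\<close> per round as long as
  \<open>g ^ 2 \<le> 2 * \<delta>\<close>. This is where \<open>\<delta>\<close> of order
  \<open>1 / L ^ 2\<close> is required.\<close>

lemma iterexp_le:
  assumes \<delta>: "0 \<le> \<delta>" "8 * \<delta> * real L ^ 2 \<le> 1" and L: "1 \<le> L"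
  shows "h \<le> L \<Longrightarrow> iterexp (1 + \<delta>) h \<le> exp (1 + 4 * \<delta> * real h)"
proof (induction h)
  case (Suc h)
  define g where "g = 4 * \<delta> * real h"
  have hL: "real h \<le> real L" using Suc.prems by simp
  have g0: "0 \<le> g" using \<delta> by (simp add: g_def)
  have "8 * \<delta> * real h ^ 2 \<le> 8 * \<delta> * real L ^ 2" using \<delta> hL by (intro mult_left_mono power_mono) auto
  then have hh: "8 * \<delta> * real h ^ 2 \<le> 1" using \<delta> by simp
  have "g ^ 2 = 2 * \<delta> * (8 * \<delta> * real h ^ 2)" by (simp add: g_def power2_eq_square)
  also have "\<dots> \<le> 2 * \<delta> * 1" using \<delta> hh by (intro mult_left_mono) auto
  finally have g2: "g ^ 2 \<le> 2 * \<delta>" by simp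
  have "8 * \<delta> * 1 \<le> 8 * \<delta> * real L ^ 2" using \<delta> L by (intro mult_left_mono) auto
  then have \<delta>8: "\<delta> \<le> 1/8" using \<delta> by simp
  then have "g ^ 2 \<le> (1/2) ^ 2" using g2 by (simp add: power2_eq_square)
  then have g12: "g \<le> 1/2" by (rule power2_le_imp_le) simp
  have "(1 + \<delta>) / exp 1 * iterexp (1 + \<delta>) h \<le> (1 + \<delta>) / exp 1 * exp (1 + g)"
    using Suc \<delta> by (intro mult_left_mono) (auto simp: g_def)
  also have "\<dots> = (1 + \<delta>) * exp g" by (simp add: exp_add)
  also have "\<dots> \<le> (1 + \<delta>) * (1 + g + g ^ 2)" using g0 g12 \<delta> by (intro mult_left_mono exp_bound) auto
  also have "\<dots> = 1 + g + g ^ 2 + \<delta> * (1 + g + g ^ 2)" by (simp add: algebra_simps)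
  also have "\<dots> \<le> 1 + g + 2 * \<delta> + \<delta> * 2"
    using g2 g12 \<delta>8 \<delta> by (intro add_mono mult_left_mono) auto
  also have "\<dots> = 1 + 4 * \<delta> * real (Suc h)" by (simp add: g_def algebra_simps)
  finally show ?case by simp
qed simp

definition subtree :: "'a set \<Rightarrow> ('a \<Rightarrow> 'a) \<Rightarrow> 'a \<Rightarrow> 'a set" where
  "subtree V p y = {w \<in> V. \<exists>k. (p ^^ k) w = y}"

definition level :: "'a set \<Rightarrow> ('a \<Rightarrow> 'a) \<Rightarrow> 'a \<Rightarrow> nat \<Rightarrow> 'a set" where
  "level V p y i = {w \<in> V. (p ^^ i) w = y}"

definition levels :: "'a set \<Rightarrow> ('a \<Rightarrow> 'a) \<Rightarrow> nat \<Rightarrow> 'a \<Rightarrow> 'a set list" where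
  "levels V p L y = map (\<lambda>i. level V p y (Suc i)) [0..<L]"

lemma level_weight_levels:
  "level_weight t (S 0) (map (\<lambda>i. S (Suc i)) [0..<h]) = (\<Prod>i<h. (real (card (S i)) * t) ^ card (S (Suc i)))"
proof (induction h arbitrary: S)
  case (Suc h)
  have "map (\<lambda>i. S (Suc i)) [0..<Suc h] = S 1 # map (\<lambda>i. S (Suc (Suc i))) [0..<h]"
    by (rule nth_equalityI) (auto simp: nth_Cons simp del: upt_Suc split: nat.split)
  then have "level_weight t (S 0) (map (\<lambda>i. S (Suc i)) [0..<Suc h]) =
      (real (card (S 0)) * t) ^ card (S 1) * level_weight t (S 1) (map (\<lambda>i. S (Suc (Suc i))) [0..<h])"
    by (simp only: level_weight.simps)
  also have "level_weight t (S 1) (map (\<lambda>i. S (Suc (Suc i))) [0..<h]) =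
      (\<Prod>i<h. (real (card (S (Suc i))) * t) ^ card (S (Suc (Suc i))))"
    using Suc.IH[of "\<lambda>i. S (Suc i)"] by simp
  also have "(real (card (S 0)) * t) ^ card (S 1) * \<dots> = (\<Prod>i<Suc h. (real (card (S i)) * t) ^ card (S (Suc i)))"
    by (simp only: prod.lessThan_Suc_shift One_nat_def)
  finally show ?case .
qed simp

text \<open>The upper limit \<open>s1\<close> controls the error factor
  \<open>exp (s1 ^ 2 / n)\<close> in the count.\<close>

definition shallow :: "'a set \<Rightarrow> nat \<Rightarrow> nat \<Rightarrow> nat \<Rightarrow> 'a \<Rightarrow> ('a \<Rightarrow> 'a) set" where
  "shallow V L s0 s1 y = {p \<in> rooted_trees V. y \<notin> (p ^^ L) ` V \<and> s0 < card (subtree V p y) \<and> card (subtree V p y) \<le> s1}"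

context rooted_tree
begin

lemma subtree_eq_sub: "subtree V p y = sub y"
  by (simp add: subtree_def sub_def)

lemma subtree_levels:
  assumes y: "y \<in> V" "y \<notin> (p ^^ L) ` V"
  shows "y \<noteq> r" "level V p y i \<inter> level V p y j \<noteq> {} \<Longrightarrow> i = j" "subtree V p y = (\<Union>i<L. level V p y i)"
    "level V p y L = {}"
proof -
  show yr: "y \<noteq> r" using y(2) rV ppr by (metis imageI)
  have lv: "dep w = dep y + i" if "w \<in> level V p y i" for w i
  proof -
    have "i \<le> dep w" using that yr pp_eq_r_iff[of w i] by (auto simp: level_def)
    then show ?thesis using that dep_pp[of w i] by (auto simp: level_def)
  qed
  show "i = j" if ne: "level V p y i \<inter> level V p y j \<noteq> {}"
  proof -
    obtain w where "w \<in> level V p y i" "w \<in> level V p y j" using ne by blast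
    then have "dep y + i = dep y + j" using lv by metis
    then show ?thesis by simp
  qed
  show e: "level V p y L = {}" using y(2) by (auto simp: level_def)
  show "subtree V p y = (\<Union>i<L. level V p y i)"
  proof (intro set_eqI iffI)
    fix w assume "w \<in> subtree V p y"
    then obtain k where k: "w \<in> V" "(p ^^ k) w = y" by (auto simp: subtree_def)
    have "k < L"
    proof (rule ccontr)
      assume "\<not> k < L"
      then have "(p ^^ L) ((p ^^ (k - L)) w) = y"
        using k(2) by (metis comp_apply funpow_add le_add_diff_inverse not_less)
      then show False using y(2) ppV[OF k(1)] by blast
    qed
    then show "w \<in> (\<Union>i<L. level V p y i)" using k by (auto simp: level_def)
  qed (auto simp: subtree_def level_def)
qed

end

lemma power_diff_le_exp:
  assumes "s \<le> n" "0 < n"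
  shows "real (n - s) ^ (n - s) \<le> real n ^ (n - s) * exp (real s ^ 2 / real n - real s)"
proof -
  have "real (n - s) ^ (n - s) = real n ^ (n - s) * (1 - real s / real n) ^ (n - s)"
    using assms by (simp add: power_mult_distrib[symmetric] field_simps of_nat_diff)
  also have "(1 - real s / real n) ^ (n - s) \<le> exp (- (real s / real n)) ^ (n - s)"
    using assms exp_ge_add_one_self[of "- (real s / real n)"] by (intro power_mono) auto
  also have "\<dots> = exp (real (n - s) * (- (real s / real n)))" by (rule exp_of_nat_mult[symmetric])
  also have "real (n - s) * (- (real s / real n)) = real s ^ 2 / real n - real s"
    using assms by (simp add: of_nat_diff field_simps power2_eq_square)
  finally show ?thesis by (simp add: mult_left_mono)
qed

text \<open>With the levels fixed, a parent map on the \<open>s - 1\<close> lower vertices of the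
  subtree takes each parent from the level above. No other vertex may be attached to the subtree, so
  it gets weight 0, and at most \<open>(n - s) ^ (n - s)\<close> extensions remain. The resulting
  factors \<open>1 / (exp 1 * n)\<close> per arc enter \<open>t\<close>; the factor
  \<open>(1 + \<delta>) ^ (s - 1) / (1 + \<delta>) ^ s0 \<ge> 1\<close> is an exponential Markov
  inequality for the size.\<close>

lemma card_fibre_levels:
  assumes fin: "finite V" and y: "y \<in> V" and p0: "p0 \<in> shallow V L s0 s1 y" and \<delta>: "0 \<le> \<delta>"
    and t: "t = (1 + \<delta>) / (exp 1 * real (card V))"
  shows "real (card {p \<in> shallow V L s0 s1 y. levels V p L y = levels V p0 L y}) \<le>
    real (card V) ^ (card V - 1) * exp (real s1 ^ 2 / real (card V)) / (1 + \<delta>) ^ s0 * level_weight t {y} (levels V p0 L y)"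
proof -
  let ?n = "card V"
  have V: "V \<noteq> {}" and n: "0 < ?n" using y fin by (auto simp: card_gt_0_iff)
  define S where "S = level V p0 y"
  define X where "X = subtree V p0 y"
  let ?A = "X - {y}"
  obtain r0 where "rooted V p0 r0" using p0 by (auto simp: shallow_def rooted_trees_def)
  then interpret P0: rooted_tree V p0 r0 using fin by unfold_locales
  have y0: "y \<notin> (p0 ^^ L) ` V" using p0 by (simp add: shallow_def)
  note SX = P0.subtree_levels[OF y y0]
  have XV: "X \<subseteq> V" by (auto simp: X_def subtree_def)
  have finX: "finite X" using XV fin finite_subset by blast
  have yX: "y \<in> X" using y by (auto simp: X_def subtree_def intro: exI[of _ 0])
  define s where "s = card X"
  have s: "s0 < s" "s \<le> s1" "s \<le> ?n" using p0 card_mono[OF fin XV] by (auto simp: shallow_def s_def X_def)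
  have S0: "S 0 = {y}" using y by (auto simp: S_def level_def)
  have finS: "finite (S i)" for i using fin by (simp add: S_def level_def)
  have dis: "i = j" if "v \<in> S i" "v \<in> S j" for v i j using SX(2)[of i j] that by (auto simp: S_def)
  have XS: "X = (\<Union>i<L. S i)" using SX(3) by (simp add: X_def S_def)
  have SL: "S L = {}" using SX(4) by (simp add: S_def)
  have SX': "S i \<subseteq> X" for i by (auto simp: S_def X_def level_def subtree_def)
  define lev where "lev v = (THE i. v \<in> S i)" for v
  have lev: "lev v = i" if "v \<in> S i" for v i unfolding lev_def using that dis by blast
  have AS: "?A = (\<Union>i<L. S (Suc i))"
  proof (intro set_eqI iffI)
    fix v assume v: "v \<in> ?A"
    then obtain i where i: "i < L" "v \<in> S i" using XS by auto
    have "i \<noteq> 0" using i(2) S0 v by (intro notI) auto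
    then show "v \<in> (\<Union>i<L. S (Suc i))" using i by (intro UN_I[of "i - 1"]) auto
  next
    fix v assume "v \<in> (\<Union>i<L. S (Suc i))"
    then obtain i where i: "v \<in> S (Suc i)" by auto
    then have "v \<noteq> y" using dis[of v "Suc i" 0] S0 by auto
    then show "v \<in> ?A" using i SX' by auto
  qed
  let ?Q = "Pi\<^sub>E ?A (\<lambda>v. S (lev v - 1))"
  define e where "e q v = (if v \<in> ?A then q v else v)" for q :: "'a \<Rightarrow> 'a" and v
  define F where "F q = {p \<in> extensions V ?A (e q). \<forall>v\<in>X. extra V ?A p v = 0}" for q
  have cov: "{p \<in> shallow V L s0 s1 y. levels V p L y = levels V p0 L y} \<subseteq> (\<Union>q\<in>?Q. F q)"
  proof
    fix p assume "p \<in> {p \<in> shallow V L s0 s1 y. levels V p L y = levels V p0 L y}"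
    then have p: "p \<in> shallow V L s0 s1 y" and leq: "levels V p L y = levels V p0 L y" by auto
    obtain r where "rooted V p r" using p by (auto simp: shallow_def rooted_trees_def)
    then interpret P: rooted_tree V p r using fin by unfold_locales
    have yp: "y \<notin> (p ^^ L) ` V" using p by (simp add: shallow_def)
    note SP = P.subtree_levels[OF y yp]
    have lS: "level V p y i = S i" if "i \<le> L" for i
    proof (cases i)
      case 0
      then show ?thesis using S0 y by (auto simp: level_def)
    next
      case (Suc j)
      then have "j < L" using that by simp
      then have "levels V p L y ! j = level V p y i" "levels V p0 L y ! j = S i"
        using Suc by (auto simp: levels_def S_def)
      then show ?thesis using leq by simp
    qed
    have Xp: "subtree V p y = X" unfolding SP(3) XS using lS by (intro SUP_cong) auto
    define q where "q = restrict p ?A"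
    have "q v \<in> S (lev v - 1)" if v: "v \<in> ?A" for v
    proof -
      obtain i where i: "i < L" "v \<in> S (Suc i)" using v AS by auto
      then have "v \<in> level V p y (Suc i)" using lS by simp
      then have "p v \<in> level V p y i" using P.pV by (auto simp: level_def funpow_swap1)
      then have "p v \<in> S i" using lS i by simp
      then show ?thesis using lev[OF i(2)] v by (simp add: q_def)
    qed
    then have "q \<in> ?Q" by (auto simp: q_def)
    moreover have "p \<in> extensions V ?A (e q)"
      using P.in_rooted_trees by (auto simp: extensions_def e_def q_def)
    moreover have "extra V ?A p v = 0" if v: "v \<in> X" for v
    proof -
      have vs: "v \<in> P.sub y" using v Xp P.subtree_eq_sub by simp
      have "w \<notin> V - ?A \<or> p w = w \<or> p w \<noteq> v" for w
      proof (rule ccontr)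
        assume "\<not> (w \<notin> V - ?A \<or> p w = w \<or> p w \<noteq> v)"
        then have w: "w \<in> V" "w \<notin> ?A" "p w = v" by auto
        obtain k where "(p ^^ k) v = y" using vs by (auto simp: P.sub_def)
        then have "(p ^^ Suc k) w = y" using w(3) by (simp add: funpow_swap1)
        then have "w \<in> X" using w(1) Xp unfolding subtree_def by blast
        then have wy: "w = y" using w(2) by simp
        have "P.dep v = P.dep y - 1" using P.dep_p[OF y] w(3) wy by simp
        moreover have "P.dep y \<le> P.dep v" using P.sub_level[OF vs SP(1)] by auto
        ultimately have "P.dep y = 0" by simp
        then show False using P.dep_eq_0[OF y] SP(1) by simp
      qed
      then have "{w \<in> V - ?A. p w \<noteq> w \<and> p w = v} = {}" by blast
      then show ?thesis unfolding extra_def by (simp only: card.empty)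
    qed
    ultimately have "p \<in> F q" unfolding F_def by blast
    then show "p \<in> (\<Union>q\<in>?Q. F q)" using \<open>q \<in> ?Q\<close> by blast
  qed
  have finF: "finite (F q)" for q using finite_extensions[OF fin] by (simp add: F_def)
  have cA: "card ?A = s - 1" using yX finX by (simp add: s_def card_Diff_singleton)
  have cF: "real (card (F q)) \<le> real (?n - s) ^ (?n - s)" if q: "q \<in> ?Q" for q
  proof -
    have q1: "q v \<in> S i" if "v \<in> S (Suc i)" "i < L" for v i
    proof -
      have "v \<in> ?A" using that AS by auto
      then have "q v \<in> S (lev v - 1)" using q by (rule PiE_mem[rotated])
      then show ?thesis using lev[OF that(1)] by simp
    qed
    have fo: "forest_on V ?A (e q)"
    proof (rule forest_on_rank[where rank = lev])
      show "?A \<subseteq> V" using XV by auto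
      fix v
      show "v \<notin> ?A \<Longrightarrow> e q v = v" by (simp only: e_def if_False)
      assume v: "v \<in> ?A"
      then obtain i where i: "i < L" "v \<in> S (Suc i)" using AS by auto
      have qv: "q v \<in> S i" by (rule q1[OF i(2,1)])
      then show "e q v \<in> V" using SX' XV v by (auto simp: e_def)
      show "lev (e q v) < lev v" using lev[OF i(2)] lev[OF qv] v by (simp add: e_def)
    qed
    let ?x = "\<lambda>v. if v \<in> X then 0 else 1 :: real"
    have one: "(\<Prod>v\<in>V. ?x v ^ extra V ?A p v) = 1" if "p \<in> F q" for p
      using that by (intro prod.neutral) (auto simp: F_def)
    have "real (card (F q)) = (\<Sum>p\<in>F q. \<Prod>v\<in>V. ?x v ^ extra V ?A p v)"
      using one by simp
    also have "\<dots> \<le> (\<Sum>p\<in>extensions V ?A (e q). \<Prod>v\<in>V. ?x v ^ extra V ?A p v)"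
      by (rule sum_mono2[OF finite_extensions[OF fin]]) (auto simp: F_def intro!: prod_nonneg)
    also have "\<dots> = (\<Sum>v\<in>V. ?x v) ^ (?n - card ?A - 1)" by (rule sum_extensions_extra[OF fin fo V])
    also have "(\<Sum>v\<in>V. ?x v) = real (?n - s)"
      unfolding sum_indicator_weight[OF fin XV] using s by (simp add: s_def of_nat_diff)
    also have "?n - card ?A - 1 = ?n - s" using cA s by simp
    finally show ?thesis .
  qed
  have finA: "finite ?A" using finX by simp
  have "finite ?Q" using finA finS by (intro finite_PiE) auto
  from card_UN_le_sum[OF this cov finF cF]
  have 1: "real (card {p \<in> shallow V L s0 s1 y. levels V p L y = levels V p0 L y}) \<le> real (card ?Q) * real (?n - s) ^ (?n - s)" .
  have cQ: "card ?Q = (\<Prod>i<L. card (S i) ^ card (S (Suc i)))"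
  proof -
    have "card ?Q = (\<Prod>v\<in>?A. card (S (lev v - 1)))" by (rule card_PiE[OF finA])
    also have "\<dots> = (\<Prod>i<L. \<Prod>v\<in>S (Suc i). card (S (lev v - 1)))"
      unfolding AS by (rule prod.UNION_disjoint) (use finS dis in blast)+
    also have "\<dots> = (\<Prod>i<L. \<Prod>v\<in>S (Suc i). card (S i))"
      using lev by (intro prod.cong refl) simp
    finally show ?thesis by simp
  qed
  have cS: "(\<Sum>i<L. card (S (Suc i))) = s - 1"
    unfolding cA[symmetric] AS by (rule card_UN_disjoint[symmetric]) (use finS dis in blast)+
  have "level_weight t {y} (levels V p0 L y) = (\<Prod>i<L. (real (card (S i)) * t) ^ card (S (Suc i)))"
    using level_weight_levels[of t S L] S0 by (simp add: levels_def S_def)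
  also have "\<dots> = (\<Prod>i<L. real (card (S i)) ^ card (S (Suc i))) * (\<Prod>i<L. t ^ card (S (Suc i)))"
    by (simp add: power_mult_distrib prod.distrib)
  also have "(\<Prod>i<L. t ^ card (S (Suc i))) = t ^ (s - 1)" by (simp add: power_sum[symmetric] cS)
  also have "(\<Prod>i<L. real (card (S i)) ^ card (S (Suc i))) = real (card ?Q)" unfolding cQ by simp
  finally have lw: "level_weight t {y} (levels V p0 L y) = real (card ?Q) * t ^ (s - 1)" .
  have key: "real (?n - s) ^ (?n - s) \<le> real ?n ^ (?n - 1) * exp (real s1 ^ 2 / real ?n) / (1 + \<delta>) ^ s0 * t ^ (s - 1)"
  proof -
    have "real (?n - s) ^ (?n - s) \<le> real ?n ^ (?n - s) * exp (real s ^ 2 / real ?n - real s)"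
      by (rule power_diff_le_exp[OF s(3) n])
    also have "\<dots> \<le> real ?n ^ (?n - s) * (exp (real s1 ^ 2 / real ?n) * exp (- real (s - 1)))"
    proof -
      have "real s ^ 2 \<le> real s1 ^ 2" using s by (intro power_mono) auto
      then have "real s ^ 2 / real ?n \<le> real s1 ^ 2 / real ?n" using n by (intro divide_right_mono) auto
      then show ?thesis unfolding exp_add[symmetric] using s by (intro mult_left_mono) auto
    qed
    also have "\<dots> \<le> real ?n ^ (?n - s) * (exp (real s1 ^ 2 / real ?n) * exp (- real (s - 1))) * ((1 + \<delta>) ^ (s - 1) / (1 + \<delta>) ^ s0)"
    proof -
      have "(1 + \<delta>) ^ s0 \<le> (1 + \<delta>) ^ (s - 1)" using \<delta> s by (intro power_increasing) auto
      then have "1 \<le> (1 + \<delta>) ^ (s - 1) / (1 + \<delta>) ^ s0" using \<delta> by simp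
      from mult_left_mono[OF this, of "real ?n ^ (?n - s) * (exp (real s1 ^ 2 / real ?n) * exp (- real (s - 1)))"]
      show ?thesis by simp
    qed
    also have "\<dots> = real ?n ^ (?n - 1) * exp (real s1 ^ 2 / real ?n) / (1 + \<delta>) ^ s0 * t ^ (s - 1)"
    proof -
      have a: "real ?n ^ (?n - 1) = real ?n ^ (?n - s) * real ?n ^ (s - 1)"
        using s by (simp add: power_add[symmetric])
      have b: "exp (- real (s - 1)) = 1 / exp 1 ^ (s - 1)"
        using exp_of_nat_mult[of "s - 1" "1 :: real"] by (simp add: exp_minus divide_inverse)
      have "t ^ (s - 1) = (1 + \<delta>) ^ (s - 1) / (exp 1 ^ (s - 1) * real ?n ^ (s - 1))"
        by (simp add: t power_divide power_mult_distrib)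
      then show ?thesis unfolding a b using n by (simp add: mult_ac)
    qed
    finally show ?thesis .
  qed
  have "real (card ?Q) * real (?n - s) ^ (?n - s) \<le>
     real (card ?Q) * (real ?n ^ (?n - 1) * exp (real s1 ^ 2 / real ?n) / (1 + \<delta>) ^ s0 * t ^ (s - 1))"
    using key by (intro mult_left_mono) auto
  then show ?thesis using 1 unfolding lw by (simp add: mult_ac)
qed

text \<open>The fibre bounds are summed over all sequences of levels; the sum is an iterated
  exponential starting from one vertex, and \<open>4 * \<delta> * L \<le> 1\<close> keeps it below
  \<open>exp 2\<close>.\<close>

theorem card_shallow:
  assumes fin: "finite V" and y: "y \<in> V" and \<delta>: "0 \<le> \<delta>" "8 * \<delta> * real L ^ 2 \<le> 1" and L: "1 \<le> L"
  shows "real (card (shallow V L s0 s1 y)) \<le>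
    real (card V) ^ (card V - 1) * exp (real s1 ^ 2 / real (card V)) / (1 + \<delta>) ^ s0 * exp 2"
proof -
  let ?n = "card V"
  have n: "0 < ?n" using y fin by (auto simp: card_gt_0_iff)
  define t where "t = (1 + \<delta>) / (exp 1 * real ?n)"
  define c where "c = real ?n ^ (?n - 1) * exp (real s1 ^ 2 / real ?n) / (1 + \<delta>) ^ s0"
  have c0: "0 \<le> c" using \<delta> by (simp add: c_def)
  have t0: "0 \<le> t" using \<delta> by (simp add: t_def)
  let ?B = "shallow V L s0 s1 y" and ?Ls = "{Cs. set Cs \<subseteq> Pow V \<and> length Cs = L}"
  have finB: "finite ?B" using finite_rooted_trees[OF fin] by (simp add: shallow_def)
  have finL: "finite ?Ls" using fin by (intro finite_lists_length_eq) simp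
  have "(\<lambda>p. levels V p L y) ` ?B \<subseteq> ?Ls" by (auto simp: levels_def level_def)
  from sum.group[OF finB finL this, of "\<lambda>_. 1::nat"]
  have "card ?B = (\<Sum>Cs\<in>?Ls. card {p \<in> ?B. levels V p L y = Cs})" by simp
  then have "real (card ?B) = (\<Sum>Cs\<in>?Ls. real (card {p \<in> ?B. levels V p L y = Cs}))" by simp
  also have "\<dots> \<le> (\<Sum>Cs\<in>?Ls. c * level_weight t {y} Cs)"
  proof (rule sum_mono)
    fix Cs
    show "real (card {p \<in> ?B. levels V p L y = Cs}) \<le> c * level_weight t {y} Cs"
    proof (cases "{p \<in> ?B. levels V p L y = Cs} = {}")
      case True
      then show ?thesis unfolding True using mult_nonneg_nonneg[OF c0 level_weight_nonneg[OF t0]] by simp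
    next
      case False
      then obtain p0 where p0: "p0 \<in> ?B" "levels V p0 L y = Cs" by blast
      from card_fibre_levels[OF fin y p0(1) \<delta>(1) t_def] show ?thesis unfolding p0(2) c_def .
    qed
  qed
  also have "\<dots> = c * (\<Sum>Cs\<in>?Ls. level_weight t {y} Cs)" by (simp add: sum_distrib_left)
  also have "\<dots> \<le> c * iterexp (1 + \<delta>) L ^ card {y}"
    using sum_level_weight[OF fin _ t_def n, where h = L and B = "{y}"] \<delta> c0 by (intro mult_left_mono) auto
  also have "\<dots> \<le> c * exp 2"
  proof (rule mult_left_mono[OF _ c0])
    have "8 * \<delta> * real L \<le> 8 * \<delta> * real L ^ 2"
      using \<delta> L by (intro mult_left_mono self_le_power) auto
    then have "1 + 4 * \<delta> * real L \<le> 2" using \<delta>(2) by simp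
    then have "exp (1 + 4 * \<delta> * real L) \<le> exp 2" by (simp only: exp_le_cancel_iff)
    from order_trans[OF iterexp_le[OF \<delta> L order_refl] this]
    show "iterexp (1 + \<delta>) L ^ card {y} \<le> exp 2" by simp
  qed
  finally show ?thesis by (simp add: c_def)
qed

text \<open>Sizes cannot jump over the excluded window. By induction the at most \<open>W\<close>
  subtrees below \<open>v\<close> have size at most \<open>s0\<close>, so that of \<open>v\<close>
  is at most \<open>Suc (W * s0)\<close>, and values between \<open>s0\<close> and this bound do not
  occur.\<close>

lemma (in rooted_tree) small_if_not_shallow:
  assumes ns: "\<And>y. y \<in> V \<Longrightarrow> p \<notin> shallow V L s0 (Suc (W * s0)) y"
    and W: "\<And>v. v \<in> V \<Longrightarrow> card (ch v) \<le> W" and v: "v \<in> V" "v \<notin> (p ^^ L) ` V"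
  shows "card (sub v) \<le> s0"
  using v
proof (induction "card (sub v)" arbitrary: v rule: less_induct)
  case less
  have "card (sub w) \<le> s0" if w: "w \<in> ch v" for w
  proof (rule less.hyps)
    have "card (sub w) \<le> (\<Sum>w\<in>ch v. card (sub w))" using w by (intro member_le_sum) auto
    then show "card (sub w) < card (sub v)" using card_sub[OF less.prems(1)] by simp
    show "w \<in> V" by (rule ch_V[OF w])
    show "w \<notin> (p ^^ L) ` V"
    proof
      assume "w \<in> (p ^^ L) ` V"
      then obtain z where z: "z \<in> V" "w = (p ^^ L) z" by blast
      then have "v = (p ^^ L) (p z)" using ch_p[OF w] by (simp add: funpow_swap1)
      then show False using less.prems(2) pV[OF z(1)] by blast
    qed
  qed
  then have "(\<Sum>w\<in>ch v. card (sub w)) \<le> (\<Sum>w\<in>ch v. s0)" by (rule sum_mono)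
  also have "\<dots> \<le> W * s0" using W[OF less.prems(1)] by simp
  finally have "card (sub v) \<le> Suc (W * s0)" using card_sub[OF less.prems(1)] by simp
  then show ?case using ns[OF less.prems(1)] less.prems(2) in_rooted_trees
    by (simp add: shallow_def subtree_eq_sub)
qed

section \<open>Vertices with many leaf children\<close>

definition star :: "'a set \<Rightarrow> ('a \<Rightarrow> 'a) \<Rightarrow> 'a \<Rightarrow> 'a set \<Rightarrow> bool" where
  "star V p v S \<longleftrightarrow> (\<forall>s\<in>S. p s = v \<and> s \<noteq> v \<and> children V p s = {})"

text \<open>With weight 0 on \<open>S\<close> and \<open>0 ^ 0 = 1\<close>, the counting formula
  retains exactly the extensions in which no vertex is attached to \<open>S\<close>.\<close>

lemma card_leaves:
  assumes fin: "finite V" and S: "S \<subseteq> V" and q: "\<And>s. s \<in> S \<Longrightarrow> q s \<in> V - S" and V: "V \<noteq> {}"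
  shows "card {p \<in> rooted_trees V. \<forall>s\<in>S. p s = q s \<and> children V p s = {}} = (card V - card S) ^ (card V - card S - 1)"
proof -
  define e where "e v = (if v \<in> S then q v else v)" for v
  have fo: "forest_on V S e"
    by (rule forest_on_rank[where rank = "\<lambda>_. 0"]) (use S q in \<open>auto simp: e_def\<close>)
  let ?x = "\<lambda>v. if v \<in> S then 0 else 1 :: real"
  let ?B = "{p \<in> rooted_trees V. \<forall>s\<in>S. p s = q s \<and> children V p s = {}}"
  have Be: "?B = {p \<in> extensions V S e. \<forall>s\<in>S. extra V S p s = 0}"
  proof -
    have "children V p s = {} \<longleftrightarrow> extra V S p s = 0" if p: "p \<in> extensions V S e" and s: "s \<in> S" for p s
    proof -
      have ne: "e w \<noteq> w" if "w \<in> S" for w using q[OF that] that by (auto simp: e_def)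
      have "{w \<in> S. e w = s} = {}" using q s by (auto simp: e_def)
      then have "card (children V p s) = extra V S p s"
        using card_children_extensions[OF fin fo p ne, of s] by (simp only: card.empty add_0)
      moreover have "finite (children V p s)" using fin by (simp add: children_def)
      ultimately show ?thesis by (metis card_0_eq)
    qed
    moreover have "p \<in> extensions V S e \<longleftrightarrow> p \<in> rooted_trees V \<and> (\<forall>s\<in>S. p s = q s)" for p
      by (auto simp: extensions_def e_def)
    ultimately show ?thesis by blast
  qed
  have ind: "(\<Prod>v\<in>V. ?x v ^ extra V S p v) = (if \<forall>s\<in>S. extra V S p s = 0 then 1 else 0)" for p
  proof (cases "\<forall>s\<in>S. extra V S p s = 0")
    case True
    then show ?thesis by (auto intro: prod.neutral)
  next
    case False
    then obtain s where "s \<in> S" "extra V S p s \<noteq> 0" by blast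
    then have "s \<in> V" "?x s ^ extra V S p s = 0" using S by auto
    then have "(\<Prod>v\<in>V. ?x v ^ extra V S p v) = 0" by (intro prod_zero[OF fin] bexI[of _ s])
    then show ?thesis using False by simp
  qed
  have finE: "finite (extensions V S e)" by (rule finite_extensions[OF fin])
  have "real (card ?B) = (\<Sum>p\<in>extensions V S e. if \<forall>s\<in>S. extra V S p s = 0 then 1 else 0)"
    unfolding Be using finE by (simp add: sum.If_cases Int_def)
  also have "\<dots> = (\<Sum>p\<in>extensions V S e. \<Prod>v\<in>V. ?x v ^ extra V S p v)" by (simp only: ind)
  also have "\<dots> = (\<Sum>v\<in>V. ?x v) ^ (card V - card S - 1)" by (rule sum_extensions_extra[OF fin fo V])
  also have "(\<Sum>v\<in>V. ?x v) = real (card V - card S)"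
    unfolding sum_indicator_weight[OF fin S] using card_mono[OF fin S] by (simp add: of_nat_diff)
  finally show ?thesis by (simp only: of_nat_power[symmetric] of_nat_eq_iff)
qed

lemma sum_Pow_prod:
  fixes f :: "'a \<Rightarrow> real"
  shows "finite V \<Longrightarrow> (\<Sum>S\<in>Pow V. \<Prod>x\<in>S. f x) = (\<Prod>x\<in>V. f x + 1)"
  using prod_add[of V f "\<lambda>_. 1"] by simp

lemma one_plus_inverse_power_le: "(1 + 1 / real n) ^ n \<le> exp 1"
proof (cases "n = 0")
  case False
  have "(1 + 1 / real n) ^ n \<le> exp (1 / real n) ^ n" by (intro power_mono exp_ge_add_one_self) auto
  also have "\<dots> = exp 1" using False exp_of_nat_mult[of n "1 / real n"] by simp
  finally show ?thesis .
qed simp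

text \<open>Second moment method.\<close>

theorem card_no_star:
  assumes fin: "finite V" and k: "1 \<le> k" "2 * k < card V"
  shows "real (card {p \<in> rooted_trees V. \<not> (\<exists>v\<in>V. \<exists>S\<subseteq>V - {v}. card S = k \<and> star V p v S)}) \<le>
    real (card V) ^ (card V - 1) *
    ((real (card V) / real (card V - k)) ^ (2 * k) - 1 + exp 1 * (4 * exp 2 * real k) ^ k / real (card V))"
proof -
  let ?n = "card V" and ?R = "rooted_trees V"
  have V: "V \<noteq> {}" and n: "0 < ?n" "1 < ?n" "k < ?n" using k by auto
  have finR: "finite ?R" by (rule finite_rooted_trees[OF fin])
  define N where "N = real ?n ^ (?n - 1)"
  have N: "real (card ?R) = N" using card_rooted_trees[OF fin V] by (simp add: N_def)
  have N0: "0 < N" using n by (simp add: N_def)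
  define Z where "Z = Sigma V (\<lambda>v. {S. S \<subseteq> V - {v} \<and> card S = k})"
  define b where "b = real ((?n - 1) choose k)"
  have cS: "card {S. S \<subseteq> V - {v} \<and> card S = k} = (?n - 1) choose k" if "v \<in> V" for v
    using n_subsets[of "V - {v}" k] fin that by (simp add: card_Diff_singleton)
  have finZ: "finite Z" unfolding Z_def using fin by (intro finite_SigmaI finite_subset[OF _ finite_Pow_iff[THEN iffD2, OF fin]]) auto
  have cZ: "real (card Z) = real ?n * b"
    unfolding Z_def b_def using fin cS by (simp add: card_SigmaI)
  have b0: "0 < b" using n by (simp add: b_def)
  define ind where "ind p z = (if star V p (fst z) (snd z) then 1 else 0 :: real)" for p z
  define Y where "Y p = (\<Sum>z\<in>Z. ind p z)" for p
  define c1 where "c1 = real (?n - k) ^ (?n - k - 1)"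
  define c2 where "c2 = real (?n - 2 * k) ^ (?n - 2 * k - 1)"
  have c1: "0 < c1" using n by (simp add: c1_def)
  have st1: "(\<Sum>p\<in>?R. ind p z) = c1" if z: "z \<in> Z" for z
  proof -
    obtain v S where vS: "z = (v, S)" "v \<in> V" "S \<subseteq> V - {v}" "card S = k" using z by (auto simp: Z_def)
    have "(\<Sum>p\<in>?R. ind p z) = real (card {p \<in> ?R. star V p v S})"
      using finR vS by (simp add: ind_def sum.If_cases Int_def)
    also have "{p \<in> ?R. star V p v S} = {p \<in> ?R. \<forall>s\<in>S. p s = v \<and> children V p s = {}}"
      using vS by (auto simp: star_def)
    also have "card \<dots> = (?n - card S) ^ (?n - card S - 1)"
      by (rule card_leaves[OF fin _ _ V]) (use vS in auto)
    finally show ?thesis by (simp add: vS c1_def)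
  qed
  have sumY: "(\<Sum>p\<in>?R. Y p) = real ?n * b * c1"
  proof -
    have "(\<Sum>p\<in>?R. Y p) = (\<Sum>z\<in>Z. \<Sum>p\<in>?R. ind p z)" unfolding Y_def by (rule sum.swap)
    then show ?thesis using st1 by (simp add: cZ)
  qed
  \<comment> \<open>Compatible stars with different centres are disjoint, as a leaf has only one
    parent; and a centre has children, so it is not a leaf of the other star. If no tree contains
    both stars, the sum is 0.\<close>
  have pair_ne: "(\<Sum>p\<in>?R. ind p (v, S) * ind p (w, S')) \<le> c2"
    if "(v, S) \<in> Z" "(w, S') \<in> Z" "v \<noteq> w" for v S w S'
  proof -
    have a: "v \<in> V" "S \<subseteq> V - {v}" "card S = k" "w \<in> V" "S' \<subseteq> V - {w}" "card S' = k" using that by (auto simp: Z_def)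
    have fS: "finite S" "finite S'" using a fin by (meson finite_Diff finite_subset)+
    have nonempty: "S \<noteq> {}" "S' \<noteq> {}" using a k by auto
    let ?q = "\<lambda>s. if s \<in> S then v else w"
    have e: "(\<Sum>p\<in>?R. ind p (v, S) * ind p (w, S')) = real (card {p \<in> ?R. star V p v S \<and> star V p w S'})"
    proof -
      have "ind p (v, S) * ind p (w, S') = (if star V p v S \<and> star V p w S' then 1 else 0)" for p
        by (simp add: ind_def)
      then show ?thesis using finR by (simp add: sum.If_cases Int_def)
    qed
    show ?thesis
    proof (cases "\<exists>p\<in>?R. star V p v S \<and> star V p w S'")
      case False
      then have "{p \<in> ?R. star V p v S \<and> star V p w S'} = {}" by blast
      then show ?thesis unfolding e by (simp only: card.empty of_nat_0 c2_def zero_le_power of_nat_0_le_iff)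
    next
      case True
      then obtain p where p: "p \<in> ?R" "star V p v S" "star V p w S'" by blast
      have dis: "S \<inter> S' = {}" using p that(3) by (auto simp: star_def)
      have "v \<notin> S'"
      proof
        assume "v \<in> S'"
        obtain s where "s \<in> S" using nonempty by blast
        then have "s \<in> children V p v" using p(2) a by (auto simp: star_def children_def)
        then show False using p(3) \<open>v \<in> S'\<close> by (auto simp: star_def)
      qed
      moreover have "w \<notin> S"
      proof
        assume "w \<in> S"
        obtain s where "s \<in> S'" using nonempty by blast
        then have "s \<in> children V p w" using p(3) a by (auto simp: star_def children_def)
        then show False using p(2) \<open>w \<in> S\<close> by (auto simp: star_def)
      qed
      ultimately have q: "?q s \<in> V - (S \<union> S')" if "s \<in> S \<union> S'" for s using that a by auto
      have cU: "card (S \<union> S') = 2 * k" using card_Un_disjoint[OF fS dis] a by simp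
      have "{p \<in> ?R. star V p v S \<and> star V p w S'} \<subseteq> {p \<in> ?R. \<forall>s\<in>S \<union> S'. p s = ?q s \<and> children V p s = {}}"
        using dis by (auto simp: star_def)
      then have "card {p \<in> ?R. star V p v S \<and> star V p w S'} \<le> card {p \<in> ?R. \<forall>s\<in>S \<union> S'. p s = ?q s \<and> children V p s = {}}"
        using finR by (intro card_mono) auto
      also have "\<dots> = (?n - card (S \<union> S')) ^ (?n - card (S \<union> S') - 1)"
        by (rule card_leaves[OF fin _ q V]) (use a in auto)
      finally have "real (card {p \<in> ?R. star V p v S \<and> star V p w S'}) \<le> real ((?n - 2 * k) ^ (?n - 2 * k - 1))"
        unfolding cU by (simp only: of_nat_le_iff)
      then show ?thesis unfolding e by (simp add: c2_def)
    qed
  qed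
  have pair_eq: "(\<Sum>p\<in>?R. ind p (v, S) * ind p (v, S')) \<le> N / real ?n ^ card (S \<union> S')"
    if "(v, S) \<in> Z" "(v, S') \<in> Z" for v S S'
  proof -
    have a: "v \<in> V" "S \<subseteq> V - {v}" "S' \<subseteq> V - {v}" using that by (auto simp: Z_def)
    let ?U = "S \<union> S'"
    have U: "?U \<subseteq> V - {v}" using a by blast
    have "card ?U \<le> card (V - {v})" using U fin by (intro card_mono) auto
    then have cU: "card ?U \<le> ?n - 1" using a fin by (simp add: card_Diff_singleton)
    have "ind p (v, S) * ind p (v, S') = (if star V p v ?U then 1 else 0)" for p
      by (auto simp: ind_def star_def)
    then have "(\<Sum>p\<in>?R. ind p (v, S) * ind p (v, S')) = real (card {p \<in> ?R. star V p v ?U})"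
      using finR by (simp add: sum.If_cases Int_def)
    also have "{p \<in> ?R. star V p v ?U} = {p \<in> ?R. \<forall>s\<in>?U. p s = v \<and> children V p s = {}}"
      using U by (auto simp: star_def)
    also have "card \<dots> = (?n - card ?U) ^ (?n - card ?U - 1)"
      by (rule card_leaves[OF fin _ _ V]) (use U a in auto)
    also have "real \<dots> \<le> real ?n ^ (?n - 1 - card ?U)" by (simp add: power_mono)
    also have "\<dots> = N / real ?n ^ card ?U" unfolding N_def using cU n by (subst power_diff) auto
    finally show ?thesis .
  qed
  \<comment> \<open>A leaf of \<open>S'\<close> that lies in \<open>S\<close> is free, any other
    costs a factor \<open>1 / n\<close>. Admitting all subsets of \<open>V\<close> turns the sum
    into a product, with factor 2 on \<open>S\<close> and \<open>1 + 1 / n\<close>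
    elsewhere.\<close>
  have diag: "(\<Sum>S'\<in>{S'. S' \<subseteq> V - {v} \<and> card S' = k}. N / real ?n ^ card (S \<union> S')) \<le> N / real ?n ^ k * (exp 1 * 2 ^ k)"
    if "(v, S) \<in> Z" for v S
  proof -
    have a: "S \<subseteq> V" "card S = k" "finite S" using that fin by (auto simp: Z_def intro: finite_subset)
    let ?f = "\<lambda>x. if x \<in> S then 1 else 1 / real ?n"
    have weight: "N / real ?n ^ card (S \<union> S') = N / real ?n ^ k * (\<Prod>x\<in>S'. ?f x)" if "S' \<subseteq> V" for S'
    proof -
      have fS': "finite S'" using that fin finite_subset by blast
      have "card (S \<union> S') = k + card (S' - S)"
        using card_Un_disjoint[of S "S' - S"] a fS' by (simp add: Un_Diff_cancel)
      moreover have "(\<Prod>x\<in>S'. ?f x) = (\<Prod>x\<in>S' - S. 1 / real ?n)"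
        using fS' by (intro prod.mono_neutral_cong_right) auto
      ultimately show ?thesis by (simp add: power_add power_divide)
    qed
    have "(\<Sum>S'\<in>Pow V. \<Prod>x\<in>S'. ?f x) = (\<Prod>x\<in>V. ?f x + 1)" by (rule sum_Pow_prod[OF fin])
    also have "\<dots> = (\<Prod>x\<in>S. ?f x + 1) * (\<Prod>x\<in>V - S. ?f x + 1)"
      using prod.subset_diff[OF a(1) fin, of "\<lambda>x. ?f x + 1"] by (simp add: mult.commute)
    also have "\<dots> = 2 ^ k * (1 + 1 / real ?n) ^ card (V - S)"
      using a by (simp add: add.commute)
    also have "\<dots> \<le> 2 ^ k * exp 1"
    proof (rule mult_left_mono)
      have "(1 + 1 / real ?n) ^ card (V - S) \<le> (1 + 1 / real ?n) ^ ?n"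
        using fin by (intro power_increasing card_mono) auto
      then show "(1 + 1 / real ?n) ^ card (V - S) \<le> exp 1" using one_plus_inverse_power_le[of ?n] by simp
    qed simp
    finally have "(\<Sum>S'\<in>Pow V. \<Prod>x\<in>S'. ?f x) \<le> exp 1 * 2 ^ k" by (simp only: mult.commute)
    then have le: "N / real ?n ^ k * (\<Sum>S'\<in>Pow V. \<Prod>x\<in>S'. ?f x) \<le> N / real ?n ^ k * (exp 1 * 2 ^ k)"
      using N0 by (intro mult_left_mono) auto
    have "(\<Sum>S'\<in>{S'. S' \<subseteq> V - {v} \<and> card S' = k}. N / real ?n ^ card (S \<union> S')) \<le> (\<Sum>S'\<in>Pow V. N / real ?n ^ card (S \<union> S'))"
      using fin N0 by (intro sum_mono2) auto
    also have "\<dots> = N / real ?n ^ k * (\<Sum>S'\<in>Pow V. \<Prod>x\<in>S'. ?f x)"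
      unfolding sum_distrib_left by (intro sum.cong refl weight) auto
    also note le
    finally show ?thesis .
  qed
  have sumY2: "(\<Sum>p\<in>?R. Y p ^ 2) \<le> (real ?n * b) ^ 2 * c2 + real ?n * b * (N / real ?n ^ k * (exp 1 * 2 ^ k))"
  proof -
    have "(\<Sum>p\<in>?R. Y p ^ 2) = (\<Sum>p\<in>?R. \<Sum>z\<in>Z. \<Sum>z'\<in>Z. ind p z * ind p z')"
      unfolding Y_def power2_eq_square sum_product ..
    also have "\<dots> = (\<Sum>z\<in>Z. \<Sum>p\<in>?R. \<Sum>z'\<in>Z. ind p z * ind p z')" by (rule sum.swap)
    also have "\<dots> = (\<Sum>z\<in>Z. \<Sum>z'\<in>Z. \<Sum>p\<in>?R. ind p z * ind p z')"
      by (intro sum.cong refl sum.swap)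
    also have "\<dots> \<le> (\<Sum>z\<in>Z. real ?n * b * c2 + N / real ?n ^ k * (exp 1 * 2 ^ k))"
    proof (rule sum_mono)
      fix z assume z: "z \<in> Z"
      obtain v S where vS: "z = (v, S)" by (cases z)
      have v: "v \<in> V" using z vS by (auto simp: Z_def)
      let ?Zv = "Pair v ` {S'. S' \<subseteq> V - {v} \<and> card S' = k}"
      have Zv: "?Zv \<subseteq> Z" using v by (auto simp: Z_def)
      have "(\<Sum>z'\<in>Z. \<Sum>p\<in>?R. ind p z * ind p z') = (\<Sum>z'\<in>Z - ?Zv. \<Sum>p\<in>?R. ind p z * ind p z') + (\<Sum>z'\<in>?Zv. \<Sum>p\<in>?R. ind p z * ind p z')"
        by (rule sum.subset_diff[OF Zv finZ])
      also have "(\<Sum>z'\<in>Z - ?Zv. \<Sum>p\<in>?R. ind p z * ind p z') \<le> (\<Sum>z'\<in>Z - ?Zv. c2)"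
      proof (rule sum_mono)
        fix z' assume z': "z' \<in> Z - ?Zv"
        obtain w S' where wS: "z' = (w, S')" by (cases z')
        have "v \<noteq> w" using z' wS by (auto simp: Z_def)
        then show "(\<Sum>p\<in>?R. ind p z * ind p z') \<le> c2" using pair_ne[of v S w S'] z z' vS wS by simp
      qed
      also have "\<dots> \<le> real ?n * b * c2"
      proof -
        have "real (card (Z - ?Zv)) \<le> real ?n * b" unfolding cZ[symmetric] using finZ by (simp add: card_mono)
        then show ?thesis by (simp add: c2_def mult_right_mono)
      qed
      also have "(\<Sum>z'\<in>?Zv. \<Sum>p\<in>?R. ind p z * ind p z') = (\<Sum>S'\<in>{S'. S' \<subseteq> V - {v} \<and> card S' = k}. \<Sum>p\<in>?R. ind p z * ind p (v, S'))"
        by (subst sum.reindex) (auto simp: inj_on_def)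
      also have "\<dots> \<le> (\<Sum>S'\<in>{S'. S' \<subseteq> V - {v} \<and> card S' = k}. N / real ?n ^ card (S \<union> S'))"
        using pair_eq[of v S] z vS v by (intro sum_mono) (auto simp: Z_def)
      also have "\<dots> \<le> N / real ?n ^ k * (exp 1 * 2 ^ k)" by (rule diag) (use z vS in simp)
      finally show "(\<Sum>z'\<in>Z. \<Sum>p\<in>?R. ind p z * ind p z') \<le> real ?n * b * c2 + N / real ?n ^ k * (exp 1 * 2 ^ k)"
        by simp
    qed
    also have "\<dots> = real ?n * b * (real ?n * b * c2 + N / real ?n ^ k * (exp 1 * 2 ^ k))" by (simp add: cZ)
    finally show ?thesis by (simp add: power2_eq_square algebra_simps)
  qed
  let ?B = "{p \<in> ?R. \<not> (\<exists>v\<in>V. \<exists>S\<subseteq>V - {v}. card S = k \<and> star V p v S)}"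
  define \<mu> where "\<mu> = real ?n * b * c1 / N"
  have \<mu>0: "0 < \<mu>" using n b0 c1 N0 by (simp add: \<mu>_def)
  have Y0: "Y p = 0" if "p \<in> ?B" for p
    unfolding Y_def by (rule sum.neutral) (use that in \<open>auto simp: ind_def Z_def\<close>)
  \<comment> \<open>Chebyshev: the number \<open>Y\<close> of stars vanishes on \<open>?B\<close>
    and so deviates there by its full mean \<open>\<mu>\<close>.\<close>
  have "real (card ?B) * \<mu> ^ 2 = (\<Sum>p\<in>?B. (Y p - \<mu>) ^ 2)" using Y0 by simp
  also have "\<dots> \<le> (\<Sum>p\<in>?R. (Y p - \<mu>) ^ 2)" using finR by (intro sum_mono2) auto
  also have "\<dots> = (\<Sum>p\<in>?R. Y p ^ 2) - 2 * \<mu> * (\<Sum>p\<in>?R. Y p) + real (card ?R) * \<mu> ^ 2"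
    by (simp add: power2_diff sum.distrib sum_subtractf sum_distrib_left algebra_simps)
  also have "\<dots> = (\<Sum>p\<in>?R. Y p ^ 2) - N * \<mu> ^ 2"
    unfolding sumY N using N0 by (simp add: \<mu>_def power2_eq_square field_simps)
  finally have "real (card ?B) * \<mu> ^ 2 \<le> (real ?n * b) ^ 2 * c2 + real ?n * b * (N / real ?n ^ k * (exp 1 * 2 ^ k)) - N * \<mu> ^ 2"
    using sumY2 by simp
  then have "real (card ?B) \<le> ((real ?n * b) ^ 2 * c2 + real ?n * b * (N / real ?n ^ k * (exp 1 * 2 ^ k)) - N * \<mu> ^ 2) / \<mu> ^ 2"
    using \<mu>0 by (simp add: pos_le_divide_eq)
  also have "\<dots> = N * (N * c2 / c1 ^ 2 - 1 + (N * N / (real ?n * b * c1 ^ 2)) / real ?n ^ k * (exp 1 * 2 ^ k))"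
    using N0 n b0 c1 by (simp add: \<mu>_def field_simps power2_eq_square)
  also have "\<dots> \<le> N * ((real ?n / real (?n - k)) ^ (2 * k) - 1 + exp 1 * (4 * exp 2 * real k) ^ k / real ?n)"
  proof (intro mult_left_mono add_mono diff_mono order_refl)
    have nk: "0 < real (?n - k)" using n by simp
    have c1': "c1 ^ 2 = real (?n - k) ^ (2 * (?n - k - 1))" by (simp add: c1_def power_mult[symmetric] mult.commute)
    show "N * c2 / c1 ^ 2 \<le> (real ?n / real (?n - k)) ^ (2 * k)"
    proof -
      have "real (?n - 2 * k) * real ?n \<le> real (?n - k) ^ 2"
        using k by (simp add: of_nat_diff power2_eq_square algebra_simps)
      then have "(real (?n - 2 * k) * real ?n) ^ (?n - 2 * k - 1) \<le> (real (?n - k) ^ 2) ^ (?n - 2 * k - 1)"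
        by (intro power_mono) auto
      then have "(real (?n - 2 * k) * real ?n) ^ (?n - 2 * k - 1) * real ?n ^ (2 * k) \<le>
          (real (?n - k) ^ 2) ^ (?n - 2 * k - 1) * real ?n ^ (2 * k)"
        by (rule mult_right_mono) simp
      moreover have "N = real ?n ^ (?n - 2 * k - 1) * real ?n ^ (2 * k)"
        unfolding N_def power_add[symmetric] using k by simp
      then have "N * c2 = (real (?n - 2 * k) * real ?n) ^ (?n - 2 * k - 1) * real ?n ^ (2 * k)"
        by (simp only: c2_def power_mult_distrib mult_ac)
      ultimately have "N * c2 \<le> (real (?n - k) ^ 2) ^ (?n - 2 * k - 1) * real ?n ^ (2 * k)" by simp
      also have "(real (?n - k) ^ 2) ^ (?n - 2 * k - 1) = c1 ^ 2 / real (?n - k) ^ (2 * k)"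
      proof -
        have "2 * (?n - k - 1) = 2 * (?n - 2 * k - 1) + 2 * k" using k by simp
        then have "c1 ^ 2 = (real (?n - k) ^ 2) ^ (?n - 2 * k - 1) * real (?n - k) ^ (2 * k)"
          unfolding c1' by (simp only: power_add power_mult)
        then show ?thesis using nk by simp
      qed
      finally show ?thesis using c1 nk by (simp add: power_divide field_simps)
    qed
    show "N * N / (real ?n * b * c1 ^ 2) / real ?n ^ k * (exp 1 * 2 ^ k) \<le> exp 1 * (4 * exp 2 * real k) ^ k / real ?n"
    proof -
      let ?e = "?n - k - 1"
      have ratio: "real ?n ^ ?e \<le> exp (real k) * real (?n - k) ^ ?e"
      proof -
        have "(real ?n / real (?n - k)) ^ ?e = (1 + real k / real (?n - k)) ^ ?e"
          using n by (simp add: of_nat_diff field_simps)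
        also have "\<dots> \<le> exp (real k / real (?n - k)) ^ ?e" by (intro power_mono exp_ge_add_one_self) auto
        also have "\<dots> = exp (real ?e * (real k / real (?n - k)))" by (rule exp_of_nat_mult[symmetric])
        also have "\<dots> \<le> exp (real k)"
        proof -
          have "real ?e * (real k / real (?n - k)) \<le> real (?n - k) * (real k / real (?n - k))"
            by (intro mult_right_mono) auto
          then show ?thesis using nk by simp
        qed
        finally show ?thesis using nk by (simp add: power_divide field_simps)
      qed
      have "N = real ?n ^ ?e * real ?n ^ k" unfolding N_def power_add[symmetric] using n by simp
      then have "N * N \<le> (exp (real k) * c1 * real ?n ^ k) * (exp (real k) * c1 * real ?n ^ k)"
        using mult_right_mono[OF ratio, of "real ?n ^ k"] N0 unfolding c1_def by (intro mult_mono) auto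
      also have "\<dots> = exp (2 * real k) * c1 ^ 2 * (real ?n ^ k * real ?n ^ k)"
        by (simp add: power2_eq_square exp_add[symmetric] mult_ac)
      finally have "N * N / (real ?n * b * c1 ^ 2) / real ?n ^ k \<le> exp (2 * real k) * c1 ^ 2 * (real ?n ^ k * real ?n ^ k) / (real ?n * b * c1 ^ 2) / real ?n ^ k"
        using n b0 by (intro divide_right_mono) auto
      also have "\<dots> = exp (2 * real k) * (real ?n ^ k / b) / real ?n" using n c1 by simp
      also have "\<dots> \<le> exp (2 * real k) * (2 * real k) ^ k / real ?n"
      proof (intro divide_right_mono mult_left_mono)
        have "(real (?n - 1) / real k) ^ k \<le> b"
          unfolding b_def using binomial_ge_n_over_k_pow_k[of k "?n - 1", where 'a = real] n by simp
        moreover have "real ?n ^ k \<le> (2 * real k) ^ k * (real (?n - 1) / real k) ^ k"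
          unfolding power_mult_distrib[symmetric] using n k by (intro power_mono) (auto simp: field_simps of_nat_diff)
        ultimately have "real ?n ^ k \<le> (2 * real k) ^ k * b" by (meson mult_left_mono order_trans zero_le_power of_nat_0_le_iff mult_nonneg_nonneg zero_le_numeral)
        then show "real ?n ^ k / b \<le> (2 * real k) ^ k" using b0 by (simp add: pos_divide_le_eq)
      qed auto
      finally have "N * N / (real ?n * b * c1 ^ 2) / real ?n ^ k * (exp 1 * 2 ^ k) \<le> exp (2 * real k) * (2 * real k) ^ k / real ?n * (exp 1 * 2 ^ k)"
        by (intro mult_right_mono) auto
      also have "\<dots> = exp 1 * (4 * exp 2 * real k) ^ k / real ?n"
      proof -
        have e2: "exp (2 * real k) = exp 2 ^ k" using exp_of_nat_mult[of k "2::real"] by (simp add: mult.commute)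
        have "4 * exp 2 * real k = exp 2 * (2 * real k) * 2" by simp
        then have "(4 * exp 2 * real k) ^ k = exp 2 ^ k * (2 * real k) ^ k * 2 ^ k"
          by (simp only: power_mult_distrib)
        then show ?thesis unfolding e2 by simp
      qed
      finally show ?thesis .
    qed
  qed (use N0 in simp)
  finally show ?thesis by (simp add: N_def)
qed

section \<open>Trees outside the exceptional sets\<close>

text \<open>One set for each random hypothesis of \<open>good_tree\<close>, where
  \<open>no_same\<close> accounts for both the two-path and the periodic pattern, and a last one for
  trees without the star of the lower bounds.\<close>

definition bad_trees :: "nat set \<Rightarrow> nat \<Rightarrow> nat \<Rightarrow> nat \<Rightarrow> nat \<Rightarrow> nat \<Rightarrow> (nat \<Rightarrow> nat) set" where
  "bad_trees V N \<kappa> s0 W k =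
    (\<Union>m\<in>{..2 * N + 1}. heavy_chain V m (Suc \<kappa>) W) \<union>
    equal_parities V (2 * N + 2) (two_paths N) {..<N} (\<lambda>j. j) (\<lambda>j. Suc N + j) \<union>
    equal_parities V (2 * N + 2) (two_paths N) {1..<N} (\<lambda>j. j) (\<lambda>j. Suc N + (N - j)) \<union>
    (\<Union>\<delta>\<in>{1..N}. equal_parities V (Suc (N + \<delta>)) {..<N + \<delta>} {t. t \<le> N \<and> even (t div \<delta>)} (\<lambda>t. t) (\<lambda>t. t + \<delta>)) \<union>
    (\<Union>y\<in>V. shallow V (2 * N + 1) s0 (Suc (W * s0)) y) \<union>
    {p \<in> rooted_trees V. \<not> (\<exists>v\<in>V. \<exists>S\<subseteq>V - {v}. card S = k \<and> star V p v S)}"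

lemma out_degree_eq: "out_degree (with_proj G) v = card {u. (v, u) \<in> parcs G}"
proof -
  have "out_arcs (with_proj G) v = Pair v ` {u. (v, u) \<in> parcs G}" by (auto simp: out_arcs_def)
  then show ?thesis by (simp add: out_degree_def card_image inj_on_def)
qed

text \<open>Taking \<open>\<kappa>\<close> both for the distances and for the recursion turns
  \<open>6 * k0 + K\<close> into \<open>7 * \<kappa>\<close>. A star with \<open>k\<close> leaves
  supplies both lower bounds; a chain of a single vertex bounds its children by \<open>W\<close>,
  and the parent adds one.\<close>

theorem degree_and_depth_bounds:
  fixes V :: "nat set"
  assumes fin: "finite V" and p: "p \<in> rooted_trees V" "p \<notin> bad_trees V N \<kappa> s0 W k"
    and s0: "2 * (2 * N + 1) + 2 \<le> s0" "s0 < 2 ^ \<kappa>"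
  shows "max_degree (tree_graph V p) \<le> W + 1" "k \<le> max_degree (tree_graph V p)"
    "k \<le> D (tree_graph V p)" "D (tree_graph V p) \<le> W + 7 * \<kappa> + 14"
proof -
  obtain r where r: "rooted V p r" using p by (auto simp: rooted_trees_def)
  interpret nat_tree V p r using fin r by unfold_locales
  let ?L = "2 * N + 1"
  have light: "(\<Sum>u\<in>S. card (ch u)) \<le> W" if "z \<in> V" "S \<subseteq> (\<lambda>i. (p ^^ i) z) ` {..?L}" "card S \<le> Suc \<kappa>" for z S
    by (rule light_chains[OF _ that]) (use p(2) in \<open>auto simp: bad_trees_def\<close>)
  have chW: "card (ch v) \<le> W" if "v \<in> V" for v
  proof -
    have "{v} \<subseteq> (\<lambda>i. (p ^^ i) v) ` {..?L}" by (auto intro: image_eqI[of _ _ 0])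
    from light[OF that this] show ?thesis by simp
  qed
  interpret good_tree V p r ?L N \<kappa> \<kappa> s0 W
  proof unfold_locales
    show "2 * ?L + 2 \<le> 2 ^ \<kappa>" using s0 by simp
    show "s0 \<le> 2 ^ \<kappa>" "s0 < 2 ^ \<kappa>" using s0 by auto
    show "card (sub v) \<le> s0" if "v \<in> V" "v \<notin> (p ^^ ?L) ` V" for v
      by (rule small_if_not_shallow[OF _ chW that]) (use p(2) in \<open>auto simp: bad_trees_def\<close>)
    show "(\<Sum>u\<in>S. card (ch u)) \<le> W" if "z \<in> V" "S \<subseteq> (\<lambda>i. (p ^^ i) z) ` {..?L}" "card S \<le> Suc \<kappa>" for z S
      by (rule light[OF that])
    show "\<exists>i<?L. odd (card (ch ((p ^^ i) a))) \<noteq> odd (card (ch ((p ^^ i) b)))"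
      if "a \<in> V" "b \<in> V" "?L \<le> dep a" "?L \<le> dep b" "\<And>i. i \<le> ?L \<Longrightarrow> (p ^^ i) a \<noteq> (p ^^ i) b" for a b
      by (rule no_same_if[OF refl _ _ that]) (use p(2) in \<open>auto simp: bad_trees_def\<close>)
    show "\<exists>i\<ge>1. i < N \<and> odd (card (ch ((p ^^ i) a))) \<noteq> odd (card (ch ((p ^^ (N - i)) b)))"
      if "a \<in> V" "b \<in> V" "N \<le> dep a" "N \<le> dep b" "\<And>i j. i \<le> N \<Longrightarrow> j \<le> N \<Longrightarrow> (p ^^ i) a \<noteq> (p ^^ j) b" for a b
      by (rule no_opp_if[OF _ that]) (use p(2) in \<open>auto simp: bad_trees_def\<close>)
  qed simp
  obtain v S where vS: "v \<in> V" "S \<subseteq> V - {v}" "card S = k" "star V p v S"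
    using p by (auto simp: bad_trees_def)
  have deg: "out_degree (with_proj T) u = card {w \<in> V. (u, w) \<in> parcs T}" for u
  proof -
    have "{w. (u, w) \<in> parcs T} = {w \<in> V. (u, w) \<in> parcs T}" by auto
    then show ?thesis unfolding out_degree_eq by (simp only:)
  qed
  have degV: "out_degree (with_proj T) u \<le> W + 1" if "u \<in> V" for u
  proof -
    have "card (ch u \<union> (if u = r then {} else {p u})) \<le> card (ch u) + card (if u = r then {} else {p u})"
      by (rule card_Un_le)
    also have "\<dots> \<le> W + 1" using chW[OF that] by (cases "u = r") auto
    finally show ?thesis unfolding deg nbrs[OF that] .
  qed
  show "max_degree T \<le> W + 1"
    unfolding max_degree_def using fin rV degV by (intro Max.boundedI) auto
  have leaf: "(x, y) \<in> parcs T \<longleftrightarrow> y = v" if "x \<in> S" for x y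
  proof -
    have x: "x \<in> V" "p x = v" "x \<noteq> v" "children V p x = {}" using vS that by (auto simp: star_def)
    have "\<not> (y \<in> V \<and> y \<noteq> x \<and> p y = x)" using x(4) by (auto simp: children_def)
    then show ?thesis using x vS(1) by auto
  qed
  have "k \<le> out_degree (with_proj T) v"
  proof -
    have "S \<subseteq> {w \<in> V. (v, w) \<in> parcs T}" using vS by (auto simp: star_def)
    then show ?thesis unfolding deg using fin card_mono[of "{w \<in> V. (v, w) \<in> parcs T}" S] vS(3) by simp
  qed
  also have "\<dots> \<le> max_degree T"
    unfolding max_degree_def using fin vS(1) by (intro Max_ge) auto
  finally show "k \<le> max_degree T" .
  obtain \<phi> where \<phi>: "defines_graph \<phi> T" "quantifier_depth \<phi> \<le> W + 6 * \<kappa> + \<kappa> + 14"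
    using D_upper by blast
  show "D T \<le> W + 7 * \<kappa> + 14" using D_le[OF \<phi>(1)] \<phi>(2) by simp
  have "card S \<le> D T"
    by (rule D_ge_twin_leaves[OF pairT _ _ leaf \<phi>(1)]) (use vS in auto)
  then show "k \<le> D T" using vS(3) by simp
qed

text \<open>The common factor is the number of rooted trees, so the bracket bounds a probability.
  Patterns with one path cost a factor \<open>n\<close>, those with two paths \<open>n ^ 2\<close>,
  and shallow subtrees one factor \<open>n\<close> for the choice of their top.\<close>

theorem card_bad_trees:
  fixes V :: "nat set"
  assumes fin: "finite V" and n: "n = card V" and N: "1 \<le> N" "4 * N + 4 \<le> n" and y: "1 \<le> y"
    and s0: "s0 = 8 * (2 * N + 1) ^ 3" and k: "1 \<le> k" "2 * k < n"
  shows "real (card (bad_trees V N \<kappa> s0 W k)) \<le> real n ^ (n - 1) *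
    (real (2 * N + 2) * (real n * real (2 * N + 2) ^ Suc \<kappa> * exp (real (Suc \<kappa>) * (y - 1)) / y ^ (W - \<kappa>)) +
     2 * (real n ^ 2 * (3/5) ^ (N - 1)) + real N * (real n * (3/5) ^ (N div 2)) +
     real n * (exp (real (Suc (W * s0)) ^ 2 / real n) / 2 ^ (2 * N + 1) * exp 2) +
     ((real n / real (n - k)) ^ (2 * k) - 1 + exp 1 * (4 * exp 2 * real k) ^ k / real n))"
proof -
  let ?R = "real n ^ (n - 1)" and ?L = "2 * N + 1"
  have V: "card V > 0" "n > 0" using N n by auto
  have Rn: "?R * real n = real n ^ n" "?R * real n ^ 2 = real n ^ (n + 1)"
  proof -
    have "n = Suc (n - 1)" "n + 1 = n - 1 + 2" using V by auto
    then show "?R * real n = real n ^ n" "?R * real n ^ 2 = real n ^ (n + 1)"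
      by (metis power_Suc2, metis power_add)
  qed
  have finR: "finite (rooted_trees V)" by (rule finite_rooted_trees[OF fin])
  define B1 where "B1 = (\<Union>m\<in>{..?L}. heavy_chain V m (Suc \<kappa>) W)"
  define B2 where "B2 = equal_parities V (2 * N + 2) (two_paths N) {..<N} (\<lambda>j. j) (\<lambda>j. Suc N + j)"
  define B3 where "B3 = equal_parities V (2 * N + 2) (two_paths N) {1..<N} (\<lambda>j. j) (\<lambda>j. Suc N + (N - j))"
  define B4 where "B4 = (\<Union>\<delta>\<in>{1..N}. equal_parities V (Suc (N + \<delta>)) {..<N + \<delta>} {t. t \<le> N \<and> even (t div \<delta>)} (\<lambda>t. t) (\<lambda>t. t + \<delta>))"
  define B5 where "B5 = (\<Union>y\<in>V. shallow V ?L s0 (Suc (W * s0)) y)"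
  define B6 where "B6 = {p \<in> rooted_trees V. \<not> (\<exists>v\<in>V. \<exists>S\<subseteq>V - {v}. card S = k \<and> star V p v S)}"
  have e: "bad_trees V N \<kappa> s0 W k = B1 \<union> B2 \<union> B3 \<union> B4 \<union> B5 \<union> B6"
    by (simp add: bad_trees_def B1_def B2_def B3_def B4_def B5_def B6_def)
  have b1: "real (card B1) \<le> real (card {..?L}) * (real n ^ n * real (2 * N + 2) ^ Suc \<kappa> * exp (real (Suc \<kappa>) * (y - 1)) / y ^ (W - \<kappa>))"
  proof (rule card_UN_le_sum)
    fix m assume m: "m \<in> {..?L}"
    show "finite (heavy_chain V m (Suc \<kappa>) W)" using finR by (simp add: heavy_chain_def)
    have "real (card (heavy_chain V m (Suc \<kappa>) W)) * y ^ (Suc W - Suc \<kappa>) \<le>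
        real n ^ n * real (Suc m) ^ Suc \<kappa> * exp (real (Suc \<kappa>) * (y - 1))"
      using card_heavy_chain[OF fin _ y, of m "Suc \<kappa>" W] m N by (simp add: n)
    also have "\<dots> \<le> real n ^ n * real (2 * N + 2) ^ Suc \<kappa> * exp (real (Suc \<kappa>) * (y - 1))"
      using m by (intro mult_right_mono mult_left_mono power_mono) auto
    finally show "real (card (heavy_chain V m (Suc \<kappa>) W)) \<le> real n ^ n * real (2 * N + 2) ^ Suc \<kappa> * exp (real (Suc \<kappa>) * (y - 1)) / y ^ (W - \<kappa>)"
      using y by (simp add: pos_le_divide_eq)
  qed (auto simp: B1_def)
  have b2: "real (card B2) \<le> real n ^ (n + 1) * (3/5) ^ (N - 1)"
  proof -
    have "real (card B2) \<le> real n ^ (n + 1) * (3/5) ^ N"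
      unfolding B2_def n by (rule card_same_direction[OF fin]) (use N n in simp)
    also have "\<dots> \<le> real n ^ (n + 1) * (3/5) ^ (N - 1)" by (intro mult_left_mono power_decreasing) auto
    finally show ?thesis .
  qed
  have b3: "real (card B3) \<le> real n ^ (n + 1) * (3/5) ^ (N - 1)"
    unfolding B3_def n by (rule card_opposite_direction[OF fin]) (use N n in simp)
  have b4: "real (card B4) \<le> real (card {1..N}) * (real n ^ n * (3/5) ^ (N div 2))"
  proof (rule card_UN_le_sum)
    fix \<delta> assume "\<delta> \<in> {1..N}"
    then show "real (card (equal_parities V (Suc (N + \<delta>)) {..<N + \<delta>} {t. t \<le> N \<and> even (t div \<delta>)} (\<lambda>t. t) (\<lambda>t. t + \<delta>)))
      \<le> real n ^ n * (3/5) ^ (N div 2)"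
      unfolding n by (intro card_periodic[OF fin]) (use N n in auto)
    show "finite (equal_parities V (Suc (N + \<delta>)) {..<N + \<delta>} {t. t \<le> N \<and> even (t div \<delta>)} (\<lambda>t. t) (\<lambda>t. t + \<delta>))"
      using finR by (simp add: equal_parities_def)
  qed (auto simp: B4_def)
  have b5: "real (card B5) \<le> real (card V) * (?R * exp (real (Suc (W * s0)) ^ 2 / real n) / 2 ^ ?L * exp 2)"
  proof (rule card_UN_le_sum[OF fin])
    fix v assume v: "v \<in> V"
    show "finite (shallow V ?L s0 (Suc (W * s0)) v)" using finR by (simp add: shallow_def)
    \<comment> \<open>The largest excess allowed by \<open>card_shallow\<close>. Bernoulli gives
      \<open>(1 + d) ^ (8 * ?L ^ 2) \<ge> 2\<close>, so the cubic choice of \<open>s0\<close> yields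
      \<open>(1 + d) ^ s0 \<ge> 2 ^ ?L\<close>, enough to outweigh the choice of the top.\<close>
    define d where "d = 1 / (8 * real ?L ^ 2)"
    have d: "0 \<le> d" "8 * d * real ?L ^ 2 \<le> 1" by (auto simp: d_def)
    have "2 \<le> (1 + d) ^ (8 * ?L ^ 2)"
    proof -
      have "real (8 * ?L ^ 2) * d = 1" by (simp add: d_def)
      then show ?thesis using Bernoulli_inequality[of d "8 * ?L ^ 2"] d by simp
    qed
    then have "2 ^ ?L \<le> ((1 + d) ^ (8 * ?L ^ 2)) ^ ?L" by (intro power_mono) auto
    also have "\<dots> = (1 + d) ^ s0" unfolding power_mult[symmetric] s0 by (simp only: power3_eq_cube power2_eq_square mult.assoc)
    finally have two: "2 ^ ?L \<le> (1 + d) ^ s0" .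
    have "real (card (shallow V ?L s0 (Suc (W * s0)) v)) \<le> ?R * exp (real (Suc (W * s0)) ^ 2 / real n) / (1 + d) ^ s0 * exp 2"
      unfolding n by (rule card_shallow[OF fin v d]) simp
    also have "\<dots> \<le> ?R * exp (real (Suc (W * s0)) ^ 2 / real n) / 2 ^ ?L * exp 2"
      using two zero_less_power[of "1 + d" s0] d(1) by (intro mult_right_mono divide_left_mono) auto
    finally show "real (card (shallow V ?L s0 (Suc (W * s0)) v)) \<le> ?R * exp (real (Suc (W * s0)) ^ 2 / real n) / 2 ^ ?L * exp 2" .
  qed (auto simp: B5_def)
  have b6: "real (card B6) \<le> ?R * ((real n / real (n - k)) ^ (2 * k) - 1 + exp 1 * (4 * exp 2 * real k) ^ k / real n)"
    unfolding B6_def n by (rule card_no_star[OF fin]) (use k n in auto)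
  have "card (B1 \<union> B2 \<union> B3 \<union> B4 \<union> B5 \<union> B6) \<le> card B1 + card B2 + card B3 + card B4 + card B5 + card B6"
    by (intro order_trans[OF card_Un_le] add_mono order_refl)
  then have "real (card (bad_trees V N \<kappa> s0 W k)) \<le> real (card B1) + real (card B2) + real (card B3) + real (card B4) + real (card B5) + real (card B6)"
    unfolding e by linarith
  also have "\<dots> \<le> real (card {..?L}) * (real n ^ n * real (2 * N + 2) ^ Suc \<kappa> * exp (real (Suc \<kappa>) * (y - 1)) / y ^ (W - \<kappa>)) +
    real n ^ (n + 1) * (3/5) ^ (N - 1) + real n ^ (n + 1) * (3/5) ^ (N - 1) + real (card {1..N}) * (real n ^ n * (3/5) ^ (N div 2)) +
    real (card V) * (?R * exp (real (Suc (W * s0)) ^ 2 / real n) / 2 ^ ?L * exp 2) +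
    ?R * ((real n / real (n - k)) ^ (2 * k) - 1 + exp 1 * (4 * exp 2 * real k) ^ k / real n)"
    by (intro add_mono b1 b2 b3 b4 b5 b6)
  also have "\<dots> = ?R *
    (real (2 * N + 2) * (real n * real (2 * N + 2) ^ Suc \<kappa> * exp (real (Suc \<kappa>) * (y - 1)) / y ^ (W - \<kappa>)) +
     2 * (real n ^ 2 * (3/5) ^ (N - 1)) + real N * (real n * (3/5) ^ (N div 2)) +
     real n * (exp (real (Suc (W * s0)) ^ 2 / real n) / 2 ^ ?L * exp 2) +
     ((real n / real (n - k)) ^ (2 * k) - 1 + exp 1 * (4 * exp 2 * real k) ^ k / real n))"
  proof -
    have alg: "c1 * ((R * m) * a / b) + (R * q) * f + (R * q) * f + c4 * ((R * m) * g) + m * (R * E / P * X) + R * Z =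
        R * (c1 * (m * a / b) + 2 * (q * f) + c4 * (m * g) + m * (E / P * X) + Z)"
      for c1 R m a b q f c4 g E P X Z :: real by (simp add: algebra_simps)
    have "card {..?L} = 2 * N + 2" "card {1..N} = N" "card V = n" using n by auto
    then show ?thesis
      unfolding Rn[symmetric] using alg[of "real (2 * N + 2)" ?R "real n" "real (2 * N + 2) ^ Suc \<kappa> * exp (real (Suc \<kappa>) * (y - 1))"]
      by (simp only: mult.assoc)
  qed
  finally show ?thesis .
qed

section \<open>The choice of parameters\<close>

text \<open>Write \<open>l = ln n\<close> and \<open>u = ln l\<close>. The weight
  \<open>y = l / u ^ 3\<close> still has \<open>ln y\<close> asymptotic to \<open>u\<close>, so the
  denominator is \<open>n\<close> to the power \<open>1 + \<epsilon> - o(1)\<close>. The cube keeps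
  \<open>u ^ 2 * y = l / u\<close> of smaller order than \<open>l\<close>; this exponential and the
  choice of positions contribute only \<open>n\<close> to the power \<open>o(1)\<close>.\<close>

lemma heavy_chain_term_tendsto_0:
  fixes \<epsilon> :: real
  assumes \<epsilon>: "0 < \<epsilon>"
  shows "(\<lambda>n::nat. (2 * ln (real n) ^ 2 + 4) * (real n * (2 * ln (real n) ^ 2 + 4) powr (ln (ln (real n)) ^ 2 + 1) *
   exp ((ln (ln (real n)) ^ 2 + 1) * (ln (real n) / ln (ln (real n)) ^ 3)) /
   (ln (real n) / ln (ln (real n)) ^ 3) powr ((1 + \<epsilon>) * (ln (real n) / ln (ln (real n))) - 1 - ln (ln (real n)) ^ 2))) \<longlonglongrightarrow> 0"
  using \<epsilon> by real_asymp

lemma parity_terms_tendsto_0: "(\<lambda>n::nat. 2 * (real n ^ 2 * (3/5) powr (ln (real n) ^ 2 - 1))) \<longlonglongrightarrow> 0"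
   "(\<lambda>n::nat. (ln (real n) ^ 2 + 1) * (real n * (3/5) powr (ln (real n) ^ 2 / 2 - 1))) \<longlonglongrightarrow> 0"
  by real_asymp+

lemma shallow_term_tendsto_0:
  fixes \<epsilon> :: real
  assumes \<epsilon>: "0 < \<epsilon>"
  shows "(\<lambda>n::nat. real n * (exp ((1 + (1 + \<epsilon>) * (ln (real n) / ln (ln (real n))) * (8 * (2 * ln (real n) ^ 2 + 3) ^ 3)) ^ 2 / real n)
    / 2 powr (2 * ln (real n) ^ 2 + 1) * exp 2)) \<longlonglongrightarrow> 0"
  using \<epsilon> by real_asymp

text \<open>With \<open>k\<close> close to \<open>(1 - \<epsilon>) * ln n / ln (ln n)\<close>, the
  power \<open>k ^ k\<close> is \<open>n\<close> to the power \<open>1 - \<epsilon> + o(1)\<close>,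
  also with the constant factors inside, and division by \<open>n\<close> wins.\<close>

lemma star_terms_tendsto_0:
  fixes \<epsilon> :: real
  assumes \<epsilon>: "0 < \<epsilon>" "\<epsilon> \<le> 1/2"
  shows "(\<lambda>n::nat. (real n / (real n - ((1 - \<epsilon>) * (ln (real n) / ln (ln (real n))) + 1))) powr (2 * ((1 - \<epsilon>) * (ln (real n) / ln (ln (real n))) + 1)) - 1) \<longlonglongrightarrow> 0"
  "(\<lambda>n::nat. exp 1 * (4 * exp 2 * ((1 - \<epsilon>) * (ln (real n) / ln (ln (real n))) + 1)) powr ((1 - \<epsilon>) * (ln (real n) / ln (ln (real n))) + 1) / real n) \<longlonglongrightarrow> 0"
  using \<epsilon> by real_asymp+

lemma eventually_ratio_ge_1: "\<forall>\<^sub>F n::nat in sequentially. 1 \<le> ln (real n) / ln (ln (real n))"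
  by real_asymp

lemma eventually_bounds:
  fixes \<epsilon> :: real
  assumes \<epsilon>: "0 < \<epsilon>" "\<epsilon> \<le> 1/2"
  shows "\<forall>\<^sub>F n::nat in sequentially. 1 \<le> ln (ln (real n))"
    "\<forall>\<^sub>F n::nat in sequentially. 4 * (ln (real n) ^ 2 + 1) + 4 \<le> real n"
    "\<forall>\<^sub>F n::nat in sequentially. 1 \<le> ln (real n) / ln (ln (real n)) ^ 3"
    "\<forall>\<^sub>F n::nat in sequentially. 1 \<le> ln (real n) / ln (ln (real n))"
    "\<forall>\<^sub>F n::nat in sequentially. 2 * ((1 - \<epsilon>) * (ln (real n) / ln (ln (real n))) + 1) < real n"
    "\<forall>\<^sub>F n::nat in sequentially. 8 * (2 * ln (real n) ^ 2 + 3) ^ 3 < 2 powr (ln (ln (real n)) ^ 2 - 1)"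
    "\<forall>\<^sub>F n::nat in sequentially. 7 * ln (ln (real n)) ^ 2 + 14 \<le> \<epsilon> * (ln (real n) / ln (ln (real n)))"
  using \<epsilon> by real_asymp+

lemma real_nat_round:
  fixes x :: real
  assumes "0 \<le> x"
  shows "x \<le> real (nat \<lceil>x\<rceil>)" "real (nat \<lceil>x\<rceil>) \<le> x + 1" "x - 1 \<le> real (nat \<lfloor>x\<rfloor>)" "real (nat \<lfloor>x\<rfloor>) \<le> x"
  using assms by linarith+

lemma bad_trees_subset: "bad_trees V N \<kappa> s0 W k \<subseteq> rooted_trees V"
  unfolding bad_trees_def heavy_chain_def equal_parities_def shallow_def
  by (intro Un_least UN_least Collect_restrict)

text \<open>\<open>h\<close> arises from the bound in \<open>card_bad_trees\<close> by replacing
  each rounded parameter by a real expression on the unfavourable side, so that only closed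
  expressions have to be estimated asymptotically.\<close>

lemma bad_trees_negligible:
  assumes \<epsilon>: "0 < \<epsilon>" "\<epsilon> \<le> 1/2"
  obtains h :: "nat \<Rightarrow> real" where "h \<longlonglongrightarrow> 0"
    "\<forall>\<^sub>F n in sequentially. \<exists>N \<kappa> s0 W k. 2 * (2 * N + 1) + 2 \<le> s0 \<and> s0 < 2 ^ \<kappa> \<and>
       real (W + 7 * \<kappa> + 14) \<le> (1 + 2 * \<epsilon>) * (ln (real n) / ln (ln (real n))) \<and>
       (1 - \<epsilon>) * (ln (real n) / ln (ln (real n))) \<le> real k \<and>
       real (card (bad_trees {1..n} N \<kappa> s0 W k)) \<le> real n ^ (n - 1) * h n"
proof -
  define h where "h n =
    (2 * ln (real n) ^ 2 + 4) * (real n * (2 * ln (real n) ^ 2 + 4) powr (ln (ln (real n)) ^ 2 + 1) *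
      exp ((ln (ln (real n)) ^ 2 + 1) * (ln (real n) / ln (ln (real n)) ^ 3)) /
      (ln (real n) / ln (ln (real n)) ^ 3) powr ((1 + \<epsilon>) * (ln (real n) / ln (ln (real n))) - 1 - ln (ln (real n)) ^ 2)) +
    2 * (real n ^ 2 * (3/5) powr (ln (real n) ^ 2 - 1)) +
    (ln (real n) ^ 2 + 1) * (real n * (3/5) powr (ln (real n) ^ 2 / 2 - 1)) +
    real n * (exp ((1 + (1 + \<epsilon>) * (ln (real n) / ln (ln (real n))) * (8 * (2 * ln (real n) ^ 2 + 3) ^ 3)) ^ 2 / real n)
      / 2 powr (2 * ln (real n) ^ 2 + 1) * exp 2) +
    ((real n / (real n - ((1 - \<epsilon>) * (ln (real n) / ln (ln (real n))) + 1))) powr (2 * ((1 - \<epsilon>) * (ln (real n) / ln (ln (real n))) + 1)) - 1 +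
     exp 1 * (4 * exp 2 * ((1 - \<epsilon>) * (ln (real n) / ln (ln (real n))) + 1)) powr ((1 - \<epsilon>) * (ln (real n) / ln (ln (real n))) + 1) / real n)"
    for n :: nat
  have "h \<longlonglongrightarrow> 0 + 0 + 0 + 0 + (0 + 0)"
    unfolding h_def by (intro tendsto_add heavy_chain_term_tendsto_0[OF \<epsilon>(1)] parity_terms_tendsto_0 shallow_term_tendsto_0[OF \<epsilon>(1)] star_terms_tendsto_0[OF \<epsilon>])
  then have "h \<longlonglongrightarrow> 0" by simp
  moreover have "\<forall>\<^sub>F n in sequentially. \<exists>N \<kappa> s0 W k. 2 * (2 * N + 1) + 2 \<le> s0 \<and> s0 < 2 ^ \<kappa> \<and>
       real (W + 7 * \<kappa> + 14) \<le> (1 + 2 * \<epsilon>) * (ln (real n) / ln (ln (real n))) \<and>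
       (1 - \<epsilon>) * (ln (real n) / ln (ln (real n))) \<le> real k \<and>
       real (card (bad_trees {1..n} N \<kappa> s0 W k)) \<le> real n ^ (n - 1) * h n"
    using eventually_bounds[OF \<epsilon>]
  proof eventually_elim
    case (elim n)
    define l u where "l = ln (real n)" and "u = ln l"
    define q y where "q = l / u" and "y = l / u ^ 3"
    note ev = elim[folded l_def, folded u_def, folded q_def y_def]
    have hn: "h n = (2 * l ^ 2 + 4) * (real n * (2 * l ^ 2 + 4) powr (u ^ 2 + 1) * exp ((u ^ 2 + 1) * y) / y powr ((1 + \<epsilon>) * q - 1 - u ^ 2)) +
      2 * (real n ^ 2 * (3/5) powr (l ^ 2 - 1)) + (l ^ 2 + 1) * (real n * (3/5) powr (l ^ 2 / 2 - 1)) +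
      real n * (exp ((1 + (1 + \<epsilon>) * q * (8 * (2 * l ^ 2 + 3) ^ 3)) ^ 2 / real n) / 2 powr (2 * l ^ 2 + 1) * exp 2) +
      ((real n / (real n - ((1 - \<epsilon>) * q + 1))) powr (2 * ((1 - \<epsilon>) * q + 1)) - 1 +
       exp 1 * (4 * exp 2 * ((1 - \<epsilon>) * q + 1)) powr ((1 - \<epsilon>) * q + 1) / real n)"
      unfolding h_def q_def y_def u_def l_def ..
    \<comment> \<open>From \<open>\<kappa>\<close> only \<open>s0 < 2 ^ \<kappa>\<close> and smaller
      order than \<open>q\<close> are required. Since \<open>ln s0\<close> is of order
      \<open>u\<close>, the choice \<open>u ^ 2\<close> leaves ample room and avoids explicit
      constants.\<close>
    define N \<kappa> W k where "N = nat \<lceil>l ^ 2\<rceil>" and "\<kappa> = nat \<lfloor>u ^ 2\<rfloor>" and "W = nat \<lfloor>(1 + \<epsilon>) * q\<rfloor>" and "k = nat \<lceil>(1 - \<epsilon>) * q\<rceil>"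
    define s0 where "s0 = 8 * (2 * N + 1) ^ 3"
    have u1: "1 \<le> u" and q1: "1 \<le> q" and y1: "1 \<le> y" using ev by auto
    have l0: "0 < l" using mult_pos_pos[of q u] q1 u1 by (simp add: q_def)
    have nn: "0 < real n" using ev(2) zero_le_power2[of l] by argo
    have \<epsilon>q: "0 \<le> (1 + \<epsilon>) * q" "0 < (1 - \<epsilon>) * q" using \<epsilon> q1 by auto
    have N: "l ^ 2 \<le> real N" "real N \<le> l ^ 2 + 1" unfolding N_def by (rule real_nat_round, simp)+
    have \<kappa>: "u ^ 2 - 1 \<le> real \<kappa>" "real \<kappa> \<le> u ^ 2" unfolding \<kappa>_def by (rule real_nat_round, simp)+
    have W: "(1 + \<epsilon>) * q - 1 \<le> real W" "real W \<le> (1 + \<epsilon>) * q" unfolding W_def using \<epsilon>q by (auto intro: real_nat_round)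
    have k: "(1 - \<epsilon>) * q \<le> real k" "real k \<le> (1 - \<epsilon>) * q + 1" unfolding k_def using \<epsilon>q by (auto intro!: real_nat_round)
    have N1: "1 \<le> N" "4 * N + 4 \<le> n"
    proof -
      have "0 < real N" using N(1) zero_less_power[OF l0, of 2] by linarith
      then show "1 \<le> N" by simp
      have "real (4 * N + 4) \<le> real n" using N ev(2) by simp
      then show "4 * N + 4 \<le> n" by (simp only: of_nat_le_iff)
    qed
    have k1: "1 \<le> k" "2 * k < n"
    proof -
      have "0 < real k" using k \<epsilon>q by linarith
      then show "1 \<le> k" by simp
      have "real (2 * k) < real n" using k ev(5) by simp
      then show "2 * k < n" by (simp only: of_nat_less_iff)
    qed
    have s0: "real s0 \<le> 8 * (2 * l ^ 2 + 3) ^ 3"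
      unfolding s0_def of_nat_mult of_nat_power using N by (intro mult_mono power_mono) auto
    have s0': "s0 < 2 ^ \<kappa>"
    proof -
      have "real s0 < 2 powr (u ^ 2 - 1)" using s0 ev(6) by linarith
      also have "\<dots> \<le> 2 powr real \<kappa>" using \<kappa> by (intro powr_mono) auto
      finally have "real s0 < real (2 ^ \<kappa>)" by (simp add: powr_realpow)
      then show ?thesis by (simp only: of_nat_less_iff)
    qed
    have L: "2 * (2 * N + 1) + 2 \<le> s0"
    proof -
      have "(2 * N + 1) ^ 1 \<le> (2 * N + 1) ^ 3" by (rule power_increasing) auto
      then show ?thesis unfolding s0_def by simp
    qed
    have size: "real (W + 7 * \<kappa> + 14) \<le> (1 + 2 * \<epsilon>) * q"
      using W \<kappa> ev(7) by (simp add: algebra_simps)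
    have t1: "real (2 * N + 2) * (real n * real (2 * N + 2) ^ Suc \<kappa> * exp (real (Suc \<kappa>) * (y - 1)) / y ^ (W - \<kappa>)) \<le>
       (2 * l ^ 2 + 4) * (real n * (2 * l ^ 2 + 4) powr (u ^ 2 + 1) * exp ((u ^ 2 + 1) * y) / y powr ((1 + \<epsilon>) * q - 1 - u ^ 2))"
    proof -
      have a: "real (2 * N + 2) \<le> 2 * l ^ 2 + 4" using N by simp
      have "real (2 * N + 2) ^ Suc \<kappa> \<le> (2 * l ^ 2 + 4) ^ Suc \<kappa>" using a by (intro power_mono) auto
      also have "\<dots> = (2 * l ^ 2 + 4) powr real (Suc \<kappa>)"
        by (rule powr_realpow[symmetric]) (use zero_le_power2[of l] in argo)
      also have "\<dots> \<le> (2 * l ^ 2 + 4) powr (u ^ 2 + 1)"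
        using \<kappa> by (intro powr_mono) (auto intro: order_trans[of _ 4])
      finally have b: "real (2 * N + 2) ^ Suc \<kappa> \<le> (2 * l ^ 2 + 4) powr (u ^ 2 + 1)" .
      have c: "exp (real (Suc \<kappa>) * (y - 1)) \<le> exp ((u ^ 2 + 1) * y)"
        unfolding exp_le_cancel_iff using \<kappa> y1 by (intro mult_mono) auto
      have "y powr ((1 + \<epsilon>) * q - 1 - u ^ 2) \<le> y powr real (W - \<kappa>)"
        using y1 W \<kappa> by (intro powr_mono) auto
      also have "\<dots> = y ^ (W - \<kappa>)" using y1 by (intro powr_realpow) auto
      finally have d: "y powr ((1 + \<epsilon>) * q - 1 - u ^ 2) \<le> y ^ (W - \<kappa>)" .
      show ?thesis
        by (intro mult_mono frac_le a b c d order_refl) (use y1 in auto)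
    qed
    have t2: "2 * (real n ^ 2 * (3/5) ^ (N - 1)) \<le> 2 * (real n ^ 2 * (3/5) powr (l ^ 2 - 1))"
    proof -
      have "(3/5::real) ^ (N - 1) = (3/5) powr real (N - 1)" by (simp add: powr_realpow)
      also have "\<dots> \<le> (3/5) powr (l ^ 2 - 1)" using N N1 by (intro powr_mono') auto
      finally show ?thesis by (intro mult_left_mono) auto
    qed
    have t3: "real N * (real n * (3/5) ^ (N div 2)) \<le> (l ^ 2 + 1) * (real n * (3/5) powr (l ^ 2 / 2 - 1))"
    proof -
      have "N \<le> 2 * (N div 2) + 1" by simp
      then have "real N \<le> 2 * real (N div 2) + 1" by linarith
      then have "l ^ 2 / 2 - 1 \<le> real (N div 2)" using N by simp
      then have "(3/5) powr real (N div 2) \<le> (3/5) powr (l ^ 2 / 2 - 1)" by (intro powr_mono') auto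
      then have "(3/5::real) ^ (N div 2) \<le> (3/5) powr (l ^ 2 / 2 - 1)" by (simp add: powr_realpow)
      then show ?thesis using N by (intro mult_mono) auto
    qed
    have t4: "real n * (exp (real (Suc (W * s0)) ^ 2 / real n) / 2 ^ (2 * N + 1) * exp 2) \<le>
      real n * (exp ((1 + (1 + \<epsilon>) * q * (8 * (2 * l ^ 2 + 3) ^ 3)) ^ 2 / real n) / 2 powr (2 * l ^ 2 + 1) * exp 2)"
    proof -
      have "real W * real s0 \<le> (1 + \<epsilon>) * q * (8 * (2 * l ^ 2 + 3) ^ 3)" using W s0 \<epsilon>q by (intro mult_mono) auto
      then have "real (Suc (W * s0)) \<le> 1 + (1 + \<epsilon>) * q * (8 * (2 * l ^ 2 + 3) ^ 3)" by simp
      then have a: "exp (real (Suc (W * s0)) ^ 2 / real n) \<le> exp ((1 + (1 + \<epsilon>) * q * (8 * (2 * l ^ 2 + 3) ^ 3)) ^ 2 / real n)"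
        unfolding exp_le_cancel_iff by (intro divide_right_mono power_mono) auto
      have "2 powr (2 * l ^ 2 + 1) \<le> 2 powr real (2 * N + 1)" using N by (intro powr_mono) auto
      also have "\<dots> = 2 ^ (2 * N + 1)" by (rule powr_realpow) simp
      finally have b: "2 powr (2 * l ^ 2 + 1) \<le> (2::real) ^ (2 * N + 1)" .
      show ?thesis by (intro mult_left_mono mult_right_mono frac_le a b) auto
    qed
    have t5: "(real n / real (n - k)) ^ (2 * k) \<le> (real n / (real n - ((1 - \<epsilon>) * q + 1))) powr (2 * ((1 - \<epsilon>) * q + 1))"
    proof -
      have pos: "0 < real n - ((1 - \<epsilon>) * q + 1)" using ev(5) \<epsilon>q by argo
      have nk: "real (n - k) = real n - real k" "0 < real n - real k" using k1 by auto
      have "(real n / real (n - k)) ^ (2 * k) = (real n / real (n - k)) powr real (2 * k)"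
        using nk nn by (intro powr_realpow[symmetric]) auto
      also have "\<dots> \<le> (real n / real (n - k)) powr (2 * ((1 - \<epsilon>) * q + 1))"
        using k nk by (intro powr_mono) auto
      also have "\<dots> \<le> (real n / (real n - ((1 - \<epsilon>) * q + 1))) powr (2 * ((1 - \<epsilon>) * q + 1))"
        unfolding nk(1) using k nk nn pos \<epsilon>q by (intro powr_mono2 divide_left_mono) auto
      finally show ?thesis .
    qed
    have t6: "exp 1 * (4 * exp 2 * real k) ^ k / real n \<le>
        exp 1 * (4 * exp 2 * ((1 - \<epsilon>) * q + 1)) powr ((1 - \<epsilon>) * q + 1) / real n"
    proof -
      have e: "1 \<le> 4 * exp (2::real)" using one_le_exp_iff[of "2::real"] by linarith
      then have one: "1 \<le> 4 * exp 2 * ((1 - \<epsilon>) * q + 1)" using \<epsilon>q mult_mono[of 1 "4 * exp 2" 1 "(1 - \<epsilon>) * q + 1"] by simp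
      have "(4 * exp 2 * real k) ^ k \<le> (4 * exp 2 * ((1 - \<epsilon>) * q + 1)) ^ k"
        using k by (intro power_mono mult_left_mono) auto
      also have "\<dots> = (4 * exp 2 * ((1 - \<epsilon>) * q + 1)) powr real k"
        using one by (intro powr_realpow[symmetric]) linarith
      also have "\<dots> \<le> (4 * exp 2 * ((1 - \<epsilon>) * q + 1)) powr ((1 - \<epsilon>) * q + 1)"
        using k one by (intro powr_mono) auto
      finally show ?thesis by (intro divide_right_mono mult_left_mono) auto
    qed
    have "real (card (bad_trees {1..n} N \<kappa> s0 W k)) \<le> real n ^ (n - 1) * h n"
    proof (rule order_trans[OF card_bad_trees[OF _ _ N1 y1 s0_def k1]])
      show "real n ^ (n - 1) *
        (real (2 * N + 2) * (real n * real (2 * N + 2) ^ Suc \<kappa> * exp (real (Suc \<kappa>) * (y - 1)) / y ^ (W - \<kappa>)) +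
         2 * (real n ^ 2 * (3/5) ^ (N - 1)) + real N * (real n * (3/5) ^ (N div 2)) +
         real n * (exp (real (Suc (W * s0)) ^ 2 / real n) / 2 ^ (2 * N + 1) * exp 2) +
         ((real n / real (n - k)) ^ (2 * k) - 1 + exp 1 * (4 * exp 2 * real k) ^ k / real n))
        \<le> real n ^ (n - 1) * h n"
        unfolding hn by (intro mult_left_mono add_mono diff_right_mono t1 t2 t3 t4 t5 t6) auto
    qed auto
    then show ?case
      using L s0' size k(1) unfolding l_def[symmetric] unfolding u_def[symmetric] unfolding q_def[symmetric] by blast
  qed
  ultimately show ?thesis by (rule that)
qed

lemma degree_and_depth_concentrated:
  assumes \<epsilon>: "0 < \<epsilon>" "\<epsilon> \<le> 1/2"
  shows "(\<lambda>n. measure_pmf.prob (random_tree n)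
    {T. \<bar>real (D T) - ln (real n) / ln (ln (real n))\<bar> \<le> 2 * \<epsilon> * (ln (real n) / ln (ln (real n))) \<and>
        \<bar>real (max_degree T) - ln (real n) / ln (ln (real n))\<bar> \<le> 2 * \<epsilon> * (ln (real n) / ln (ln (real n)))}) \<longlonglongrightarrow> 1"
    (is "(\<lambda>n. ?P n) \<longlonglongrightarrow> 1")
proof -
  obtain h :: "nat \<Rightarrow> real" where h: "h \<longlonglongrightarrow> 0" and
    ev: "\<forall>\<^sub>F n in sequentially. \<exists>N \<kappa> s0 W k. 2 * (2 * N + 1) + 2 \<le> s0 \<and> s0 < 2 ^ \<kappa> \<and>
       real (W + 7 * \<kappa> + 14) \<le> (1 + 2 * \<epsilon>) * (ln (real n) / ln (ln (real n))) \<and>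
       (1 - \<epsilon>) * (ln (real n) / ln (ln (real n))) \<le> real k \<and>
       real (card (bad_trees {1..n} N \<kappa> s0 W k)) \<le> real n ^ (n - 1) * h n"
    using bad_trees_negligible[OF \<epsilon>] by blast
  have "\<forall>\<^sub>F n in sequentially. 1 - h n \<le> ?P n"
    using ev eventually_ge_at_top[of 1] eventually_ratio_ge_1
  proof eventually_elim
    case (elim n)
    define q where "q = ln (real n) / ln (ln (real n))"
    from elim(1) obtain N \<kappa> s0 W k where par: "2 * (2 * N + 1) + 2 \<le> s0" "s0 < 2 ^ \<kappa>"
      "real (W + 7 * \<kappa> + 14) \<le> (1 + 2 * \<epsilon>) * q" "(1 - \<epsilon>) * q \<le> real k"
      and bad: "real (card (bad_trees {1..n} N \<kappa> s0 W k)) \<le> real n ^ (n - 1) * h n"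
      unfolding q_def by blast
    define B where "B = bad_trees {1..n} N \<kappa> s0 W k"
    define E where "E T \<longleftrightarrow> \<bar>real (D T) - q\<bar> \<le> 2 * \<epsilon> * q \<and> \<bar>real (max_degree T) - q\<bar> \<le> 2 * \<epsilon> * q" for T :: "nat pair_pre_digraph"
    let ?R = "rooted_trees {1..n}"
    have q: "1 \<le> q" using elim(3) by (simp add: q_def)
    have E: "E (tree_graph {1..n} p)" if "p \<in> ?R" "p \<notin> B" for p
    proof -
      note b = degree_and_depth_bounds[OF finite_atLeastAtMost that[unfolded B_def] par(1,2)]
      have "0 < \<epsilon> * q" using q \<epsilon>(1) by simp
      then have "q - 2 * (\<epsilon> * q) \<le> real k" "real (W + 7 * \<kappa> + 14) \<le> q + 2 * (\<epsilon> * q)"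
        using par(3,4) by (simp_all add: algebra_simps)
      moreover have "real (max_degree (tree_graph {1..n} p)) \<le> real (W + 7 * \<kappa> + 14)"
        "real k \<le> real (max_degree (tree_graph {1..n} p))"
        "real (D (tree_graph {1..n} p)) \<le> real (W + 7 * \<kappa> + 14)" "real k \<le> real (D (tree_graph {1..n} p))"
        unfolding of_nat_le_iff using b by auto
      ultimately show ?thesis unfolding E_def abs_le_iff mult.assoc by linarith
    qed
    have fin: "finite ?R" by (simp add: finite_rooted_trees)
    have "card ?R \<le> card ({p \<in> ?R. E (tree_graph {1..n} p)} \<union> B \<inter> ?R)"
      using fin E by (intro card_mono) auto
    also have "\<dots> \<le> card {p \<in> ?R. E (tree_graph {1..n} p)} + card (B \<inter> ?R)" by (rule card_Un_le)
    finally have "real (card ?R) \<le> real (card {p \<in> ?R. E (tree_graph {1..n} p)}) + real (card (B \<inter> ?R))" by linarith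
    moreover have "B \<inter> ?R = B"
      using bad_trees_subset unfolding B_def by (rule Int_absorb2)
    moreover have "card ?R = n ^ (n - 1)" using card_rooted_trees[of "{1..n}"] elim(2) by simp
    ultimately have "real n ^ (n - 1) \<le> real (card {p \<in> ?R. E (tree_graph {1..n} p)}) + real n ^ (n - 1) * h n"
      using bad by (simp add: B_def)
    then have "1 - h n \<le> real (card {p \<in> ?R. E (tree_graph {1..n} p)}) / real n ^ (n - 1)"
      using elim(2) by (simp add: field_simps)
    also have "\<dots> = measure_pmf.prob (random_tree n) {T. E T}" using prob_random_tree[OF elim(2), of E] by simp
    finally show ?case unfolding E_def q_def .
  qed
  moreover have "\<forall>\<^sub>F n in sequentially. ?P n \<le> 1" by simp
  moreover have "(\<lambda>n. 1 - h n) \<longlonglongrightarrow> 1" using tendsto_diff[OF tendsto_const h, of 1] by simp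
  ultimately show ?thesis by (rule tendsto_sandwich[OF _ _ _ tendsto_const])
qed

text \<open>The precision \<open>1 / Suc j\<close> is guaranteed from \<open>N j\<close> on, and
  \<open>g n\<close> is the largest index available at \<open>n\<close>. The restriction
  \<open>j \<le> n\<close> keeps the set finite, and the added 0 keeps it nonempty.\<close>

lemma diagonal_tendsto:
  fixes P :: "real \<Rightarrow> nat \<Rightarrow> real"
  assumes P: "\<And>a. 0 < a \<Longrightarrow> a \<le> 1 \<Longrightarrow> P a \<longlonglongrightarrow> 1"
  shows "\<exists>\<epsilon>. \<epsilon> \<longlonglongrightarrow> 0 \<and> (\<lambda>n. P (\<epsilon> n) n) \<longlonglongrightarrow> 1"
proof -
  have "\<exists>N. \<forall>n\<ge>N. norm (P (1 / real (Suc j)) n - 1) < 1 / real (Suc j)" for j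
    using LIMSEQ_D[OF P[of "1 / real (Suc j)"], of "1 / real (Suc j)"] by simp
  then obtain N where N: "\<And>j n. N j \<le> n \<Longrightarrow> norm (P (1 / real (Suc j)) n - 1) < 1 / real (Suc j)"
    by metis
  define g where "g n = Max (insert 0 {j. j \<le> n \<and> N j \<le> n})" for n
  define \<epsilon> where "\<epsilon> n = 1 / real (Suc (g n))" for n
  have fin: "finite (insert 0 {j. j \<le> n \<and> N j \<le> n})" for n by simp
  have ge: "J \<le> g n" if "max J (N J) \<le> n" for J n
    unfolding g_def using that by (intro Max_ge[OF fin]) auto
  have g: "filterlim g at_top sequentially"
    unfolding filterlim_at_top eventually_sequentially using ge by blast
  have \<epsilon>0: "\<epsilon> \<longlonglongrightarrow> 0"
    unfolding \<epsilon>_def by (rule filterlim_compose[OF LIMSEQ_inverse_real_of_nat[unfolded inverse_eq_divide] g])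
  have close: "norm (P (\<epsilon> n) n - 1) \<le> \<epsilon> n" if "N 0 \<le> n" for n
  proof -
    have "g n \<in> insert 0 {j. j \<le> n \<and> N j \<le> n}" unfolding g_def by (rule Max_in[OF fin]) simp
    then have "N (g n) \<le> n" using that by auto
    from N[OF this] show ?thesis by (simp add: \<epsilon>_def)
  qed
  have "(\<lambda>n. P (\<epsilon> n) n - 1) \<longlonglongrightarrow> 0"
    by (rule Lim_null_comparison[OF _ \<epsilon>0]) (use close in \<open>auto simp: eventually_sequentially\<close>)
  then show ?thesis using \<epsilon>0 LIM_zero_iff by blast
qed

theorem theorem4:
  shows "\<exists>\<epsilon> :: nat \<Rightarrow> real. \<epsilon> \<longlonglongrightarrow> 0 \<and>
    (\<lambda>n. measure_pmf.prob (random_tree n)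
       {T. \<bar>real (D T) - real (max_degree T)\<bar> \<le> \<epsilon> n * real (max_degree T) \<and>
           \<bar>real (D T) - ln (real n) / ln (ln (real n))\<bar> \<le> \<epsilon> n * (ln (real n) / ln (ln (real n))) \<and>
           \<bar>real (max_degree T) - ln (real n) / ln (ln (real n))\<bar> \<le> \<epsilon> n * (ln (real n) / ln (ln (real n)))})
    \<longlonglongrightarrow> 1"
proof (rule diagonal_tendsto[where P = "\<lambda>a n. measure_pmf.prob (random_tree n)
    {T. \<bar>real (D T) - real (max_degree T)\<bar> \<le> a * real (max_degree T) \<and>
        \<bar>real (D T) - ln (real n) / ln (ln (real n))\<bar> \<le> a * (ln (real n) / ln (ln (real n))) \<and>
        \<bar>real (max_degree T) - ln (real n) / ln (ln (real n))\<bar> \<le> a * (ln (real n) / ln (ln (real n)))}"])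
  fix a :: real assume a: "0 < a" "a \<le> 1"
  let ?q = "\<lambda>n::nat. ln (real n) / ln (ln (real n))"
  let ?A = "\<lambda>n. {T :: nat pair_pre_digraph. \<bar>real (D T) - ?q n\<bar> \<le> 2 * (a / 8) * ?q n \<and>
    \<bar>real (max_degree T) - ?q n\<bar> \<le> 2 * (a / 8) * ?q n}"
  let ?E = "\<lambda>n. {T. \<bar>real (D T) - real (max_degree T)\<bar> \<le> a * real (max_degree T) \<and>
    \<bar>real (D T) - ?q n\<bar> \<le> a * ?q n \<and> \<bar>real (max_degree T) - ?q n\<bar> \<le> a * ?q n}"
  \<comment> \<open>Tolerance \<open>2 * (a / 8) = a / 4\<close> for both quantities makes them
    differ by at most \<open>a * q / 2\<close>. The maximum degree is at least \<open>q / 2\<close>,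
    so the difference is at most \<open>a\<close> times the maximum degree.\<close>
  have lim: "(\<lambda>n. measure_pmf.prob (random_tree n) (?A n)) \<longlonglongrightarrow> 1"
    using degree_and_depth_concentrated[of "a / 8"] a by simp
  have "\<forall>\<^sub>F n in sequentially. measure_pmf.prob (random_tree n) (?A n) \<le> measure_pmf.prob (random_tree n) (?E n)"
    using eventually_ratio_ge_1
  proof eventually_elim
    case (elim n)
    have "?A n \<subseteq> ?E n"
    proof
      fix T assume T: "T \<in> ?A n"
      define q d m where "q = ?q n" and "d = real (D T)" and "m = real (max_degree T)"
      have t: "\<bar>d - q\<bar> \<le> a * q / 4" "\<bar>m - q\<bar> \<le> a * q / 4"
        using T unfolding q_def d_def m_def by simp_all
      have q: "1 \<le> q" using elim a by (simp add: q_def)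
      then have aq: "0 \<le> a * q" "a * q \<le> q" using a by auto
      then have "q / 2 \<le> m" using t by argo
      then have "a * (q / 2) \<le> a * m" using a by (intro mult_left_mono) auto
      then have "\<bar>d - m\<bar> \<le> a * m" "\<bar>d - q\<bar> \<le> a * q" "\<bar>m - q\<bar> \<le> a * q" using t aq by argo+
      then show "T \<in> ?E n" unfolding q_def d_def m_def by simp
    qed
    then show ?case by (intro measure_pmf.finite_measure_mono) auto
  qed
  moreover have "\<forall>\<^sub>F n in sequentially. measure_pmf.prob (random_tree n) (?E n) \<le> 1" by simp
  ultimately show "(\<lambda>n. measure_pmf.prob (random_tree n) (?E n)) \<longlonglongrightarrow> 1"
    by (rule tendsto_sandwich[OF _ _ lim tendsto_const])
qed

end
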